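(* Let $(B^H_t)_{t\in T}$ be a fractional Brownian motion with Hurst index $H\in(0,1)$, let $x\in\mathbb{R}$, $f\in C^{0,1}_b(T\times\mathbb{R})$, and let $(X_t)_{t\in T}$ be a solution of $$X_t = x+\int_0^t f(s,X_s)\,ds + B^H_t,\qquad t\in T .$$ Let $\Delta=n^{-\alpha}$, where - if $H<\frac12$: $T=[0,\infty)$ and $\alpha>\frac{1}{2(1-H)}$; - if $H\ge\frac12$: $T=[0,1]$, $\alpha\ge1$ and $\alpha>\max\left(\frac{2H-1}{2-2H},\frac1{4-4H}\right)$. Let $a^{(1)},\dots,a^{(m)}$ be filters of respective lengths $p_1+1,\dots,p_m+1$ with $M(a^{(i)})>H+\frac14$ for $i=1,\dots,m$, such that the associated matrix $A$ (defined in the context) is of full rank, and let $\hat H_1,\hat H_2$ be the associated estimators (defined in the context) computed from the observations of $X$. Then, as $n\to\infty$, the sequences $\sqrt n(\hat H_1-H)$ and $\sqrt n(\hat H_2-H)$ converge weakly to normally distributed, centered random variables.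
   Context: Fractional Brownian motion $(B^H_t)_{t\in T}$ with Hurst index $H\in(0,1)$ on an interval $T$ is the centered Gaussian process with covariance $\mathbb{E}[B^H_tB^H_s]=\frac12(t^{2H}+s^{2H}-|t-s|^{2H})$. $f\in C^{0,1}_b(T\times\mathbb{R})$ means that $f(s,x)$ is continuous in the time component $s$, continuously differentiable in the space component $x$, and that $f$ and its derivative $f'$ with respect to the second variable are bounded, $\|f\|_\infty+\|f'\|_\infty\le M$ for a fixed constant $M>0$. A filter of length $p+1$ ($p\in\mathbb{N}$, $p\ge1$) is a tuple $a=(a_0,\dots,a_p)$ of real numbers with $\sum_{q=0}^p a_q=0$. Its order $M(a)$ is the order of its first non-zero moment: $\sum_{i=0}^p a_i i^k=0$ for $0\le k<M(a)$ and $\sum_{i=0}^p a_i i^{M(a)}\ne0$ (in particular $a$ is not identically zero). For a filter $a$ of length $p+1$, a process $Z$, and mesh size $\Delta>0$, put $\Delta_aZ_j=\sum_{i=0}^p a_i Z_{(i+j)\Delta}$ and, for $n>p$, $U(a,n,\Delta,Z)=\frac1n\sum_{j=1}^{n-p}(\Delta_aZ_j)^2$. Estimators. Given filters $a^{(i)}=(a^{(i)}_0,\dots,a^{(i)}_{p_i})$, $i=1,\dots,m$, let $P=\max_i p_i$ and let $A=(A_{ij})\in\mathbb{R}^{m\times P}$ be given by $A_{ij}=-\sum_{k=0}^{p_i-j}a^{(i)}_ka^{(i)}_{k+j}$ for $j\le p_i$ and $A_{ij}=0$ otherwise. The filters are chosen such that $A$ is of full rank, in the sense that $A^TA$ is invertible.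 Let $U_n=(U(a^{(i)},n,\Delta,X))_{i=1,\dots,m}$ and $\hat D=(A^TA)^{-1}A^TU_n\in\mathbb{R}^P$. Define $$\hat H_1=\frac{\sum_{d=1}^P\log|\hat D_d|\,\log(d\Delta)}{2\sum_{d=1}^P\log(d\Delta)^2},$$ $$\hat H_2=\frac{\sum_{d=1}^P\log|\hat D_d|\log(d)-\frac1P\sum_{d=1}^P\log|\hat D_d|\sum_{d=1}^P\log(d)}{2\left(\sum_{d=1}^P\log(d)^2-\frac1P\left(\sum_{d=1}^P\log(d)\right)^2\right)},$$ where $\log(\cdot)^2$ denotes the square of the logarithm. For $\hat H_2$ to be defined one takes $P\ge2$. *)

theory Defs
  imports "HOL-Probability.Probability" "Jordan_Normal_Form.Gauss_Jordan_Elimination"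
begin

section \<open>Centered Gaussian processes and fractional Brownian motion\<close>

text \<open>The degenerate law (the point mass at 0) counts as a centered normal law; the library's
  \<^term>\<open>normal_density\<close> is the zero function for standard deviation 0, hence the case split.\<close>

definition centered_normal :: "real \<Rightarrow> real measure" where
  "centered_normal \<sigma> =
     (if \<sigma> = 0 then return borel 0 else density lborel (normal_density 0 \<sigma>))"

definition centered_gaussian_process ::
  "'a measure \<Rightarrow> real set \<Rightarrow> (real \<Rightarrow> 'a \<Rightarrow> real) \<Rightarrow> bool" where
  "centered_gaussian_process M T B \<longleftrightarrow>
     (\<forall>t\<in>T. B t \<in> borel_measurable M) \<and>
     (\<forall>J c. finite J \<longrightarrow> J \<subseteq> T \<longrightarrow>
        (\<exists>\<sigma>\<ge>0. distr M borel (\<lambda>\<omega>. \<Sum>t\<in>J. c t * B t \<omega>) = centered_normal \<sigma>))"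

definition fractional_Brownian_motion ::
  "'a measure \<Rightarrow> real set \<Rightarrow> real \<Rightarrow> (real \<Rightarrow> 'a \<Rightarrow> real) \<Rightarrow> bool" where
  "fractional_Brownian_motion M T H B \<longleftrightarrow>
     centered_gaussian_process M T B \<and>
     (\<forall>s\<in>T. \<forall>t\<in>T. (\<integral>\<omega>. B t \<omega> * B s \<omega> \<partial>M) =
        (t powr (2 * H) + s powr (2 * H) - \<bar>t - s\<bar> powr (2 * H)) / 2)"


section \<open>The integral equation\<close>

text \<open>The last conjunct says that the sum of the supremum norms of \<open>f\<close> and of its
  space derivative over \<open>T \<times> \<real>\<close> is at most \<open>K\<close>.\<close>

definition C01b :: "real set \<Rightarrow> (real \<Rightarrow> real \<Rightarrow> real) set" where
  "C01b T = {f.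
     (\<forall>x. continuous_on T (\<lambda>s. f s x)) \<and>
     (\<forall>s\<in>T. (\<forall>x. f s differentiable (at x)) \<and> continuous_on UNIV (deriv (f s))) \<and>
     (\<exists>K>0. \<forall>s\<in>T. \<forall>x. \<forall>s'\<in>T. \<forall>x'. \<bar>f s x\<bar> + \<bar>deriv (f s') x'\<bar> \<le> K)}"

text \<open>A solution is a measurable process, i.e. jointly measurable in time and \<open>\<omega>\<close>, as is needed
  for the drift integral to make sense as a random variable. Measurability is only required with
  respect to the completed product measure, so every process whose paths are almost surely
  continuous qualifies.\<close>

definition measurable_process ::
  "'a measure \<Rightarrow> real set \<Rightarrow> (real \<Rightarrow> 'a \<Rightarrow> real) \<Rightarrow> bool" where
  "measurable_process M T X \<longleftrightarrow>
     (\<forall>t\<in>T. X t \<in> borel_measurable M) \<and>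
     (\<lambda>(t, \<omega>). X t \<omega>) \<in> borel_measurable (completion (restrict_space lborel T \<Otimes>\<^sub>M M))"

definition solves_equation ::
  "'a measure \<Rightarrow> real set \<Rightarrow> real \<Rightarrow> (real \<Rightarrow> real \<Rightarrow> real) \<Rightarrow> (real \<Rightarrow> 'a \<Rightarrow> real) \<Rightarrow>
   (real \<Rightarrow> 'a \<Rightarrow> real) \<Rightarrow> bool" where
  "solves_equation M T x f B X \<longleftrightarrow>
     measurable_process M T X \<and>
     (AE \<omega> in M. \<forall>t\<in>T.
        set_integrable lebesgue {0..t} (\<lambda>s. f s (X s \<omega>)) \<and>
        X t \<omega> = x + (LINT s:{0..t}|lebesgue. f s (X s \<omega>)) + B t \<omega>)"


section \<open>Filters and quadratic variations\<close>

text \<open>A filter of length \<open>p + 1\<close> is a list of that length; \<open>0 ^ 0 = 1\<close> in the zeroth moment.\<close>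

definition filter_moment :: "real list \<Rightarrow> nat \<Rightarrow> real" where
  "filter_moment a k = (\<Sum>i<length a. a ! i * real i ^ k)"

definition diff_filter :: "real list \<Rightarrow> bool" where
  "diff_filter a \<longleftrightarrow> length a \<ge> 2 \<and> sum_list a = 0 \<and> (\<exists>q<length a. a ! q \<noteq> 0)"

definition filter_order :: "real list \<Rightarrow> nat" where
  "filter_order a = (LEAST k. filter_moment a k \<noteq> 0)"

definition filter_p :: "real list \<Rightarrow> nat" where
  "filter_p a = length a - 1"

definition filter_incr :: "real list \<Rightarrow> real \<Rightarrow> (real \<Rightarrow> real) \<Rightarrow> nat \<Rightarrow> real" where
  "filter_incr a \<Delta> Z j = (\<Sum>i=0..filter_p a. a ! i * Z (real (i + j) * \<Delta>))"

definition quad_var :: "real list \<Rightarrow> nat \<Rightarrow> real \<Rightarrow> (real \<Rightarrow> real) \<Rightarrow> real" where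
  "quad_var a n \<Delta> Z = 1 / real n * (\<Sum>j=1..n - filter_p a. (filter_incr a \<Delta> Z j)\<^sup>2)"


section \<open>The estimators\<close>

definition max_p :: "real list list \<Rightarrow> nat" where
  "max_p as = Max (filter_p ` set as)"

text \<open>Matrix and vector indices start at 0 in the library, so column \<open>j\<close> of the usual
  notation, \<open>1 \<le> j \<le> P\<close>, is stored at index \<open>j - 1\<close>.\<close>

definition filter_mat :: "real list list \<Rightarrow> real mat" where
  "filter_mat as = mat (length as) (max_p as)
     (\<lambda>(i, j'). let a = as ! i; j = Suc j' in
        if j \<le> filter_p a then - (\<Sum>k=0..filter_p a - j. a ! k * a ! (k + j)) else 0)"

definition quad_var_vec :: "real list list \<Rightarrow> nat \<Rightarrow> real \<Rightarrow> (real \<Rightarrow> real) \<Rightarrow> real vec" where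
  "quad_var_vec as n \<Delta> Z = vec (length as) (\<lambda>i. quad_var (as ! i) n \<Delta> Z)"

definition D_hat :: "real list list \<Rightarrow> nat \<Rightarrow> real \<Rightarrow> (real \<Rightarrow> real) \<Rightarrow> nat \<Rightarrow> real" where
  "D_hat as n \<Delta> Z d =
     (let A = filter_mat as in
        vec_index
          ((the (mat_inverse (transpose_mat A * A)) * transpose_mat A) *\<^sub>v quad_var_vec as n \<Delta> Z)
          (d - 1))"

definition H1_hat :: "real list list \<Rightarrow> nat \<Rightarrow> real \<Rightarrow> (real \<Rightarrow> real) \<Rightarrow> real" where
  "H1_hat as n \<Delta> Z =
     (\<Sum>d=1..max_p as. ln \<bar>D_hat as n \<Delta> Z d\<bar> * ln (real d * \<Delta>)) /
     (2 * (\<Sum>d=1..max_p as. (ln (real d * \<Delta>))\<^sup>2))"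

definition H2_hat :: "real list list \<Rightarrow> nat \<Rightarrow> real \<Rightarrow> (real \<Rightarrow> real) \<Rightarrow> real" where
  "H2_hat as n \<Delta> Z =
     (let P = max_p as in
        ((\<Sum>d=1..P. ln \<bar>D_hat as n \<Delta> Z d\<bar> * ln (real d))
          - 1 / real P * (\<Sum>d=1..P. ln \<bar>D_hat as n \<Delta> Z d\<bar>) * (\<Sum>d=1..P. ln (real d))) /
        (2 * ((\<Sum>d=1..P. (ln (real d))\<^sup>2) - 1 / real P * (\<Sum>d=1..P. ln (real d))\<^sup>2)))"

end

theory Submission
  imports Defs "HOL-Real_Asymp.Real_Asymp"
begin

text \<open>Put \<open>F = X - x - B\<close>. After division by \<open>\<Delta> powr (2 * H)\<close> the quadratic variations of \<open>B\<close> are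
  quadratic forms in a jointly Gaussian family whose covariance does not depend on \<open>n\<close> and decays
  like \<open>\<bar>h\<bar> powr - \<beta>\<close> with \<open>\<beta> > 1/2\<close>. Gaussian integration by parts shows that the characteristic function
  of such a form satisfies the differential equation of the normal law up to an error controlled by the
  variance of a second quadratic form, which tends to 0 because the covariances are square summable.

  The squared increments of \<open>F\<close> are negligible by size. So are the cross terms of \<open>B\<close> and \<open>F\<close>
  when \<open>H < 1/2\<close>. When \<open>H \<ge> 1/2\<close>, the increment of \<open>F\<close> is replaced by the integral of \<open>f\<close> with the space
  variable frozen at \<open>X\<close> in the left endpoint. Sums over dyadic blocks with the frozen point held fixed are
  Gaussian with small variance, a union bound over a grid makes this uniform in the frozen point, and
  moving the frozen point from block to parent block loses only the Hoelder modulus of \<open>X\<close>.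

  Finally \<open>D_hat\<close> inverts the linear relation between the variances of the filtered increments and the numbers
  \<open>(d * \<Delta>) powr (2 * H)\<close>, and linearising the logarithm makes both estimation errors, up to negligible terms,
  linear combinations of the normalised quadratic variations. For \<open>H1_hat\<close> the coefficients are of order
  \<open>1 / ln n\<close>, so its limit law is the point mass at 0.\<close>

section \<open>Gaussian spaces\<close>

text \<open>The bounds on \<alpha> and on the filter orders mark where single error terms stop
  vanishing. Order \<open>m\<close> gives covariance decay of exponent \<open>2 * m - 2 * H\<close>;
  that this exceeds 1/2 (square summability) is the condition \<open>m > H + 1/4\<close>. After
  normalisation the squared drift increments have size n^(1/2 - \<alpha> (2 - 2 H)), the cross terms
  in absolute value n^(1/2 - \<alpha> (1 - H)). The latter need not vanish for H >= 1/2 (H = 1/2,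
  \<alpha> = 1), so there the cancellation between Gaussian increments has to be used. The obstacle
  is that the drift depends on the path of the same Gaussian process, for general H there is no
  martingale structure, and variance bounds apply only to deterministic weights; freezing the space
  variable produces such weights. For \<beta> = 2 - 2 H the first is small exactly if \<alpha> > (2
  H - 1)/(2 - 2 H).\<close>

lemma centered_normal_eq_distr:
  assumes "0 \<le> \<sigma>"
  shows "centered_normal \<sigma> = distr std_normal_distribution borel (\<lambda>x. \<sigma> * x)"
proof (cases "\<sigma> = 0")
  case True
  interpret real_distribution std_normal_distribution by (rule real_dist_normal_dist)
  have "distr std_normal_distribution borel (\<lambda>x::real. 0::real) = return borel 0"
    by (rule distr_const) auto
  then show ?thesis using True by (simp add: centered_normal_def)
next
  case False
  interpret N: prob_space std_normal_distribution
    by (rule prob_space_normal_density) simp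
  have "distributed std_normal_distribution lborel (\<lambda>x. x) (normal_density 0 1)"
    unfolding distributed_def by (auto simp: distr_id2)
  from N.normal_density_affine[OF this, of \<sigma> 0] False assms
  have "distributed std_normal_distribution lborel (\<lambda>x. \<sigma> * x) (normal_density 0 \<sigma>)"
    by simp
  then have "distr std_normal_distribution lborel (\<lambda>x. \<sigma> * x) = density lborel (normal_density 0 \<sigma>)"
    unfolding distributed_def by auto
  moreover have "distr std_normal_distribution lborel (\<lambda>x. \<sigma> * x) = distr std_normal_distribution borel (\<lambda>x. \<sigma> * x)"
    by (rule distr_cong) auto
  ultimately show ?thesis using False by (simp add: centered_normal_def)
qed

lemma real_distribution_centered_normal:
  assumes "0 \<le> \<sigma>"
  shows "real_distribution (centered_normal \<sigma>)"
proof -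
  interpret real_distribution std_normal_distribution by (rule real_dist_normal_dist)
  show ?thesis unfolding centered_normal_eq_distr[OF assms] by (rule real_distribution_distr) auto
qed

lemma char_centered_normal:
  assumes "0 \<le> \<sigma>"
  shows "char (centered_normal \<sigma>) t = of_real (exp (- (\<sigma> * t)\<^sup>2 / 2))"
proof -
  have "char (centered_normal \<sigma>) t = char std_normal_distribution (\<sigma> * t)"
    unfolding centered_normal_eq_distr[OF assms] char_def
    by (subst integral_distr) (auto simp: mult_ac)
  then show ?thesis by (simp add: char_std_normal_distribution)
qed

text \<open>Joint normality is encoded in the manner of Cramer and Wold: every linear combination is
  again a member and has a centered normal law. No dimension or covariance matrix has to be carried
  along, degenerate members are included, and covariances are plain integrals of products.\<close>

locale gaussian_space = prob_space M for M :: "'a measure" +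
  fixes G :: "('a \<Rightarrow> real) set"
  assumes measurable_G: "L \<in> G \<Longrightarrow> L \<in> borel_measurable M"
    and centered_normal_G: "L \<in> G \<Longrightarrow> \<exists>\<sigma>\<ge>0. distr M borel L = centered_normal \<sigma>"
    and zero_G: "(\<lambda>_. 0) \<in> G"
    and lincomb_G: "L \<in> G \<Longrightarrow> L' \<in> G \<Longrightarrow> (\<lambda>\<omega>. a * L \<omega> + b * L' \<omega>) \<in> G"
begin

lemma scale_G: "L \<in> G \<Longrightarrow> (\<lambda>\<omega>. a * L \<omega>) \<in> G"
  using lincomb_G[of L L a 0] by simp

lemma add_G: "L \<in> G \<Longrightarrow> L' \<in> G \<Longrightarrow> (\<lambda>\<omega>. L \<omega> + L' \<omega>) \<in> G"
  using lincomb_G[of L L' 1 1] by simp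

lemma diff_G: "L \<in> G \<Longrightarrow> L' \<in> G \<Longrightarrow> (\<lambda>\<omega>. L \<omega> - L' \<omega>) \<in> G"
  using lincomb_G[of L L' 1 "-1"] by simp

lemma sum_G:
  assumes "finite I" "\<And>i. i \<in> I \<Longrightarrow> Y i \<in> G"
  shows "(\<lambda>\<omega>. \<Sum>i\<in>I. c i * Y i \<omega>) \<in> G"
  using assms
proof (induction I rule: finite_induct)
  case empty then show ?case by (simp add: zero_G)
next
  case (insert i I)
  then show ?case using lincomb_G[of "Y i" "\<lambda>\<omega>. \<Sum>i\<in>I. c i * Y i \<omega>" "c i" 1] by simp
qed

text \<open>The image of a standard normal variable under x |-> \<sigma> x covers \<sigma> = 0 and
  \<sigma> > 0 alike, so later moments are pulled back to the standard normal law without a case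
  split.\<close>

lemma G_distr_std:
  assumes "L \<in> G"
  obtains \<sigma> where "0 \<le> \<sigma>" "\<sigma>\<^sup>2 = (\<integral>\<omega>. (L \<omega>)\<^sup>2 \<partial>M)"
    "distr M borel L = centered_normal \<sigma>"
    "distr M borel L = distr std_normal_distribution borel (\<lambda>x. \<sigma> * x)"
proof -
  from centered_normal_G[OF assms] obtain \<sigma> where s: "0 \<le> \<sigma>" "distr M borel L = centered_normal \<sigma>" by auto
  have [measurable]: "L \<in> borel_measurable M" by (rule measurable_G[OF assms])
  have d: "distr M borel L = distr std_normal_distribution borel (\<lambda>x. \<sigma> * x)"
    using s centered_normal_eq_distr by simp
  have "(\<integral>\<omega>. (L \<omega>)\<^sup>2 \<partial>M) = (\<integral>x. x\<^sup>2 \<partial>(distr M borel L))"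
    by (subst integral_distr) auto
  also have "\<dots> = (\<integral>x. (\<sigma> * x)\<^sup>2 \<partial>std_normal_distribution)"
    unfolding d by (subst integral_distr) auto
  also have "\<dots> = \<sigma>\<^sup>2 * (\<integral>x. x^(2*1) \<partial>std_normal_distribution)"
    by (simp add: power_mult_distrib)
  also have "\<dots> = \<sigma>\<^sup>2"
    using std_normal_distribution_even_moments(1)[of 1]
    by simp
  finally show thesis using s d that by simp
qed

lemma integrable_abs_power_G: "L \<in> G \<Longrightarrow> integrable M (\<lambda>\<omega>. \<bar>L \<omega>\<bar> ^ k)"
proof -
  assume L: "L \<in> G"
  have [measurable]: "L \<in> borel_measurable M" by (rule measurable_G[OF L])
  obtain \<sigma> where d: "distr M borel L = distr std_normal_distribution borel (\<lambda>x. \<sigma> * x)"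
    using G_distr_std[OF L] by metis
  have "integrable std_normal_distribution (\<lambda>x. \<bar>\<sigma>\<bar>^k * \<bar>x^k\<bar>)"
    using integrable_std_normal_distribution_moment[of k] by (intro integrable_mult_right integrable_abs) auto
  then have "integrable std_normal_distribution (\<lambda>x. \<bar>\<sigma> * x\<bar>^k)"
    by (simp add: abs_mult power_mult_distrib power_abs)
  then have "integrable (distr M borel L) (\<lambda>x. \<bar>x\<bar>^k)"
    unfolding d by (subst integrable_distr_eq) auto
  then show ?thesis by (subst (asm) integrable_distr_eq) auto
qed

lemma integrable_power_G: "L \<in> G \<Longrightarrow> integrable M (\<lambda>\<omega>. L \<omega> ^ k)"
  using integrable_abs_power_G[of L k] measurable_G[of L]
  by (intro Bochner_Integration.integrable_bound[OF integrable_abs_power_G[of L k]]) (auto simp: power_abs)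

lemma integrable_G: "L \<in> G \<Longrightarrow> integrable M L"
  using integrable_power_G[of L 1] by simp

lemma integrable_mult_G:
  assumes "L \<in> G" "L' \<in> G"
  shows "integrable M (\<lambda>\<omega>. L \<omega> * L' \<omega>)"
proof -
  \<comment> \<open>Polarisation: a product is a difference of two squares of members of
    \<open>G\<close>.\<close>
  have "integrable M (\<lambda>\<omega>. ((L \<omega> + L' \<omega>)^2 - (L \<omega> - L' \<omega>)^2) / 4)"
    using assms by (intro Bochner_Integration.integrable_diff integrable_divide_zero integrable_power_G add_G diff_G)
      (auto intro!: integrable_power_G add_G diff_G)
  then show ?thesis by (simp add: power2_eq_square algebra_simps)
qed

lemma char_G:
  assumes "L \<in> G"
  shows "(\<integral>\<omega>. iexp (L \<omega>) \<partial>M) = of_real (exp (- (\<integral>\<omega>. (L \<omega>)\<^sup>2 \<partial>M) / 2))"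
proof -
  have [measurable]: "L \<in> borel_measurable M" by (rule measurable_G[OF assms])
  obtain \<sigma> where s: "0 \<le> \<sigma>" "\<sigma>\<^sup>2 = (\<integral>\<omega>. (L \<omega>)\<^sup>2 \<partial>M)" "distr M borel L = centered_normal \<sigma>"
    using G_distr_std[OF assms] by metis
  have "(\<integral>\<omega>. iexp (L \<omega>) \<partial>M) = char (distr M borel L) 1"
    unfolding char_def by (subst integral_distr) auto
  also have "\<dots> = of_real (exp (- (\<sigma> * 1)\<^sup>2 / 2))" unfolding s(3) by (rule char_centered_normal[OF s(1)])
  finally show ?thesis using s(2) by simp
qed

lemma even_moment_G:
  assumes "L \<in> G"
  shows "(\<integral>\<omega>. L \<omega> ^ (2 * k) \<partial>M) = fact (2 * k) / (2 ^ k * fact k) * (\<integral>\<omega>. (L \<omega>)\<^sup>2 \<partial>M) ^ k"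
proof -
  have [measurable]: "L \<in> borel_measurable M" by (rule measurable_G[OF assms])
  obtain \<sigma> where s: "0 \<le> \<sigma>" "\<sigma>\<^sup>2 = (\<integral>\<omega>. (L \<omega>)\<^sup>2 \<partial>M)"
    "distr M borel L = distr std_normal_distribution borel (\<lambda>x. \<sigma> * x)"
    using G_distr_std[OF assms] by metis
  have "(\<integral>\<omega>. L \<omega> ^ (2 * k) \<partial>M) = (\<integral>x. x ^ (2 * k) \<partial>(distr M borel L))"
    by (subst integral_distr) auto
  also have "\<dots> = (\<integral>x. (\<sigma> * x) ^ (2 * k) \<partial>std_normal_distribution)"
    unfolding s(3) by (subst integral_distr) auto
  also have "\<dots> = (\<sigma>\<^sup>2) ^ k * (\<integral>x. x^(2*k) \<partial>std_normal_distribution)"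
    by (simp add: power_mult_distrib power_mult)
  also have "\<dots> = (\<sigma>\<^sup>2) ^ k * (fact (2 * k) / (2 ^ k * fact k))"
    using std_normal_distribution_even_moments(1)[of k] by simp
  finally show ?thesis using s(2) by (simp add: mult_ac)
qed

text \<open>Markov's inequality for the moment of order \<open>2 * k\<close>; the constant is that
  moment of a standard normal variable. Polynomial tails of arbitrary order suffice, because the
  later unions have polynomially many members.\<close>

lemma tail_G:
  assumes L: "L \<in> G" and s: "(\<integral>\<omega>. (L \<omega>)\<^sup>2 \<partial>M) \<le> s\<^sup>2" "0 < s" and l: "0 < l"
  shows "prob {\<omega> \<in> space M. l * s < \<bar>L \<omega>\<bar>} \<le> fact (2 * k) / (2 ^ k * fact k) / l ^ (2 * k)"
proof -
  have [measurable]: "L \<in> borel_measurable M" by (rule measurable_G[OF L])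
  have pos: "0 < (l * s) ^ (2 * k)" using s l by simp
  have "prob {\<omega> \<in> space M. l * s < \<bar>L \<omega>\<bar>} \<le> prob {\<omega> \<in> space M. (l * s) ^ (2 * k) \<le> L \<omega> ^ (2 * k)}"
  proof (rule finite_measure_mono)
    show "{\<omega> \<in> space M. l * s < \<bar>L \<omega>\<bar>} \<subseteq> {\<omega> \<in> space M. (l * s) ^ (2 * k) \<le> L \<omega> ^ (2 * k)}"
    proof safe
      fix \<omega> assume "l * s < \<bar>L \<omega>\<bar>"
      then have "(l * s) ^ (2 * k) \<le> \<bar>L \<omega>\<bar> ^ (2 * k)" using s l by (intro power_mono) auto
      then show "(l * s) ^ (2 * k) \<le> L \<omega> ^ (2 * k)" by (simp add: power_even_abs)
    qed
  qed measurable
  also have "\<dots> \<le> (\<integral>\<omega>. L \<omega> ^ (2 * k) \<partial>M) / (l * s) ^ (2 * k)"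
    using integral_Markov_inequality_measure[OF integrable_power_G[OF L], of "space M" "2 * k" "(l * s) ^ (2 * k)"] pos
    by (auto simp: power_mult)
  also have "\<dots> \<le> fact (2 * k) / (2 ^ k * fact k) * (s\<^sup>2) ^ k / (l * s) ^ (2 * k)"
    unfolding even_moment_G[OF L] using s pos
    by (intro divide_right_mono mult_left_mono power_mono) auto
  also have "\<dots> = fact (2 * k) / (2 ^ k * fact k) / l ^ (2 * k)"
    proof -
    have "(l * s) ^ (2 * k) = l ^ (2 * k) * (s\<^sup>2) ^ k" by (simp add: power_mult_distrib power_mult)
    moreover have "(s\<^sup>2) ^ k \<noteq> 0" using s by simp
    ultimately show ?thesis by simp
  qed
  finally show ?thesis .
qed

end

section \<open>Joint characteristic functions\<close>

text \<open>Division by the common total mass, read off at t = 0, reduces this to the uniqueness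
  theorem for probability laws; mass 0 is treated apart. Finite measures are needed because
  restricted and weighted laws are no longer normalised.\<close>

lemma finite_measure_eqI_char:
  fixes M1 M2 :: "real measure"
  assumes "finite_measure M1" "finite_measure M2" and s: "sets M1 = sets borel" "sets M2 = sets borel"
    and c: "\<And>t. (\<integral>x. iexp (t * x) \<partial>M1) = (\<integral>x. iexp (t * x) \<partial>M2)"
  shows "M1 = M2"
proof -
  interpret M1: finite_measure M1 by fact
  interpret M2: finite_measure M2 by fact
  have sp: "space M1 = UNIV" "space M2 = UNIV" using s[THEN sets_eq_imp_space_eq] by simp_all
  have "complex_of_real (measure M1 UNIV) = complex_of_real (measure M2 UNIV)"
    using c[of 0] sp by simp
  then have m: "measure M1 UNIV = measure M2 UNIV" by simp
  define m where "m = measure M1 UNIV"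
  show ?thesis
  proof (cases "m = 0")
    case True
    show ?thesis
    proof (rule measure_eqI)
      fix A assume A: "A \<in> sets M1"
      have "measure M1 A \<le> measure M1 UNIV" "measure M2 A \<le> measure M2 UNIV"
        using M1.bounded_measure[of A] M2.bounded_measure[of A] sp by simp_all
      then have "measure M1 A = 0" "measure M2 A = 0"
        using True m measure_nonneg[of M1 A] measure_nonneg[of M2 A] unfolding m_def by linarith+
      then show "emeasure M1 A = emeasure M2 A"
        by (simp add: M1.emeasure_eq_measure M2.emeasure_eq_measure)
    qed (simp add: s)
  next
    case False
    then have mp: "0 < m" using measure_nonneg[of M1 UNIV] by (simp add: m_def less_le)
    define N where "N M = density M (\<lambda>_. ennreal (1/m))" for M :: "real measure"
    have rd: "real_distribution (N M)" if "finite_measure M" "sets M = sets borel" "measure M UNIV = m" for M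
    proof -
      have sM: "space M = UNIV" using that(2) sets_eq_imp_space_eq by force
      interpret finite_measure M by fact
      have "emeasure (N M) (space (N M)) = ennreal (1/m) * emeasure M (space M)"
        unfolding N_def by (simp add: emeasure_density_const)
      also have "emeasure M (space M) = ennreal m"
        using that(3) by (simp only: emeasure_eq_measure sM)
      also have "ennreal (1/m) * ennreal m = 1"
        using mp by (subst ennreal_mult[symmetric]) auto
      finally have "prob_space (N M)" by (rule prob_spaceI)
      then show ?thesis
        unfolding real_distribution_def real_distribution_axioms_def by (simp add: that(2) N_def sM)
    qed
    have ch: "char (N M) t = (1/m) *\<^sub>R (\<integral>x. iexp (t * x) \<partial>M)" if sM: "sets M = sets borel" for M t
    proof -
      have "(\<lambda>x. iexp (t * x)) \<in> borel_measurable borel" by measurable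
      then have *: "(\<lambda>x. iexp (t * x)) \<in> borel_measurable M" by (simp only: measurable_cong_sets[OF sM refl])
      have "char (N M) t = (\<integral>x. (1/m) *\<^sub>R iexp (t * x) \<partial>M)"
        unfolding char_def N_def by (rule integral_density[OF *]) (use mp in auto)
      also have "\<dots> = (1/m) *\<^sub>R (\<integral>x. iexp (t * x) \<partial>M)" by (rule integral_scaleR_right)
      finally show ?thesis .
    qed
    have "char (N M1) = char (N M2)"
      using ch[OF s(1)] ch[OF s(2)] c by (simp add: fun_eq_iff)
    then have NN: "N M1 = N M2"
      by (intro Levy_uniqueness rd assms(1,2) s) (simp_all add: m_def m)
    show ?thesis
    proof (rule measure_eqI)
      fix A assume A: "A \<in> sets M1"
      have "emeasure (N M1) A = emeasure (N M2) A" using NN by simp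
      then have "ennreal (1/m) * emeasure M1 A = ennreal (1/m) * emeasure M2 A"
        using A s unfolding N_def by (simp add: emeasure_density_const)
      then show "emeasure M1 A = emeasure M2 A"
        using mp by (simp add: ennreal_mult_cancel_left)
    qed (simp add: s)
  qed
qed

lemma (in finite_measure) integrable_bounded_complex:
  fixes f :: "'a \<Rightarrow> complex"
  assumes "f \<in> borel_measurable M" "\<And>x. norm (f x) \<le> B"
  shows "integrable M f"
  using assms by (intro integrable_const_bound[of f B]) auto

lemma finite_measure_weighted_distr:
  fixes w :: "real \<Rightarrow> real"
  assumes "finite_measure \<kappa>" and [measurable]: "Y \<in> borel_measurable \<kappa>" "S \<in> borel_measurable \<kappa>" "w \<in> borel_measurable borel"
    and w: "\<And>x. w x \<le> B"
  shows "finite_measure (distr (density \<kappa> (\<lambda>\<omega>. ennreal (w (S \<omega>)))) borel Y)"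
proof -
  interpret finite_measure \<kappa> by fact
  have "emeasure (density \<kappa> (\<lambda>\<omega>. ennreal (w (S \<omega>)))) (space \<kappa>) = (\<integral>\<^sup>+\<omega>. ennreal (w (S \<omega>)) \<partial>\<kappa>)"
    by (subst emeasure_density) (auto intro!: nn_integral_cong)
  also have "\<dots> \<le> (\<integral>\<^sup>+\<omega>. ennreal B \<partial>\<kappa>)" using w by (intro nn_integral_mono ennreal_leI) auto
  also have "\<dots> < \<infinity>" by (simp add: emeasure_eq_measure ennreal_mult_less_top)
  finally have "finite_measure (density \<kappa> (\<lambda>\<omega>. ennreal (w (S \<omega>))))"
    by (intro finite_measureI) auto
  then show ?thesis by (rule finite_measure.finite_measure_distr) auto
qed

text \<open>A trigonometric weight is a combination of three exponentials, so weighting only shifts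
  the frequency of \<open>S\<close> to 0, 1 or -1. The transform of the weighted law is therefore
  determined by the joint transform of \<open>Y\<close> and \<open>S\<close>.\<close>

lemma char_weighted_distr:
  fixes w :: "real \<Rightarrow> real" and a b c :: complex
  assumes "finite_measure \<kappa>" and [measurable]: "Y \<in> borel_measurable \<kappa>" "S \<in> borel_measurable \<kappa>" "w \<in> borel_measurable borel"
    and w0: "\<And>x. 0 \<le> w x" and wexp: "\<And>x. complex_of_real (w x) = a + b * iexp x + c * iexp (- x)"
  shows "(\<integral>x. iexp (t * x) \<partial>distr (density \<kappa> (\<lambda>\<omega>. ennreal (w (S \<omega>)))) borel Y) =
    a * (\<integral>\<omega>. iexp (t * Y \<omega> + 0 * S \<omega>) \<partial>\<kappa>) + b * (\<integral>\<omega>. iexp (t * Y \<omega> + 1 * S \<omega>) \<partial>\<kappa>)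
      + c * (\<integral>\<omega>. iexp (t * Y \<omega> + (-1) * S \<omega>) \<partial>\<kappa>)"
proof -
  interpret finite_measure \<kappa> by fact
  have i: "integrable \<kappa> (\<lambda>\<omega>. iexp (t * Y \<omega> + u * S \<omega>))" for u
    by (rule integrable_bounded_complex[where B=1]) auto
  have e: "w s *\<^sub>R iexp (t * y) = a * iexp (t * y + 0 * s) + b * iexp (t * y + 1 * s) + c * iexp (t * y + (-1) * s)" for s y
  proof -
    have "iexp (t * y + u * s) = iexp (t * y) * iexp (u * s)" for u
      by (simp add: distrib_left exp_add)
    from this[of 0] this[of 1] this[of "-1"] show ?thesis by (simp only: scaleR_conv_of_real wexp) (simp add: algebra_simps)
  qed
  have "(\<integral>x. iexp (t * x) \<partial>distr (density \<kappa> (\<lambda>\<omega>. ennreal (w (S \<omega>)))) borel Y) = (\<integral>\<omega>. w (S \<omega>) *\<^sub>R iexp (t * Y \<omega>) \<partial>\<kappa>)"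
    using w0 by (subst integral_distr, simp, simp) (subst integral_density, auto)
  also have "\<dots> = (\<integral>\<omega>. a * iexp (t * Y \<omega> + 0 * S \<omega>) + b * iexp (t * Y \<omega> + 1 * S \<omega>)
      + c * iexp (t * Y \<omega> + (-1) * S \<omega>) \<partial>\<kappa>)"
    by (simp only: e)
  also have "\<dots> = a * (\<integral>\<omega>. iexp (t * Y \<omega> + 0 * S \<omega>) \<partial>\<kappa>)
    + b * (\<integral>\<omega>. iexp (t * Y \<omega> + 1 * S \<omega>) \<partial>\<kappa>) + c * (\<integral>\<omega>. iexp (t * Y \<omega> + (-1) * S \<omega>) \<partial>\<kappa>)"
    using i by (simp only: Bochner_Integration.integral_add Bochner_Integration.integrable_add
        integrable_mult_right integral_mult_right_zero)
  finally show ?thesis .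
qed

lemma weighted_distr_indicator:
  fixes w :: "real \<Rightarrow> real"
  assumes [measurable]: "w \<in> borel_measurable borel" "Y \<in> borel_measurable \<kappa>" "S \<in> borel_measurable \<kappa>"
    "A \<in> sets borel" and w0: "\<And>x. 0 \<le> w x"
  shows "(\<integral>x. indicator A x \<partial>distr (density \<kappa> (\<lambda>\<omega>. ennreal (w (S \<omega>)))) borel Y)
    = (\<integral>\<omega>. indicator A (Y \<omega>) * w (S \<omega>) \<partial>\<kappa> :: real)"
proof -
  have "(\<integral>x. indicator A x \<partial>distr (density \<kappa> (\<lambda>\<omega>. ennreal (w (S \<omega>)))) borel Y)
      = (\<integral>\<omega>. indicator A (Y \<omega>) \<partial>density \<kappa> (\<lambda>\<omega>. ennreal (w (S \<omega>))) :: real)"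
    by (subst integral_distr) auto
  also have "\<dots> = (\<integral>\<omega>. indicator A (Y \<omega>) * w (S \<omega>) \<partial>\<kappa>)"
    using w0 by (subst integral_density) (auto simp: mult.commute)
  finally show ?thesis .
qed

lemma density_indicator_finite:
  fixes Y :: "'a \<Rightarrow> real"
  assumes "finite_measure \<kappa>" and [measurable]: "Y \<in> borel_measurable \<kappa>" "B \<in> sets borel"
  shows "finite_measure (density \<kappa> (\<lambda>\<omega>. indicator B (Y \<omega>)))"
proof (rule finite_measureI)
  interpret finite_measure \<kappa> by fact
  have "emeasure (density \<kappa> (\<lambda>\<omega>. indicator B (Y \<omega>))) (space \<kappa>) = (\<integral>\<^sup>+\<omega>. indicator B (Y \<omega>) * indicator (space \<kappa>) \<omega> \<partial>\<kappa>)"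
    by (subst emeasure_density) auto
  also have "\<dots> \<le> (\<integral>\<^sup>+\<omega>. 1 \<partial>\<kappa>)"
    by (intro nn_integral_mono) (auto split: split_indicator)
  also have "\<dots> < \<infinity>" by (simp add: emeasure_eq_measure)
  finally show "emeasure (density \<kappa> (\<lambda>\<omega>. indicator B (Y \<omega>))) (space (density \<kappa> (\<lambda>\<omega>. indicator B (Y \<omega>)))) \<noteq> \<infinity>" by simp
qed

lemma integral_density_indicator:
  fixes Y :: "'a \<Rightarrow> real" and g :: "'a \<Rightarrow> complex"
  assumes [measurable]: "Y \<in> borel_measurable \<kappa>" "B \<in> sets borel" "g \<in> borel_measurable \<kappa>"
  shows "(\<integral>\<omega>. g \<omega> \<partial>density \<kappa> (\<lambda>\<omega>. indicator B (Y \<omega>))) = (\<integral>\<omega>. indicator B (Y \<omega>) *\<^sub>R g \<omega> \<partial>\<kappa>)"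
proof -
  have "(\<integral>\<omega>. g \<omega> \<partial>density \<kappa> (\<lambda>\<omega>. ennreal (indicator B (Y \<omega>)))) = (\<integral>\<omega>. indicator B (Y \<omega>) *\<^sub>R g \<omega> \<partial>\<kappa>)"
    by (subst integral_density) auto
  then show ?thesis by (simp add: ennreal_indicator)
qed

text \<open>Serves to peel off one coordinate: restricting the measure to the event that
  \<open>Y i\<close> lies in \<open>A i\<close> shortens the rectangle by one side, which is the
  induction step for equality on rectangles.\<close>

lemma emeasure_density_rectangle:
  fixes Y :: "'i \<Rightarrow> 'a \<Rightarrow> real"
  assumes I: "finite I" and Y: "\<And>l. l \<in> insert i I \<Longrightarrow> Y l \<in> borel_measurable \<kappa>"
    and A: "\<And>l. l \<in> insert i I \<Longrightarrow> A l \<in> sets borel"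
  shows "emeasure (density \<kappa> (\<lambda>\<omega>. indicator (A i) (Y i \<omega>))) {\<omega>\<in>space \<kappa>. \<forall>l\<in>I. Y l \<omega> \<in> A l}
      = emeasure \<kappa> {\<omega>\<in>space \<kappa>. \<forall>l\<in>insert i I. Y l \<omega> \<in> A l}"
proof -
  have [measurable]: "Y i \<in> borel_measurable \<kappa>" "A i \<in> sets borel" using Y A by auto
  have m: "{\<omega>\<in>space \<kappa>. Y l \<omega> \<in> A l} \<in> sets \<kappa>" if "l \<in> insert i I" for l
    using measurable_sets[OF Y[OF that] A[OF that]] by (simp add: vimage_def Int_def conj_commute)
  have [measurable]: "{\<omega>\<in>space \<kappa>. \<forall>l\<in>I. Y l \<omega> \<in> A l} \<in> sets \<kappa>"
    "{\<omega>\<in>space \<kappa>. \<forall>l\<in>insert i I. Y l \<omega> \<in> A l} \<in> sets \<kappa>"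
    using I m by (intro sets.sets_Collect_finite_All; auto)+
  have "emeasure (density \<kappa> (\<lambda>\<omega>. indicator (A i) (Y i \<omega>))) {\<omega>\<in>space \<kappa>. \<forall>l\<in>I. Y l \<omega> \<in> A l}
      = (\<integral>\<^sup>+\<omega>. indicator (A i) (Y i \<omega>) * indicator {\<omega>\<in>space \<kappa>. \<forall>l\<in>I. Y l \<omega> \<in> A l} \<omega> \<partial>\<kappa>)"
    by (rule emeasure_density) measurable
  also have "\<dots> = (\<integral>\<^sup>+\<omega>. indicator {\<omega>\<in>space \<kappa>. \<forall>l\<in>insert i I. Y l \<omega> \<in> A l} \<omega> \<partial>\<kappa>)"
    by (intro nn_integral_cong) (auto split: split_indicator)
  finally show ?thesis by (simp only: nn_integral_indicator \<open>{\<omega>\<in>space \<kappa>. \<forall>l\<in>insert i I. Y l \<omega> \<in> A l} \<in> sets \<kappa>\<close>)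
qed

text \<open>Testing against the nonnegative weights \<open>2 + cos \<langle>u, Z\<rangle>\<close> and \<open>2 + sin \<langle>u, Z\<rangle>\<close> reduces the
  separation of one coordinate to the uniqueness theorem on the line.\<close>

lemma char_restrict_coordinate:
  fixes \<mu> :: "'a measure" and \<nu> :: "'b measure"
  assumes fin: "finite_measure \<mu>" "finite_measure \<nu>"
    and [measurable]: "Y \<in> borel_measurable \<mu>" "Y' \<in> borel_measurable \<nu>"
      "S \<in> borel_measurable \<mu>" "S' \<in> borel_measurable \<nu>"
    and eq: "\<And>t u. (\<integral>\<omega>. iexp (t * Y \<omega> + u * S \<omega>) \<partial>\<mu>) = (\<integral>\<omega>. iexp (t * Y' \<omega> + u * S' \<omega>) \<partial>\<nu>)"
    and [measurable]: "A \<in> sets borel"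
  shows "(\<integral>\<omega>. indicator A (Y \<omega>) *\<^sub>R iexp (S \<omega>) \<partial>\<mu>) = (\<integral>\<omega>. indicator A (Y' \<omega>) *\<^sub>R iexp (S' \<omega>) \<partial>\<nu>)"
proof -
  interpret \<mu>: finite_measure \<mu> by fact
  interpret \<nu>: finite_measure \<nu> by fact
  have int: "integrable \<mu> (\<lambda>\<omega>. iexp (t * Y \<omega> + u * S \<omega>))" for t u
    by (rule \<mu>.integrable_bounded_complex[where B=1]) auto
  have int': "integrable \<nu> (\<lambda>\<omega>. iexp (t * Y' \<omega> + u * S' \<omega>))" for t u
    by (rule \<nu>.integrable_bounded_complex[where B=1]) auto
  \<comment> \<open>Nonnegativity of the weight makes the weighted object a measure, to which the
    uniqueness theorem on the line applies.\<close>
  have key: "(\<integral>\<omega>. indicator A (Y \<omega>) * w (S \<omega>) \<partial>\<mu>) = (\<integral>\<omega>. indicator A (Y' \<omega>) * w (S' \<omega>) \<partial>\<nu>)"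
    if [measurable]: "w \<in> borel_measurable borel" and w0: "\<And>x. 0 \<le> w x" and w3: "\<And>x. w x \<le> 3"
      and wexp: "\<And>x. complex_of_real (w x) = a + b * iexp x + c * iexp (- x)" for w :: "real \<Rightarrow> real" and a b c
  proof -
    have "distr (density \<mu> (\<lambda>\<omega>. ennreal (w (S \<omega>)))) borel Y = distr (density \<nu> (\<lambda>\<omega>. ennreal (w (S' \<omega>)))) borel Y'"
    proof (rule finite_measure_eqI_char)
      show "finite_measure (distr (density \<mu> (\<lambda>\<omega>. ennreal (w (S \<omega>)))) borel Y)"
        by (rule finite_measure_weighted_distr) (use fin w3 in auto)
      show "finite_measure (distr (density \<nu> (\<lambda>\<omega>. ennreal (w (S' \<omega>)))) borel Y')"
        by (rule finite_measure_weighted_distr) (use fin w3 in auto)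
      fix t
      have "(\<integral>x. iexp (t * x) \<partial>distr (density \<mu> (\<lambda>\<omega>. ennreal (w (S \<omega>)))) borel Y) =
        a * (\<integral>\<omega>. iexp (t * Y \<omega> + 0 * S \<omega>) \<partial>\<mu>) + b * (\<integral>\<omega>. iexp (t * Y \<omega> + 1 * S \<omega>) \<partial>\<mu>)
        + c * (\<integral>\<omega>. iexp (t * Y \<omega> + (-1) * S \<omega>) \<partial>\<mu>)"
        by (rule char_weighted_distr) (use fin w0 wexp in auto)
      moreover have "(\<integral>x. iexp (t * x) \<partial>distr (density \<nu> (\<lambda>\<omega>. ennreal (w (S' \<omega>)))) borel Y') =
        a * (\<integral>\<omega>. iexp (t * Y' \<omega> + 0 * S' \<omega>) \<partial>\<nu>) + b * (\<integral>\<omega>. iexp (t * Y' \<omega> + 1 * S' \<omega>) \<partial>\<nu>)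
        + c * (\<integral>\<omega>. iexp (t * Y' \<omega> + (-1) * S' \<omega>) \<partial>\<nu>)"
        by (rule char_weighted_distr) (use fin w0 wexp in auto)
      ultimately show "(\<integral>x. iexp (t * x) \<partial>distr (density \<mu> (\<lambda>\<omega>. ennreal (w (S \<omega>)))) borel Y) =
          (\<integral>x. iexp (t * x) \<partial>distr (density \<nu> (\<lambda>\<omega>. ennreal (w (S' \<omega>)))) borel Y')"
        by (simp only: eq)
    qed simp_all
    then show ?thesis
      using weighted_distr_indicator[of w Y \<mu> S A] weighted_distr_indicator[of w Y' \<nu> S' A] w0 by simp
  qed
  have b: "\<bar>cos x\<bar> \<le> 3" "\<bar>sin x\<bar> \<le> 3" for x :: real
    using abs_cos_le_one[of x] abs_sin_le_one[of x] by linarith+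
  have bint: "integrable \<mu> (\<lambda>\<omega>. indicator A (Y \<omega>) * g (S \<omega>))"
    "integrable \<nu> (\<lambda>\<omega>. indicator A (Y' \<omega>) * g (S' \<omega>))"
    if [measurable]: "g \<in> borel_measurable borel" and "\<And>x. \<bar>g x\<bar> \<le> 3" for g :: "real \<Rightarrow> real"
    using that(2) by (auto intro!: \<mu>.integrable_const_bound[where B=3] \<nu>.integrable_const_bound[where B=3]
        split: split_indicator)
  note bi = bint[OF borel_measurable_const, of 1, simplified] bint[of cos, OF _ b(1)] bint[of sin, OF _ b(2)]
  \<comment> \<open>The constant weight gives the part to be subtracted, twice, from the weights
    \<open>2 + cos\<close> and \<open>2 + sin\<close>.\<close>
  have k1: "(\<integral>\<omega>. indicat_real A (Y \<omega>) * 1 \<partial>\<mu>) = (\<integral>\<omega>. indicat_real A (Y' \<omega>) * 1 \<partial>\<nu>)"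
    using key[of "\<lambda>_. 1" 1 0 0] by simp
  have "(\<integral>\<omega>. indicat_real A (Y \<omega>) * (2 + cos (S \<omega>)) \<partial>\<mu>) = (\<integral>\<omega>. indicat_real A (Y' \<omega>) * (2 + cos (S' \<omega>)) \<partial>\<nu>)"
  proof (rule key[of "\<lambda>x. 2 + cos x" 2 "1/2" "1/2"])
    show "complex_of_real (2 + cos x) = 2 + 1 / 2 * iexp x + 1 / 2 * iexp (- x)" for x
      by (simp add: cos_exp_eq field_simps flip: cos_of_real)
    show "0 \<le> 2 + cos x" for x :: real using cos_ge_minus_one[of x] by linarith
    show "2 + cos x \<le> 3" for x :: real using cos_le_one[of x] by linarith
  qed measurable
  moreover have "(\<integral>\<omega>. indicat_real A (Y \<omega>) * (2 + cos (S \<omega>)) \<partial>\<mu>) = 2 * (\<integral>\<omega>. indicat_real A (Y \<omega>) * 1 \<partial>\<mu>) + (\<integral>\<omega>. indicat_real A (Y \<omega>) * cos (S \<omega>) \<partial>\<mu>)"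
    "(\<integral>\<omega>. indicat_real A (Y' \<omega>) * (2 + cos (S' \<omega>)) \<partial>\<nu>) = 2 * (\<integral>\<omega>. indicat_real A (Y' \<omega>) * 1 \<partial>\<nu>) + (\<integral>\<omega>. indicat_real A (Y' \<omega>) * cos (S' \<omega>) \<partial>\<nu>)"
    using bi by (simp_all add: distrib_left mult.commute[of _ 2])
  ultimately have kc: "(\<integral>\<omega>. indicat_real A (Y \<omega>) * cos (S \<omega>) \<partial>\<mu>) = (\<integral>\<omega>. indicat_real A (Y' \<omega>) * cos (S' \<omega>) \<partial>\<nu>)"
    using k1 by simp
  have "(\<integral>\<omega>. indicat_real A (Y \<omega>) * (2 + sin (S \<omega>)) \<partial>\<mu>) = (\<integral>\<omega>. indicat_real A (Y' \<omega>) * (2 + sin (S' \<omega>)) \<partial>\<nu>)"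
  proof (rule key[of "\<lambda>x. 2 + sin x" 2 "-\<i>/2" "\<i>/2"])
    show "complex_of_real (2 + sin x) = 2 + - \<i> / 2 * iexp x + \<i> / 2 * iexp (- x)" for x
      by (simp add: sin_exp_eq field_simps flip: sin_of_real)
    show "0 \<le> 2 + sin x" for x :: real using sin_ge_minus_one[of x] by linarith
    show "2 + sin x \<le> 3" for x :: real using sin_le_one[of x] by linarith
  qed measurable
  moreover have "(\<integral>\<omega>. indicat_real A (Y \<omega>) * (2 + sin (S \<omega>)) \<partial>\<mu>) = 2 * (\<integral>\<omega>. indicat_real A (Y \<omega>) * 1 \<partial>\<mu>) + (\<integral>\<omega>. indicat_real A (Y \<omega>) * sin (S \<omega>) \<partial>\<mu>)"
    "(\<integral>\<omega>. indicat_real A (Y' \<omega>) * (2 + sin (S' \<omega>)) \<partial>\<nu>) = 2 * (\<integral>\<omega>. indicat_real A (Y' \<omega>) * 1 \<partial>\<nu>) + (\<integral>\<omega>. indicat_real A (Y' \<omega>) * sin (S' \<omega>) \<partial>\<nu>)"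
    using bi by (simp_all add: distrib_left mult.commute[of _ 2])
  ultimately have ks: "(\<integral>\<omega>. indicat_real A (Y \<omega>) * sin (S \<omega>) \<partial>\<mu>) = (\<integral>\<omega>. indicat_real A (Y' \<omega>) * sin (S' \<omega>) \<partial>\<nu>)"
    using k1 by simp
  have "indicator A y *\<^sub>R iexp s = complex_of_real (indicat_real A y * cos s) + \<i> * complex_of_real (indicat_real A y * sin s)" for y s :: real
    by (simp add: exp_Euler cos_of_real sin_of_real split: split_indicator)
  moreover have "integrable \<mu> (\<lambda>\<omega>. complex_of_real (indicator A (Y \<omega>) * cos (S \<omega>)))"
    "integrable \<mu> (\<lambda>\<omega>. complex_of_real (indicator A (Y \<omega>) * sin (S \<omega>)))"
    "integrable \<nu> (\<lambda>\<omega>. complex_of_real (indicator A (Y' \<omega>) * cos (S' \<omega>)))"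
    "integrable \<nu> (\<lambda>\<omega>. complex_of_real (indicator A (Y' \<omega>) * sin (S' \<omega>)))"
    by (rule integrable_of_real; use bi in simp)+
  ultimately show ?thesis
    using kc ks by (simp only: Bochner_Integration.integral_add integrable_mult_right integral_mult_right_zero integral_complex_of_real)
qed

text \<open>Induction over the coordinates with both measures generalised: restriction to a
  condition on one coordinate keeps the joint transforms of the remaining coordinates equal, by
  \<open>char_restrict_coordinate\<close>.\<close>

lemma char_eq_imp_rectangle_eq:
  fixes Z :: "'i \<Rightarrow> 'a \<Rightarrow> real" and Z' :: "'i \<Rightarrow> 'b \<Rightarrow> real"
  assumes "finite I" "finite_measure \<mu>" "finite_measure \<nu>"
    and "\<And>l. l \<in> I \<Longrightarrow> Z l \<in> borel_measurable \<mu>" "\<And>l. l \<in> I \<Longrightarrow> Z' l \<in> borel_measurable \<nu>"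
    and "\<And>u. (\<integral>\<omega>. iexp (\<Sum>l\<in>I. u l * Z l \<omega>) \<partial>\<mu>) = (\<integral>\<omega>. iexp (\<Sum>l\<in>I. u l * Z' l \<omega>) \<partial>\<nu>)"
    and "\<And>l. l \<in> I \<Longrightarrow> A l \<in> sets borel"
  shows "emeasure \<mu> {\<omega>\<in>space \<mu>. \<forall>l\<in>I. Z l \<omega> \<in> A l} = emeasure \<nu> {\<omega>\<in>space \<nu>. \<forall>l\<in>I. Z' l \<omega> \<in> A l}"
  using assms
proof (induction I arbitrary: \<mu> \<nu> rule: finite_induct)
  case empty
  interpret \<mu>: finite_measure \<mu> by fact
  interpret \<nu>: finite_measure \<nu> by fact
  have "complex_of_real (measure \<mu> (space \<mu>)) = complex_of_real (measure \<nu> (space \<nu>))"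
    using empty(5)[of "\<lambda>_. 0"] by simp
  then have "measure \<mu> (space \<mu>) = measure \<nu> (space \<nu>)" by (simp only: of_real_eq_iff)
  then show ?case by (simp add: \<mu>.emeasure_eq_measure \<nu>.emeasure_eq_measure)
next
  case (insert i I)
  note [measurable] = insert(6,7,9)
  define \<mu>' where "\<mu>' = density \<mu> (\<lambda>\<omega>. indicator (A i) (Z i \<omega>))"
  define \<nu>' where "\<nu>' = density \<nu> (\<lambda>\<omega>. indicator (A i) (Z' i \<omega>))"
  have m[measurable]: "Z i \<in> borel_measurable \<mu>" "Z' i \<in> borel_measurable \<nu>" "A i \<in> sets borel"
    using insert.prems by auto
  have mI[measurable]: "l \<in> I \<Longrightarrow> Z l \<in> borel_measurable \<mu>" "l \<in> I \<Longrightarrow> Z' l \<in> borel_measurable \<nu>" "l \<in> I \<Longrightarrow> A l \<in> sets borel" for l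
    using insert.prems by auto
  have "emeasure \<mu>' {\<omega>\<in>space \<mu>'. \<forall>l\<in>I. Z l \<omega> \<in> A l} = emeasure \<nu>' {\<omega>\<in>space \<nu>'. \<forall>l\<in>I. Z' l \<omega> \<in> A l}"
  proof (rule insert.IH)
    show "finite_measure \<mu>'" "finite_measure \<nu>'"
      unfolding \<mu>'_def \<nu>'_def using insert.prems by (auto intro!: density_indicator_finite)
    show "l \<in> I \<Longrightarrow> Z l \<in> borel_measurable \<mu>'" "l \<in> I \<Longrightarrow> Z' l \<in> borel_measurable \<nu>'" for l
      unfolding \<mu>'_def \<nu>'_def using insert.prems by auto
    show "l \<in> I \<Longrightarrow> A l \<in> sets borel" for l using insert.prems by auto
    fix u
    have *: "(\<integral>\<omega>. iexp (t * Z i \<omega> + v * (\<Sum>l\<in>I. u l * Z l \<omega>)) \<partial>\<mu>)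
        = (\<integral>\<omega>. iexp (t * Z' i \<omega> + v * (\<Sum>l\<in>I. u l * Z' l \<omega>)) \<partial>\<nu>)" for t v
    proof -
      have e: "(\<Sum>l\<in>insert i I. (if l = i then t else v * u l) * y l) = t * y i + v * (\<Sum>l\<in>I. u l * y l)" for y
      proof -
        have "(\<Sum>l\<in>I. (if l = i then t else v * u l) * y l) = (\<Sum>l\<in>I. v * (u l * y l))"
          using insert.hyps by (intro sum.cong) auto
        then show ?thesis using insert.hyps by (simp add: sum_distrib_left)
      qed
      show ?thesis using insert.prems(5)[of "\<lambda>l. if l = i then t else v * u l"] unfolding e .
    qed
    have "(\<integral>\<omega>. indicator (A i) (Z i \<omega>) *\<^sub>R iexp (\<Sum>l\<in>I. u l * Z l \<omega>) \<partial>\<mu>)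
      = (\<integral>\<omega>. indicator (A i) (Z' i \<omega>) *\<^sub>R iexp (\<Sum>l\<in>I. u l * Z' l \<omega>) \<partial>\<nu>)"
    proof (rule char_restrict_coordinate[OF insert.prems(1,2)])
      show "(\<integral>\<omega>. iexp (t * Z i \<omega> + v * (\<Sum>l\<in>I. u l * Z l \<omega>)) \<partial>\<mu>)
        = (\<integral>\<omega>. iexp (t * Z' i \<omega> + v * (\<Sum>l\<in>I. u l * Z' l \<omega>)) \<partial>\<nu>)" for t v by (rule *)
    qed measurable
    then show "(\<integral>\<omega>. iexp (\<Sum>l\<in>I. u l * Z l \<omega>) \<partial>\<mu>') = (\<integral>\<omega>. iexp (\<Sum>l\<in>I. u l * Z' l \<omega>) \<partial>\<nu>')"
      unfolding \<mu>'_def \<nu>'_def using insert.prems by (simp add: integral_density_indicator borel_measurable_sum)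
  qed
  then show ?case unfolding \<mu>'_def \<nu>'_def using insert.hyps insert.prems by (simp add: emeasure_density_rectangle)
qed

text \<open>Rectangles are stable under intersection and generate the product sigma-algebra, so
  equality on them is equality of the joint laws.\<close>

lemma char_eq_imp_distr_PiM_eq:
  fixes Z :: "'i \<Rightarrow> 'a \<Rightarrow> real" and Z' :: "'i \<Rightarrow> 'b \<Rightarrow> real"
  assumes I: "finite I" and fin: "finite_measure \<mu>" "finite_measure \<nu>"
    and m: "\<And>l. l \<in> I \<Longrightarrow> Z l \<in> borel_measurable \<mu>" "\<And>l. l \<in> I \<Longrightarrow> Z' l \<in> borel_measurable \<nu>"
    and ch: "\<And>u. (\<integral>\<omega>. iexp (\<Sum>l\<in>I. u l * Z l \<omega>) \<partial>\<mu>) = (\<integral>\<omega>. iexp (\<Sum>l\<in>I. u l * Z' l \<omega>) \<partial>\<nu>)"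
  shows "distr \<mu> (PiM I (\<lambda>_. borel)) (\<lambda>\<omega>. \<lambda>l\<in>I. Z l \<omega>) = distr \<nu> (PiM I (\<lambda>_. borel)) (\<lambda>\<omega>. \<lambda>l\<in>I. Z' l \<omega>)"
    (is "?P = ?Q")
proof (rule measure_eqI_PiM_finite[OF I])
  interpret \<mu>: finite_measure \<mu> by fact
  have mm[measurable]: "(\<lambda>\<omega>. \<lambda>l\<in>I. Z l \<omega>) \<in> measurable \<mu> (PiM I (\<lambda>_. borel))"
    "(\<lambda>\<omega>. \<lambda>l\<in>I. Z' l \<omega>) \<in> measurable \<nu> (PiM I (\<lambda>_. borel))"
    using m by (auto intro!: measurable_restrict)
  show "sets ?P = sets (PiM I (\<lambda>_. borel))" "sets ?Q = sets (PiM I (\<lambda>_. borel))" by simp_all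
  show "emeasure ?P (Pi\<^sub>E I A) = emeasure ?Q (Pi\<^sub>E I A)" if A: "\<And>i. i \<in> I \<Longrightarrow> A i \<in> sets borel" for A
  proof -
    have [measurable]: "Pi\<^sub>E I A \<in> sets (PiM I (\<lambda>_. borel))" using A I by (auto intro!: sets_PiM_I_finite)
    have "(\<lambda>\<omega>. \<lambda>l\<in>I. Z l \<omega>) -` Pi\<^sub>E I A \<inter> space \<mu> = {\<omega>\<in>space \<mu>. \<forall>l\<in>I. Z l \<omega> \<in> A l}"
      "(\<lambda>\<omega>. \<lambda>l\<in>I. Z' l \<omega>) -` Pi\<^sub>E I A \<inter> space \<nu> = {\<omega>\<in>space \<nu>. \<forall>l\<in>I. Z' l \<omega> \<in> A l}"
      by (auto simp: PiE_iff)
    then show ?thesis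
      using char_eq_imp_rectangle_eq[OF I fin m ch A] by (simp add: emeasure_distr)
  qed
  show "range (\<lambda>_::nat. space (PiM I (\<lambda>_. borel :: real measure))) \<subseteq> prod_algebra I (\<lambda>_. borel)"
    using I by (auto simp: space_PiM intro!: prod_algebraI_finite)
  show "(\<Union>i::nat. space (PiM I (\<lambda>_. borel :: real measure))) = space (PiM I (\<lambda>_. borel))" by simp
  show "emeasure ?P (space (PiM I (\<lambda>_. borel))) \<noteq> \<infinity>"
    using \<mu>.emeasure_finite by (subst emeasure_distr) auto
qed

section \<open>Gaussian integration by parts\<close>

lemma power_add_le_two_power:
  fixes a b :: real
  assumes "0 \<le> a" "0 \<le> b"
  shows "(a + b) ^ k \<le> 2 ^ k * (a ^ k + b ^ k)"
proof -
  have "(a + b) ^ k \<le> (2 * max a b) ^ k" using assms by (intro power_mono) auto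
  also have "\<dots> = 2 ^ k * max (a ^ k) (b ^ k)"
    using assms by (auto simp: power_mult_distrib max_def power_mono intro: antisym)
  also have "\<dots> \<le> 2 ^ k * (a ^ k + b ^ k)" using assms by (intro mult_left_mono) auto
  finally show ?thesis .
qed

lemma tendsto_std_normal_density_power:
  "((\<lambda>x. std_normal_density x * (1 + \<bar>x\<bar>) ^ k) \<longlongrightarrow> 0) at_top"
  "((\<lambda>x. std_normal_density x * (1 + \<bar>x\<bar>) ^ k) \<longlongrightarrow> 0) at_bot"
proof -
  \<comment> \<open>Inserting exp (1 + x) and its inverse separates the Gaussian decay from the
    polynomial, each tending to 0 on its own; the other end follows by symmetry.\<close>
  have "((\<lambda>x::real. 1 / sqrt (2 * pi) * (exp (- x\<^sup>2 / 2) * exp (1 + x)) * ((1 + x) ^ k / exp (1 + x))) \<longlongrightarrow> 1 / sqrt (2 * pi) * 0 * 0) at_top"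
  proof (intro tendsto_mult tendsto_const)
    show "((\<lambda>x::real. exp (- x\<^sup>2 / 2) * exp (1 + x)) \<longlongrightarrow> 0) at_top" by real_asymp
    show "((\<lambda>x::real. (1 + x) ^ k / exp (1 + x)) \<longlongrightarrow> 0) at_top"
      by (rule filterlim_compose[OF tendsto_power_div_exp_0]) real_asymp
  qed
  then have *: "((\<lambda>x. std_normal_density x * (1 + x) ^ k) \<longlongrightarrow> 0) at_top"
    by (simp add: std_normal_density_def field_simps)
  show 1: "((\<lambda>x. std_normal_density x * (1 + \<bar>x\<bar>) ^ k) \<longlongrightarrow> 0) at_top"
    by (rule Lim_transform_eventually[OF *]) (use eventually_ge_at_top[of 0] in eventually_elim, auto)
  show "((\<lambda>x. std_normal_density x * (1 + \<bar>x\<bar>) ^ k) \<longlongrightarrow> 0) at_bot"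
    using 1 by (simp add: filterlim_at_bot_mirror std_normal_density_def)
qed

lemma integrable_std_normal_polynomial_growth:
  fixes h :: "real \<Rightarrow> complex"
  assumes [measurable]: "h \<in> borel_measurable borel" and b: "\<And>y. norm (h y) \<le> C * (1 + \<bar>y\<bar>) ^ k"
  shows "integrable lborel (\<lambda>x. std_normal_density x *\<^sub>R h x)"
proof (rule Bochner_Integration.integrable_bound)
  have C: "0 \<le> C" using order_trans[OF norm_ge_zero b[of 0]] by simp
  show "integrable lborel (\<lambda>x. C * 2 ^ k * (std_normal_density x + std_normal_density x * \<bar>x\<bar> ^ k))"
    using integrable_std_normal_moment_abs[of k] integrable_normal_density[of 1 0]
    by (intro integrable_mult_right Bochner_Integration.integrable_add) auto
  show "AE x in lborel. norm (std_normal_density x *\<^sub>R h x) \<le> norm (C * 2 ^ k * (std_normal_density x + std_normal_density x * \<bar>x\<bar> ^ k))"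
  proof (rule AE_I2)
    fix x
    have "norm (h x) \<le> C * (2 ^ k * (1 ^ k + \<bar>x\<bar> ^ k))"
      using b[of x] mult_left_mono[OF power_add_le_two_power[of 1 "\<bar>x\<bar>" k] C] by simp
    from mult_left_mono[OF this, of "std_normal_density x"]
    have "norm (std_normal_density x *\<^sub>R h x) \<le> std_normal_density x * (C * (2 ^ k * (1 ^ k + \<bar>x\<bar> ^ k)))"
      by simp
    then show "norm (std_normal_density x *\<^sub>R h x) \<le> norm (C * 2 ^ k * (std_normal_density x + std_normal_density x * \<bar>x\<bar> ^ k))"
      using C by (simp add: algebra_simps abs_mult)
  qed
qed measurable

text \<open>The density satisfies \<phi>' = - x \<phi>, so the difference of the two integrands is
  the derivative of \<phi> h; polynomial growth makes \<phi> h vanish at both ends.\<close>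

lemma std_normal_integration_by_parts:
  fixes h h' :: "real \<Rightarrow> complex"
  assumes d: "\<And>y. (h has_vector_derivative h' y) (at y)" and c: "continuous_on UNIV h'"
    and b: "\<And>y. norm (h y) \<le> C * (1 + \<bar>y\<bar>) ^ k" "\<And>y. norm (h' y) \<le> C * (1 + \<bar>y\<bar>) ^ k"
  shows "(\<integral>x. x *\<^sub>R h x \<partial>std_normal_distribution) = (\<integral>x. h' x \<partial>std_normal_distribution)"
proof -
  have C: "0 \<le> C" using order_trans[OF norm_ge_zero b(1)[of 0]] by simp
  have ch: "continuous_on UNIV h"
    using d by (auto intro!: continuous_at_imp_continuous_on has_vector_derivative_continuous)
  have [measurable]: "h \<in> borel_measurable borel" "h' \<in> borel_measurable borel"
    using c ch by (auto intro: borel_measurable_continuous_onI)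
  have i1: "integrable lborel (\<lambda>x. std_normal_density x *\<^sub>R h' x)"
    using b(2) by (intro integrable_std_normal_polynomial_growth) auto
  have i2: "integrable lborel (\<lambda>x. std_normal_density x *\<^sub>R (x *\<^sub>R h x))"
  proof (rule integrable_std_normal_polynomial_growth)
    show "norm (y *\<^sub>R h y) \<le> C * (1 + \<bar>y\<bar>) ^ (k + 1)" for y
      using mult_mono[OF _ b(1)[of y], of "\<bar>y\<bar>" "1 + \<bar>y\<bar>"] C by (simp add: mult_ac)
  qed measurable
  define f where "f x = std_normal_density x *\<^sub>R h' x - std_normal_density x *\<^sub>R (x *\<^sub>R h x)" for x
  define F where "F x = std_normal_density x *\<^sub>R h x" for x
  have dens: "(std_normal_density has_real_derivative - x * std_normal_density x) (at x)" for x
    unfolding std_normal_density_def by (auto intro!: derivative_eq_intros simp: field_simps)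
  have dF: "(F has_vector_derivative f x) (at x)" for x
  proof -
    have "(F has_vector_derivative (std_normal_density x *\<^sub>R h' x + (- x * std_normal_density x) *\<^sub>R h x)) (at x)"
      unfolding F_def by (intro has_vector_derivative_scaleR dens d)
    then show ?thesis by (simp add: f_def mult.commute)
  qed
  have cf: "continuous_on UNIV f"
    unfolding f_def std_normal_density_def by (intro continuous_intros c ch) auto
  have if': "integrable lborel f" unfolding f_def using i1 i2 by simp
  have nF: "norm (F x) \<le> C * (std_normal_density x * (1 + \<bar>x\<bar>) ^ k)" for x
    unfolding F_def using mult_left_mono[OF b(1)[of x], of "std_normal_density x"] by (simp add: mult_ac)
  have lim: "(F \<longlongrightarrow> 0) at_top" "(F \<longlongrightarrow> 0) at_bot"
    by (rule Lim_null_comparison[OF always_eventually], rule allI, rule nF,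
        use tendsto_mult_left[OF tendsto_std_normal_density_power(1)[of k], of C]
          tendsto_mult_left[OF tendsto_std_normal_density_power(2)[of k], of C] in simp)+
  have "(LBINT x=-\<infinity>..\<infinity>. f x) = 0 - 0"
  proof (rule interval_integral_FTC_integrable[where F=F])
    show "isCont f x" for x using cf by (simp add: continuous_on_eq_continuous_at)
    show "set_integrable lborel (einterval (- \<infinity>) \<infinity>) f" using if' by (simp add: set_integrable_def)
    show "((F \<circ> real_of_ereal) \<longlongrightarrow> 0) (at_right (- \<infinity>))" "((F \<circ> real_of_ereal) \<longlongrightarrow> 0) (at_left \<infinity>)"
      using lim by (simp_all add: ereal_tendsto_simps)
  qed (auto simp: dF)
  then have "(\<integral>x. f x \<partial>lborel) = 0"
    by (simp add: interval_lebesgue_integral_def set_lebesgue_integral_def)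
  then have "(\<integral>x. std_normal_density x *\<^sub>R h' x \<partial>lborel) = (\<integral>x. std_normal_density x *\<^sub>R (x *\<^sub>R h x) \<partial>lborel)"
    unfolding f_def using i1 i2 by simp
  then show ?thesis by (subst (1 2) integral_density) auto
qed

context gaussian_space
begin

text \<open>Transport along x |-> \<sigma> x: one factor \<sigma> comes from \<open>L\<close>
  itself, the other from the chain rule, and together they give the variance. The case \<sigma> = 0
  needs no separate treatment.\<close>

lemma integration_by_parts_G:
  fixes h h' :: "real \<Rightarrow> complex"
  assumes L: "L \<in> G"
    and d: "\<And>y. (h has_vector_derivative h' y) (at y)" and c: "continuous_on UNIV h'"
    and b: "\<And>y. norm (h y) \<le> C * (1 + \<bar>y\<bar>) ^ k" "\<And>y. norm (h' y) \<le> C * (1 + \<bar>y\<bar>) ^ k"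
  shows "(\<integral>\<omega>. L \<omega> *\<^sub>R h (L \<omega>) \<partial>M) = (\<integral>\<omega>. (L \<omega>)\<^sup>2 \<partial>M) *\<^sub>R (\<integral>\<omega>. h' (L \<omega>) \<partial>M)"
proof -
  have [measurable]: "L \<in> borel_measurable M" by (rule measurable_G[OF L])
  obtain \<sigma> where s: "0 \<le> \<sigma>" "\<sigma>\<^sup>2 = (\<integral>\<omega>. (L \<omega>)\<^sup>2 \<partial>M)"
    "distr M borel L = distr std_normal_distribution borel (\<lambda>x. \<sigma> * x)"
    using G_distr_std[OF L] by metis
  have C: "0 \<le> C" using order_trans[OF norm_ge_zero b(1)[of 0]] by simp
  have ch: "continuous_on UNIV h"
    using d by (auto intro!: continuous_at_imp_continuous_on has_vector_derivative_continuous)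
  have [measurable]: "h \<in> borel_measurable borel" "h' \<in> borel_measurable borel"
    using c ch by (auto intro: borel_measurable_continuous_onI)
  have growth: "C * (1 + \<bar>\<sigma> * y\<bar>) ^ k \<le> C * (1 + \<sigma>) ^ k * (1 + \<bar>y\<bar>) ^ k" for y
  proof -
    have "1 + \<bar>\<sigma> * y\<bar> \<le> (1 + \<sigma>) * (1 + \<bar>y\<bar>)" using s(1) by (simp add: abs_mult algebra_simps)
    then have "(1 + \<bar>\<sigma> * y\<bar>) ^ k \<le> ((1 + \<sigma>) * (1 + \<bar>y\<bar>)) ^ k" by (rule power_mono) simp
    then show ?thesis using C by (simp add: power_mult_distrib mult_left_mono mult.assoc)
  qed
  have "(\<integral>\<omega>. L \<omega> *\<^sub>R h (L \<omega>) \<partial>M) = (\<integral>x. x *\<^sub>R h x \<partial>(distr M borel L))"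
    by (subst integral_distr) auto
  also have "\<dots> = (\<integral>x. \<sigma> *\<^sub>R (x *\<^sub>R h (\<sigma> * x)) \<partial>std_normal_distribution)"
    unfolding s(3) by (subst integral_distr) auto
  also have "\<dots> = \<sigma> *\<^sub>R (\<integral>x. x *\<^sub>R h (\<sigma> * x) \<partial>std_normal_distribution)" by (rule integral_scaleR_right)
  also have "(\<integral>x. x *\<^sub>R h (\<sigma> * x) \<partial>std_normal_distribution) = (\<integral>x. \<sigma> *\<^sub>R h' (\<sigma> * x) \<partial>std_normal_distribution)"
  proof (rule std_normal_integration_by_parts[where C="(1 + \<sigma>) * (C * (1 + \<sigma>) ^ k)" and k=k])
    show "((\<lambda>x. h (\<sigma> * x)) has_vector_derivative \<sigma> *\<^sub>R h' (\<sigma> * y)) (at y)" for y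
    proof -
      have "((\<lambda>x. \<sigma> * x) has_vector_derivative \<sigma>) (at y)" by (auto intro!: derivative_eq_intros)
      from vector_diff_chain_at[OF this d] show ?thesis by (simp add: o_def)
    qed
    show "continuous_on UNIV (\<lambda>x. \<sigma> *\<^sub>R h' (\<sigma> * x))"
      by (intro continuous_intros continuous_on_compose2[OF c]) auto
    have pos: "0 \<le> C * (1 + \<sigma>) ^ k * (1 + \<bar>y\<bar>) ^ k" for y using C s(1) by simp
    show "norm (h (\<sigma> * y)) \<le> (1 + \<sigma>) * (C * (1 + \<sigma>) ^ k) * (1 + \<bar>y\<bar>) ^ k" for y
    proof -
      have "norm (h (\<sigma> * y)) \<le> 1 * (C * (1 + \<sigma>) ^ k * (1 + \<bar>y\<bar>) ^ k)" using b(1)[of "\<sigma> * y"] growth[of y] by linarith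
      also have "\<dots> \<le> (1 + \<sigma>) * (C * (1 + \<sigma>) ^ k * (1 + \<bar>y\<bar>) ^ k)" using pos s(1) by (intro mult_right_mono) auto
      finally show ?thesis by (simp add: mult.assoc)
    qed
    show "norm (\<sigma> *\<^sub>R h' (\<sigma> * y)) \<le> (1 + \<sigma>) * (C * (1 + \<sigma>) ^ k) * (1 + \<bar>y\<bar>) ^ k" for y
    proof -
      have "norm (\<sigma> *\<^sub>R h' (\<sigma> * y)) \<le> \<sigma> * (C * (1 + \<sigma>) ^ k * (1 + \<bar>y\<bar>) ^ k)"
        using b(2)[of "\<sigma> * y"] growth[of y] s(1) by (simp add: mult_left_mono)
      also have "\<dots> \<le> (1 + \<sigma>) * (C * (1 + \<sigma>) ^ k * (1 + \<bar>y\<bar>) ^ k)" using pos s(1) by (intro mult_right_mono) auto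
      finally show ?thesis by (simp add: mult.assoc)
    qed
  qed
  also have "\<sigma> *\<^sub>R \<dots> = \<sigma>\<^sup>2 *\<^sub>R (\<integral>x. h' (\<sigma> * x) \<partial>std_normal_distribution)"
    by (simp add: power2_eq_square)
  also have "(\<integral>x. h' (\<sigma> * x) \<partial>std_normal_distribution) = (\<integral>x. h' x \<partial>(distr M borel L))"
    unfolding s(3) by (subst integral_distr) auto
  also have "\<dots> = (\<integral>\<omega>. h' (L \<omega>) \<partial>M)" by (subst integral_distr) auto
  finally show ?thesis unfolding s(2) .
qed

lemma integrable_power_sum_G:
  assumes "finite I" "\<And>l. l \<in> I \<Longrightarrow> Y l \<in> G"
  shows "integrable M (\<lambda>\<omega>. (1 + (\<Sum>l\<in>I. \<bar>Y l \<omega>\<bar>)) ^ k)"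
  using assms
proof (induction I rule: finite_induct)
  case empty then show ?case by simp
next
  case (insert i I)
  have [measurable]: "Y l \<in> borel_measurable M" if "l \<in> insert i I" for l
    using insert.prems that measurable_G by auto
  have [measurable]: "Y i \<in> borel_measurable M" "\<And>l. l \<in> I \<Longrightarrow> Y l \<in> borel_measurable M" by simp_all
  have int: "integrable M (\<lambda>\<omega>. 2 ^ k * ((1 + (\<Sum>l\<in>I. \<bar>Y l \<omega>\<bar>)) ^ k + \<bar>Y i \<omega>\<bar> ^ k))"
    using insert by (intro integrable_mult_right Bochner_Integration.integrable_add integrable_abs_power_G) auto
  show ?case
  proof (rule Bochner_Integration.integrable_bound[OF int])
    show "AE \<omega> in M. norm ((1 + (\<Sum>l\<in>insert i I. \<bar>Y l \<omega>\<bar>)) ^ k) \<le> norm (2 ^ k * ((1 + (\<Sum>l\<in>I. \<bar>Y l \<omega>\<bar>)) ^ k + \<bar>Y i \<omega>\<bar> ^ k))"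
    proof (rule AE_I2)
      fix \<omega>
      have s: "0 \<le> (\<Sum>l\<in>I. \<bar>Y l \<omega>\<bar>)" by (simp add: sum_nonneg)
      have "(1 + (\<Sum>l\<in>insert i I. \<bar>Y l \<omega>\<bar>)) = (1 + (\<Sum>l\<in>I. \<bar>Y l \<omega>\<bar>)) + \<bar>Y i \<omega>\<bar>" using insert.hyps by simp
      then show "norm ((1 + (\<Sum>l\<in>insert i I. \<bar>Y l \<omega>\<bar>)) ^ k) \<le> norm (2 ^ k * ((1 + (\<Sum>l\<in>I. \<bar>Y l \<omega>\<bar>)) ^ k + \<bar>Y i \<omega>\<bar> ^ k))"
        using power_add_le_two_power[of "1 + (\<Sum>l\<in>I. \<bar>Y l \<omega>\<bar>)" "\<bar>Y i \<omega>\<bar>" k] s by (simp add: add.assoc)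
    qed
  qed (use insert.hyps in measurable)
qed

text \<open>Resampling \<open>Y i\<close> independently, while moving the other coordinates along their regression on
  \<open>Y i\<close>, preserves the joint law; this reduces integration by parts to the line.\<close>

lemma distr_resample_G:
  assumes I: "finite I" "i \<in> I" and Y: "\<And>l. l \<in> I \<Longrightarrow> Y l \<in> G"
    and v: "v = (\<integral>\<omega>. (Y i \<omega>)\<^sup>2 \<partial>M)" "v \<noteq> 0" and r: "\<And>l. l \<in> I \<Longrightarrow> r l = (\<integral>\<omega>. Y i \<omega> * Y l \<omega> \<partial>M)"
  shows "distr M (PiM I (\<lambda>_. borel)) (\<lambda>\<omega>. \<lambda>l\<in>I. Y l \<omega>) =
    distr (M \<Otimes>\<^sub>M M) (PiM I (\<lambda>_. borel)) (\<lambda>p. \<lambda>l\<in>I. Y l (fst p) + r l / v * (Y i (snd p) - Y i (fst p)))"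
proof -
  interpret PP: pair_prob_space M M by unfold_locales
  have [measurable]: "Y i \<in> borel_measurable M" using I Y measurable_G by auto
  have [measurable]: "l \<in> I \<Longrightarrow> Y l \<in> borel_measurable M" for l using Y measurable_G by auto
  have Yi: "Y i \<in> G" using I Y by auto
  show ?thesis
  proof (rule char_eq_imp_distr_PiM_eq[OF I(1)])
    show "finite_measure M" "finite_measure (M \<Otimes>\<^sub>M M)" by unfold_locales
    show "l \<in> I \<Longrightarrow> Y l \<in> borel_measurable M" for l by measurable
    show "l \<in> I \<Longrightarrow> (\<lambda>p. Y l (fst p) + r l / v * (Y i (snd p) - Y i (fst p))) \<in> borel_measurable (M \<Otimes>\<^sub>M M)" for l
      by measurable
    fix u :: "'b \<Rightarrow> real"
    define L where "L \<omega> = (\<Sum>l\<in>I. u l * Y l \<omega>)" for \<omega>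
    \<comment> \<open>The regression coefficient of the linear combination \<open>L\<close> on
      \<open>Y i\<close>.\<close>
    define k where "k = (\<Sum>l\<in>I. u l * r l) / v"
    have L: "L \<in> G" unfolding L_def by (rule sum_G[OF I(1) Y])
    have [measurable]: "L \<in> borel_measurable M" by (rule measurable_G[OF L])
    have cov: "(\<integral>\<omega>. L \<omega> * Y i \<omega> \<partial>M) = k * v"
    proof -
      have "(\<integral>\<omega>. L \<omega> * Y i \<omega> \<partial>M) = (\<integral>\<omega>. (\<Sum>l\<in>I. u l * (Y i \<omega> * Y l \<omega>)) \<partial>M)"
        unfolding L_def by (intro Bochner_Integration.integral_cong refl) (simp add: sum_distrib_left mult_ac)
      also have "\<dots> = (\<Sum>l\<in>I. u l * r l)"
        using integrable_mult_G[OF Yi Y] by (subst Bochner_Integration.integral_sum) (auto simp: r)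
      finally show ?thesis using v(2) by (simp add: k_def)
    qed
    have D: "(\<lambda>\<omega>. L \<omega> - k * Y i \<omega>) \<in> G" using lincomb_G[OF L Yi, of 1 "- k"] by simp
    have kY: "(\<lambda>\<omega>. k * Y i \<omega>) \<in> G" by (rule scale_G[OF Yi])
    have varD: "(\<integral>\<omega>. (L \<omega> - k * Y i \<omega>)\<^sup>2 \<partial>M) = (\<integral>\<omega>. (L \<omega>)\<^sup>2 \<partial>M) - k\<^sup>2 * v"
    proof -
      have "(\<integral>\<omega>. (L \<omega> - k * Y i \<omega>)\<^sup>2 \<partial>M) = (\<integral>\<omega>. (L \<omega>)\<^sup>2 - 2 * k * (L \<omega> * Y i \<omega>) + k\<^sup>2 * (Y i \<omega>)\<^sup>2 \<partial>M)"
        by (simp add: power2_eq_square algebra_simps)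
      also have "\<dots> = (\<integral>\<omega>. (L \<omega>)\<^sup>2 \<partial>M) - 2 * k * (k * v) + k\<^sup>2 * v"
        using integrable_power_G[OF L] integrable_power_G[OF Yi] integrable_mult_G[OF L Yi]
        by (simp add: cov v(1)[symmetric])
      finally show ?thesis by (simp add: power2_eq_square)
    qed
    have varkY: "(\<integral>\<omega>. (k * Y i \<omega>)\<^sup>2 \<partial>M) = k\<^sup>2 * v"
      by (simp add: power_mult_distrib v(1))
    \<comment> \<open>The resampled combination is the residual \<open>L - k * Y i\<close> of the
      first copy plus \<open>k * Y i\<close> of the second. These are independent, and their
      variances add up to that of \<open>L\<close> because the residual is uncorrelated with
      \<open>Y i\<close>.\<close>
    have eq: "(\<Sum>l\<in>I. u l * (Y l w + r l / v * (Y i z - Y i w))) = (L w - k * Y i w) + k * Y i z" for w z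
    proof -
      have "(\<Sum>l\<in>I. u l * (Y l w + r l / v * (Y i z - Y i w))) = (\<Sum>l\<in>I. u l * Y l w) + (\<Sum>l\<in>I. u l * r l * ((Y i z - Y i w) / v))"
        by (simp add: distrib_left sum.distrib mult_ac)
      also have "(\<Sum>l\<in>I. u l * r l * ((Y i z - Y i w) / v)) = k * (Y i z - Y i w)"
        unfolding sum_distrib_right[symmetric] by (simp add: k_def)
      finally show ?thesis by (simp add: L_def algebra_simps)
    qed
    have "(\<integral>p. iexp (\<Sum>l\<in>I. u l * (Y l (fst p) + r l / v * (Y i (snd p) - Y i (fst p)))) \<partial>(M \<Otimes>\<^sub>M M))
       = (\<integral>p. iexp ((L (fst p) - k * Y i (fst p)) + k * Y i (snd p)) \<partial>(M \<Otimes>\<^sub>M M))"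
      by (simp only: eq)
    also have "\<dots> = (\<integral>w. \<integral>z. iexp ((L w - k * Y i w) + k * Y i z) \<partial>M \<partial>M)"
    proof -
      have "integrable (M \<Otimes>\<^sub>M M) (\<lambda>p. iexp ((L (fst p) - k * Y i (fst p)) + k * Y i (snd p)))"
        by (rule PP.integrable_bounded_complex[where B=1]) auto
      from PP.integral_fst'[OF this] show ?thesis by (simp only: fst_conv snd_conv)
    qed
    also have "\<dots> = (\<integral>w. iexp (L w - k * Y i w) * (\<integral>z. iexp (k * Y i z) \<partial>M) \<partial>M)"
    proof -
      have "iexp ((L w - k * Y i w) + k * Y i z) = iexp (L w - k * Y i w) * iexp (k * Y i z)" for w z
        by (simp only: of_real_add distrib_left exp_add)
      then show ?thesis by (simp only: integral_mult_right_zero)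
    qed
    also have "\<dots> = (\<integral>w. iexp (L w - k * Y i w) \<partial>M) * (\<integral>z. iexp (k * Y i z) \<partial>M)"
      by (simp only: integral_mult_left_zero)
    also have "\<dots> = of_real (exp (- (\<integral>\<omega>. (L \<omega>)\<^sup>2 \<partial>M) / 2))"
      unfolding char_G[OF D] char_G[OF kY] varD varkY
      by (simp only: of_real_mult[symmetric] exp_add[symmetric]) (simp add: field_simps)
    also have "\<dots> = (\<integral>\<omega>. iexp (\<Sum>l\<in>I. u l * Y l \<omega>) \<partial>M)"
      using char_G[OF L] unfolding L_def by (rule sym)
    finally show "(\<integral>\<omega>. iexp (\<Sum>l\<in>I. u l * Y l \<omega>) \<partial>M) = (\<integral>p. iexp (\<Sum>l\<in>I. u l * (Y l (fst p) + r l / v * (Y i (snd p) - Y i (fst p)))) \<partial>(M \<Otimes>\<^sub>M M))"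
      by (rule sym)
  qed
qed

lemma integrable_growth_G:
  fixes g :: "('i \<Rightarrow> real) \<Rightarrow> complex"
  assumes I: "finite I" and Y: "\<And>l. l \<in> I \<Longrightarrow> Y l \<in> G"
    and [measurable]: "g \<in> borel_measurable (PiM I (\<lambda>_. borel))"
    and b: "\<And>y. norm (g y) \<le> C * (1 + (\<Sum>l\<in>I. \<bar>y l\<bar>)) ^ k"
  shows "integrable M (\<lambda>\<omega>. g (\<lambda>l\<in>I. Y l \<omega>))"
proof (rule Bochner_Integration.integrable_bound)
  have [measurable]: "(\<lambda>\<omega>. \<lambda>l\<in>I. Y l \<omega>) \<in> measurable M (PiM I (\<lambda>_. borel))"
    using Y measurable_G by (auto intro!: measurable_restrict)
  show "(\<lambda>\<omega>. g (\<lambda>l\<in>I. Y l \<omega>)) \<in> borel_measurable M" by measurable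
  show "integrable M (\<lambda>\<omega>. C * (1 + (\<Sum>l\<in>I. \<bar>Y l \<omega>\<bar>)) ^ k)"
    using integrable_power_sum_G[OF I Y] by simp
  show "AE \<omega> in M. norm (g (\<lambda>l\<in>I. Y l \<omega>)) \<le> norm (C * (1 + (\<Sum>l\<in>I. \<bar>Y l \<omega>\<bar>)) ^ k)"
    using b[of "\<lambda>l\<in>I. Y l \<omega>" for \<omega>] by (auto intro!: AE_I2 order_trans[OF _ abs_ge_self] simp del: abs_mult)
qed

text \<open>In coordinates \<open>g'\<close> is the sum of \<open>r l\<close> times the l-th partial
  derivative of \<open>g\<close>; only this derivative in the direction of the covariance vector is
  asked for, so no partial derivatives have to exist. After resampling, \<open>Y i\<close> is
  independent of the rest and the one-dimensional formula applies along a line.\<close>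

lemma gaussian_integration_by_parts:
  fixes g g' :: "('i \<Rightarrow> real) \<Rightarrow> complex"
  assumes I: "finite I" "i \<in> I" and Y: "\<And>l. l \<in> I \<Longrightarrow> Y l \<in> G"
    and r: "\<And>l. l \<in> I \<Longrightarrow> r l = (\<integral>\<omega>. Y i \<omega> * Y l \<omega> \<partial>M)"
    and [measurable]: "g \<in> borel_measurable (PiM I (\<lambda>_. borel))" "g' \<in> borel_measurable (PiM I (\<lambda>_. borel))"
    and d: "\<And>y s. ((\<lambda>s. g (\<lambda>l\<in>I. y l + s * r l)) has_vector_derivative g' (\<lambda>l\<in>I. y l + s * r l)) (at s)"
    and c: "\<And>y. continuous_on UNIV (\<lambda>s. g' (\<lambda>l\<in>I. y l + s * r l))"
    and b: "\<And>y. norm (g y) \<le> C * (1 + (\<Sum>l\<in>I. \<bar>y l\<bar>)) ^ k" "\<And>y. norm (g' y) \<le> C * (1 + (\<Sum>l\<in>I. \<bar>y l\<bar>)) ^ k"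
  shows "(\<integral>\<omega>. Y i \<omega> *\<^sub>R g (\<lambda>l\<in>I. Y l \<omega>) \<partial>M) = (\<integral>\<omega>. g' (\<lambda>l\<in>I. Y l \<omega>) \<partial>M)"
proof -
  have Ym: "l \<in> I \<Longrightarrow> Y l \<in> borel_measurable M" for l using Y measurable_G by auto
  have Yi: "Y i \<in> G" using I Y by auto
  have [measurable]: "Y i \<in> borel_measurable M" using Ym I by auto
  have [measurable]: "(\<lambda>\<omega>. \<lambda>l\<in>I. Y l \<omega>) \<in> measurable M (PiM I (\<lambda>_. borel))"
    using Ym by (auto intro!: measurable_restrict)
  define v where "v = (\<integral>\<omega>. (Y i \<omega>)\<^sup>2 \<partial>M)"
  have C: "0 \<le> C" using order_trans[OF norm_ge_zero b(1)[of "\<lambda>_. 0"]] by simp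
  show ?thesis
  proof (cases "v = 0")
    \<comment> \<open>A vanishing variance forces \<open>Y i = 0\<close> almost surely and
      \<open>r = 0\<close>; the derivative of \<open>g\<close> in the zero direction is 0, so both
      sides vanish.\<close>
    case True
    then have "AE \<omega> in M. (Y i \<omega>)\<^sup>2 = 0"
      using integral_nonneg_eq_0_iff_AE[OF integrable_power_G[OF Yi, of 2]] by (simp add: v_def)
    then have ae: "AE \<omega> in M. Y i \<omega> = 0" by simp
    have r0: "r l = 0" if "l \<in> I" for l
    proof -
      have "(\<integral>\<omega>. Y i \<omega> * Y l \<omega> \<partial>M) = (\<integral>\<omega>. 0 \<partial>M)"
        using ae Ym[OF that] by (intro integral_cong_AE) auto
      then show ?thesis using r[OF that] by simp
    qed
    have "g' (\<lambda>l\<in>I. y l) = 0" for y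
    proof -
      have e: "(\<lambda>l\<in>I. y l + s * r l) = (\<lambda>l\<in>I. y l)" for s by (auto simp: r0 intro!: restrict_ext)
      have "((\<lambda>s::real. g (\<lambda>l\<in>I. y l)) has_vector_derivative g' (\<lambda>l\<in>I. y l)) (at 0)"
        using d[of y 0] unfolding e .
      from vector_derivative_unique_at[OF this has_vector_derivative_const] show ?thesis .
    qed
    then have "(\<integral>\<omega>. g' (\<lambda>l\<in>I. Y l \<omega>) \<partial>M) = 0" by simp
    moreover have "(\<integral>\<omega>. Y i \<omega> *\<^sub>R g (\<lambda>l\<in>I. Y l \<omega>) \<partial>M) = (\<integral>\<omega>. 0 \<partial>M)"
      using ae by (intro integral_cong_AE) auto
    ultimately show ?thesis by simp
  next
    case False
    interpret PP: pair_prob_space M M by unfold_locales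
    define R where "R p = (\<lambda>l\<in>I. Y l (fst p) + r l / v * (Y i (snd p) - Y i (fst p)))" for p
    have [measurable]: "R \<in> measurable (M \<Otimes>\<^sub>M M) (PiM I (\<lambda>_. borel))"
      unfolding R_def
    proof (intro measurable_restrict)
      fix l assume "l \<in> I"
      note [measurable] = Ym[OF this]
      show "(\<lambda>p. Y l (fst p) + r l / v * (Y i (snd p) - Y i (fst p))) \<in> borel_measurable (M \<Otimes>\<^sub>M M)" by measurable
    qed
    have law: "distr M (PiM I (\<lambda>_. borel)) (\<lambda>\<omega>. \<lambda>l\<in>I. Y l \<omega>) = distr (M \<Otimes>\<^sub>M M) (PiM I (\<lambda>_. borel)) R"
      unfolding R_def using I Y False r by (intro distr_resample_G) (simp_all add: v_def)
    have ri: "r i = v" using r[OF I(2)] by (simp add: v_def power2_eq_square)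
    have Ri: "R (w, z) i = Y i z" for w z using I False by (simp add: R_def ri)
    have [measurable]: "(\<lambda>y. y i) \<in> borel_measurable (PiM I (\<lambda>_. borel :: real measure))"
      using I by (auto intro: measurable_component_singleton)
    \<comment> \<open>Integrals against the joint law become iterated integrals over the two
      independent copies, the inner one over the resampled value.\<close>
    have transfer: "integrable (M \<Otimes>\<^sub>M M) (\<lambda>p. q (R p))" "(\<integral>\<omega>. q (\<lambda>l\<in>I. Y l \<omega>) \<partial>M) = (\<integral>w. \<integral>z. q (R (w, z)) \<partial>M \<partial>M)"
      if [measurable]: "q \<in> borel_measurable (PiM I (\<lambda>_. borel))" and "\<And>y. norm (q y) \<le> C * (1 + (\<Sum>l\<in>I. \<bar>y l\<bar>)) ^ m"
      for q :: "('i \<Rightarrow> real) \<Rightarrow> complex" and m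
    proof -
      have "integrable M (\<lambda>\<omega>. q (\<lambda>l\<in>I. Y l \<omega>))" using that by (intro integrable_growth_G[OF I(1) Y]) auto
      then have "integrable (distr M (PiM I (\<lambda>_. borel)) (\<lambda>\<omega>. \<lambda>l\<in>I. Y l \<omega>)) q" by (subst integrable_distr_eq) auto
      then show i: "integrable (M \<Otimes>\<^sub>M M) (\<lambda>p. q (R p))" unfolding law by (subst (asm) integrable_distr_eq) auto
      have "(\<integral>\<omega>. q (\<lambda>l\<in>I. Y l \<omega>) \<partial>M) = (\<integral>y. q y \<partial>distr M (PiM I (\<lambda>_. borel)) (\<lambda>\<omega>. \<lambda>l\<in>I. Y l \<omega>))"
        by (subst integral_distr) auto
      also have "\<dots> = (\<integral>p. q (R p) \<partial>(M \<Otimes>\<^sub>M M))" unfolding law by (subst integral_distr) auto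
      also have "\<dots> = (\<integral>w. \<integral>z. q (R (w, z)) \<partial>M \<partial>M)" using PP.integral_fst'[OF i] by simp
      finally show "(\<integral>\<omega>. q (\<lambda>l\<in>I. Y l \<omega>) \<partial>M) = (\<integral>w. \<integral>z. q (R (w, z)) \<partial>M \<partial>M)" .
    qed
    have inner: "(\<integral>z. Y i z *\<^sub>R g (R (w, z)) \<partial>M) = (\<integral>z. g' (R (w, z)) \<partial>M)" for w
    proof -
      \<comment> \<open>With the first copy \<open>w\<close> fixed, the resampled vector runs
        through the line \<open>a + (Y i z / v) * r\<close>. The factor \<open>1 / v\<close> from
        the chain rule cancels the variance \<open>v\<close> in the one-dimensional formula.\<close>
      define a where "a l = Y l w - r l / v * Y i w" for l
      have Rw: "R (w, z) = (\<lambda>l\<in>I. a l + (1 / v * Y i z) * r l)" for z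
        by (auto simp: R_def a_def field_simps diff_divide_distrib intro!: restrict_ext)
      define B where "B = C * (1 + (\<Sum>l\<in>I. \<bar>a l\<bar>) + (\<Sum>l\<in>I. \<bar>r l / v\<bar>)) ^ k"
      have growth: "C * (1 + (\<Sum>l\<in>I. \<bar>(\<lambda>l\<in>I. a l + (1 / v * y) * r l) l\<bar>)) ^ k \<le> B * (1 + \<bar>y\<bar>) ^ k" for y
      proof -
        have "(\<Sum>l\<in>I. \<bar>(\<lambda>l\<in>I. a l + (1 / v * y) * r l) l\<bar>) \<le> (\<Sum>l\<in>I. \<bar>a l\<bar> + \<bar>r l / v\<bar> * \<bar>y\<bar>)"
          by (intro sum_mono) (auto intro!: order_trans[OF abs_triangle_ineq] simp: abs_mult mult.commute)
        also have "\<dots> = (\<Sum>l\<in>I. \<bar>a l\<bar>) + (\<Sum>l\<in>I. \<bar>r l / v\<bar>) * \<bar>y\<bar>"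
          by (simp add: sum.distrib sum_distrib_right)
        finally have "1 + (\<Sum>l\<in>I. \<bar>(\<lambda>l\<in>I. a l + (1 / v * y) * r l) l\<bar>) \<le> 1 + (\<Sum>l\<in>I. \<bar>a l\<bar>) + (\<Sum>l\<in>I. \<bar>r l / v\<bar>) * \<bar>y\<bar>" by simp
        also have "\<dots> \<le> (1 + (\<Sum>l\<in>I. \<bar>a l\<bar>) + (\<Sum>l\<in>I. \<bar>r l / v\<bar>)) * (1 + \<bar>y\<bar>)"
          by (simp add: algebra_simps sum_nonneg)
        finally have "(1 + (\<Sum>l\<in>I. \<bar>(\<lambda>l\<in>I. a l + (1 / v * y) * r l) l\<bar>)) ^ k \<le> ((1 + (\<Sum>l\<in>I. \<bar>a l\<bar>) + (\<Sum>l\<in>I. \<bar>r l / v\<bar>)) * (1 + \<bar>y\<bar>)) ^ k"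
          by (intro power_mono) (auto simp: sum_nonneg add_nonneg_nonneg)
        then show ?thesis using C by (simp add: B_def power_mult_distrib mult_left_mono mult.assoc)
      qed
      have B0: "0 \<le> B" unfolding B_def using C by (auto intro!: mult_nonneg_nonneg zero_le_power add_nonneg_nonneg sum_nonneg)
      define h where "h y = g (\<lambda>l\<in>I. a l + (1 / v * y) * r l)" for y
      define h' where "h' y = (1 / v) *\<^sub>R g' (\<lambda>l\<in>I. a l + (1 / v * y) * r l)" for y
      have "(\<integral>z. Y i z *\<^sub>R h (Y i z) \<partial>M) = v *\<^sub>R (\<integral>z. h' (Y i z) \<partial>M)"
        unfolding v_def
      proof (rule integration_by_parts_G[OF Yi, where k=k and C="(1 + \<bar>1 / v\<bar>) * B"])
        show "(h has_vector_derivative h' y) (at y)" for y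
        proof -
          have "((\<lambda>x. 1 / v * x) has_vector_derivative 1 / v) (at y)" by (auto intro!: derivative_eq_intros)
          from vector_diff_chain_at[OF this d[of a "1 / v * y"]] show ?thesis by (simp add: o_def h_def[abs_def] h'_def)
        qed
        show "continuous_on UNIV h'" unfolding h'_def
          by (intro continuous_intros continuous_on_compose2[OF c[of a]]) auto
        have pos: "0 \<le> B * (1 + \<bar>y\<bar>) ^ k" for y using B0 by simp
        show "norm (h y) \<le> (1 + \<bar>1 / v\<bar>) * B * (1 + \<bar>y\<bar>) ^ k" for y
        proof -
          have "norm (h y) \<le> 1 * (B * (1 + \<bar>y\<bar>) ^ k)" unfolding h_def mult_1 by (rule order_trans[OF b(1) growth])
          also have "\<dots> \<le> (1 + \<bar>1 / v\<bar>) * (B * (1 + \<bar>y\<bar>) ^ k)" using pos by (intro mult_right_mono) auto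
          finally show ?thesis by (simp add: mult.assoc)
        qed
        show "norm (h' y) \<le> (1 + \<bar>1 / v\<bar>) * B * (1 + \<bar>y\<bar>) ^ k" for y
        proof -
          have "norm (h' y) = \<bar>1 / v\<bar> * norm (g' (\<lambda>l\<in>I. a l + (1 / v * y) * r l))" unfolding h'_def by simp
          also have "\<dots> \<le> (1 + \<bar>1 / v\<bar>) * (B * (1 + \<bar>y\<bar>) ^ k)"
            by (intro mult_mono order_trans[OF b(2) growth]) auto
          finally show ?thesis by (simp add: mult.assoc)
        qed
      qed
      then show ?thesis using False by (simp add: Rw h_def h'_def)
    qed
    have b1: "norm (y i *\<^sub>R g y) \<le> C * (1 + (\<Sum>l\<in>I. \<bar>y l\<bar>)) ^ (k + 1)" for y
    proof -
      have "\<bar>y i\<bar> \<le> (\<Sum>l\<in>I. \<bar>y l\<bar>)" using I by (intro member_le_sum) auto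
      then have "\<bar>y i\<bar> * norm (g y) \<le> (1 + (\<Sum>l\<in>I. \<bar>y l\<bar>)) * (C * (1 + (\<Sum>l\<in>I. \<bar>y l\<bar>)) ^ k)"
        using b(1)[of y] by (intro mult_mono) (auto simp: sum_nonneg)
      then show ?thesis by (simp add: mult_ac)
    qed
    have "(\<integral>\<omega>. Y i \<omega> *\<^sub>R g (\<lambda>l\<in>I. Y l \<omega>) \<partial>M) = (\<integral>\<omega>. (\<lambda>y. y i *\<^sub>R g y) (\<lambda>l\<in>I. Y l \<omega>) \<partial>M)"
      using I by simp
    also have "\<dots> = (\<integral>w. \<integral>z. (\<lambda>y. y i *\<^sub>R g y) (R (w, z)) \<partial>M \<partial>M)"
      by (rule transfer(2)[OF _ b1]) measurable
    also have "\<dots> = (\<integral>w. \<integral>z. g' (R (w, z)) \<partial>M \<partial>M)" by (simp add: Ri inner)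
    also have "\<dots> = (\<integral>\<omega>. g' (\<lambda>l\<in>I. Y l \<omega>) \<partial>M)" by (rule transfer(2)[OF _ b(2), symmetric]) measurable
    finally show ?thesis .
  qed
qed

end

section \<open>Quadratic forms in Gaussian variables\<close>

text \<open>Integrating the bound x^2 / 2 for the remainder of exp (i x) after its linear part
  yields an error quadratic in the increment of t, which is why a second moment is asked
  for.\<close>

lemma (in prob_space) has_vector_derivative_char:
  assumes [measurable]: "V \<in> borel_measurable M" and i: "integrable M (\<lambda>\<omega>. (V \<omega>)\<^sup>2)" "integrable M V"
  shows "((\<lambda>t. \<integral>\<omega>. iexp (t * V \<omega>) \<partial>M) has_vector_derivative (\<integral>\<omega>. \<i> * V \<omega> * iexp (t * V \<omega>) \<partial>M)) (at t)"
proof -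
  define \<phi> where "\<phi> t = (\<integral>\<omega>. iexp (t * V \<omega>) \<partial>M)" for t
  define D where "D = (\<integral>\<omega>. \<i> * V \<omega> * iexp (t * V \<omega>) \<partial>M)"
  define K where "K = (\<integral>\<omega>. (V \<omega>)\<^sup>2 \<partial>M)"
  have int: "integrable M (\<lambda>\<omega>. iexp (t * V \<omega>))" for t by (rule integrable_bounded_complex[where B=1]) auto
  have intD: "integrable M (\<lambda>\<omega>. \<i> * V \<omega> * iexp (t * V \<omega>))"
    by (rule Bochner_Integration.integrable_bound[OF i(2)]) (auto simp: norm_mult)
  have est: "norm (\<phi> u - \<phi> t - (u - t) *\<^sub>R D) \<le> K * (u - t)\<^sup>2" for u
  proof -
    have "\<phi> u - \<phi> t - (u - t) *\<^sub>R D = (\<integral>\<omega>. iexp (u * V \<omega>) - iexp (t * V \<omega>) - (u - t) *\<^sub>R (\<i> * V \<omega> * iexp (t * V \<omega>)) \<partial>M)"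
      unfolding \<phi>_def D_def using int intD by simp
    also have "norm \<dots> \<le> (\<integral>\<omega>. (u - t)\<^sup>2 * (V \<omega>)\<^sup>2 \<partial>M)"
    proof (rule order_trans[OF integral_norm_bound integral_mono])
      show "integrable M (\<lambda>\<omega>. norm (iexp (u * V \<omega>) - iexp (t * V \<omega>) - (u - t) *\<^sub>R (\<i> * V \<omega> * iexp (t * V \<omega>))))"
        using int intD by (intro integrable_norm Bochner_Integration.integrable_diff integrable_scaleR_right) auto
      show "integrable M (\<lambda>\<omega>. (u - t)\<^sup>2 * (V \<omega>)\<^sup>2)" using i by simp
      fix \<omega>
      let ?x = "(u - t) * V \<omega>"
      have "iexp (u * V \<omega>) = iexp (t * V \<omega>) * iexp ?x"
        by (simp add: exp_add[symmetric] algebra_simps)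
      then have "iexp (u * V \<omega>) - iexp (t * V \<omega>) - (u - t) *\<^sub>R (\<i> * V \<omega> * iexp (t * V \<omega>))
          = iexp (t * V \<omega>) * (iexp ?x - (1 + \<i> * ?x))"
        by (simp add: scaleR_conv_of_real algebra_simps)
      also have "norm \<dots> = norm (iexp ?x - (1 + \<i> * ?x))" by (simp add: norm_mult)
      also have "\<dots> \<le> ?x\<^sup>2 / 2"
        using iexp_approx1[of ?x 1] by (simp add: numeral_2_eq_2 power2_eq_square)
      also have "\<dots> \<le> (u - t)\<^sup>2 * (V \<omega>)\<^sup>2" by (simp add: power_mult_distrib)
      finally show "norm (iexp (u * V \<omega>) - iexp (t * V \<omega>) - (u - t) *\<^sub>R (\<i> * V \<omega> * iexp (t * V \<omega>))) \<le> (u - t)\<^sup>2 * (V \<omega>)\<^sup>2" .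
    qed
    also have "\<dots> = K * (u - t)\<^sup>2" by (simp add: K_def)
    finally show ?thesis .
  qed
  have "(\<phi> has_derivative (\<lambda>h. h *\<^sub>R D)) (at t)"
  proof (rule has_derivativeI_sandwich[where e=1 and H="\<lambda>u. K * \<bar>u - t\<bar>"])
    show "bounded_linear (\<lambda>h. h *\<^sub>R D)" by (rule bounded_linear_scaleR_left)
    show "norm (\<phi> u - \<phi> t - (u - t) *\<^sub>R D) / norm (u - t) \<le> K * \<bar>u - t\<bar>" if "u \<noteq> t" for u
      using est[of u] that by (simp add: divide_le_eq power2_eq_square mult.assoc abs_mult_self_eq)
    have "((\<lambda>u. K * \<bar>u - t\<bar>) \<longlongrightarrow> K * \<bar>t - t\<bar>) (at t)" by (intro tendsto_intros)
    then show "((\<lambda>u. K * \<bar>u - t\<bar>) \<longlongrightarrow> 0) (at t)" by simp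
  qed simp
  then show ?thesis unfolding has_vector_derivative_def \<phi>_def[abs_def] D_def .
qed

text \<open>Stein's method for characteristic functions: an approximate version of the differential
  equation \<open>\<phi>' t = - t s \<phi> t\<close>.\<close>

lemma char_ode_estimate:
  fixes \<phi> :: "real \<Rightarrow> complex"
  assumes d: "\<And>t. (\<phi> has_vector_derivative (- of_real (t * s) * \<phi> t - 2 * of_real t * R t)) (at t)"
    and R: "\<And>t. norm (R t) \<le> \<delta>" and 0: "\<phi> 0 = 1" and s: "0 \<le> s"
  shows "norm (\<phi> t - exp (- of_real (s * t\<^sup>2 / 2))) \<le> 2 * t\<^sup>2 * \<delta>"
proof -
  \<comment> \<open>Integrating factor: in the derivative of \<open>e * \<phi>\<close> only the
    error \<open>R\<close> survives. Since \<open>e\<close> grows with |t|, its value at the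
    endpoint bounds it on the segment from 0 to t, and it cancels on dividing back, so the final
    bound is free of exponentials.\<close>
  define e where "e t = exp (s * t\<^sup>2 / 2)" for t :: real
  define \<psi> where "\<psi> t = e t *\<^sub>R \<phi> t" for t
  have \<delta>: "0 \<le> \<delta>" using order_trans[OF norm_ge_zero R] .
  have epos: "0 < e t" for t by (simp add: e_def)
  have de: "(e has_real_derivative (s * t) * e t) (at t)" for t
    unfolding e_def[abs_def] by (auto intro!: derivative_eq_intros)
  have d\<psi>: "(\<psi> has_vector_derivative - 2 * of_real t * e t *\<^sub>R R t) (at t)" for t
  proof -
    have "(\<psi> has_vector_derivative (e t *\<^sub>R (- of_real (t * s) * \<phi> t - 2 * of_real t * R t) + ((s * t) * e t) *\<^sub>R \<phi> t)) (at t)"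
      unfolding \<psi>_def[abs_def] by (intro has_vector_derivative_scaleR de d)
    then show ?thesis by (simp add: scaleR_conv_of_real algebra_simps)
  qed
  have "norm (\<psi> t - \<psi> 0) \<le> (2 * \<bar>t\<bar> * e t * \<delta>) * \<bar>t - 0\<bar>"
  proof -
    have bnd: "norm (- 2 * of_real x * e x *\<^sub>R R x) \<le> 2 * \<bar>t\<bar> * e t * \<delta>" if "x \<in> closed_segment 0 t" for x
    proof -
      have x: "\<bar>x\<bar> \<le> \<bar>t\<bar>" using that by (auto simp: closed_segment_eq_real_ivl split: if_splits)
      then have "x\<^sup>2 \<le> t\<^sup>2" by (simp add: abs_le_square_iff)
      then have "e x \<le> e t" unfolding e_def using s by (auto intro!: mult_left_mono)
      moreover have "0 \<le> e x" by (simp add: e_def)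
      ultimately have "2 * \<bar>x\<bar> * e x * norm (R x) \<le> 2 * \<bar>t\<bar> * e t * \<delta>"
        using x R[of x] by (intro mult_mono) (auto intro!: mult_nonneg_nonneg)
      moreover have "norm (- 2 * of_real x * e x *\<^sub>R R x) = 2 * \<bar>x\<bar> * e x * norm (R x)"
        using \<open>0 \<le> e x\<close> by (simp add: norm_mult)
      ultimately show ?thesis by simp
    qed
    have "norm (\<psi> t - \<psi> 0) \<le> (2 * \<bar>t\<bar> * e t * \<delta>) * norm (t - 0)"
    proof (rule differentiable_bound[where S="closed_segment 0 t" and f'="\<lambda>x h. h *\<^sub>R (- 2 * of_real x * e x *\<^sub>R R x)"])
      show "(\<psi> has_derivative (\<lambda>h. h *\<^sub>R (- 2 * of_real x * e x *\<^sub>R R x))) (at x within closed_segment 0 t)" for x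
        using has_vector_derivative_at_within[OF d\<psi>] unfolding has_vector_derivative_def .
      show "onorm (\<lambda>h. h *\<^sub>R (- 2 * of_real x * e x *\<^sub>R R x)) \<le> 2 * \<bar>t\<bar> * e t * \<delta>"
        if "x \<in> closed_segment 0 t" for x
        using mult_left_mono[OF bnd[OF that], of "\<bar>h\<bar>" for h] \<delta> epos[of t]
        by (intro onorm_bound) (auto simp only: norm_scaleR real_norm_def mult_ac intro!: mult_nonneg_nonneg)
    qed auto
    then show ?thesis by simp
  qed
  moreover have "\<phi> t - exp (- of_real (s * t\<^sup>2 / 2)) = (1 / e t) *\<^sub>R (\<psi> t - \<psi> 0)"
    by (simp add: \<psi>_def e_def 0 scaleR_conv_of_real exp_minus inverse_eq_divide exp_of_real[symmetric] right_diff_distrib)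
  ultimately have "norm (\<phi> t - exp (- of_real (s * t\<^sup>2 / 2))) \<le> (1 / e t) * ((2 * \<bar>t\<bar> * e t * \<delta>) * \<bar>t\<bar>)"
  proof -
    assume a: "norm (\<psi> t - \<psi> 0) \<le> (2 * \<bar>t\<bar> * e t * \<delta>) * \<bar>t - 0\<bar>"
      and b: "\<phi> t - exp (- of_real (s * t\<^sup>2 / 2)) = (1 / e t) *\<^sub>R (\<psi> t - \<psi> 0)"
    have "norm (\<phi> t - exp (- of_real (s * t\<^sup>2 / 2))) = (1 / e t) * norm (\<psi> t - \<psi> 0)"
      unfolding b using epos[of t] by simp
    also have "\<dots> \<le> (1 / e t) * ((2 * \<bar>t\<bar> * e t * \<delta>) * \<bar>t - 0\<bar>)"
      using epos[of t] by (intro mult_left_mono a) simp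
    finally show ?thesis by simp
  qed
  also have "\<dots> = 2 * \<bar>t\<bar> * \<bar>t\<bar> * \<delta>" using epos[of t] by simp
  also have "\<dots> = 2 * t\<^sup>2 * \<delta>" by (simp add: power2_eq_square abs_mult_self_eq mult.assoc)
  finally show ?thesis .
qed

context gaussian_space
begin

text \<open>Integration by parts in \<open>A\<close> against the product of the other three:
  differentiating that product in the direction of the covariances with \<open>A\<close> produces
  the three pairings.\<close>

lemma wick_four_G:
  assumes "A \<in> G" "B \<in> G" "C \<in> G" "D \<in> G"
  shows "(\<integral>\<omega>. A \<omega> * B \<omega> * C \<omega> * D \<omega> \<partial>M) =
    (\<integral>\<omega>. A \<omega> * B \<omega> \<partial>M) * (\<integral>\<omega>. C \<omega> * D \<omega> \<partial>M) + (\<integral>\<omega>. A \<omega> * C \<omega> \<partial>M) * (\<integral>\<omega>. B \<omega> * D \<omega> \<partial>M)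
      + (\<integral>\<omega>. A \<omega> * D \<omega> \<partial>M) * (\<integral>\<omega>. B \<omega> * C \<omega> \<partial>M)"
proof -
  define Y where "Y l = (if l = 0 then A else if l = 1 then B else if l = 2 then C else D)" for l :: nat
  define I where "I = {0, 1, 2, 3::nat}"
  define r where "r l = (\<integral>\<omega>. A \<omega> * Y l \<omega> \<partial>M)" for l
  have Y: "Y l \<in> G" for l using assms by (simp add: Y_def)
  have Y0: "Y 0 = A" "Y 1 = B" "Y 2 = C" "Y 3 = D" by (simp_all add: Y_def)
  have I: "finite I" "0 \<in> I" "1 \<in> I" "2 \<in> I" "3 \<in> I" by (simp_all add: I_def)
  define g :: "(nat \<Rightarrow> real) \<Rightarrow> complex" where "g y = of_real (y 1 * y 2 * y 3)" for y
  define g' :: "(nat \<Rightarrow> real) \<Rightarrow> complex" where "g' y = of_real (r 1 * (y 2 * y 3) + r 2 * (y 1 * y 3) + r 3 * (y 1 * y 2))" for y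
  define K where "K = 1 + \<bar>r 1\<bar> + \<bar>r 2\<bar> + \<bar>r 3\<bar>"
  have [measurable]: "(\<lambda>y. y l) \<in> borel_measurable (PiM I (\<lambda>_. borel :: real measure))" if "l \<in> I" for l
    using that by (rule measurable_component_singleton)
  have [measurable]: "(\<lambda>y. y 1) \<in> borel_measurable (PiM I (\<lambda>_. borel :: real measure))"
    "(\<lambda>y. y 2) \<in> borel_measurable (PiM I (\<lambda>_. borel :: real measure))"
    "(\<lambda>y. y 3) \<in> borel_measurable (PiM I (\<lambda>_. borel :: real measure))"
    using I by (auto intro!: measurable_component_singleton)
  have "(\<integral>\<omega>. Y 0 \<omega> *\<^sub>R g (\<lambda>l\<in>I. Y l \<omega>) \<partial>M) = (\<integral>\<omega>. g' (\<lambda>l\<in>I. Y l \<omega>) \<partial>M)"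
  proof (rule gaussian_integration_by_parts[OF I(1,2) Y, where r=r and C=K and k=3])
    show "r l = (\<integral>\<omega>. Y 0 \<omega> * Y l \<omega> \<partial>M)" for l by (simp add: r_def Y0)
    show "g \<in> borel_measurable (PiM I (\<lambda>_. borel))" "g' \<in> borel_measurable (PiM I (\<lambda>_. borel))"
      unfolding g_def[abs_def] g'_def[abs_def] by measurable
    show "((\<lambda>s. g (\<lambda>l\<in>I. y l + s * r l)) has_vector_derivative g' (\<lambda>l\<in>I. y l + s * r l)) (at s)" for y s
      unfolding g_def g'_def using I
      by (simp del: of_real_mult of_real_add add: restrict_apply,
        intro has_vector_derivative_of_real) (auto intro!: derivative_eq_intros simp: algebra_simps)
    show "continuous_on UNIV (\<lambda>s. g' (\<lambda>l\<in>I. y l + s * r l))" for y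
      unfolding g'_def using I by (simp add: restrict_apply) (intro continuous_intros)
    fix y :: "nat \<Rightarrow> real"
    define S where "S = 1 + (\<Sum>l\<in>I. \<bar>y l\<bar>)"
    have S: "\<bar>y l\<bar> \<le> S" "1 \<le> S" if "l \<in> I" for l
      using member_le_sum[of l I "\<lambda>l. \<bar>y l\<bar>"] that I by (auto simp: S_def sum_nonneg)
    have two: "\<bar>y l * y m\<bar> \<le> S ^ 3" if "l \<in> I" "m \<in> I" for l m
    proof -
      have "\<bar>y l * y m\<bar> * 1 \<le> S * S * S" unfolding abs_mult using S[OF that(1)] S[OF that(2)]
        by (intro mult_mono) auto
      then show ?thesis by (simp add: power3_eq_cube)
    qed
    have three: "\<bar>y 1 * y 2 * y 3\<bar> \<le> S ^ 3"
      unfolding abs_mult power3_eq_cube using S[OF I(3)] S[OF I(4)] S[OF I(5)] by (intro mult_mono) auto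
    have S3: "0 \<le> S ^ 3" using S[OF I(2)] by simp
    have "norm (g y) \<le> 1 * S ^ 3" unfolding g_def norm_of_real using three by simp
    also have "\<dots> \<le> K * S ^ 3" using S3 by (intro mult_right_mono) (auto simp: K_def)
    finally show "norm (g y) \<le> K * (1 + (\<Sum>l\<in>I. \<bar>y l\<bar>)) ^ 3" unfolding S_def .
    have "norm (g' y) \<le> \<bar>r 1 * (y 2 * y 3)\<bar> + \<bar>r 2 * (y 1 * y 3)\<bar> + \<bar>r 3 * (y 1 * y 2)\<bar>"
      unfolding g'_def norm_of_real by linarith
    also have "\<dots> \<le> \<bar>r 1\<bar> * S ^ 3 + \<bar>r 2\<bar> * S ^ 3 + \<bar>r 3\<bar> * S ^ 3"
      using two[OF I(4,5)] two[OF I(3,5)] two[OF I(3,4)]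
      unfolding abs_mult[of "r _"] by (intro add_mono mult_left_mono) auto
    also have "\<dots> \<le> K * S ^ 3" using S3 by (simp add: K_def algebra_simps)
    finally show "norm (g' y) \<le> K * (1 + (\<Sum>l\<in>I. \<bar>y l\<bar>)) ^ 3" unfolding S_def .
  qed
  moreover have "(\<integral>\<omega>. Y 0 \<omega> *\<^sub>R g (\<lambda>l\<in>I. Y l \<omega>) \<partial>M) = of_real (\<integral>\<omega>. A \<omega> * B \<omega> * C \<omega> * D \<omega> \<partial>M)"
    using I by (simp add: g_def Y0[unfolded One_nat_def] Y0 scaleR_conv_of_real integral_complex_of_real[symmetric] mult_ac del: integral_complex_of_real)
  moreover have "(\<integral>\<omega>. g' (\<lambda>l\<in>I. Y l \<omega>) \<partial>M) = of_real (\<integral>\<omega>. r 1 * (C \<omega> * D \<omega>) + r 2 * (B \<omega> * D \<omega>) + r 3 * (B \<omega> * C \<omega>) \<partial>M)"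
    using I unfolding g'_def by (simp only: restrict_apply if_True Y0 integral_complex_of_real)
  moreover have "(\<integral>\<omega>. r 1 * (C \<omega> * D \<omega>) + r 2 * (B \<omega> * D \<omega>) + r 3 * (B \<omega> * C \<omega>) \<partial>M)
      = r 1 * (\<integral>\<omega>. C \<omega> * D \<omega> \<partial>M) + r 2 * (\<integral>\<omega>. B \<omega> * D \<omega> \<partial>M) + r 3 * (\<integral>\<omega>. B \<omega> * C \<omega> \<partial>M)"
    using assms by (simp add: integrable_mult_G)
  ultimately show ?thesis unfolding r_def Y0 by (simp only: of_real_eq_iff)
qed

lemma integrable_mult4_G:
  assumes "A \<in> G" "B \<in> G" "C \<in> G" "D \<in> G"
  shows "integrable M (\<lambda>\<omega>. A \<omega> * B \<omega> * C \<omega> * D \<omega>)"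
proof (rule Bochner_Integration.integrable_bound)
  show "integrable M (\<lambda>\<omega>. A \<omega> ^ 4 + B \<omega> ^ 4 + (C \<omega> ^ 4 + D \<omega> ^ 4))"
    using assms by (intro Bochner_Integration.integrable_add integrable_power_G)
  have [measurable]: "A \<in> borel_measurable M" "B \<in> borel_measurable M" "C \<in> borel_measurable M" "D \<in> borel_measurable M"
    using assms measurable_G by auto
  show "(\<lambda>\<omega>. A \<omega> * B \<omega> * C \<omega> * D \<omega>) \<in> borel_measurable M" by measurable
  have am: "\<bar>x * y\<bar> \<le> x\<^sup>2 + y\<^sup>2" for x y :: real
  proof -
    have "2 * \<bar>x * y\<bar> \<le> x\<^sup>2 + y\<^sup>2" using sum_squares_bound[of "\<bar>x\<bar>" "\<bar>y\<bar>"] by (simp add: abs_mult)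
    then show ?thesis using abs_ge_zero[of "x * y"] by linarith
  qed
  have am2: "(x * y)\<^sup>2 \<le> x ^ 4 + y ^ 4" for x y :: real
    using am[of "x\<^sup>2" "y\<^sup>2"] by (simp add: power_mult_distrib abs_mult power_mult[symmetric])
  show "AE \<omega> in M. norm (A \<omega> * B \<omega> * C \<omega> * D \<omega>) \<le> norm (A \<omega> ^ 4 + B \<omega> ^ 4 + (C \<omega> ^ 4 + D \<omega> ^ 4))"
  proof (rule AE_I2)
    fix \<omega>
    have "\<bar>A \<omega> * B \<omega> * C \<omega> * D \<omega>\<bar> \<le> A \<omega> ^ 4 + B \<omega> ^ 4 + (C \<omega> ^ 4 + D \<omega> ^ 4)"
      using am[of "A \<omega> * B \<omega>" "C \<omega> * D \<omega>"] am2[of "A \<omega>" "B \<omega>"] am2[of "C \<omega>" "D \<omega>"] by (simp add: mult.assoc)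
    then show "norm (A \<omega> * B \<omega> * C \<omega> * D \<omega>) \<le> norm (A \<omega> ^ 4 + B \<omega> ^ 4 + (C \<omega> ^ 4 + D \<omega> ^ 4))" by simp
  qed
qed

end

lemma (in prob_space) second_moment_sum:
  fixes U :: "'p \<Rightarrow> 'a \<Rightarrow> real" and w :: "'p \<Rightarrow> real"
  assumes "finite P" "\<And>p q. p \<in> P \<Longrightarrow> q \<in> P \<Longrightarrow> integrable M (\<lambda>\<omega>. U p \<omega> * U q \<omega>)"
  shows "integrable M (\<lambda>\<omega>. (\<Sum>p\<in>P. w p * U p \<omega>)\<^sup>2)"
    "(\<integral>\<omega>. (\<Sum>p\<in>P. w p * U p \<omega>)\<^sup>2 \<partial>M) = (\<Sum>p\<in>P. \<Sum>q\<in>P. w p * w q * (\<integral>\<omega>. U p \<omega> * U q \<omega> \<partial>M))"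
proof -
  have e: "(\<Sum>p\<in>P. w p * U p \<omega>)\<^sup>2 = (\<Sum>p\<in>P. \<Sum>q\<in>P. w p * w q * (U p \<omega> * U q \<omega>))" for \<omega>
    by (simp only: power2_eq_square sum_product) (intro sum.cong refl, simp)
  have i: "p \<in> P \<Longrightarrow> q \<in> P \<Longrightarrow> integrable M (\<lambda>\<omega>. w p * w q * (U p \<omega> * U q \<omega>))" for p q
    using assms(2) by simp
  show "integrable M (\<lambda>\<omega>. (\<Sum>p\<in>P. w p * U p \<omega>)\<^sup>2)"
    unfolding e by (intro Bochner_Integration.integrable_sum i)
  have "(\<integral>\<omega>. (\<Sum>p\<in>P. w p * U p \<omega>)\<^sup>2 \<partial>M) = (\<Sum>p\<in>P. \<integral>\<omega>. (\<Sum>q\<in>P. w p * w q * (U p \<omega> * U q \<omega>)) \<partial>M)"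
    unfolding e by (rule Bochner_Integration.integral_sum) (intro Bochner_Integration.integrable_sum i)
  also have "\<dots> = (\<Sum>p\<in>P. \<Sum>q\<in>P. \<integral>\<omega>. w p * w q * (U p \<omega> * U q \<omega>) \<partial>M)"
    by (intro sum.cong refl Bochner_Integration.integral_sum i)
  finally show "(\<integral>\<omega>. (\<Sum>p\<in>P. w p * U p \<omega>)\<^sup>2 \<partial>M) = (\<Sum>p\<in>P. \<Sum>q\<in>P. w p * w q * (\<integral>\<omega>. U p \<omega> * U q \<omega> \<partial>M))"
    by (simp only: integral_mult_right_zero)
qed

text \<open>The inequality is the nonnegativity of the variance of |Z|.\<close>

lemma (in prob_space) expectation_abs_le_sqrt:
  assumes [measurable]: "Z \<in> borel_measurable M" and "integrable M (\<lambda>\<omega>. (Z \<omega>)\<^sup>2)"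
  shows "integrable M Z" "(\<integral>\<omega>. \<bar>Z \<omega>\<bar> \<partial>M) \<le> sqrt (\<integral>\<omega>. (Z \<omega>)\<^sup>2 \<partial>M)"
proof -
  show i: "integrable M Z" by (rule square_integrable_imp_integrable[OF assms])
  have "0 \<le> variance (\<lambda>\<omega>. \<bar>Z \<omega>\<bar>)" by (rule variance_positive)
  also have "\<dots> = (\<integral>\<omega>. (Z \<omega>)\<^sup>2 \<partial>M) - (\<integral>\<omega>. \<bar>Z \<omega>\<bar> \<partial>M)\<^sup>2"
    using i assms(2) by (subst variance_eq) auto
  finally show "(\<integral>\<omega>. \<bar>Z \<omega>\<bar> \<partial>M) \<le> sqrt (\<integral>\<omega>. (Z \<omega>)\<^sup>2 \<partial>M)" by (intro real_le_rsqrt) simp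
qed

locale gaussian_quadratic_form = gaussian_space M G for M :: "'a measure" and G +
  fixes J :: "'i set" and Y :: "'i \<Rightarrow> 'a \<Rightarrow> real" and c :: "'i \<Rightarrow> real"
  assumes finJ: "finite J" and YG: "j \<in> J \<Longrightarrow> Y j \<in> G"
begin

definition cov :: "'i \<Rightarrow> 'i \<Rightarrow> real" where "cov a b = (\<integral>\<omega>. Y a \<omega> * Y b \<omega> \<partial>M)"

definition V :: "'a \<Rightarrow> real" where "V \<omega> = (\<Sum>j\<in>J. c j * ((Y j \<omega>)\<^sup>2 - cov j j))"

text \<open>A quarter of the squared norm of the Malliavin derivative of \<open>V\<close>. Its mean
  is \<open>s2 / 2\<close>, half the variance of \<open>V\<close>, and its fluctuation about this
  mean measures how far \<open>V\<close> is from being normal.\<close>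

definition W :: "'a \<Rightarrow> real" where
  "W \<omega> = (\<Sum>a\<in>J. \<Sum>b\<in>J. c a * c b * cov a b * (Y a \<omega> * Y b \<omega>))"

definition s2 :: real where "s2 = 2 * (\<Sum>a\<in>J. \<Sum>b\<in>J. c a * c b * (cov a b)\<^sup>2)"

lemma cov_sym: "cov a b = cov b a"
  by (simp add: cov_def mult.commute)

lemma Y_measurable: "j \<in> J \<Longrightarrow> Y j \<in> borel_measurable M"
  using YG measurable_G by blast

lemma V_measurable [measurable]: "V \<in> borel_measurable M"
  unfolding V_def[abs_def] using Y_measurable by (intro borel_measurable_sum borel_measurable_times borel_measurable_diff borel_measurable_power) auto

lemma W_measurable [measurable]: "W \<in> borel_measurable M"
  unfolding W_def[abs_def] using Y_measurable by (intro borel_measurable_sum borel_measurable_times) auto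

text \<open>Centring removes the pairing inside each product, so only the two mixed pairings of the
  four-point formula remain.\<close>

lemma integrable_centered_products:
  assumes "a \<in> J" "b \<in> J" "p \<in> J" "q \<in> J"
  shows "integrable M (\<lambda>\<omega>. (Y a \<omega> * Y b \<omega> - cov a b) * (Y p \<omega> * Y q \<omega> - cov p q))"
    "(\<integral>\<omega>. (Y a \<omega> * Y b \<omega> - cov a b) * (Y p \<omega> * Y q \<omega> - cov p q) \<partial>M) = cov a p * cov b q + cov a q * cov b p"
proof -
  have G: "Y a \<in> G" "Y b \<in> G" "Y p \<in> G" "Y q \<in> G" using assms YG by auto
  have e: "(Y a \<omega> * Y b \<omega> - cov a b) * (Y p \<omega> * Y q \<omega> - cov p q) =
     Y a \<omega> * Y b \<omega> * Y p \<omega> * Y q \<omega> - cov a b * (Y p \<omega> * Y q \<omega>) - cov p q * (Y a \<omega> * Y b \<omega>) + cov a b * cov p q" for \<omega>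
    by (simp add: algebra_simps)
  note i = integrable_mult4_G[OF G] integrable_mult_G[OF G(1,2)] integrable_mult_G[OF G(3,4)]
  show "integrable M (\<lambda>\<omega>. (Y a \<omega> * Y b \<omega> - cov a b) * (Y p \<omega> * Y q \<omega> - cov p q))"
    unfolding e using i by simp
  show "(\<integral>\<omega>. (Y a \<omega> * Y b \<omega> - cov a b) * (Y p \<omega> * Y q \<omega> - cov p q) \<partial>M) = cov a p * cov b q + cov a q * cov b p"
    unfolding e using i wick_four_G[OF G] by (simp add: cov_def prob_space)
qed

lemma V_second_moment: "integrable M (\<lambda>\<omega>. (V \<omega>)\<^sup>2)" "(\<integral>\<omega>. (V \<omega>)\<^sup>2 \<partial>M) = s2"
proof -
  let ?U = "\<lambda>j \<omega>. (Y j \<omega>)\<^sup>2 - cov j j"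
  have 1: "integrable M (\<lambda>\<omega>. ?U a \<omega> * ?U b \<omega>)" if "a \<in> J" "b \<in> J" for a b
    using integrable_centered_products(1)[OF that(1) that(1) that(2) that(2)] by (simp add: power2_eq_square)
  have 2: "(\<integral>\<omega>. ?U a \<omega> * ?U b \<omega> \<partial>M) = 2 * (cov a b)\<^sup>2" if "a \<in> J" "b \<in> J" for a b
    using integrable_centered_products(2)[OF that(1) that(1) that(2) that(2)] by (simp add: power2_eq_square)
  show "integrable M (\<lambda>\<omega>. (V \<omega>)\<^sup>2)" unfolding V_def by (rule second_moment_sum(1)[OF finJ 1])
  have "(\<integral>\<omega>. (V \<omega>)\<^sup>2 \<partial>M) = (\<Sum>a\<in>J. \<Sum>b\<in>J. c a * c b * (\<integral>\<omega>. ?U a \<omega> * ?U b \<omega> \<partial>M))"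
    unfolding V_def by (rule second_moment_sum(2)[OF finJ 1])
  also have "\<dots> = s2" unfolding s2_def by (simp add: 2 sum_distrib_left mult_ac)
  finally show "(\<integral>\<omega>. (V \<omega>)\<^sup>2 \<partial>M) = s2" .
qed

lemma s2_nonneg: "0 \<le> s2"
  unfolding V_second_moment(2)[symmetric] by simp

lemma W_variance:
  "integrable M (\<lambda>\<omega>. (W \<omega> - s2 / 2)\<^sup>2)"
  "(\<integral>\<omega>. (W \<omega> - s2 / 2)\<^sup>2 \<partial>M) = (\<Sum>p\<in>J\<times>J. \<Sum>q\<in>J\<times>J.
     (c (fst p) * c (snd p) * cov (fst p) (snd p)) * (c (fst q) * c (snd q) * cov (fst q) (snd q)) *
     (cov (fst p) (fst q) * cov (snd p) (snd q) + cov (fst p) (snd q) * cov (snd p) (fst q)))"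
proof -
  let ?U = "\<lambda>p \<omega>. Y (fst p) \<omega> * Y (snd p) \<omega> - cov (fst p) (snd p)"
  let ?w = "\<lambda>p. c (fst p) * c (snd p) * cov (fst p) (snd p)"
  \<comment> \<open>Since \<open>s2 / 2\<close> is the mean of \<open>W\<close>, the difference is a
    weighted sum of centered products indexed by pairs.\<close>
  have e: "W \<omega> - s2 / 2 = (\<Sum>p\<in>J\<times>J. ?w p * ?U p \<omega>)" for \<omega>
    unfolding W_def s2_def sum.cartesian_product
    by (simp add: split_beta right_diff_distrib sum_subtractf power2_eq_square mult.assoc)
  have f: "finite (J \<times> J)" using finJ by simp
  have i: "integrable M (\<lambda>\<omega>. ?U p \<omega> * ?U q \<omega>)" if "p \<in> J \<times> J" "q \<in> J \<times> J" for p q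
    using that by (intro integrable_centered_products(1)) auto
  show "integrable M (\<lambda>\<omega>. (W \<omega> - s2 / 2)\<^sup>2)" unfolding e by (rule second_moment_sum(1)[OF f i])
  have "(\<integral>\<omega>. (W \<omega> - s2 / 2)\<^sup>2 \<partial>M) = (\<Sum>p\<in>J\<times>J. \<Sum>q\<in>J\<times>J. ?w p * ?w q * (\<integral>\<omega>. ?U p \<omega> * ?U q \<omega> \<partial>M))"
    unfolding e by (rule second_moment_sum(2)[OF f i])
  also have "\<dots> = (\<Sum>p\<in>J\<times>J. \<Sum>q\<in>J\<times>J. ?w p * ?w q *
     (cov (fst p) (fst q) * cov (snd p) (snd q) + cov (fst p) (snd q) * cov (snd p) (fst q)))"
    by (intro sum.cong refl arg_cong2[where f="(*)"] integrable_centered_products(2)) auto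
  finally show "(\<integral>\<omega>. (W \<omega> - s2 / 2)\<^sup>2 \<partial>M) = (\<Sum>p\<in>J\<times>J. \<Sum>q\<in>J\<times>J. ?w p * ?w q *
     (cov (fst p) (fst q) * cov (snd p) (snd q) + cov (fst p) (snd q) * cov (snd p) (fst q)))" .
qed

text \<open>Integration by parts for g(y) = y_a exp (i t v(y)). The direction is the covariance
  vector of \<open>Y a\<close>: the derivative of the linear factor gives \<open>cov a a\<close>,
  that of the phase gives twice the sum over \<open>b\<close>. The growth exponent 2 is due to the
  second of these.\<close>

lemma quadratic_form_by_parts:
  assumes a: "a \<in> J"
  shows "(\<integral>\<omega>. of_real ((Y a \<omega>)\<^sup>2) * iexp (t * V \<omega>) \<partial>M) = of_real (cov a a) * (\<integral>\<omega>. iexp (t * V \<omega>) \<partial>M)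
    + 2 * \<i> * t * (\<integral>\<omega>. of_real (\<Sum>b\<in>J. c b * cov a b * (Y a \<omega> * Y b \<omega>)) * iexp (t * V \<omega>) \<partial>M)"
proof -
  define v where "v y = (\<Sum>j\<in>J. c j * ((y j)\<^sup>2 - cov j j))" for y :: "'i \<Rightarrow> real"
  define dv where "dv y = (\<Sum>j\<in>J. c j * cov a j * y j)" for y :: "'i \<Rightarrow> real"
  define g where "g y = of_real (y a) * iexp (t * v y)" for y
  define g' where "g' y = of_real (cov a a) * iexp (t * v y) + of_real (y a) * (2 * \<i> * t * of_real (dv y)) * iexp (t * v y)" for y
  have [measurable]: "(\<lambda>y. y l) \<in> borel_measurable (PiM J (\<lambda>_. borel :: real measure))" if "l \<in> J" for l
    using that by (rule measurable_component_singleton)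
  have [measurable]: "(\<lambda>y. y a) \<in> borel_measurable (PiM J (\<lambda>_. borel :: real measure))"
    using a by (rule measurable_component_singleton)
  have [measurable]: "v \<in> borel_measurable (PiM J (\<lambda>_. borel))" "dv \<in> borel_measurable (PiM J (\<lambda>_. borel))"
    unfolding v_def[abs_def] dv_def[abs_def] by (auto intro!: borel_measurable_sum)
  define K where "K = 1 + \<bar>cov a a\<bar> + 2 * \<bar>t\<bar> * (\<Sum>j\<in>J. \<bar>c j * cov a j\<bar>)"
  have K: "1 \<le> K" unfolding K_def by (auto intro!: sum_nonneg)
  have vR: "v (\<lambda>l\<in>J. y l + s * cov a l) = (\<Sum>j\<in>J. c j * ((y j + s * cov a j)\<^sup>2 - cov j j))" for y s
    unfolding v_def by (intro sum.cong) auto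
  have dvR: "dv (\<lambda>l\<in>J. y l + s * cov a l) = (\<Sum>j\<in>J. c j * cov a j * (y j + s * cov a j))" for y s
    unfolding dv_def by (intro sum.cong) auto
  have vd: "((\<lambda>s. t * v (\<lambda>l\<in>J. y l + s * cov a l)) has_real_derivative (2 * t * dv (\<lambda>l\<in>J. y l + s * cov a l))) (at s)" for y s
  proof -
    have "((\<lambda>s. c j * ((y j + s * cov a j)\<^sup>2 - cov j j)) has_real_derivative 2 * (c j * cov a j * (y j + s * cov a j))) (at s)" for j
      by (auto intro!: derivative_eq_intros)
    then have "((\<lambda>s. t * (\<Sum>j\<in>J. c j * ((y j + s * cov a j)\<^sup>2 - cov j j))) has_real_derivative t * (\<Sum>j\<in>J. 2 * (c j * cov a j * (y j + s * cov a j)))) (at s)"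
      by (intro DERIV_cmult DERIV_sum)
    moreover have "t * (\<Sum>j\<in>J. 2 * (c j * cov a j * (y j + s * cov a j))) = 2 * t * (\<Sum>j\<in>J. c j * cov a j * (y j + s * cov a j))"
      by (simp only: sum_distrib_left[symmetric])
    ultimately show ?thesis unfolding vR dvR by (simp only:)
  qed
  have ie: "((\<lambda>s. iexp (t * v (\<lambda>l\<in>J. y l + s * cov a l))) has_vector_derivative
      (2 * t * dv (\<lambda>l\<in>J. y l + s * cov a l)) *\<^sub>R (\<i> * iexp (t * v (\<lambda>l\<in>J. y l + s * cov a l)))) (at s)" for y s
    using vector_diff_chain_at[OF vd[unfolded has_real_derivative_iff_has_vector_derivative] has_vector_derivative_iexp]
    by (simp add: o_def)
  have "(\<integral>\<omega>. Y a \<omega> *\<^sub>R g (\<lambda>l\<in>J. Y l \<omega>) \<partial>M) = (\<integral>\<omega>. g' (\<lambda>l\<in>J. Y l \<omega>) \<partial>M)"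
  proof (rule gaussian_integration_by_parts[OF finJ a YG, where r="cov a" and C=K and k=2])
    show "cov a l = (\<integral>\<omega>. Y a \<omega> * Y l \<omega> \<partial>M)" for l by (simp add: cov_def)
    show "g \<in> borel_measurable (PiM J (\<lambda>_. borel))" "g' \<in> borel_measurable (PiM J (\<lambda>_. borel))"
      unfolding g_def[abs_def] g'_def[abs_def] by measurable
    show "((\<lambda>s. g (\<lambda>l\<in>J. y l + s * cov a l)) has_vector_derivative g' (\<lambda>l\<in>J. y l + s * cov a l)) (at s)" for y s
    proof -
      have "((\<lambda>s. of_real (y a + s * cov a a) :: complex) has_vector_derivative of_real (cov a a)) (at s)"
        by (auto intro!: derivative_eq_intros has_vector_derivative_of_real)
      from has_vector_derivative_mult[OF this ie[of y s]]
      show ?thesis using a by (simp add: g_def g'_def scaleR_conv_of_real algebra_simps)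
    qed
    show "continuous_on UNIV (\<lambda>s. g' (\<lambda>l\<in>J. y l + s * cov a l))" for y
      unfolding g'_def vR dvR using a by (simp del: of_real_add of_real_mult of_real_sum) (intro continuous_intros)
    fix y :: "'i \<Rightarrow> real"
    define S where "S = 1 + (\<Sum>l\<in>J. \<bar>y l\<bar>)"
    have S1: "1 \<le> S" by (simp add: S_def sum_nonneg)
    have S: "\<bar>y l\<bar> \<le> S" if "l \<in> J" for l
      using member_le_sum[of l J "\<lambda>l. \<bar>y l\<bar>"] that finJ by (auto simp: S_def)
    have S2: "S \<le> S ^ 2" "1 \<le> S ^ 2" using S1 by (auto simp: power2_eq_square mult_le_cancel_left1 intro: one_le_power order_trans)
    have "norm (g y) \<le> 1 * S ^ 2" unfolding g_def using S[OF a] S2 by (simp add: norm_mult)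
    also have "\<dots> \<le> K * S ^ 2" using K by (intro mult_right_mono) auto
    finally show "norm (g y) \<le> K * (1 + (\<Sum>l\<in>J. \<bar>y l\<bar>)) ^ 2" unfolding S_def .
    have dvb: "\<bar>dv y\<bar> \<le> (\<Sum>j\<in>J. \<bar>c j * cov a j\<bar>) * S"
      unfolding dv_def sum_distrib_right using S
      by (intro order_trans[OF sum_abs] sum_mono) (simp add: abs_mult mult_left_mono)
    have "norm (g' y) \<le> norm (of_real (cov a a) * iexp (t * v y)) + norm (of_real (y a) * (2 * \<i> * t * of_real (dv y)) * iexp (t * v y))"
      unfolding g'_def by (rule norm_triangle_ineq)
    also have "\<dots> = \<bar>cov a a\<bar> * 1 + \<bar>y a\<bar> * (2 * \<bar>t\<bar> * \<bar>dv y\<bar>)" by (simp add: norm_mult)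
    also have "\<dots> \<le> \<bar>cov a a\<bar> * S ^ 2 + S * (2 * \<bar>t\<bar> * ((\<Sum>j\<in>J. \<bar>c j * cov a j\<bar>) * S))"
      using S[OF a] S2 dvb S1 by (intro add_mono mult_mono) (auto intro!: mult_nonneg_nonneg)
    also have "\<dots> \<le> K * S ^ 2" using S2 by (simp add: K_def algebra_simps power2_eq_square)
    finally show "norm (g' y) \<le> K * (1 + (\<Sum>l\<in>J. \<bar>y l\<bar>)) ^ 2" unfolding S_def .
  qed
  moreover have vY: "v (\<lambda>l\<in>J. Y l \<omega>) = V \<omega>" for \<omega> unfolding v_def V_def by (intro sum.cong) auto
  moreover have dvY: "Y a \<omega> * dv (\<lambda>l\<in>J. Y l \<omega>) = (\<Sum>b\<in>J. c b * cov a b * (Y a \<omega> * Y b \<omega>))" for \<omega>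
    unfolding dv_def sum_distrib_left by (intro sum.cong) auto
  moreover have "Y a \<omega> *\<^sub>R g (\<lambda>l\<in>J. Y l \<omega>) = of_real ((Y a \<omega>)\<^sup>2) * iexp (t * V \<omega>)" for \<omega>
    using a by (simp add: g_def vY scaleR_conv_of_real power2_eq_square)
  moreover have "g' (\<lambda>l\<in>J. Y l \<omega>) = of_real (cov a a) * iexp (t * V \<omega>)
      + 2 * \<i> * t * (of_real (\<Sum>b\<in>J. c b * cov a b * (Y a \<omega> * Y b \<omega>)) * iexp (t * V \<omega>))" for \<omega>
    unfolding dvY[symmetric] using a by (simp add: g'_def vY mult_ac)
  moreover have "integrable M (\<lambda>\<omega>. iexp (t * V \<omega>))"
    by (rule integrable_bounded_complex[where B=1]) auto
  moreover have "integrable M (\<lambda>\<omega>. of_real (\<Sum>b\<in>J. c b * cov a b * (Y a \<omega> * Y b \<omega>)) * iexp (t * V \<omega>))"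
  proof (rule Bochner_Integration.integrable_bound)
    show i: "integrable M (\<lambda>\<omega>. (\<Sum>b\<in>J. c b * cov a b * (Y a \<omega> * Y b \<omega>)))"
      using integrable_mult_G[OF YG[OF a] YG] by (intro Bochner_Integration.integrable_sum integrable_mult_right) auto
    show "(\<lambda>\<omega>. of_real (\<Sum>b\<in>J. c b * cov a b * (Y a \<omega> * Y b \<omega>)) * iexp (t * V \<omega>)) \<in> borel_measurable M"
      using borel_measurable_integrable[OF i] by measurable
  qed (simp add: norm_mult del: of_real_sum of_real_mult)
  ultimately show ?thesis by (simp only: Bochner_Integration.integral_add integrable_mult_right integral_mult_right_zero)
qed

text \<open>Summing the by-parts identities with the weights \<open>c a\<close> cancels the centring
  of \<open>V\<close> and leaves \<phi>' = - 2 t E (W exp (i t V)). Replacing \<open>W\<close> by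
  its mean gives the equation of the normal law with variance \<open>s2\<close>; the error is at
  most the L^2 distance of \<open>W\<close> from its mean.\<close>

lemma char_quadratic_form:
  "norm ((\<integral>\<omega>. iexp (t * V \<omega>) \<partial>M) - exp (- of_real (s2 * t\<^sup>2 / 2))) \<le> 2 * t\<^sup>2 * sqrt (\<integral>\<omega>. (W \<omega> - s2 / 2)\<^sup>2 \<partial>M)"
proof (rule char_ode_estimate[OF _ _ _ s2_nonneg, where R="\<lambda>t. (\<integral>\<omega>. of_real (W \<omega> - s2 / 2) * iexp (t * V \<omega>) \<partial>M)"])
  define \<phi> where "\<phi> t = (\<integral>\<omega>. iexp (t * V \<omega>) \<partial>M)" for t
  have iV: "integrable M V" using V_measurable V_second_moment(1) by (rule expectation_abs_le_sqrt(1))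
  have iW': "integrable M (\<lambda>\<omega>. W \<omega> - s2 / 2)" by (rule expectation_abs_le_sqrt(1)[OF _ W_variance(1)]) measurable
  have ie: "integrable M (\<lambda>\<omega>. iexp (t * V \<omega>))" for t by (rule integrable_bounded_complex[where B=1]) auto
  have iexpi: "integrable M (\<lambda>\<omega>. of_real (Z \<omega>) * iexp (t * V \<omega>))" if "integrable M Z" for Z t
    using that borel_measurable_integrable[OF that]
    by (intro Bochner_Integration.integrable_bound[OF that]) (auto simp: norm_mult)
  have iY2: "integrable M (\<lambda>\<omega>. (Y a \<omega>)\<^sup>2)" if "a \<in> J" for a using YG[OF that] by (rule integrable_power_G)
  have iYY: "integrable M (\<lambda>\<omega>. \<Sum>b\<in>J. c b * cov a b * (Y a \<omega> * Y b \<omega>))" if "a \<in> J" for a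
    using integrable_mult_G[OF YG[OF that] YG] by (intro Bochner_Integration.integrable_sum integrable_mult_right) auto
  show "(\<integral>\<omega>. iexp (0 * V \<omega>) \<partial>M) = 1" by (simp add: prob_space)
  show "norm (\<integral>\<omega>. of_real (W \<omega> - s2 / 2) * iexp (t * V \<omega>) \<partial>M) \<le> sqrt (\<integral>\<omega>. (W \<omega> - s2 / 2)\<^sup>2 \<partial>M)" for t
  proof -
    have "norm (\<integral>\<omega>. of_real (W \<omega> - s2 / 2) * iexp (t * V \<omega>) \<partial>M) \<le> (\<integral>\<omega>. \<bar>W \<omega> - s2 / 2\<bar> \<partial>M)"
      by (rule order_trans[OF integral_norm_bound]) (simp add: norm_mult del: of_real_diff)
    also have "\<dots> \<le> sqrt (\<integral>\<omega>. (W \<omega> - s2 / 2)\<^sup>2 \<partial>M)"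
      by (rule expectation_abs_le_sqrt(2)[OF _ W_variance(1)]) measurable
    finally show ?thesis .
  qed
  show "((\<lambda>t. \<integral>\<omega>. iexp (t * V \<omega>) \<partial>M) has_vector_derivative
      - of_real (t * s2) * (\<integral>\<omega>. iexp (t * V \<omega>) \<partial>M) - 2 * of_real t * (\<integral>\<omega>. of_real (W \<omega> - s2 / 2) * iexp (t * V \<omega>) \<partial>M)) (at t)" for t
  proof -
    define E where "E Z = (\<integral>\<omega>. of_real (Z \<omega>) * iexp (t * V \<omega>) \<partial>M)" for Z :: "'a \<Rightarrow> real"
    \<comment> \<open>The term \<open>cov a a * \<phi>\<close> produced by integration by parts is
      exactly what the centring of \<open>V\<close> subtracts.\<close>
    have step: "of_real (c a) * (\<integral>\<omega>. of_real ((Y a \<omega>)\<^sup>2) * iexp (t * V \<omega>) \<partial>M) - of_real (c a * cov a a) * \<phi> t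
        = 2 * \<i> * t * (of_real (c a) * E (\<lambda>\<omega>. \<Sum>b\<in>J. c b * cov a b * (Y a \<omega> * Y b \<omega>)))" if "a \<in> J" for a
      unfolding quadratic_form_by_parts[OF that] E_def \<phi>_def
      by (simp add: distrib_left mult.assoc mult.left_commute[of "of_real (c a)"] del: of_real_sum)
    have "(\<integral>\<omega>. \<i> * V \<omega> * iexp (t * V \<omega>) \<partial>M) = \<i> * (\<integral>\<omega>. (\<Sum>a\<in>J. of_real (c a) * (of_real ((Y a \<omega>)\<^sup>2) * iexp (t * V \<omega>)) - of_real (c a * cov a a) * iexp (t * V \<omega>)) \<partial>M)"
    proof -
      have "\<i> * V \<omega> * iexp (t * V \<omega>) = \<i> * (\<Sum>a\<in>J. of_real (c a) * (of_real ((Y a \<omega>)\<^sup>2) * iexp (t * V \<omega>)) - of_real (c a * cov a a) * iexp (t * V \<omega>))" for \<omega>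

      proof -
        have "of_real (V \<omega>) = (\<Sum>a\<in>J. of_real (c a) * of_real ((Y a \<omega>)\<^sup>2) - of_real (c a * cov a a) :: complex)"
          by (simp add: V_def right_diff_distrib)
        then have "\<i> * V \<omega> * iexp (t * V \<omega>) = \<i> * ((\<Sum>a\<in>J. of_real (c a) * of_real ((Y a \<omega>)\<^sup>2) - of_real (c a * cov a a)) * iexp (t * V \<omega>))"
          by (simp only: mult.assoc)
        then show ?thesis by (simp only: sum_distrib_right left_diff_distrib mult.assoc)
      qed
      then show ?thesis by (simp only: integral_mult_right_zero)
    qed
    also have "(\<integral>\<omega>. (\<Sum>a\<in>J. of_real (c a) * (of_real ((Y a \<omega>)\<^sup>2) * iexp (t * V \<omega>)) - of_real (c a * cov a a) * iexp (t * V \<omega>)) \<partial>M)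
        = (\<Sum>a\<in>J. (of_real (c a) * (\<integral>\<omega>. of_real ((Y a \<omega>)\<^sup>2) * iexp (t * V \<omega>) \<partial>M) - of_real (c a * cov a a) * \<phi> t))"
    proof -
      have 1: "integrable M (\<lambda>\<omega>. of_real (c a) * (of_real ((Y a \<omega>)\<^sup>2) * iexp (t * V \<omega>)))" if "a \<in> J" for a
        by (rule integrable_mult_right, rule iexpi, rule iY2, rule that)
      have 2: "integrable M (\<lambda>\<omega>. of_real (c a * cov a a) * iexp (t * V \<omega>))" for a
        by (rule integrable_mult_right, rule ie)
      show ?thesis
        unfolding \<phi>_def integral_mult_right_zero[symmetric]
        by (subst Bochner_Integration.integral_sum, rule Bochner_Integration.integrable_diff[OF 1 2], assumption,
          intro sum.cong refl Bochner_Integration.integral_diff 1 2, assumption)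
    qed
    also have "\<dots> = (\<Sum>a\<in>J. 2 * \<i> * t * (of_real (c a) * E (\<lambda>\<omega>. \<Sum>b\<in>J. c b * cov a b * (Y a \<omega> * Y b \<omega>))))"
      by (intro sum.cong refl step)
    also have "\<dots> = 2 * \<i> * t * E W"
    proof -
      have "E W = (\<integral>\<omega>. (\<Sum>a\<in>J. of_real (c a) * (of_real (\<Sum>b\<in>J. c b * cov a b * (Y a \<omega> * Y b \<omega>)) * iexp (t * V \<omega>))) \<partial>M)"
      proof -
        have "W \<omega> = (\<Sum>a\<in>J. c a * (\<Sum>b\<in>J. c b * cov a b * (Y a \<omega> * Y b \<omega>)))" for \<omega>
          by (simp add: W_def sum_distrib_left mult.assoc)
        then show ?thesis
          unfolding E_def by (simp only: of_real_sum[where f="\<lambda>a. c a * _ a"] of_real_mult[of "c _"] sum_distrib_right[where r="iexp _"] mult.assoc)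
      qed
      also have "\<dots> = (\<Sum>a\<in>J. of_real (c a) * E (\<lambda>\<omega>. \<Sum>b\<in>J. c b * cov a b * (Y a \<omega> * Y b \<omega>)))"
        unfolding E_def integral_mult_right_zero[symmetric]
        by (rule Bochner_Integration.integral_sum, rule integrable_mult_right, rule iexpi, rule iYY)
      finally show ?thesis by (simp add: sum_distrib_left)
    qed
    finally have D: "(\<integral>\<omega>. \<i> * V \<omega> * iexp (t * V \<omega>) \<partial>M) = \<i> * (2 * \<i> * t * E W)" .
    have "\<i> * (2 * \<i> * t * E W) = (\<i> * \<i>) * (2 * t * E W)" by (simp only: mult.assoc mult.left_commute of_real_mult of_real_numeral)
    with D have D: "(\<integral>\<omega>. \<i> * V \<omega> * iexp (t * V \<omega>) \<partial>M) = - (2 * t * E W)" by (simp only: i_squared mult_minus1)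
    \<comment> \<open>Splitting off the mean of \<open>W\<close> isolates the linear term of the
      differential equation.\<close>
    have "E W = E (\<lambda>\<omega>. W \<omega> - s2 / 2) + of_real (s2 / 2) * \<phi> t"
    proof -
      have "E W = (\<integral>\<omega>. of_real (W \<omega> - s2 / 2) * iexp (t * V \<omega>) + of_real (s2 / 2) * iexp (t * V \<omega>) \<partial>M)"
        unfolding E_def by (simp only: distrib_right[symmetric] of_real_add[symmetric] diff_add_cancel)
      also have "\<dots> = E (\<lambda>\<omega>. W \<omega> - s2 / 2) + of_real (s2 / 2) * \<phi> t"
        unfolding E_def \<phi>_def by (subst Bochner_Integration.integral_add, rule iexpi[OF iW'], rule integrable_mult_right, rule ie, simp only: integral_mult_right_zero)
      finally show ?thesis .
    qed
    then have "(\<integral>\<omega>. \<i> * V \<omega> * iexp (t * V \<omega>) \<partial>M) = - of_real (t * s2) * \<phi> t - 2 * of_real t * E (\<lambda>\<omega>. W \<omega> - s2 / 2)"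
      unfolding D by (simp add: distrib_left)
    then show ?thesis
      using has_vector_derivative_char[OF V_measurable V_second_moment(1) iV, of t] unfolding \<phi>_def E_def by simp
  qed
qed

text \<open>Each of the two terms of the variance is a sum over cycles of four covariances. Summing
  one vertex costs \<open>S\<close> by the Cauchy-Schwarz idea, two further vertices cost an
  absolute row sum \<open>S1\<close> each, and the last one the cardinality of
  \<open>J\<close>.\<close>

lemma W_variance_bound:
  assumes c: "\<And>j. j \<in> J \<Longrightarrow> \<bar>c j\<bar> \<le> K" and S: "\<And>a. a \<in> J \<Longrightarrow> (\<Sum>b\<in>J. (cov a b)\<^sup>2) \<le> S"
    and S1: "\<And>a. a \<in> J \<Longrightarrow> (\<Sum>b\<in>J. \<bar>cov a b\<bar>) \<le> S1"
  shows "(\<integral>\<omega>. (W \<omega> - s2 / 2)\<^sup>2 \<partial>M) \<le> 2 * K ^ 4 * (real (card J) * S * S1\<^sup>2)"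
proof (cases "J = {}")
  case True then show ?thesis unfolding W_variance(2) by simp
next
  case False
  then obtain a0 where "a0 \<in> J" by auto
  have K0: "0 \<le> K" using order_trans[OF abs_ge_zero c[OF \<open>a0 \<in> J\<close>]] .
  have S0: "0 \<le> S" using order_trans[OF sum_nonneg S[OF \<open>a0 \<in> J\<close>]] by simp
  have S10: "0 \<le> S1" using order_trans[OF sum_nonneg S1[OF \<open>a0 \<in> J\<close>]] by simp
  define q where "q a b = \<bar>cov a b\<bar>" for a b
  have q0: "0 \<le> q a b" for a b by (simp add: q_def)
  have qs: "q a b = q b a" for a b by (simp add: q_def cov_sym)
  have inner: "(\<Sum>a\<in>J. q a b * q a d) \<le> S" if "b \<in> J" "d \<in> J" for b d
  proof -
    have "(\<Sum>a\<in>J. q a b * q a d) \<le> (\<Sum>a\<in>J. ((q a b)\<^sup>2 + (q a d)\<^sup>2) / 2)"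
      using sum_squares_bound[of "q _ b" "q _ d"] by (intro sum_mono) (simp add: field_simps)
    also have "\<dots> = ((\<Sum>a\<in>J. (cov b a)\<^sup>2) + (\<Sum>a\<in>J. (cov d a)\<^sup>2)) / 2"
      by (simp add: q_def sum.distrib sum_divide_distrib[symmetric] cov_sym)
    also have "\<dots> \<le> S" using S[OF that(1)] S[OF that(2)] by simp
    finally show ?thesis .
  qed
  \<comment> \<open>The four factors are the edges of the cycle a - b - e - d; in this order
    \<open>a\<close> can be summed first, then \<open>d\<close>, then \<open>e\<close>.\<close>
  have eq: "q a b * q d e * (q a d * q b e) = q b e * (q e d * (q a b * q a d))" for a b d e
    by (subst qs[of d e]) (simp add: mult_ac)
  have four: "(\<Sum>b\<in>J. \<Sum>e\<in>J. \<Sum>d\<in>J. \<Sum>a\<in>J. q a b * q d e * (q a d * q b e)) \<le> real (card J) * S * S1\<^sup>2"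
  proof -
    have "(\<Sum>b\<in>J. \<Sum>e\<in>J. \<Sum>d\<in>J. \<Sum>a\<in>J. q a b * q d e * (q a d * q b e))
        = (\<Sum>b\<in>J. \<Sum>e\<in>J. q b e * (\<Sum>d\<in>J. q e d * (\<Sum>a\<in>J. q a b * q a d)))"
      by (simp only: eq sum_distrib_left)
    also have "\<dots> \<le> (\<Sum>b\<in>J. \<Sum>e\<in>J. q b e * (\<Sum>d\<in>J. q e d * S))"
      using inner q0 by (intro sum_mono mult_left_mono) auto
    also have "\<dots> \<le> (\<Sum>b\<in>J. \<Sum>e\<in>J. q b e * (S1 * S))"
    proof (intro sum_mono mult_left_mono q0)
      fix e assume "e \<in> J"
      then show "(\<Sum>d\<in>J. q e d * S) \<le> S1 * S"
        unfolding sum_distrib_right[symmetric] using S1 S0 by (intro mult_right_mono) (auto simp: q_def)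
    qed
    also have "\<dots> \<le> (\<Sum>b\<in>J. S1 * (S1 * S))"
    proof (intro sum_mono)
      fix b assume "b \<in> J"
      then show "(\<Sum>e\<in>J. q b e * (S1 * S)) \<le> S1 * (S1 * S)"
        unfolding sum_distrib_right[symmetric] using S1 S0 S10 by (intro mult_right_mono) (auto simp: q_def)
    qed
    finally show ?thesis by (simp add: power2_eq_square mult_ac)
  qed
  have sw1: "(\<Sum>a\<in>J. \<Sum>b\<in>J. \<Sum>d\<in>J. \<Sum>e\<in>J. h a b d e) = (\<Sum>b\<in>J. \<Sum>e\<in>J. \<Sum>d\<in>J. \<Sum>a\<in>J. h a b d e)"
    for h :: "'i \<Rightarrow> 'i \<Rightarrow> 'i \<Rightarrow> 'i \<Rightarrow> real"
  proof -
    have "(\<Sum>a\<in>J. \<Sum>b\<in>J. \<Sum>d\<in>J. \<Sum>e\<in>J. h a b d e) = (\<Sum>b\<in>J. \<Sum>a\<in>J. \<Sum>e\<in>J. \<Sum>d\<in>J. h a b d e)"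
      by (subst sum.swap) (intro sum.cong refl sum.swap)
    also have "\<dots> = (\<Sum>b\<in>J. \<Sum>e\<in>J. \<Sum>a\<in>J. \<Sum>d\<in>J. h a b d e)" by (intro sum.cong refl sum.swap)
    also have "\<dots> = (\<Sum>b\<in>J. \<Sum>e\<in>J. \<Sum>d\<in>J. \<Sum>a\<in>J. h a b d e)" by (intro sum.cong refl sum.swap)
    finally show ?thesis .
  qed
  have cc: "\<bar>c a * c b * cov a b * (c d * c e * cov d e)\<bar> \<le> K ^ 4 * (q a b * q d e)" if "a \<in> J" "b \<in> J" "d \<in> J" "e \<in> J" for a b d e
  proof -
    have "\<bar>c a\<bar> * \<bar>c b\<bar> * (\<bar>c d\<bar> * \<bar>c e\<bar>) \<le> K * K * (K * K)"
      using that c K0 by (intro mult_mono) (auto intro: mult_nonneg_nonneg)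
    then have "\<bar>c a\<bar> * \<bar>c b\<bar> * (\<bar>c d\<bar> * \<bar>c e\<bar>) * (q a b * q d e) \<le> K ^ 4 * (q a b * q d e)"
      using q0 by (intro mult_right_mono) (auto simp: power4_eq_xxxx)
    then show ?thesis by (simp add: abs_mult q_def mult_ac)
  qed
  have "(\<integral>\<omega>. (W \<omega> - s2 / 2)\<^sup>2 \<partial>M) = (\<Sum>a\<in>J. \<Sum>b\<in>J. \<Sum>d\<in>J. \<Sum>e\<in>J.
     c a * c b * cov a b * (c d * c e * cov d e) * (cov a d * cov b e + cov a e * cov b d))"
    unfolding W_variance(2) by (simp add: sum.cartesian_product' split_beta)
  also have "\<dots> \<le> (\<Sum>a\<in>J. \<Sum>b\<in>J. \<Sum>d\<in>J. \<Sum>e\<in>J. K ^ 4 * (q a b * q d e * (q a d * q b e)) + K ^ 4 * (q a b * q d e * (q a e * q b d)))"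
  proof (intro sum_mono)
    fix a b d e assume J: "a \<in> J" "b \<in> J" "d \<in> J" "e \<in> J"
    have "c a * c b * cov a b * (c d * c e * cov d e) * (cov a d * cov b e + cov a e * cov b d)
       \<le> \<bar>c a * c b * cov a b * (c d * c e * cov d e)\<bar> * \<bar>cov a d * cov b e + cov a e * cov b d\<bar>"
      unfolding abs_mult[symmetric] by (rule abs_ge_self)
    also have "\<dots> \<le> (K ^ 4 * (q a b * q d e)) * (q a d * q b e + q a e * q b d)"
      using cc[OF J] by (intro mult_mono) (auto simp: q_def abs_mult[symmetric] K0)
    finally show "c a * c b * cov a b * (c d * c e * cov d e) * (cov a d * cov b e + cov a e * cov b d)
       \<le> K ^ 4 * (q a b * q d e * (q a d * q b e)) + K ^ 4 * (q a b * q d e * (q a e * q b d))"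
      by (simp add: algebra_simps)
  qed
  also have "\<dots> = K ^ 4 * (\<Sum>a\<in>J. \<Sum>b\<in>J. \<Sum>d\<in>J. \<Sum>e\<in>J. q a b * q d e * (q a d * q b e))
     + K ^ 4 * (\<Sum>a\<in>J. \<Sum>b\<in>J. \<Sum>d\<in>J. \<Sum>e\<in>J. q a b * q d e * (q a e * q b d))"
    by (simp only: sum.distrib sum_distrib_left)
  \<comment> \<open>Exchanging the names \<open>d\<close> and \<open>e\<close> turns the second
    pairing into the first.\<close>
  also have "(\<Sum>a\<in>J. \<Sum>b\<in>J. \<Sum>d\<in>J. \<Sum>e\<in>J. q a b * q d e * (q a e * q b d)) =
     (\<Sum>a\<in>J. \<Sum>b\<in>J. \<Sum>d\<in>J. \<Sum>e\<in>J. q a b * q e d * (q a d * q b e))"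
    by (intro sum.cong refl sum.swap)
  also have "\<dots> = (\<Sum>a\<in>J. \<Sum>b\<in>J. \<Sum>d\<in>J. \<Sum>e\<in>J. q a b * q d e * (q a d * q b e))"
    by (intro sum.cong refl arg_cong2[where f="(*)"] qs)
  also have "(\<Sum>a\<in>J. \<Sum>b\<in>J. \<Sum>d\<in>J. \<Sum>e\<in>J. q a b * q d e * (q a d * q b e)) =
      (\<Sum>b\<in>J. \<Sum>e\<in>J. \<Sum>d\<in>J. \<Sum>a\<in>J. q a b * q d e * (q a d * q b e))"
    by (rule sw1)
  finally have "(\<integral>\<omega>. (W \<omega> - s2 / 2)\<^sup>2 \<partial>M) \<le> 2 * (K ^ 4 * (\<Sum>b\<in>J. \<Sum>e\<in>J. \<Sum>d\<in>J. \<Sum>a\<in>J. q a b * q d e * (q a d * q b e)))"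
    by simp
  also have "\<dots> \<le> 2 * (K ^ 4 * (real (card J) * S * S1\<^sup>2))"
    using four K0 by (intro mult_left_mono) auto
  finally show ?thesis by (simp add: mult.assoc)
qed

end

section \<open>Convergence in probability\<close>

text \<open>The exceptional set is measurable but only has to contain the failure of
  \<open>Q\<close>, so \<open>Q\<close> may be a non-measurable condition, and intersections of such
  statements cost only the sum of the probabilities.\<close>

definition whp :: "'a measure \<Rightarrow> real \<Rightarrow> ('a \<Rightarrow> bool) \<Rightarrow> bool" where
  "whp M \<epsilon> Q \<longleftrightarrow> (\<exists>E\<in>sets M. measure M E \<le> \<epsilon> \<and> (\<forall>\<omega>\<in>space M - E. Q \<omega>))"

definition oP :: "'a measure \<Rightarrow> (nat \<Rightarrow> 'a \<Rightarrow> real) \<Rightarrow> bool" where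
  "oP M Z \<longleftrightarrow> (\<forall>\<epsilon>>0. \<forall>\<delta>>0. \<forall>\<^sub>F n in sequentially. whp M \<epsilon> (\<lambda>\<omega>. \<bar>Z n \<omega>\<bar> \<le> \<delta>))"

definition OP :: "'a measure \<Rightarrow> (nat \<Rightarrow> 'a \<Rightarrow> real) \<Rightarrow> bool" where
  "OP M Z \<longleftrightarrow> (\<forall>\<epsilon>>0. \<exists>C\<ge>0. \<forall>\<^sub>F n in sequentially. whp M \<epsilon> (\<lambda>\<omega>. \<bar>Z n \<omega>\<bar> \<le> C))"

context prob_space
begin

lemma whp_mono: "whp M \<epsilon> Q \<Longrightarrow> \<epsilon> \<le> \<epsilon>' \<Longrightarrow> (\<And>\<omega>. \<omega> \<in> space M \<Longrightarrow> Q \<omega> \<Longrightarrow> Q' \<omega>) \<Longrightarrow> whp M \<epsilon>' Q'"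
  unfolding whp_def by (meson DiffD1 order_trans)

lemma whp_conj:
  assumes "whp M \<epsilon> Q" "whp M \<epsilon>' Q'"
  shows "whp M (\<epsilon> + \<epsilon>') (\<lambda>\<omega>. Q \<omega> \<and> Q' \<omega>)"
proof -
  obtain E E' where E: "E \<in> sets M" "measure M E \<le> \<epsilon>" "\<forall>\<omega>\<in>space M - E. Q \<omega>"
    "E' \<in> sets M" "measure M E' \<le> \<epsilon>'" "\<forall>\<omega>\<in>space M - E'. Q' \<omega>"
    using assms unfolding whp_def by auto
  have "measure M (E \<union> E') \<le> \<epsilon> + \<epsilon>'"
    using measure_Un_le[of E M E'] E by simp
  then show ?thesis using E unfolding whp_def by (intro bexI[of _ "E \<union> E'"]) auto
qed

lemma whp_AE:
  assumes "AE \<omega> in M. Q \<omega>" "0 \<le> \<epsilon>"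
  shows "whp M \<epsilon> Q"
proof -
  from assms(1) obtain N where "N \<in> null_sets M" "{\<omega> \<in> space M. \<not> Q \<omega>} \<subseteq> N"
    by (auto simp: eventually_ae_filter)
  then show ?thesis using assms(2) unfolding whp_def by (intro bexI[of _ N]) (auto simp: measure_eq_0_null_sets)
qed

lemma whp_finite_union:
  assumes "finite I" "\<And>i. i \<in> I \<Longrightarrow> whp M \<epsilon> (Q i)" "0 \<le> \<epsilon>"
  shows "whp M (real (card I) * \<epsilon>) (\<lambda>\<omega>. \<forall>i\<in>I. Q i \<omega>)"
  using assms
proof (induction I rule: finite_induct)
  case empty
  show ?case by (rule whp_AE) auto
next
  case (insert i I)
  have "whp M (\<epsilon> + real (card I) * \<epsilon>) (\<lambda>\<omega>. Q i \<omega> \<and> (\<forall>i\<in>I. Q i \<omega>))"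
    using insert by (intro whp_conj) auto
  then show ?case by (rule whp_mono) (use insert in \<open>auto simp: algebra_simps\<close>)
qed

lemma whp_Markov:
  assumes i: "integrable M Z" and e: "(\<integral>\<omega>. \<bar>Z \<omega>\<bar> \<partial>M) \<le> \<epsilon> * \<delta>" and d: "0 < \<delta>"
  shows "whp M \<epsilon> (\<lambda>\<omega>. \<bar>Z \<omega>\<bar> \<le> \<delta>)"
proof -
  have [measurable]: "Z \<in> borel_measurable M" using i by auto
  have "prob {\<omega> \<in> space M. \<delta> \<le> \<bar>Z \<omega>\<bar>} \<le> (\<integral>\<omega>. \<bar>Z \<omega>\<bar> \<partial>M) / \<delta>"
    using integral_Markov_inequality_measure[OF integrable_abs[OF i], of "space M" \<delta>] d by auto
  also have "\<dots> \<le> \<epsilon>" using e d by (simp add: divide_le_eq)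
  finally have "prob {\<omega> \<in> space M. \<delta> \<le> \<bar>Z \<omega>\<bar>} \<le> \<epsilon>" .
  then show ?thesis unfolding whp_def by (intro bexI[of _ "{\<omega> \<in> space M. \<delta> \<le> \<bar>Z \<omega>\<bar>}"]) auto
qed

lemma oPD: "oP M Z \<Longrightarrow> 0 < \<epsilon> \<Longrightarrow> 0 < \<delta> \<Longrightarrow> \<forall>\<^sub>F n in sequentially. whp M \<epsilon> (\<lambda>\<omega>. \<bar>Z n \<omega>\<bar> \<le> \<delta>)"
  unfolding oP_def by blast

lemma OPD: "OP M Z \<Longrightarrow> 0 < \<epsilon> \<Longrightarrow> \<exists>C\<ge>0. \<forall>\<^sub>F n in sequentially. whp M \<epsilon> (\<lambda>\<omega>. \<bar>Z n \<omega>\<bar> \<le> C)"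
  unfolding OP_def by blast

lemma oP_dominated:
  assumes "oP M Z'" and le: "\<forall>\<^sub>F n in sequentially. AE \<omega> in M. \<bar>Z n \<omega>\<bar> \<le> \<bar>Z' n \<omega>\<bar>"
  shows "oP M Z"
  unfolding oP_def
proof (intro allI impI)
  fix \<epsilon> \<delta> :: real assume "0 < \<epsilon>" "0 < \<delta>"
  from oPD[OF assms(1) this] le show "\<forall>\<^sub>F n in sequentially. whp M \<epsilon> (\<lambda>\<omega>. \<bar>Z n \<omega>\<bar> \<le> \<delta>)"
  proof eventually_elim
    case (elim n)
    from whp_conj[OF elim(1) whp_AE[OF elim(2) order_refl]] show ?case by (rule whp_mono) auto
  qed
qed

lemma oP_cong:
  assumes "oP M Z'" and "\<forall>\<^sub>F n in sequentially. \<forall>\<omega>\<in>space M. Z n \<omega> = Z' n \<omega>"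
  shows "oP M Z"
  by (rule oP_dominated[OF assms(1)]) (use assms(2) in eventually_elim, auto)

lemma oP_add:
  assumes "oP M Z" "oP M Z'"
  shows "oP M (\<lambda>n \<omega>. Z n \<omega> + Z' n \<omega>)"
  unfolding oP_def
proof (intro allI impI)
  fix \<epsilon> \<delta> :: real assume "0 < \<epsilon>" "0 < \<delta>"
  then have "0 < \<epsilon> / 2" "0 < \<delta> / 2" by auto
  from oPD[OF assms(1) this] oPD[OF assms(2) this]
  show "\<forall>\<^sub>F n in sequentially. whp M \<epsilon> (\<lambda>\<omega>. \<bar>Z n \<omega> + Z' n \<omega>\<bar> \<le> \<delta>)"
  proof eventually_elim
    case (elim n)
    from whp_conj[OF elim] show ?case by (rule whp_mono) auto
  qed
qed

lemma OP_add:
  assumes "OP M Z" "OP M Z'"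
  shows "OP M (\<lambda>n \<omega>. Z n \<omega> + Z' n \<omega>)"
  unfolding OP_def
proof (intro allI impI)
  fix \<epsilon> :: real assume "0 < \<epsilon>"
  then have "0 < \<epsilon> / 2" by auto
  from OPD[OF assms(1) this] OPD[OF assms(2) this] obtain C C' where C: "C \<ge> 0" "C' \<ge> 0"
    and ev: "\<forall>\<^sub>F n in sequentially. whp M (\<epsilon> / 2) (\<lambda>\<omega>. \<bar>Z n \<omega>\<bar> \<le> C)" "\<forall>\<^sub>F n in sequentially. whp M (\<epsilon> / 2) (\<lambda>\<omega>. \<bar>Z' n \<omega>\<bar> \<le> C')"
    by auto
  from ev have "\<forall>\<^sub>F n in sequentially. whp M \<epsilon> (\<lambda>\<omega>. \<bar>Z n \<omega> + Z' n \<omega>\<bar> \<le> C + C')"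
  proof eventually_elim
    case (elim n)
    from whp_conj[OF elim] show ?case by (rule whp_mono) auto
  qed
  with C show "\<exists>C\<ge>0. \<forall>\<^sub>F n in sequentially. whp M \<epsilon> (\<lambda>\<omega>. \<bar>Z n \<omega> + Z' n \<omega>\<bar> \<le> C)"
    by (intro exI[of _ "C + C'"]) auto
qed

lemma oP_zero: "oP M (\<lambda>n \<omega>. 0)"
  unfolding oP_def by (auto intro!: whp_AE always_eventually)

lemma OP_const: "OP M (\<lambda>n \<omega>. c)"
  unfolding OP_def by (auto intro!: whp_AE always_eventually exI[of _ "\<bar>c\<bar>"])

lemma oP_mult:
  assumes "oP M Z" "OP M Z'"
  shows "oP M (\<lambda>n \<omega>. Z n \<omega> * Z' n \<omega>)"
  unfolding oP_def
proof (intro allI impI)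
  fix \<epsilon> \<delta> :: real assume e: "0 < \<epsilon>" "0 < \<delta>"
  then have "0 < \<epsilon> / 2" by simp
  from OPD[OF assms(2) this] obtain C where C: "C \<ge> 0"
    and ev: "\<forall>\<^sub>F n in sequentially. whp M (\<epsilon> / 2) (\<lambda>\<omega>. \<bar>Z' n \<omega>\<bar> \<le> C)" by auto
  have "0 < \<delta> / (C + 1)" using C e by simp
  from oPD[OF assms(1) \<open>0 < \<epsilon> / 2\<close> this] ev
  show "\<forall>\<^sub>F n in sequentially. whp M \<epsilon> (\<lambda>\<omega>. \<bar>Z n \<omega> * Z' n \<omega>\<bar> \<le> \<delta>)"
  proof eventually_elim
    case (elim n)
    from whp_conj[OF elim] show ?case
    proof (rule whp_mono)
      fix \<omega> assume a: "\<bar>Z n \<omega>\<bar> \<le> \<delta> / (C + 1) \<and> \<bar>Z' n \<omega>\<bar> \<le> C"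
      then have "\<bar>Z n \<omega>\<bar> * \<bar>Z' n \<omega>\<bar> \<le> \<delta> / (C + 1) * (C + 1)" using C by (intro mult_mono) auto
      then show "\<bar>Z n \<omega> * Z' n \<omega>\<bar> \<le> \<delta>" using C by (simp add: abs_mult)
    qed simp
  qed
qed

lemma oP_deterministic:
  assumes "a \<longlonglongrightarrow> 0"
  shows "oP M (\<lambda>n \<omega>. a n)"
  unfolding oP_def
proof (intro allI impI)
  fix \<epsilon> \<delta> :: real assume e: "0 < \<epsilon>" "0 < \<delta>"
  from tendstoD[OF assms e(2)] show "\<forall>\<^sub>F n in sequentially. whp M \<epsilon> (\<lambda>\<omega>. \<bar>a n\<bar> \<le> \<delta>)"
    by eventually_elim (use e in \<open>auto intro!: whp_AE\<close>)
qed

lemma oP_scale_null: "OP M Z \<Longrightarrow> a \<longlonglongrightarrow> 0 \<Longrightarrow> oP M (\<lambda>n \<omega>. a n * Z n \<omega>)"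
  by (rule oP_mult[OF oP_deterministic])

lemma oP_cmult: "oP M Z \<Longrightarrow> oP M (\<lambda>n \<omega>. c * Z n \<omega>)"
  using oP_mult[OF _ OP_const, of Z c] by (simp add: mult.commute)

lemma oP_imp_OP: "oP M Z \<Longrightarrow> OP M Z"
  unfolding OP_def using oPD[of Z _ 1] by (auto intro!: exI[of _ 1])

lemma oP_sum:
  assumes "finite I" "\<And>i. i \<in> I \<Longrightarrow> oP M (Z i)"
  shows "oP M (\<lambda>n \<omega>. \<Sum>i\<in>I. c i * Z i n \<omega>)"
  using assms by (induction I rule: finite_induct) (auto intro!: oP_add oP_cmult simp: oP_zero)

lemma oP_L1:
  assumes i: "\<forall>\<^sub>F n in sequentially. integrable M (Z n) \<and> (\<integral>\<omega>. \<bar>Z n \<omega>\<bar> \<partial>M) \<le> e n" and e: "e \<longlonglongrightarrow> 0"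
  shows "oP M Z"
  unfolding oP_def
proof (intro allI impI)
  fix \<epsilon> \<delta> :: real assume ed: "0 < \<epsilon>" "0 < \<delta>"
  have "\<forall>\<^sub>F n in sequentially. e n < \<epsilon> * \<delta>" using e ed by (intro order_tendstoD) auto
  with i show "\<forall>\<^sub>F n in sequentially. whp M \<epsilon> (\<lambda>\<omega>. \<bar>Z n \<omega>\<bar> \<le> \<delta>)"
    by eventually_elim (use ed in \<open>auto intro!: whp_Markov\<close>)
qed

lemma OP_L1:
  assumes i: "\<forall>\<^sub>F n in sequentially. integrable M (Z n) \<and> (\<integral>\<omega>. \<bar>Z n \<omega>\<bar> \<partial>M) \<le> K"
  shows "OP M Z"
  unfolding OP_def
proof (intro allI impI)
  fix \<epsilon> :: real assume e: "0 < \<epsilon>"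
  define C where "C = (\<bar>K\<bar> + 1) / \<epsilon>"
  have C: "0 < C" using e by (simp add: C_def)
  from i have "\<forall>\<^sub>F n in sequentially. whp M \<epsilon> (\<lambda>\<omega>. \<bar>Z n \<omega>\<bar> \<le> C)"
    by eventually_elim (use e C in \<open>auto intro!: whp_Markov simp: C_def\<close>)
  with C show "\<exists>C\<ge>0. \<forall>\<^sub>F n in sequentially. whp M \<epsilon> (\<lambda>\<omega>. \<bar>Z n \<omega>\<bar> \<le> C)" by (intro exI[of _ C]) auto
qed

text \<open>The role of Slutsky's theorem at the level of characteristic functions: off the
  exceptional set the exponentials differ by at most |t| \<delta>, and on it by at most 2.\<close>

lemma char_perturbation:
  assumes [measurable]: "\<And>n. Z n \<in> borel_measurable M" "\<And>n. Z' n \<in> borel_measurable M"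
    and o: "oP M (\<lambda>n \<omega>. Z n \<omega> - Z' n \<omega>)"
  shows "(\<lambda>n. (\<integral>\<omega>. iexp (t * Z n \<omega>) \<partial>M) - (\<integral>\<omega>. iexp (t * Z' n \<omega>) \<partial>M)) \<longlonglongrightarrow> 0"
proof (rule tendstoI)
  fix e :: real assume e: "0 < e"
  \<comment> \<open>Chosen so that |t| \<delta> is at most e/4; the exceptional set of probability
    at most e/8 contributes another e/4, together e/2 < e.\<close>
  define \<delta> where "\<delta> = e / (4 * (\<bar>t\<bar> + 1))"
  have d: "0 < \<delta>" using e by (simp add: \<delta>_def)
  have "\<bar>t\<bar> * \<delta> \<le> (\<bar>t\<bar> + 1) * \<delta>" using d by simp
  also have "\<dots> = e / 4" by (simp add: \<delta>_def field_simps)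
  finally have td: "\<bar>t\<bar> * \<delta> \<le> e / 4" .
  have "0 < e / 8" using e by simp
  from oPD[OF o this d]
  show "\<forall>\<^sub>F n in sequentially. dist ((\<integral>\<omega>. iexp (t * Z n \<omega>) \<partial>M) - (\<integral>\<omega>. iexp (t * Z' n \<omega>) \<partial>M)) 0 < e"
  proof eventually_elim
    case (elim n)
    then obtain E where E[measurable]: "E \<in> sets M" and pE: "prob E \<le> e / 8"
      and off: "\<And>\<omega>. \<omega> \<in> space M \<Longrightarrow> \<omega> \<notin> E \<Longrightarrow> \<bar>Z n \<omega> - Z' n \<omega>\<bar> \<le> \<delta>"
      unfolding whp_def by auto
    have int: "integrable M (\<lambda>\<omega>. iexp (t * Z n \<omega>))" "integrable M (\<lambda>\<omega>. iexp (t * Z' n \<omega>))"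
      by (rule integrable_bounded_complex[where B=1]; simp)+
    have "norm ((\<integral>\<omega>. iexp (t * Z n \<omega>) \<partial>M) - (\<integral>\<omega>. iexp (t * Z' n \<omega>) \<partial>M)) =
        norm (\<integral>\<omega>. iexp (t * Z n \<omega>) - iexp (t * Z' n \<omega>) \<partial>M)" using int by simp
    also have "\<dots> \<le> (\<integral>\<omega>. e / 4 + 2 * indicator E \<omega> \<partial>M)"
    proof (rule order_trans[OF integral_norm_bound integral_mono])
      show "integrable M (\<lambda>\<omega>. norm (iexp (t * Z n \<omega>) - iexp (t * Z' n \<omega>)))"
        using int by (intro integrable_norm Bochner_Integration.integrable_diff)
      show "integrable M (\<lambda>\<omega>. e / 4 + 2 * indicator E \<omega> :: real)"
        by (intro Bochner_Integration.integrable_add integrable_mult_right integrable_real_indicator) (auto simp: emeasure_eq_measure)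
      fix \<omega> assume w: "\<omega> \<in> space M"
      show "norm (iexp (t * Z n \<omega>) - iexp (t * Z' n \<omega>)) \<le> e / 4 + 2 * indicator E \<omega>"
      proof (cases "\<omega> \<in> E")
        case True
        have "norm (iexp (t * Z n \<omega>) - iexp (t * Z' n \<omega>)) \<le> norm (iexp (t * Z n \<omega>)) + norm (iexp (t * Z' n \<omega>))"
          by (rule norm_triangle_ineq4)
        also have "\<dots> = 2" by simp
        finally show ?thesis using True e by simp
      next
        case False
        have "iexp (t * Z n \<omega>) = iexp (t * Z' n \<omega>) * iexp (t * (Z n \<omega> - Z' n \<omega>))"
          by (simp add: exp_add[symmetric] right_diff_distrib distrib_left)
        then have "iexp (t * Z n \<omega>) - iexp (t * Z' n \<omega>) = iexp (t * Z' n \<omega>) * (iexp (t * (Z n \<omega> - Z' n \<omega>)) - 1)"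
          by (simp add: right_diff_distrib)
        then have "norm (iexp (t * Z n \<omega>) - iexp (t * Z' n \<omega>)) = norm (iexp (t * (Z n \<omega> - Z' n \<omega>)) - 1)"
          by (simp add: norm_mult)
        also have "\<dots> \<le> \<bar>t * (Z n \<omega> - Z' n \<omega>)\<bar>" using iexp_approx1[of "t * (Z n \<omega> - Z' n \<omega>)" 0] by simp
        also have "\<dots> \<le> \<bar>t\<bar> * \<delta>" using off[OF w False] by (simp add: abs_mult mult_left_mono)
        finally show ?thesis using td False by simp
      qed
    qed
    also have "\<dots> = e / 4 + 2 * prob E"
      by (subst Bochner_Integration.integral_add) (auto simp: prob_space emeasure_eq_measure intro!: integrable_mult_right integrable_real_indicator)
    also have "\<dots> < e" using pE e by simp
    finally show ?case by (simp add: dist_norm)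
  qed
qed

end

text \<open>Polynomially many Gaussian variables are simultaneously within a factor n^\<kappa> of
  their standard deviations, for any \<kappa> > 0: a moment of sufficiently high order beats the
  number of variables.\<close>

lemma (in gaussian_space) whp_union_bound:
  assumes fin: "\<And>n. finite (I n)" and card: "\<forall>\<^sub>F n in sequentially. real (card (I n)) \<le> real n powr q"
    and L: "\<forall>\<^sub>F n in sequentially. \<forall>i\<in>I n. L n i \<in> G \<and> 0 < s n i \<and> (\<integral>\<omega>. (L n i \<omega>)\<^sup>2 \<partial>M) \<le> (s n i)\<^sup>2"
    and \<kappa>: "0 < \<kappa>" and \<epsilon>: "0 < \<epsilon>"
  shows "\<forall>\<^sub>F n in sequentially. whp M \<epsilon> (\<lambda>\<omega>. \<forall>i\<in>I n. \<bar>L n i \<omega>\<bar> \<le> real n powr \<kappa> * s n i)"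
proof -
  \<comment> \<open>The moment order: n^q events of probability of order n^(- 2 k \<kappa>) have a
    vanishing union as soon as 2 k \<kappa> > q.\<close>
  obtain k :: nat where k: "\<bar>q\<bar> + 1 < real k * (2 * \<kappa>)" using \<kappa> reals_Archimedean3[of "2 * \<kappa>"] by auto
  define K where "K = fact (2 * k) / (2 ^ k * fact k :: real)"
  have "(\<lambda>n. real n powr q * (K / (real n powr \<kappa>) ^ (2 * k))) \<longlonglongrightarrow> 0"
  proof -
    have "(\<lambda>n. K * real n powr (q - real (2 * k) * \<kappa>)) \<longlonglongrightarrow> K * 0"
      using k by (intro tendsto_mult tendsto_const tendsto_neg_powr filterlim_real_sequentially) (auto simp: abs_if split: if_splits)
    moreover have "\<forall>\<^sub>F n in sequentially. K * real n powr (q - real (2 * k) * \<kappa>) = real n powr q * (K / (real n powr \<kappa>) ^ (2 * k))"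
      using eventually_gt_at_top[of 0]
      by eventually_elim (simp add: powr_diff powr_realpow[symmetric] powr_powr mult.commute)
    ultimately show ?thesis by (simp add: tendsto_cong)
  qed
  then have small: "\<forall>\<^sub>F n in sequentially. real n powr q * (K / (real n powr \<kappa>) ^ (2 * k)) < \<epsilon>"
    using \<epsilon> by (intro order_tendstoD) auto
  from small card L eventually_gt_at_top[of 0]
  show ?thesis
  proof eventually_elim
    case (elim n)
    have l: "0 < real n powr \<kappa>" using elim by simp
    define e where "e = K / (real n powr \<kappa>) ^ (2 * k)"
    have e0: "0 \<le> e" by (simp add: e_def K_def)
    have "whp M (real (card (I n)) * e) (\<lambda>\<omega>. \<forall>i\<in>I n. \<bar>L n i \<omega>\<bar> \<le> real n powr \<kappa> * s n i)"
    proof (rule whp_finite_union[OF fin _ e0])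
      fix i assume i: "i \<in> I n"
      then have Li: "L n i \<in> G" "0 < s n i" "(\<integral>\<omega>. (L n i \<omega>)\<^sup>2 \<partial>M) \<le> (s n i)\<^sup>2" using elim by auto
      have [measurable]: "L n i \<in> borel_measurable M" by (rule measurable_G[OF Li(1)])
      have "prob {\<omega> \<in> space M. real n powr \<kappa> * s n i < \<bar>L n i \<omega>\<bar>} \<le> e"
        unfolding e_def K_def by (rule tail_G[OF Li(1) Li(3) Li(2) l])
      then show "whp M e (\<lambda>\<omega>. \<bar>L n i \<omega>\<bar> \<le> real n powr \<kappa> * s n i)"
        unfolding whp_def by (intro bexI[of _ "{\<omega> \<in> space M. real n powr \<kappa> * s n i < \<bar>L n i \<omega>\<bar>}"]) auto
    qed
    then show ?case
    proof (rule whp_mono)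
      have "real (card (I n)) * e \<le> real n powr q * e" using elim e0 by (intro mult_right_mono) auto
      then show "real (card (I n)) * e \<le> \<epsilon>" using elim by (simp add: e_def)
    qed
  qed
qed

section \<open>The linear span of a Gaussian process\<close>

definition gaussian_span :: "real set \<Rightarrow> (real \<Rightarrow> 'a \<Rightarrow> real) \<Rightarrow> ('a \<Rightarrow> real) set" where
  "gaussian_span T B = {L. \<exists>J c. finite J \<and> J \<subseteq> T \<and> L = (\<lambda>\<omega>. \<Sum>t\<in>J. c t * B t \<omega>)}"

text \<open>Normality of finite linear combinations is the definition of the process; only closure
  needs an argument, and there two index sets are merged by extending the coefficients by
  zero.\<close>

lemma gaussian_space_span:
  assumes "prob_space M" "centered_gaussian_process M T B"
  shows "gaussian_space M (gaussian_span T B)"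
proof -
  interpret prob_space M by fact
  show ?thesis
  proof
    fix L assume "L \<in> gaussian_span T B"
    then obtain J c where J: "finite J" "J \<subseteq> T" "L = (\<lambda>\<omega>. \<Sum>t\<in>J. c t * B t \<omega>)"
      unfolding gaussian_span_def by auto
    show "L \<in> borel_measurable M"
      unfolding J(3) using J(2) assms(2)
      by (intro borel_measurable_sum borel_measurable_times) (auto simp: centered_gaussian_process_def)
    show "\<exists>\<sigma>\<ge>0. distr M borel L = centered_normal \<sigma>"
      using J assms(2) unfolding centered_gaussian_process_def by auto
    fix L' and a b :: real assume "L' \<in> gaussian_span T B"
    then obtain J' c' where J': "finite J'" "J' \<subseteq> T" "L' = (\<lambda>\<omega>. \<Sum>t\<in>J'. c' t * B t \<omega>)"
      unfolding gaussian_span_def by auto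
    have ext: "(\<Sum>t\<in>K. d t * B t \<omega>) = (\<Sum>t\<in>J \<union> J'. (if t \<in> K then d t else 0) * B t \<omega>)" if "K \<subseteq> J \<union> J'" for K d \<omega>
    proof -
      have "(\<Sum>t\<in>J \<union> J'. (if t \<in> K then d t else 0) * B t \<omega>) = (\<Sum>t\<in>K. (if t \<in> K then d t else 0) * B t \<omega>)"
        using that J(1) J'(1) by (intro sum.mono_neutral_right) auto
      then show ?thesis by simp
    qed
    have "(\<lambda>\<omega>. a * L \<omega> + b * L' \<omega>) = (\<lambda>\<omega>. \<Sum>t\<in>J \<union> J'. (a * (if t \<in> J then c t else 0) + b * (if t \<in> J' then c' t else 0)) * B t \<omega>)"
      unfolding J(3) J'(3) ext[of J c, OF Un_upper1] ext[of J' c', OF Un_upper2]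
      by (simp add: distrib_right sum.distrib sum_distrib_left mult.assoc)
    then show "(\<lambda>\<omega>. a * L \<omega> + b * L' \<omega>) \<in> gaussian_span T B"
      unfolding gaussian_span_def using J J' by (intro CollectI exI[of _ "J \<union> J'"]) auto
  next
    show "(\<lambda>_. 0) \<in> gaussian_span T B" unfolding gaussian_span_def by (intro CollectI exI[of _ "{}"]) auto
  qed
qed

lemma process_in_gaussian_span: "t \<in> T \<Longrightarrow> B t \<in> gaussian_span T B"
  unfolding gaussian_span_def by (intro CollectI exI[of _ "{t}"] exI[of _ "\<lambda>_. 1"]) auto

section \<open>Covariances of filtered increments\<close>

text \<open>The covariance at lag \<open>h\<close> of the increments filtered by \<open>a\<close>
  and \<open>b\<close> for unit mesh. Of the covariance of the process only the part in |t - s| is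
  left, because each filter annihilates functions of the other time alone.\<close>

definition filter_cov :: "real \<Rightarrow> real list \<Rightarrow> real list \<Rightarrow> int \<Rightarrow> real" where
  "filter_cov H a b h = - (\<Sum>i<length a. \<Sum>k<length b. a ! i * b ! k * \<bar>of_int h + real i - real k\<bar> powr (2 * H)) / 2"

lemma filter_cov_minus: "filter_cov H a b (- h) = filter_cov H b a h"
proof -
  have "filter_cov H a b (- h) = - (\<Sum>k<length b. \<Sum>i<length a. a ! i * b ! k * \<bar>of_int (- h) + real i - real k\<bar> powr (2 * H)) / 2"
    unfolding filter_cov_def by (subst sum.swap) (rule refl)
  also have "\<dots> = filter_cov H b a h"
    unfolding filter_cov_def
  proof (intro arg_cong2[where f="(/)"] arg_cong[where f=uminus] refl sum.cong)
    fix k i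
    have "\<bar>of_int (- h) + real i - real k\<bar> = \<bar>of_int h + real k - real i\<bar>" by simp
    then show "a ! i * b ! k * \<bar>of_int (- h) + real i - real k\<bar> powr (2 * H) = b ! k * a ! i * \<bar>of_int h + real k - real i\<bar> powr (2 * H)"
      by (simp only: mult.commute[of "a ! i"])
  qed
  finally show ?thesis .
qed

text \<open>The binomial theorem splits the sum into products of a moment of \<open>a\<close> of
  order \<open>t\<close> and one of \<open>b\<close> of order \<open>l - t\<close>; as these orders
  add up to less than \<open>2 * m\<close>, one of them is below \<open>m\<close>. The factor
  \<open>s\<close> accommodates the sign of the lag.\<close>

lemma product_moments_vanish:
  assumes a: "\<And>k. k < m \<Longrightarrow> filter_moment a k = 0" and b: "\<And>k. k < m \<Longrightarrow> filter_moment b k = 0"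
    and l: "l < 2 * m"
  shows "(\<Sum>i<length a. \<Sum>k<length b. a ! i * b ! k * (s * (real i - real k)) ^ l) = 0"
proof -
  have e: "(real i - real k) ^ l = (\<Sum>t\<le>l. real (l choose t) * real i ^ t * (- real k) ^ (l - t))" for i k
    using binomial_ring[of "real i" "- real k" l] by simp
  have "(\<Sum>i<length a. \<Sum>k<length b. a ! i * b ! k * (s * (real i - real k)) ^ l)
      = s ^ l * (\<Sum>i<length a. \<Sum>k<length b. \<Sum>t\<le>l. real (l choose t) * (-1) ^ (l - t) * ((a ! i * real i ^ t) * (b ! k * real k ^ (l - t))))"
    unfolding power_mult_distrib e sum_distrib_left
    by (intro sum.cong refl) (simp add: power_minus[of "real _"])
  also have "(\<Sum>i<length a. \<Sum>k<length b. \<Sum>t\<le>l. real (l choose t) * (-1) ^ (l - t) * ((a ! i * real i ^ t) * (b ! k * real k ^ (l - t))))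
      = (\<Sum>t\<le>l. \<Sum>i<length a. \<Sum>k<length b. real (l choose t) * (-1) ^ (l - t) * ((a ! i * real i ^ t) * (b ! k * real k ^ (l - t))))"
  proof -
    have "(\<Sum>i<length a. \<Sum>k<length b. \<Sum>t\<le>l. h i k t) = (\<Sum>t\<le>l. \<Sum>i<length a. \<Sum>k<length b. h i k t)" for h :: "nat \<Rightarrow> nat \<Rightarrow> nat \<Rightarrow> real"
    proof -
      have "(\<Sum>i<length a. \<Sum>k<length b. \<Sum>t\<le>l. h i k t) = (\<Sum>i<length a. \<Sum>t\<le>l. \<Sum>k<length b. h i k t)"
        by (intro sum.cong refl sum.swap)
      also have "\<dots> = (\<Sum>t\<le>l. \<Sum>i<length a. \<Sum>k<length b. h i k t)" by (rule sum.swap)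
      finally show ?thesis .
    qed
    then show ?thesis .
  qed
  also have "\<dots> = (\<Sum>t\<le>l. real (l choose t) * (-1) ^ (l - t) * (filter_moment a t * filter_moment b (l - t)))"
    unfolding filter_moment_def sum_product by (simp only: sum_distrib_left)
  also have "\<dots> = 0"
  proof (rule sum.neutral, rule ballI)
    fix t assume "t \<in> {..l}"
    then have "t < m \<or> l - t < m" using l by auto
    then show "real (l choose t) * (-1) ^ (l - t) * (filter_moment a t * filter_moment b (l - t)) = 0"
      using a b by auto
  qed
  finally show ?thesis by simp
qed

text \<open>The coefficients are generalised binomial coefficients. The remainder is uniform because
  the intermediate point stays above x/2 and the exponent q - N is not positive, so the power at
  that point is at most its value at x/2.\<close>

lemma powr_taylor:
  fixes q :: real and N :: nat
  assumes "0 < N" "q \<le> real N"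
  obtains D C where "0 \<le> C"
    "\<And>x d. 0 < x \<Longrightarrow> \<bar>d\<bar> \<le> x / 2 \<Longrightarrow>
      \<bar>(x + d) powr q - (\<Sum>k<N. D k * x powr (q - real k) * d ^ k)\<bar> \<le> C * x powr (q - real N) * \<bar>d\<bar> ^ N"
proof
  define F where "F k = (\<Prod>i<k. q - real i)" for k
  define C where "C = \<bar>F N\<bar> / fact N * 2 powr (real N - q)"
  show "0 \<le> C" by (simp add: C_def)
  fix x d :: real assume x: "0 < x" and d: "\<bar>d\<bar> \<le> x / 2"
  define D where "D k = F k / fact k" for k
  define diff where "diff k t = F k * t powr (q - real k)" for k and t :: real
  show "\<bar>(x + d) powr q - (\<Sum>k<N. F k / fact k * x powr (q - real k) * d ^ k)\<bar> \<le> C * x powr (q - real N) * \<bar>d\<bar> ^ N"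
  proof (cases "d = 0")
    case True
    have "(\<Sum>k<N. F k / fact k * x powr (q - real k) * d ^ k) = (\<Sum>k\<in>{0}. F k / fact k * x powr (q - real k) * d ^ k)"
      using True assms(1) by (intro sum.mono_neutral_right) auto
    then show ?thesis using True \<open>0 \<le> C\<close> by (simp add: F_def)
  next
    case False
    have "\<exists>t. (if x + d < x then x + d < t \<and> t < x else x < t \<and> t < x + d) \<and>
        diff 0 (x + d) = (\<Sum>m<N. diff m x / fact m * (x + d - x) ^ m) + diff N t / fact N * (x + d - x) ^ N"
    proof (rule Taylor[where a="x/2" and b="3*x/2"])
      show "\<forall>m t. m < N \<and> x / 2 \<le> t \<and> t \<le> 3 * x / 2 \<longrightarrow> DERIV (diff m) t :> diff (Suc m) t"
      proof (intro allI impI)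
        fix m t assume "m < N \<and> x / 2 \<le> t \<and> t \<le> 3 * x / 2"
        then have t: "0 < t" using x by auto
        have "DERIV (\<lambda>t. F m * t powr (q - real m)) t :> F m * ((q - real m) * t powr (q - real m - 1))"
          using t by (auto intro!: derivative_eq_intros)
        then show "DERIV (diff m) t :> diff (Suc m) t"
          by (simp add: diff_def[abs_def] F_def mult.assoc algebra_simps)
      qed
    qed (use assms x d False in auto)
    then obtain t where t: "if x + d < x then x + d < t \<and> t < x else x < t \<and> t < x + d"
      and eq: "diff 0 (x + d) = (\<Sum>m<N. diff m x / fact m * d ^ m) + diff N t / fact N * d ^ N" by auto
    have t2: "x / 2 \<le> t" using t d x by (auto split: if_splits)
    have "(x + d) powr q - (\<Sum>k<N. F k / fact k * x powr (q - real k) * d ^ k) = diff N t / fact N * d ^ N"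
      using eq by (simp add: diff_def F_def)
    also have "\<bar>\<dots>\<bar> = \<bar>F N\<bar> / fact N * t powr (q - real N) * \<bar>d\<bar> ^ N"
      by (simp add: diff_def abs_mult power_abs)
    also have "\<dots> \<le> \<bar>F N\<bar> / fact N * (2 powr (real N - q) * x powr (q - real N)) * \<bar>d\<bar> ^ N"
    proof (intro mult_right_mono mult_left_mono)
      have "t powr (q - real N) \<le> (x / 2) powr (q - real N)" using t2 x assms(2) by (intro powr_mono2') auto
      also have "\<dots> = 2 powr (real N - q) * x powr (q - real N)"
      proof -
        have "(2::real) powr (real N - q) = 1 / 2 powr (q - real N)" by (metis minus_diff_eq powr_minus_divide)
        then show ?thesis using x by (simp add: powr_divide)
      qed
      finally show "t powr (q - real N) \<le> 2 powr (real N - q) * x powr (q - real N)" .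
    qed auto
    finally show ?thesis by (simp add: C_def mult.assoc)
  qed
qed

lemma double_sum_abs_le:
  fixes c X :: "nat \<Rightarrow> nat \<Rightarrow> real"
  assumes "\<And>i k. i < m \<Longrightarrow> k < n \<Longrightarrow> \<bar>X i k\<bar> \<le> K"
  shows "\<bar>\<Sum>i<m. \<Sum>k<n. c i k * X i k\<bar> \<le> (\<Sum>i<m. \<Sum>k<n. \<bar>c i k\<bar>) * K"
proof -
  have "\<bar>\<Sum>i<m. \<Sum>k<n. c i k * X i k\<bar> \<le> (\<Sum>i<m. \<bar>\<Sum>k<n. c i k * X i k\<bar>)" by (rule sum_abs)
  also have "\<dots> \<le> (\<Sum>i<m. \<Sum>k<n. \<bar>c i k * X i k\<bar>)" by (intro sum_mono sum_abs)
  also have "\<dots> \<le> (\<Sum>i<m. \<Sum>k<n. \<bar>c i k\<bar> * K)"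
    using assms by (intro sum_mono) (simp add: abs_mult mult_left_mono)
  finally show ?thesis by (simp add: sum_distrib_right)
qed

text \<open>The power function is expanded around the lag to order \<open>2 * m\<close>. All Taylor
  terms are annihilated by the vanishing moments of the two filters, which leaves the remainder of
  order |h|^(2 H - 2 m).\<close>

lemma filter_cov_decay:
  assumes H: "0 < H" "H < 1" and m: "1 \<le> m"
    and a: "\<And>k. k < m \<Longrightarrow> filter_moment a k = 0" and b: "\<And>k. k < m \<Longrightarrow> filter_moment b k = 0"
  shows "\<exists>C\<ge>0. \<forall>h. \<bar>filter_cov H a b h\<bar> \<le> C * (1 + \<bar>of_int h\<bar>) powr (2 * H - 2 * real m)"
proof -
  define N where "N = 2 * m"
  define q where "q = 2 * H"
  have N: "0 < N" "q \<le> real N" using m H by (auto simp: N_def q_def)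
  obtain D C where C: "0 \<le> C" and tay: "\<And>x d. 0 < x \<Longrightarrow> \<bar>d\<bar> \<le> x / 2 \<Longrightarrow>
      \<bar>(x + d) powr q - (\<Sum>k<N. D k * x powr (q - real k) * d ^ k)\<bar> \<le> C * x powr (q - real N) * \<bar>d\<bar> ^ N"
    by (rule powr_taylor[OF N], rule that)
  define L where "L = real (length a + length b) + 1"
  define S where "S = (\<Sum>i<length a. \<Sum>k<length b. \<bar>a ! i * b ! k\<bar>)"
  have S0: "0 \<le> S" by (auto simp: S_def intro!: sum_nonneg)
  have L1: "1 \<le> L" by (simp add: L_def)
  have ik: "\<bar>real i - real k\<bar> \<le> L" if "i < length a" "k < length b" for i k using that by (simp add: L_def)
  define C1 where "C1 = S * (C * L ^ N) * 2 powr (real N - q)"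
  define C2 where "C2 = S * (3 * L) powr q * (1 + 2 * L) powr (real N - q)"
  have far: "\<bar>filter_cov H a b h\<bar> \<le> C1 * (1 + \<bar>of_int h\<bar>) powr (q - real N)" if h: "2 * L \<le> \<bar>of_int h\<bar>" for h
  proof -
    define x where "x = \<bar>real_of_int h\<bar>"
    \<comment> \<open>The sign makes |h + i - k| equal to x + s (i - k) for both signs of
      \<open>h\<close>, once |h| exceeds all differences i - k.\<close>
    define s where "s = sgn (real_of_int h)"
    have x: "2 * L \<le> x" "0 < x" "1 \<le> x" using h L1 by (auto simp: x_def)
    have s1: "\<bar>s\<bar> = 1" using x by (simp add: s_def x_def)
    define R where "R i k = (x + s * (real i - real k)) powr q - (\<Sum>l<N. D l * x powr (q - real l) * (s * (real i - real k)) ^ l)" for i k :: nat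
    have R: "\<bar>R i k\<bar> \<le> C * x powr (q - real N) * L ^ N" if "i < length a" "k < length b" for i k
    proof -
      have d: "\<bar>s * (real i - real k)\<bar> \<le> L" using ik[OF that] s1 by (simp add: abs_mult)
      have "\<bar>R i k\<bar> \<le> C * x powr (q - real N) * \<bar>s * (real i - real k)\<bar> ^ N"
        unfolding R_def using d x by (intro tay) auto
      also have "\<dots> \<le> C * x powr (q - real N) * L ^ N" using d C by (intro mult_left_mono power_mono) auto
      finally show ?thesis .
    qed
    have pw: "\<bar>of_int h + real i - real k\<bar> powr q = R i k + (\<Sum>l<N. D l * x powr (q - real l) * (s * (real i - real k)) ^ l)"
      if "i < length a" "k < length b" for i k
    proof -
      have "\<bar>of_int h + real i - real k\<bar> = x + s * (real i - real k)"
        using ik[OF that] x unfolding x_def s_def by (auto simp: sgn_if abs_if split: if_splits)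
      then show ?thesis by (simp add: R_def)
    qed
    have "(\<Sum>i<length a. \<Sum>k<length b. a ! i * b ! k * \<bar>of_int h + real i - real k\<bar> powr q)
        = (\<Sum>i<length a. \<Sum>k<length b. a ! i * b ! k * R i k)
          + (\<Sum>i<length a. \<Sum>k<length b. a ! i * b ! k * (\<Sum>l<N. D l * x powr (q - real l) * (s * (real i - real k)) ^ l))"
      by (simp add: pw distrib_left sum.distrib)
    also have "(\<Sum>i<length a. \<Sum>k<length b. a ! i * b ! k * (\<Sum>l<N. D l * x powr (q - real l) * (s * (real i - real k)) ^ l))
        = (\<Sum>i<length a. \<Sum>l<N. \<Sum>k<length b. D l * x powr (q - real l) * (a ! i * b ! k * (s * (real i - real k)) ^ l))"
      unfolding sum_distrib_left by (rule sum.cong[OF refl], subst sum.swap) (simp add: mult_ac)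
    also have "\<dots> = (\<Sum>l<N. D l * x powr (q - real l) * (\<Sum>i<length a. \<Sum>k<length b. a ! i * b ! k * (s * (real i - real k)) ^ l))"
      by (subst sum.swap) (simp add: sum_distrib_left)
    also have "\<dots> = 0"
      by (intro sum.neutral ballI) (use product_moments_vanish[OF a b] in \<open>simp add: N_def\<close>)
    finally have "filter_cov H a b h = - (\<Sum>i<length a. \<Sum>k<length b. a ! i * b ! k * R i k) / 2"
      unfolding filter_cov_def q_def by simp
    then have "\<bar>filter_cov H a b h\<bar> \<le> \<bar>\<Sum>i<length a. \<Sum>k<length b. a ! i * b ! k * R i k\<bar>" by simp
    also have "\<dots> \<le> S * (C * x powr (q - real N) * L ^ N)"
      unfolding S_def by (rule double_sum_abs_le[OF R])
    also have "\<dots> = S * (C * L ^ N) * x powr (q - real N)" by (simp only: mult_ac)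
    also have "\<dots> \<le> S * (C * L ^ N) * (2 powr (real N - q) * (1 + x) powr (q - real N))"
    proof (intro mult_left_mono)
      have "x powr (q - real N) \<le> ((1 + x) / 2) powr (q - real N)" using x N by (intro powr_mono2') auto
      also have "\<dots> = 2 powr (real N - q) * (1 + x) powr (q - real N)"
      proof -
        have "(2::real) powr (real N - q) = 1 / 2 powr (q - real N)" by (metis minus_diff_eq powr_minus_divide)
        then show ?thesis using x by (simp add: powr_divide)
      qed
      finally show "x powr (q - real N) \<le> 2 powr (real N - q) * (1 + x) powr (q - real N)" .
    qed (use S0 C L1 in auto)
    finally show ?thesis by (simp add: C1_def x_def mult.assoc)
  qed
  \<comment> \<open>Only finitely many lags remain; a trivial bound suffices, and the factor (1 + 2
    L)^(N - q) in \<open>C2\<close> compensates the decaying weight on this range.\<close>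
  have near: "\<bar>filter_cov H a b h\<bar> \<le> C2 * (1 + \<bar>of_int h\<bar>) powr (q - real N)" if h: "\<bar>of_int h\<bar> < 2 * L" for h
  proof -
    have "\<bar>filter_cov H a b h\<bar> \<le> \<bar>\<Sum>i<length a. \<Sum>k<length b. a ! i * b ! k * \<bar>of_int h + real i - real k\<bar> powr q\<bar>"
      unfolding filter_cov_def q_def by simp
    also have "\<dots> \<le> S * (3 * L) powr q"
      unfolding S_def
    proof (rule double_sum_abs_le)
      fix i k assume "i < length a" "k < length b"
      then have "\<bar>of_int h + real i - real k\<bar> \<le> 3 * L" using ik[of i k] h by auto
      then have "\<bar>of_int h + real i - real k\<bar> powr q \<le> (3 * L) powr q" using H by (intro powr_mono2) (auto simp: q_def)
      then show "\<bar>\<bar>of_int h + real i - real k\<bar> powr q\<bar> \<le> (3 * L) powr q" by simp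
    qed
    also have "\<dots> = S * (3 * L) powr q * 1" by simp
    also have "\<dots> \<le> S * (3 * L) powr q * ((1 + 2 * L) powr (real N - q) * (1 + \<bar>of_int h\<bar>) powr (q - real N))"
    proof (intro mult_left_mono)
      have "(1 + 2 * L) powr (q - real N) \<le> (1 + \<bar>of_int h\<bar>) powr (q - real N)" using h N by (intro powr_mono2') auto
      then have "(1 + 2 * L) powr (real N - q) * (1 + 2 * L) powr (q - real N) \<le> (1 + 2 * L) powr (real N - q) * (1 + \<bar>of_int h\<bar>) powr (q - real N)"
        by (intro mult_left_mono) auto
      moreover have "(1 + 2 * L) powr (real N - q) * (1 + 2 * L) powr (q - real N) = 1"
        using L1 by (simp add: powr_add[symmetric])
      ultimately show "1 \<le> (1 + 2 * L) powr (real N - q) * (1 + \<bar>of_int h\<bar>) powr (q - real N)" by simp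
    qed (use S0 in auto)
    finally show ?thesis by (simp add: C2_def mult.assoc)
  qed
  have C12: "0 \<le> C1" "0 \<le> C2" using S0 C L1 by (auto simp: C1_def C2_def)
  show ?thesis
  proof (intro exI[of _ "C1 + C2"] conjI allI)
    show "0 \<le> C1 + C2" using C12 by simp
    fix h
    have p: "0 \<le> (1 + \<bar>real_of_int h\<bar>) powr (q - real N)" by simp
    have "\<bar>filter_cov H a b h\<bar> \<le> (C1 + C2) * (1 + \<bar>of_int h\<bar>) powr (q - real N)"
      using far[of h] near[of h] mult_nonneg_nonneg[OF C12(1) p] mult_nonneg_nonneg[OF C12(2) p]
      by (cases "2 * L \<le> \<bar>of_int h\<bar>") (auto simp: distrib_right)
    then show "\<bar>filter_cov H a b h\<bar> \<le> (C1 + C2) * (1 + \<bar>of_int h\<bar>) powr (2 * H - 2 * real m)"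
      by (simp add: q_def N_def)
  qed
qed

text \<open>Comparison with an integral, written as a telescoping sum: by the mean value theorem
  each summand is below a difference of the antiderivative.\<close>

lemma sum_powr_le:
  assumes "0 < \<beta>" "\<beta> < 1"
  shows "(\<Sum>h<n. (1 + real h) powr (- \<beta>)) \<le> real n powr (1 - \<beta>) / (1 - \<beta>)"
proof (induction n)
  case 0 then show ?case by simp
next
  case (Suc n)
  have "(1 - \<beta>) * (1 + real n) powr (- \<beta>) \<le> real (Suc n) powr (1 - \<beta>) - real n powr (1 - \<beta>)"
  proof (cases "n = 0")
    case True then show ?thesis using assms by simp
  next
    case False
    have "\<exists>z. real n < z \<and> z < real n + 1 \<and> (real n + 1) powr (1 - \<beta>) - real n powr (1 - \<beta>) = (real n + 1 - real n) * ((1 - \<beta>) * z powr (1 - \<beta> - 1))"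
      using False by (intro MVT2) (auto intro!: derivative_eq_intros)
    then obtain z where z: "real n < z" "z < real n + 1" "(real n + 1) powr (1 - \<beta>) - real n powr (1 - \<beta>) = (1 - \<beta>) * z powr (- \<beta>)"
      by auto
    have "(1 + real n) powr (- \<beta>) \<le> z powr (- \<beta>)" using z False assms by (intro powr_mono2') auto
    then show ?thesis using z(3) assms by (simp add: add.commute mult_left_mono)
  qed
  then have "(1 + real n) powr (- \<beta>) \<le> (real (Suc n) powr (1 - \<beta>) - real n powr (1 - \<beta>)) / (1 - \<beta>)"
    using assms by (simp add: field_simps)
  then show ?case using Suc.IH by (simp add: diff_divide_distrib)
qed

lemma sum_powr_bounded:
  assumes "1 < \<gamma>"
  shows "\<exists>S\<ge>0. \<forall>n. (\<Sum>h<n. (1 + real h) powr (- \<gamma>)) \<le> S"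
proof -
  have "summable (\<lambda>h. real (Suc h) powr (- \<gamma>))"
    using assms by (subst summable_Suc_iff) (simp add: summable_real_powr_iff)
  then have s: "summable (\<lambda>h. (1 + real h) powr (- \<gamma>))" by (simp add: add.commute)
  have "(\<Sum>h<n. (1 + real h) powr (- \<gamma>)) \<le> (\<Sum>h. (1 + real h) powr (- \<gamma>))" for n
    by (rule sum_le_suminf[OF s]) auto
  moreover have "0 \<le> (\<Sum>h. (1 + real h) powr (- \<gamma>))" by (rule suminf_nonneg[OF s]) simp
  ultimately show ?thesis by blast
qed

text \<open>Seen from \<open>j\<close>, every absolute lag occurs at most once to the left and once
  to the right.\<close>

lemma sum_lag_le:
  fixes \<phi> :: "nat \<Rightarrow> real"
  assumes \<phi>: "\<And>h. 0 \<le> \<phi> h" and j: "j \<in> {1..N}"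
  shows "(\<Sum>l\<in>{1..N}. \<phi> (nat \<bar>int j - int l\<bar>)) \<le> 2 * (\<Sum>h<N. \<phi> h)"
proof -
  have "{1..N} = {1..j} \<union> {j+1..N}" "{1..j} \<inter> {j+1..N} = {}" using j by auto
  then have "(\<Sum>l\<in>{1..N}. \<phi> (nat \<bar>int j - int l\<bar>)) = (\<Sum>l\<in>{1..j}. \<phi> (nat \<bar>int j - int l\<bar>)) + (\<Sum>l\<in>{j+1..N}. \<phi> (nat \<bar>int j - int l\<bar>))"
    by (metis finite_atLeastAtMost sum.union_disjoint)
  also have "(\<Sum>l\<in>{1..j}. \<phi> (nat \<bar>int j - int l\<bar>)) = sum \<phi> ((\<lambda>l. nat \<bar>int j - int l\<bar>) ` {1..j})"
    by (subst sum.reindex) (auto simp: inj_on_def)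
  also have "\<dots> \<le> (\<Sum>h<N. \<phi> h)" using j \<phi> by (intro sum_mono2) auto
  also have "(\<Sum>l\<in>{j+1..N}. \<phi> (nat \<bar>int j - int l\<bar>)) = sum \<phi> ((\<lambda>l. nat \<bar>int j - int l\<bar>) ` {j+1..N})"
    by (subst sum.reindex) (auto simp: inj_on_def)
  also have "\<dots> \<le> (\<Sum>h<N. \<phi> h)" using j \<phi> by (intro sum_mono2) auto
  finally show ?thesis by simp
qed

section \<open>Asymptotic normality of quadratic variations\<close>

lemma Cesaro_mean:
  fixes x :: "nat \<Rightarrow> real"
  assumes "x \<longlonglongrightarrow> L"
  shows "(\<lambda>n. (\<Sum>k<n. x k) / real n) \<longlonglongrightarrow> L"
proof -
  have main: "(\<lambda>n. (\<Sum>k<n. \<bar>x k - L\<bar>) / real n) \<longlonglongrightarrow> 0"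
  proof (rule tendstoI)
    fix e :: real assume e: "0 < e"
    then have "0 < e / 2" by simp
    from tendstoD[OF assms this] obtain K where K: "\<And>k. K \<le> k \<Longrightarrow> \<bar>x k - L\<bar> < e / 2"
      unfolding eventually_sequentially dist_real_def by auto
    define A where "A = (\<Sum>k<K. \<bar>x k - L\<bar>)"
    have "(\<lambda>n. A / real n) \<longlonglongrightarrow> 0" by (rule lim_const_over_n)
    then have "\<forall>\<^sub>F n in sequentially. A / real n < e / 2" using e by (intro order_tendstoD) auto
    with eventually_gt_at_top[of K] show "\<forall>\<^sub>F n in sequentially. dist ((\<Sum>k<n. \<bar>x k - L\<bar>) / real n) 0 < e"
    proof eventually_elim
      case (elim n)
      have "{..<n} = {..<K} \<union> {K..<n}" "{..<K} \<inter> {K..<n} = {}" using elim by auto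
      then have "(\<Sum>k<n. \<bar>x k - L\<bar>) = A + (\<Sum>k\<in>{K..<n}. \<bar>x k - L\<bar>)"
        unfolding A_def by (metis finite_atLeastLessThan finite_lessThan sum.union_disjoint)
      also have "\<dots> \<le> A + (\<Sum>k\<in>{K..<n}. e / 2)" using K by (intro add_left_mono sum_mono) (auto intro: less_imp_le)
      also have "\<dots> \<le> A + real n * (e / 2)" using e by (auto intro!: mult_right_mono)
      finally have "(\<Sum>k<n. \<bar>x k - L\<bar>) / real n \<le> A / real n + e / 2" using elim by (simp add: field_simps)
      moreover have "0 \<le> (\<Sum>k<n. \<bar>x k - L\<bar>) / real n" by (simp add: sum_nonneg)
      moreover have "A / real n < e / 2" using elim by simp
      ultimately have "(\<Sum>k<n. \<bar>x k - L\<bar>) / real n < e" by linarith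
      then show ?case by (simp add: dist_real_def sum_nonneg)
    qed
  qed
  have "(\<lambda>n. (\<Sum>k<n. x k) / real n - L) \<longlonglongrightarrow> 0"
  proof (rule Lim_null_comparison[OF _ main])
    show "\<forall>\<^sub>F n in sequentially. norm ((\<Sum>k<n. x k) / real n - L) \<le> (\<Sum>k<n. \<bar>x k - L\<bar>) / real n"
      using eventually_gt_at_top[of 0]
    proof eventually_elim
      case (elim n)
      have "(\<Sum>k<n. x k) / real n - L = (\<Sum>k<n. x k - L) / real n" using elim by (simp add: sum_subtractf field_simps)
      then show ?case by (simp add: divide_right_mono sum_abs)
    qed
  qed
  then show ?thesis by (simp add: LIM_zero_iff)
qed

text \<open>Enlarging the square by one row and column adds a partial sum of the lag series, so the
  normalised double sum is a Cesaro mean of convergent partial sums. The shift by \<open>p\<close>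
  does not change the limit.\<close>

lemma double_lag_sum_limit:
  fixes R :: "int \<Rightarrow> real"
  assumes even: "\<And>h. R (- h) = R h" and s: "summable (\<lambda>h. R (int h))"
  shows "(\<lambda>n. (\<Sum>j\<in>{1..n-p}. \<Sum>l\<in>{1..n-p}. R (int j - int l)) / real n) \<longlonglongrightarrow> R 0 + 2 * (\<Sum>h. R (int (Suc h)))"
proof -
  define T where "T N = (\<Sum>j\<in>{1..N}. \<Sum>l\<in>{1..N}. R (int j - int l))" for N
  define x where "x N = R 0 + 2 * (\<Sum>h<N. R (int (Suc h)))" for N
  \<comment> \<open>The new row and the new column contain the lags 1 to N with opposite signs and
    have equal sums because \<open>R\<close> is even.\<close>
  have step: "T (Suc N) = T N + x N" for N
  proof -
    have "(\<Sum>j\<in>{1..N}. R (int j - int (Suc N))) = (\<Sum>h<N. R (int (Suc h)))"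
    proof (rule sum.reindex_bij_witness[where i="\<lambda>h. N - h" and j="\<lambda>j. N - j"])
      fix j assume j: "j \<in> {1..N}"
      have "R (int (Suc (N - j))) = R (- (int j - int (Suc N)))" using j by (intro arg_cong[where f=R]) auto
      then show "R (int (Suc (N - j))) = R (int j - int (Suc N))" by (simp only: even)
    qed auto
    moreover have "(\<Sum>l\<in>{1..N}. R (int (Suc N) - int l)) = (\<Sum>h<N. R (int (Suc h)))"
      by (rule sum.reindex_bij_witness[where i="\<lambda>h. N - h" and j="\<lambda>j. N - j"]) (auto intro!: arg_cong[where f=R])
    ultimately show ?thesis by (simp add: T_def x_def sum.distrib del: of_nat_Suc)
  qed
  have "T N = (\<Sum>k<N. x k)" for N
    by (induction N) (auto simp: step, simp add: T_def)
  moreover have "x \<longlonglongrightarrow> R 0 + 2 * (\<Sum>h. R (int (Suc h)))"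
    unfolding x_def[abs_def] using s[THEN summable_ignore_initial_segment, of 1]
    by (intro tendsto_intros summable_LIMSEQ) simp
  ultimately have "(\<lambda>N. T N / real N) \<longlonglongrightarrow> R 0 + 2 * (\<Sum>h. R (int (Suc h)))" using Cesaro_mean by simp
  then have "(\<lambda>n. T (n - p) / real (n - p)) \<longlonglongrightarrow> R 0 + 2 * (\<Sum>h. R (int (Suc h)))"
    by (rule filterlim_compose) (rule filterlim_minus_const_nat_at_top)
  moreover have "(\<lambda>n. real (n - p) / real n) \<longlonglongrightarrow> 1"
  proof -
    have "(\<lambda>n. 1 - real p / real n) \<longlonglongrightarrow> 1 - 0" by (intro tendsto_intros lim_const_over_n)
    moreover have "\<forall>\<^sub>F n in sequentially. 1 - real p / real n = real (n - p) / real n"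
      using eventually_gt_at_top[of p] by eventually_elim (simp add: field_simps of_nat_diff)
    ultimately show ?thesis by (simp add: tendsto_cong)
  qed
  ultimately have "(\<lambda>n. T (n - p) / real (n - p) * (real (n - p) / real n)) \<longlonglongrightarrow> (R 0 + 2 * (\<Sum>h. R (int (Suc h)))) * 1"
    by (intro tendsto_mult)
  then have lim: "(\<lambda>n. T (n - p) / real (n - p) * (real (n - p) / real n)) \<longlonglongrightarrow> R 0 + 2 * (\<Sum>h. R (int (Suc h)))"
    by (simp only: mult_1_right)
  have "\<forall>\<^sub>F n in sequentially. T (n - p) / real (n - p) * (real (n - p) / real n) = T (n - p) / real n"
    using eventually_gt_at_top[of p] by eventually_elim simp
  with lim have "(\<lambda>n. T (n - p) / real n) \<longlonglongrightarrow> R 0 + 2 * (\<Sum>h. R (int (Suc h)))"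
    by (rule Lim_transform_eventually)
  then show ?thesis unfolding T_def .
qed

text \<open>The quadratic form estimate is applied to the pairs (i, j) with weights
  \<open>c i / sqrt n\<close>. Row sums of squared covariances stay bounded since 2 \<beta> > 1,
  absolute row sums are of order n^(1 - \<beta>), and the variance of \<open>W\<close> becomes of
  order n^(1 - 2 \<beta>). The limit variance may be 0, so no lower bound on variances is
  required.\<close>

lemma (in gaussian_space) quadratic_variation_clt:
  fixes Y :: "nat \<Rightarrow> nat \<Rightarrow> nat \<Rightarrow> 'a \<Rightarrow> real" and r :: "nat \<Rightarrow> nat \<Rightarrow> int \<Rightarrow> real" and c :: "nat \<Rightarrow> real"
  assumes \<beta>: "1/2 < \<beta>" "\<beta> < 1"
    and Y: "\<And>n i j. 0 < n \<Longrightarrow> i < m \<Longrightarrow> j \<in> {1..n-p} \<Longrightarrow> Y n i j \<in> G"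
    and cov: "\<And>n i j k l. 0 < n \<Longrightarrow> i < m \<Longrightarrow> j \<in> {1..n-p} \<Longrightarrow> k < m \<Longrightarrow> l \<in> {1..n-p} \<Longrightarrow>
      (\<integral>\<omega>. Y n i j \<omega> * Y n k l \<omega> \<partial>M) = r i k (int j - int l)"
    and C: "0 \<le> C" "\<And>i k h. i < m \<Longrightarrow> k < m \<Longrightarrow> \<bar>r i k h\<bar> \<le> C * (1 + \<bar>of_int h\<bar>) powr (- \<beta>)"
    and sym: "\<And>i k h. i < m \<Longrightarrow> k < m \<Longrightarrow> r i k (- h) = r k i h"
  defines "V \<equiv> \<lambda>n \<omega>. (\<Sum>i<m. c i * (\<Sum>j\<in>{1..n-p}. (Y n i j \<omega>)\<^sup>2 - r i i 0)) / sqrt (real n)"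
  shows "\<exists>\<Lambda>\<ge>0. \<forall>t. (\<lambda>n. \<integral>\<omega>. iexp (t * V n \<omega>) \<partial>M) \<longlonglongrightarrow> exp (- of_real (\<Lambda> * t\<^sup>2 / 2))"
    "OP M V" "0 < n \<Longrightarrow> V n \<in> borel_measurable M"
proof -
  \<comment> \<open>Twice \<open>R (j - l)\<close> is the covariance between the weighted sums of
    squares at positions \<open>j\<close> and \<open>l\<close>.\<close>
  define R where "R h = (\<Sum>i<m. \<Sum>k<m. c i * c k * (r i k h)\<^sup>2)" for h
  define s where "s n = 2 * ((\<Sum>j\<in>{1..n-p}. \<Sum>l\<in>{1..n-p}. R (int j - int l)) / real n)" for n
  define \<Lambda> where "\<Lambda> = 2 * (R 0 + 2 * (\<Sum>h. R (int (Suc h))))"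
  have pw2: "((1 + \<bar>x\<bar>) powr (- \<beta>))\<^sup>2 = (1 + \<bar>x\<bar>) powr (- (2 * \<beta>))" for x :: real
    by (simp add: power2_eq_square powr_add[symmetric])
  have r2: "(r i k h)\<^sup>2 \<le> C\<^sup>2 * (1 + \<bar>of_int h\<bar>) powr (- (2 * \<beta>))" if "i < m" "k < m" for i k h
  proof -
    have "(r i k h)\<^sup>2 = \<bar>r i k h\<bar>\<^sup>2" by simp
    also have "\<dots> \<le> (C * (1 + \<bar>of_int h\<bar>) powr (- \<beta>))\<^sup>2" by (rule power_mono[OF C(2)[OF that]]) simp
    also have "\<dots> = C\<^sup>2 * (1 + \<bar>of_int h\<bar>) powr (- (2 * \<beta>))" by (simp only: power_mult_distrib pw2)
    finally show ?thesis .
  qed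
  obtain S' where S': "0 \<le> S'" "\<And>n. (\<Sum>h<n. (1 + real h) powr (- (2 * \<beta>))) \<le> S'"
    using sum_powr_bounded[of "2 * \<beta>"] \<beta> by auto
  have Reven: "R (- h) = R h" for h
  proof -
    have "R (- h) = (\<Sum>i<m. \<Sum>k<m. c i * c k * (r k i h)\<^sup>2)"
      unfolding R_def by (intro sum.cong refl) (simp add: sym)
    also have "\<dots> = (\<Sum>k<m. \<Sum>i<m. c i * c k * (r k i h)\<^sup>2)" by (rule sum.swap)
    also have "\<dots> = R h" unfolding R_def by (intro sum.cong refl) simp
    finally show ?thesis .
  qed
  have Rsum: "summable (\<lambda>h. R (int h))"
  proof -
    have "summable (\<lambda>h. real (Suc h) powr (- (2 * \<beta>)))"
      using \<beta> by (subst summable_Suc_iff) (simp add: summable_real_powr_iff)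
    then have "summable (\<lambda>h. (C\<^sup>2 * (1 + \<bar>of_int (int h)\<bar>) powr (- (2 * \<beta>))))"
      by (intro summable_mult) (simp add: add.commute)
    then have "summable (\<lambda>h. (r i k (int h))\<^sup>2)" if "i < m" "k < m" for i k
      by (rule summable_comparison_test'[where N=0]) (use r2[OF that, of "int n" for n] in simp)
    then show ?thesis unfolding R_def by (intro summable_sum summable_mult) auto
  qed
  have slim: "s \<longlonglongrightarrow> \<Lambda>"
    unfolding s_def[abs_def] \<Lambda>_def by (intro tendsto_mult tendsto_const double_lag_sum_limit Reven Rsum)
  define K where "K = (\<Sum>i<m. \<bar>c i\<bar>)"
  have K: "\<bar>c i\<bar> \<le> K" if "i < m" for i unfolding K_def by (rule member_le_sum) (use that in auto)
  have K0: "0 \<le> K" by (auto simp: K_def intro: sum_nonneg)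
  define S where "S = real m * (C\<^sup>2 * (2 * S'))"
  define B where "B = real m * (C * (2 * (1 / (1 - \<beta>))))"
  have B0: "0 \<le> B" using C \<beta> by (simp add: B_def)
  have S0: "0 \<le> S" using S' by (simp add: S_def)
  \<comment> \<open>Collects the constants: (K / sqrt n)^4 from the weights, at most m n for the
    number of pairs, \<open>S\<close> and \<open>B * n powr (1 - \<beta>)\<close> for the two kinds
    of row sums.\<close>
  define A where "A = 2 * K ^ 4 * (real m * S * B\<^sup>2)"
  have A0: "0 \<le> A" using S0 by (simp add: A_def)
  have per_n: "V n \<in> borel_measurable M \<and> integrable M (\<lambda>\<omega>. (V n \<omega>)\<^sup>2) \<and> (\<integral>\<omega>. (V n \<omega>)\<^sup>2 \<partial>M) = s n \<and>
     (\<forall>t. norm ((\<integral>\<omega>. iexp (t * V n \<omega>) \<partial>M) - exp (- of_real (s n * t\<^sup>2 / 2))) \<le> 2 * t\<^sup>2 * sqrt (A * real n powr (1 - 2 * \<beta>)))"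
    if n: "0 < n" for n
  proof -
    define N where "N = n - p"
    interpret Q: gaussian_quadratic_form M G "{..<m} \<times> {1..N}" "\<lambda>(i, j). Y n i j" "\<lambda>(i, j). c i / sqrt (real n)"
      by unfold_locales (use Y[OF n] in \<open>auto simp: N_def\<close>)
    have qcov: "Q.cov (i, j) (k, l) = r i k (int j - int l)" if "i < m" "j \<in> {1..N}" "k < m" "l \<in> {1..N}" for i j k l
      unfolding Q.cov_def using cov[OF n] that by (simp add: N_def)
    have VQ: "Q.V = V n"
    proof
      fix \<omega>
      have "Q.V \<omega> = (\<Sum>i<m. \<Sum>j\<in>{1..N}. c i / sqrt (real n) * ((Y n i j \<omega>)\<^sup>2 - Q.cov (i, j) (i, j)))"
        unfolding Q.V_def sum.cartesian_product by (intro sum.cong refl) auto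
      also have "\<dots> = (\<Sum>i<m. \<Sum>j\<in>{1..N}. c i / sqrt (real n) * ((Y n i j \<omega>)\<^sup>2 - r i i 0))"
        by (intro sum.cong refl) (simp add: qcov)
      also have "\<dots> = V n \<omega>"
        unfolding V_def N_def sum_divide_distrib sum_distrib_left by (simp add: sum_divide_distrib)
      finally show "Q.V \<omega> = V n \<omega>" .
    qed
    have sQ: "Q.s2 = s n"
    proof -
      have "Q.s2 = 2 * (\<Sum>i<m. \<Sum>j\<in>{1..N}. \<Sum>k<m. \<Sum>l\<in>{1..N}. c i / sqrt (real n) * (c k / sqrt (real n)) * (Q.cov (i, j) (k, l))\<^sup>2)"
        unfolding Q.s2_def by (simp add: sum.cartesian_product' split_beta)
      also have "(\<Sum>i<m. \<Sum>j\<in>{1..N}. \<Sum>k<m. \<Sum>l\<in>{1..N}. c i / sqrt (real n) * (c k / sqrt (real n)) * (Q.cov (i, j) (k, l))\<^sup>2)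
          = (\<Sum>i<m. \<Sum>j\<in>{1..N}. \<Sum>k<m. \<Sum>l\<in>{1..N}. c i * c k * (r i k (int j - int l))\<^sup>2 / real n)"
        by (intro sum.cong refl) (use n in \<open>simp add: qcov\<close>)
      also have "\<dots> = (\<Sum>j\<in>{1..N}. \<Sum>i<m. \<Sum>l\<in>{1..N}. \<Sum>k<m. c i * c k * (r i k (int j - int l))\<^sup>2 / real n)"
        by (subst sum.swap) (intro sum.cong refl sum.swap)
      also have "\<dots> = (\<Sum>j\<in>{1..N}. \<Sum>l\<in>{1..N}. \<Sum>i<m. \<Sum>k<m. c i * c k * (r i k (int j - int l))\<^sup>2 / real n)"
        by (intro sum.cong refl sum.swap)
      also have "2 * \<dots> = s n" unfolding s_def R_def N_def by (simp only: sum_divide_distrib)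
      finally show ?thesis .
    qed
    have natabs: "\<bar>real_of_int (int j - int l)\<bar> = real (nat \<bar>int j - int l\<bar>)" for j l by simp
    have r2n: "(r i k (int j - int l))\<^sup>2 \<le> C\<^sup>2 * (1 + real (nat \<bar>int j - int l\<bar>)) powr (- (2 * \<beta>))" if "i < m" "k < m" for i k j l
      using r2[OF that, of "int j - int l"] by (simp only: natabs)
    have r1n: "\<bar>r i k (int j - int l)\<bar> \<le> C * (1 + real (nat \<bar>int j - int l\<bar>)) powr (- \<beta>)" if "i < m" "k < m" for i k j l
      using C(2)[OF that, of "int j - int l"] by (simp only: natabs)
    have row: "(\<Sum>b\<in>{..<m} \<times> {1..N}. g b) = (\<Sum>k<m. \<Sum>l\<in>{1..N}. g (k, l))" for g :: "nat \<times> nat \<Rightarrow> real"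
      by (simp add: sum.cartesian_product')
    have Wv: "(\<integral>\<omega>. (Q.W \<omega> - Q.s2 / 2)\<^sup>2 \<partial>M) \<le> 2 * (K / sqrt (real n)) ^ 4 * (real (card ({..<m} \<times> {1..N})) * S * (B * real n powr (1 - \<beta>))\<^sup>2)"
    proof (rule Q.W_variance_bound)
      fix a assume "a \<in> {..<m} \<times> {1..N}"
      then obtain i j where a: "a = (i, j)" "i < m" "j \<in> {1..N}" by auto
      show "\<bar>case a of (i, j) \<Rightarrow> c i / sqrt (real n)\<bar> \<le> K / sqrt (real n)"
        using K[OF a(2)] by (simp add: a(1) divide_right_mono)
      have "(\<Sum>b\<in>{..<m} \<times> {1..N}. (Q.cov a b)\<^sup>2) = (\<Sum>k<m. \<Sum>l\<in>{1..N}. (r i k (int j - int l))\<^sup>2)"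
        unfolding row a(1) using a by (intro sum.cong refl) (simp add: qcov)
      also have "\<dots> \<le> (\<Sum>k<m. \<Sum>l\<in>{1..N}. C\<^sup>2 * (1 + real (nat \<bar>int j - int l\<bar>)) powr (- (2 * \<beta>)))"
        by (intro sum_mono r2n[OF a(2)]) auto
      also have "\<dots> = real m * (C\<^sup>2 * (\<Sum>l\<in>{1..N}. (1 + real (nat \<bar>int j - int l\<bar>)) powr (- (2 * \<beta>))))"
        by (simp add: sum_distrib_left[symmetric])
      also have "\<dots> \<le> real m * (C\<^sup>2 * (2 * S'))"
        using sum_lag_le[of "\<lambda>h. (1 + real h) powr (- (2 * \<beta>))", OF _ a(3)] S'(2)[of N]
        by (intro mult_left_mono) auto
      finally show "(\<Sum>b\<in>{..<m} \<times> {1..N}. (Q.cov a b)\<^sup>2) \<le> S" unfolding S_def .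
      have "(\<Sum>b\<in>{..<m} \<times> {1..N}. \<bar>Q.cov a b\<bar>) = (\<Sum>k<m. \<Sum>l\<in>{1..N}. \<bar>r i k (int j - int l)\<bar>)"
        unfolding row a(1) using a by (intro sum.cong refl) (simp add: qcov)
      also have "\<dots> \<le> (\<Sum>k<m. \<Sum>l\<in>{1..N}. C * (1 + real (nat \<bar>int j - int l\<bar>)) powr (- \<beta>))"
        by (intro sum_mono r1n[OF a(2)]) auto
      also have "\<dots> = real m * (C * (\<Sum>l\<in>{1..N}. (1 + real (nat \<bar>int j - int l\<bar>)) powr (- \<beta>)))"
        by (simp add: sum_distrib_left[symmetric])
      also have "\<dots> \<le> real m * (C * (2 * (real n powr (1 - \<beta>) / (1 - \<beta>))))"
      proof (intro mult_left_mono)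
        have "(\<Sum>l\<in>{1..N}. (1 + real (nat \<bar>int j - int l\<bar>)) powr (- \<beta>)) \<le> 2 * (\<Sum>h<N. (1 + real h) powr (- \<beta>))"
          by (rule sum_lag_le[of "\<lambda>h. (1 + real h) powr (- \<beta>)", OF _ a(3)]) simp
        also have "\<dots> \<le> 2 * (real N powr (1 - \<beta>) / (1 - \<beta>))"
          using sum_powr_le[of \<beta> N] \<beta> by simp
        also have "\<dots> \<le> 2 * (real n powr (1 - \<beta>) / (1 - \<beta>))"
          using \<beta> by (intro mult_left_mono divide_right_mono powr_mono2) (auto simp: N_def)
        finally show "(\<Sum>l\<in>{1..N}. (1 + real (nat \<bar>int j - int l\<bar>)) powr (- \<beta>)) \<le> 2 * (real n powr (1 - \<beta>) / (1 - \<beta>))" .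
      qed (use C in auto)
      also have "\<dots> = B * real n powr (1 - \<beta>)" by (simp add: B_def)
      finally show "(\<Sum>b\<in>{..<m} \<times> {1..N}. \<bar>Q.cov a b\<bar>) \<le> B * real n powr (1 - \<beta>)" .
    qed
    have "(\<integral>\<omega>. (Q.W \<omega> - Q.s2 / 2)\<^sup>2 \<partial>M) \<le> A * real n powr (1 - 2 * \<beta>)"
    proof (rule order_trans[OF Wv])
      have n4: "(K / sqrt (real n)) ^ 4 = K ^ 4 / (real n)\<^sup>2"
        by (simp add: power_divide power4_eq_xxxx power2_eq_square)
      have "real (card ({..<m} \<times> {1..N})) \<le> real m * real n" by (simp add: card_cartesian_product N_def mult_left_mono)
      then have "2 * (K ^ 4 / (real n)\<^sup>2) * (real (card ({..<m} \<times> {1..N})) * S * (B * real n powr (1 - \<beta>))\<^sup>2)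
          \<le> 2 * (K ^ 4 / (real n)\<^sup>2) * (real m * real n * S * (B * real n powr (1 - \<beta>))\<^sup>2)"
        using S0 by (intro mult_left_mono mult_right_mono) auto
      also have "\<dots> = A * (real n * (real n powr (1 - \<beta>))\<^sup>2 / (real n)\<^sup>2)"
        by (simp add: A_def power_mult_distrib mult_ac)
      also have "real n * (real n powr (1 - \<beta>))\<^sup>2 / (real n)\<^sup>2 = real n powr (1 - 2 * \<beta>)"
      proof -
        have "(real n powr (1 - \<beta>))\<^sup>2 = real n powr (2 - 2 * \<beta>)"
          by (simp add: power2_eq_square powr_add[symmetric])
        moreover have "real n * y / (real n)\<^sup>2 = y / real n" for y
          using n by (simp add: power2_eq_square)
        moreover have "real n powr (2 - 2 * \<beta>) / real n = real n powr (2 - 2 * \<beta> - 1)"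
          using n by (simp only: powr_diff powr_one of_nat_0_le_iff)
        ultimately show ?thesis by simp
      qed
      finally show "2 * (K / sqrt (real n)) ^ 4 * (real (card ({..<m} \<times> {1..N})) * S * (B * real n powr (1 - \<beta>))\<^sup>2) \<le> A * real n powr (1 - 2 * \<beta>)"
        unfolding n4 .
    qed
    then have "2 * t\<^sup>2 * sqrt (\<integral>\<omega>. (Q.W \<omega> - Q.s2 / 2)\<^sup>2 \<partial>M) \<le> 2 * t\<^sup>2 * sqrt (A * real n powr (1 - 2 * \<beta>))" for t :: real
      by (intro mult_left_mono real_sqrt_le_mono) auto
    from order_trans[OF Q.char_quadratic_form this] Q.V_second_moment Q.V_measurable
    show ?thesis unfolding VQ sQ by blast
  qed
  show "0 < n \<Longrightarrow> V n \<in> borel_measurable M" using per_n by blast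
  show "OP M V"
  proof (rule OP_L1)
    have "\<forall>\<^sub>F n in sequentially. s n < \<Lambda> + 1" using slim by (intro order_tendstoD) auto
    with eventually_gt_at_top[of 0]
    show "\<forall>\<^sub>F n in sequentially. integrable M (V n) \<and> (\<integral>\<omega>. \<bar>V n \<omega>\<bar> \<partial>M) \<le> sqrt (\<Lambda> + 1)"
    proof eventually_elim
      case (elim n)
      from per_n[OF elim(1)] have v: "V n \<in> borel_measurable M" "integrable M (\<lambda>\<omega>. (V n \<omega>)\<^sup>2)" "(\<integral>\<omega>. (V n \<omega>)\<^sup>2 \<partial>M) = s n" by auto
      have "(\<integral>\<omega>. \<bar>V n \<omega>\<bar> \<partial>M) \<le> sqrt (s n)" using expectation_abs_le_sqrt(2)[OF v(1,2)] v(3) by simp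
      also have "\<dots> \<le> sqrt (\<Lambda> + 1)" using elim by simp
      finally show ?case using expectation_abs_le_sqrt(1)[OF v(1,2)] by simp
    qed
  qed
  have s_nonneg: "0 \<le> s n" if "0 < n" for n
    using per_n[OF that] by (metis integral_nonneg_AE AE_I2 zero_le_power2)
  \<comment> \<open>The limit inherits nonnegativity from the variances \<open>s n\<close>.\<close>
  have \<Lambda>0: "0 \<le> \<Lambda>"
  proof (rule tendsto_lowerbound[OF slim])
    show "\<forall>\<^sub>F n in sequentially. 0 \<le> s n"
      using eventually_gt_at_top[of 0] by eventually_elim (rule s_nonneg)
  qed simp
  have "(\<lambda>n. \<integral>\<omega>. iexp (t * V n \<omega>) \<partial>M) \<longlonglongrightarrow> exp (- of_real (\<Lambda> * t\<^sup>2 / 2))" for t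
  proof -
    have "(\<lambda>n. (\<integral>\<omega>. iexp (t * V n \<omega>) \<partial>M) - exp (- of_real (s n * t\<^sup>2 / 2))) \<longlonglongrightarrow> 0"
    proof (rule Lim_null_comparison)
      show "\<forall>\<^sub>F n in sequentially. norm ((\<integral>\<omega>. iexp (t * V n \<omega>) \<partial>M) - exp (- of_real (s n * t\<^sup>2 / 2))) \<le> 2 * t\<^sup>2 * sqrt (A * real n powr (1 - 2 * \<beta>))"
        using eventually_gt_at_top[of 0] by eventually_elim (use per_n in blast)
      have "(\<lambda>n. real n powr (1 - 2 * \<beta>)) \<longlonglongrightarrow> 0"
        using \<beta> by (intro tendsto_neg_powr filterlim_real_sequentially) auto
      then have "(\<lambda>n. 2 * t\<^sup>2 * sqrt (A * real n powr (1 - 2 * \<beta>))) \<longlonglongrightarrow> 2 * t\<^sup>2 * sqrt (A * 0)"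
        by (intro tendsto_intros)
      then show "(\<lambda>n. 2 * t\<^sup>2 * sqrt (A * real n powr (1 - 2 * \<beta>))) \<longlonglongrightarrow> 0" by simp
    qed
    moreover have "(\<lambda>n. exp (- complex_of_real (s n * t\<^sup>2 / 2))) \<longlonglongrightarrow> exp (- of_real (\<Lambda> * t\<^sup>2 / 2))"
      by (intro tendsto_intros slim) auto
    ultimately have "(\<lambda>n. ((\<integral>\<omega>. iexp (t * V n \<omega>) \<partial>M) - exp (- of_real (s n * t\<^sup>2 / 2))) + exp (- of_real (s n * t\<^sup>2 / 2))) \<longlonglongrightarrow> 0 + exp (- of_real (\<Lambda> * t\<^sup>2 / 2))"
      by (rule tendsto_add)
    then show ?thesis by simp
  qed
  with \<Lambda>0 show "\<exists>\<Lambda>\<ge>0. \<forall>t. (\<lambda>n. \<integral>\<omega>. iexp (t * V n \<omega>) \<partial>M) \<longlonglongrightarrow> exp (- of_real (\<Lambda> * t\<^sup>2 / 2))" by blast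
qed

section \<open>Fractional Brownian motion with drift\<close>

text \<open>Only neighbouring grid points then require a probabilistic bound, which keeps the union
  bound linear in the size of the grid; all other pairs follow by the triangle inequality along the
  chain.\<close>

lemma adjacent_to_lipschitz:
  fixes g :: "int \<Rightarrow> real"
  assumes adj: "\<And>k. - K \<le> k \<Longrightarrow> k < K \<Longrightarrow> \<bar>g (k + 1) - g k\<bar> \<le> e"
    and "- K \<le> k" "k \<le> K" "- K \<le> k'" "k' \<le> K"
  shows "\<bar>g k - g k'\<bar> \<le> of_int \<bar>k - k'\<bar> * e"
proof -
  have up: "\<bar>g (k + int d) - g k\<bar> \<le> real d * e" if "- K \<le> k" "k + int d \<le> K" for k d
    using that(2)
  proof (induction d)
    case (Suc d)
    have "\<bar>g (k + int d + 1) - g (k + int d)\<bar> \<le> e" using Suc.prems that(1) by (intro adj) auto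
    moreover have "\<bar>g (k + int d) - g k\<bar> \<le> real d * e" using Suc by auto
    ultimately show ?case by (simp add: algebra_simps)
  qed simp
  show ?thesis
  proof (cases "k' \<le> k")
    case True
    then have "k = k' + int (nat (k - k'))" by simp
    then show ?thesis using up[of k' "nat (k - k')"] assms True by simp
  next
    case False
    then have "k' = k + int (nat (k' - k))" by simp
    then have "\<bar>g k' - g k\<bar> \<le> of_int \<bar>k' - k\<bar> * e" using up[of k "nat (k' - k)"] assms False by simp
    then show ?thesis by (simp add: abs_minus_commute)
  qed
qed

text \<open>A discrete sewing estimate: the anchor of each block is moved to the anchor of its parent block,
  one dyadic level at a time.\<close>

lemma dyadic_telescope:
  fixes u :: "nat \<Rightarrow> 'b \<Rightarrow> real" and z :: "nat \<Rightarrow> 'b"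
  defines "R \<equiv> \<lambda>l q y. \<Sum>j\<in>{q * 2 ^ l..<(q + 1) * 2 ^ l}. u j y"
  assumes \<kappa>: "\<And>l q. l < L \<Longrightarrow> q < 2 ^ (L - l) \<Longrightarrow>
    \<bar>R l q (z (q * 2 ^ l)) - R l q (z (q div 2 * 2 ^ (l + 1)))\<bar> \<le> \<kappa> l"
  shows "\<bar>(\<Sum>j<2 ^ L. u j (z j)) - (\<Sum>j<2 ^ L. u j (z 0))\<bar> \<le> (\<Sum>l<L. 2 ^ (L - l) * \<kappa> l)"
proof -
  define S where "S l = (\<Sum>q<2 ^ (L - l). R l q (z (q * 2 ^ l)))" for l
  have S0: "S 0 = (\<Sum>j<2 ^ L. u j (z j))" by (simp add: S_def R_def)
  have SL: "S L = (\<Sum>j<2 ^ L. u j (z 0))" by (simp add: S_def R_def lessThan_atLeast0)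
  have step: "\<bar>S l - S (Suc l)\<bar> \<le> 2 ^ (L - l) * \<kappa> l" if l: "l < L" for l
  proof -
    define m :: nat where "m = 2 ^ (L - Suc l)"
    have m2: "2 ^ (L - l) = 2 * m" using l by (simp add: m_def Suc_diff_Suc[symmetric] flip: power_Suc)
    have pair: "(\<Sum>q<2 * m. g q) = (\<Sum>q<m. g (2 * q) + g (2 * q + 1))" for g :: "nat \<Rightarrow> real"
      by (induction m) auto
    have split: "R (Suc l) q y = R l (2 * q) y + R l (2 * q + 1) y" for q y
    proof -
      have "{q * 2 ^ Suc l..<(q + 1) * 2 ^ Suc l} = {(2 * q) * 2 ^ l..<(2 * q + 1) * 2 ^ l} \<union> {(2 * q + 1) * 2 ^ l..<(2 * q + 1 + 1) * 2 ^ l}"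
        by (auto simp: algebra_simps)
      then show ?thesis unfolding R_def by (simp only:) (rule sum.union_disjoint, auto)
    qed
    \<comment> \<open>A block of level l + 1 consists of two children; keeping the parent's anchor
      in both writes \<open>S (Suc l)\<close> as a sum over the blocks of level l.\<close>
    have "S (Suc l) = (\<Sum>q<m. R l (2 * q) (z (q * 2 ^ Suc l)) + R l (2 * q + 1) (z (q * 2 ^ Suc l)))"
      unfolding S_def m_def[symmetric] split by simp
    also have "\<dots> = (\<Sum>q<2 * m. R l q (z (q div 2 * 2 ^ (l + 1))))"
      by (simp add: pair)
    finally have "S l - S (Suc l) = (\<Sum>q<2 * m. R l q (z (q * 2 ^ l)) - R l q (z (q div 2 * 2 ^ (l + 1))))"
      unfolding S_def m2 by (simp add: sum_subtractf)
    also have "\<bar>\<dots>\<bar> \<le> (\<Sum>q<2 * m. \<kappa> l)"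
      using \<kappa>[OF l] unfolding m2 by (intro order_trans[OF sum_abs] sum_mono) auto
    also have "\<dots> = 2 ^ (L - l) * \<kappa> l"
    proof -
      have "real (2 * m) = 2 ^ (L - l)" unfolding m2[symmetric] by simp
      then show ?thesis by simp
    qed
    finally show ?thesis .
  qed
  have "\<bar>S 0 - S l\<bar> \<le> (\<Sum>i<l. 2 ^ (L - i) * \<kappa> i)" if "l \<le> L" for l
    using that
  proof (induction l)
    case (Suc l)
    then show ?case using step[of l] by (auto intro: abs_triangle_ineq order_trans)
  qed simp
  from this[of L] show ?thesis unfolding S0 SL by simp
qed

section \<open>Fractional Brownian motion and sums of its filtered increments\<close>

locale fractional_bm = prob_space M for M :: "'a measure" +
  fixes T :: "real set" and H :: real and B :: "real \<Rightarrow> 'a \<Rightarrow> real"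
  assumes H: "0 < H" "H < 1" and fbm: "fractional_Brownian_motion M T H B" and T0: "T \<subseteq> {0..}"
begin

sublocale gaussian_space M "gaussian_span T B"
  using fbm by (intro gaussian_space_span) (auto simp: fractional_Brownian_motion_def prob_space_axioms)

lemma B_in_G: "t \<in> T \<Longrightarrow> B t \<in> gaussian_span T B"
  by (rule process_in_gaussian_span)

lemma B_measurable: "t \<in> T \<Longrightarrow> B t \<in> borel_measurable M"
  using B_in_G measurable_G by blast

lemma B_cov: "s \<in> T \<Longrightarrow> t \<in> T \<Longrightarrow> (\<integral>\<omega>. B t \<omega> * B s \<omega> \<partial>M) = (t powr (2 * H) + s powr (2 * H) - \<bar>t - s\<bar> powr (2 * H)) / 2"
  using fbm by (simp add: fractional_Brownian_motion_def)

lemma B_increment_variance: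
  assumes "s \<in> T" "t \<in> T"
  shows "(\<integral>\<omega>. (B t \<omega> - B s \<omega>)\<^sup>2 \<partial>M) = \<bar>t - s\<bar> powr (2 * H)"
proof -
  have i: "integrable M (\<lambda>\<omega>. B u \<omega> * B v \<omega>)" if "u \<in> T" "v \<in> T" for u v
    using that by (intro integrable_mult_G B_in_G)
  have "(\<integral>\<omega>. (B t \<omega> - B s \<omega>)\<^sup>2 \<partial>M) = (\<integral>\<omega>. B t \<omega> * B t \<omega> - 2 * (B t \<omega> * B s \<omega>) + B s \<omega> * B s \<omega> \<partial>M)"
    by (intro Bochner_Integration.integral_cong) (auto simp: power2_eq_square algebra_simps)
  also have "\<dots> = (\<integral>\<omega>. B t \<omega> * B t \<omega> \<partial>M) - 2 * (\<integral>\<omega>. B t \<omega> * B s \<omega> \<partial>M) + (\<integral>\<omega>. B s \<omega> * B s \<omega> \<partial>M)"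
    using i assms by simp
  also have "\<dots> = \<bar>t - s\<bar> powr (2 * H)" using B_cov[OF assms] B_cov[OF assms(1,1)] B_cov[OF assms(2,2)] by simp
  finally show ?thesis .
qed

lemma filter_incr_in_G:
  assumes "\<And>i. i \<le> filter_p a \<Longrightarrow> real (i + j) * \<Delta> \<in> T"
  shows "(\<lambda>\<omega>. filter_incr a \<Delta> (\<lambda>t. B t \<omega>) j) \<in> gaussian_span T B"
  unfolding filter_incr_def using assms by (intro sum_G B_in_G) auto

text \<open>The terms t^(2 H) and s^(2 H) of the covariance depend on one time only and are killed
  by the other filter, whose coefficients sum to zero. What is left is homogeneous of degree 2 H in
  the mesh.\<close>

lemma filter_incr_cov:
  assumes a: "diff_filter a" and b: "diff_filter b" and \<Delta>: "0 < \<Delta>"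
    and aT: "\<And>i. i \<le> filter_p a \<Longrightarrow> real (i + j) * \<Delta> \<in> T"
    and bT: "\<And>i. i \<le> filter_p b \<Longrightarrow> real (i + l) * \<Delta> \<in> T"
  shows "(\<integral>\<omega>. filter_incr a \<Delta> (\<lambda>t. B t \<omega>) j * filter_incr b \<Delta> (\<lambda>t. B t \<omega>) l \<partial>M) =
    \<Delta> powr (2 * H) * filter_cov H a b (int j - int l)"
proof -
  have ra: "{0..filter_p a} = {..<length a}" and rb: "{0..filter_p b} = {..<length b}"
    using a b by (auto simp: filter_p_def diff_filter_def)
  have sa: "(\<Sum>i<length a. a ! i) = 0" and sb: "(\<Sum>i<length b. b ! i) = 0"
    using a b by (auto simp: diff_filter_def sum_list_sum_nth atLeast0LessThan)
  define t where "t i = real (i + j) * \<Delta>" for i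
  define s where "s i = real (i + l) * \<Delta>" for i
  have tT: "t i \<in> T" if "i < length a" for i unfolding t_def using that by (intro aT) (auto simp: filter_p_def)
  have sT: "s i \<in> T" if "i < length b" for i unfolding s_def using that by (intro bT) (auto simp: filter_p_def)
  have i: "integrable M (\<lambda>\<omega>. a ! i * b ! k * (B (t i) \<omega> * B (s k) \<omega>))" if "i < length a" "k < length b" for i k
    using that by (intro integrable_mult_right integrable_mult_G B_in_G tT sT)
  have "(\<integral>\<omega>. filter_incr a \<Delta> (\<lambda>t. B t \<omega>) j * filter_incr b \<Delta> (\<lambda>t. B t \<omega>) l \<partial>M)
      = (\<integral>\<omega>. (\<Sum>i<length a. \<Sum>k<length b. a ! i * b ! k * (B (t i) \<omega> * B (s k) \<omega>)) \<partial>M)"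
    unfolding filter_incr_def ra rb sum_product t_def s_def
    by (intro Bochner_Integration.integral_cong refl sum.cong) (simp add: mult_ac)
  also have "\<dots> = (\<Sum>i<length a. \<integral>\<omega>. (\<Sum>k<length b. a ! i * b ! k * (B (t i) \<omega> * B (s k) \<omega>)) \<partial>M)"
    by (rule Bochner_Integration.integral_sum) (intro Bochner_Integration.integrable_sum i, auto)
  also have "\<dots> = (\<Sum>i<length a. \<Sum>k<length b. \<integral>\<omega>. a ! i * b ! k * (B (t i) \<omega> * B (s k) \<omega>) \<partial>M)"
    by (intro sum.cong refl Bochner_Integration.integral_sum i) auto
  also have "\<dots> = (\<Sum>i<length a. \<Sum>k<length b. a ! i * b ! k * ((t i powr (2 * H) + s k powr (2 * H) - \<bar>t i - s k\<bar> powr (2 * H)) / 2))"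
    by (intro sum.cong refl) (simp add: B_cov sT tT)
  also have "\<dots> = (\<Sum>i<length a. \<Sum>k<length b. a ! i * (t i powr (2 * H) / 2) * b ! k) +
     (\<Sum>i<length a. \<Sum>k<length b. a ! i * (b ! k * (s k powr (2 * H) / 2))) +
     (\<Sum>i<length a. \<Sum>k<length b. a ! i * b ! k * (- (\<bar>t i - s k\<bar> powr (2 * H)) / 2))"
    unfolding sum.distrib[symmetric] by (intro sum.cong refl) (simp add: field_simps)
  also have "(\<Sum>i<length a. \<Sum>k<length b. a ! i * (t i powr (2 * H) / 2) * b ! k) = 0"
    unfolding sum_distrib_left[symmetric] sb by simp
  also have "(\<Sum>i<length a. \<Sum>k<length b. a ! i * (b ! k * (s k powr (2 * H) / 2))) = 0"
    unfolding sum_product[symmetric] sa by simp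
  also have "0 + 0 + (\<Sum>i<length a. \<Sum>k<length b. a ! i * b ! k * (- (\<bar>t i - s k\<bar> powr (2 * H)) / 2)) =
     (\<Sum>i<length a. \<Sum>k<length b. a ! i * b ! k * (- (\<bar>t i - s k\<bar> powr (2 * H)) / 2))" by simp
  also have "\<dots> = (\<Sum>i<length a. \<Sum>k<length b. \<Delta> powr (2 * H) * (- (a ! i * b ! k * \<bar>of_int (int j - int l) + real i - real k\<bar> powr (2 * H)) / 2))"
  proof (intro sum.cong refl)
    fix i k
    have "t i - s k = \<Delta> * (of_int (int j - int l) + real i - real k)" by (simp add: t_def s_def algebra_simps)
    then have "\<bar>t i - s k\<bar> powr (2 * H) = \<Delta> powr (2 * H) * \<bar>of_int (int j - int l) + real i - real k\<bar> powr (2 * H)"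
      using \<Delta> by (simp add: abs_mult powr_mult)
    then show "a ! i * b ! k * (- (\<bar>t i - s k\<bar> powr (2 * H)) / 2) =
      \<Delta> powr (2 * H) * (- (a ! i * b ! k * \<bar>of_int (int j - int l) + real i - real k\<bar> powr (2 * H)) / 2)"
      by simp
  qed
  also have "\<dots> = \<Delta> powr (2 * H) * filter_cov H a b (int j - int l)"
    unfolding filter_cov_def sum_distrib_left[symmetric] sum_divide_distrib[symmetric] sum_negf ..
  finally show ?thesis .
qed

text \<open>Each row of covariances sums to the order len^(1 - \<beta>), so the standard deviation
  grows like len^(1 - \<beta>/2) rather than len. This gain over absolute values makes the cross
  terms small for \<open>H >= 1/2\<close>. The weights have to be deterministic.\<close>

lemma block_variance:
  assumes a: "diff_filter a" and \<Delta>: "0 < \<Delta>"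
    and aT: "\<And>i j. i \<le> filter_p a \<Longrightarrow> j \<in> J \<Longrightarrow> real (i + j) * \<Delta> \<in> T"
    and \<beta>: "0 < \<beta>" "\<beta> < 1" and C: "0 \<le> C" "\<And>h. \<bar>filter_cov H a a h\<bar> \<le> C * (1 + \<bar>of_int h\<bar>) powr (- \<beta>)"
    and J: "J \<subseteq> {s..<s + len}" and w: "\<And>j. j \<in> J \<Longrightarrow> \<bar>w j\<bar> \<le> W" "0 \<le> W"
  shows "(\<integral>\<omega>. (\<Sum>j\<in>J. w j * filter_incr a \<Delta> (\<lambda>t. B t \<omega>) j)\<^sup>2 \<partial>M)
    \<le> W\<^sup>2 * \<Delta> powr (2 * H) * (2 * C / (1 - \<beta>)) * real len powr (2 - \<beta>)"
proof -
  have finJ: "finite J" using J by (rule finite_subset) simp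
  define b where "b j \<omega> = filter_incr a \<Delta> (\<lambda>t. B t \<omega>) j" for j \<omega>
  have bG: "b j \<in> gaussian_span T B" if "j \<in> J" for j
    unfolding b_def using that by (intro filter_incr_in_G aT)
  have i: "integrable M (\<lambda>\<omega>. b j \<omega> * b l \<omega>)" if "j \<in> J" "l \<in> J" for j l
    using that by (intro integrable_mult_G bG)
  define \<phi> where "\<phi> h = (1 + real h) powr (- \<beta>)" for h
  have "(\<integral>\<omega>. (\<Sum>j\<in>J. w j * b j \<omega>)\<^sup>2 \<partial>M) = (\<Sum>j\<in>J. \<Sum>l\<in>J. w j * w l * (\<integral>\<omega>. b j \<omega> * b l \<omega> \<partial>M))"
    by (rule second_moment_sum(2)[OF finJ i])
  also have "\<dots> \<le> (\<Sum>j\<in>J. \<Sum>l\<in>J. W\<^sup>2 * (\<Delta> powr (2 * H) * (C * \<phi> (nat \<bar>int j - int l\<bar>))))"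
  proof (intro sum_mono)
    fix j l assume jl: "j \<in> J" "l \<in> J"
    have cov: "(\<integral>\<omega>. b j \<omega> * b l \<omega> \<partial>M) = \<Delta> powr (2 * H) * filter_cov H a a (int j - int l)"
      unfolding b_def using jl by (intro filter_incr_cov a \<Delta> aT)
    have "\<bar>filter_cov H a a (int j - int l)\<bar> \<le> C * \<phi> (nat \<bar>int j - int l\<bar>)"
      using C(2)[of "int j - int l"] by (simp add: \<phi>_def)
    then have c: "\<bar>\<integral>\<omega>. b j \<omega> * b l \<omega> \<partial>M\<bar> \<le> \<Delta> powr (2 * H) * (C * \<phi> (nat \<bar>int j - int l\<bar>))"
      unfolding cov abs_mult by (simp add: mult_left_mono)
    have ww: "\<bar>w j * w l\<bar> \<le> W\<^sup>2"
      unfolding abs_mult power2_eq_square using w jl by (intro mult_mono) auto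
    have "w j * w l * (\<integral>\<omega>. b j \<omega> * b l \<omega> \<partial>M) \<le> \<bar>w j * w l\<bar> * \<bar>\<integral>\<omega>. b j \<omega> * b l \<omega> \<partial>M\<bar>"
      unfolding abs_mult[symmetric] by (rule abs_ge_self)
    also have "\<dots> \<le> W\<^sup>2 * (\<Delta> powr (2 * H) * (C * \<phi> (nat \<bar>int j - int l\<bar>)))"
      using ww c by (intro mult_mono) auto
    finally show "w j * w l * (\<integral>\<omega>. b j \<omega> * b l \<omega> \<partial>M) \<le> W\<^sup>2 * (\<Delta> powr (2 * H) * (C * \<phi> (nat \<bar>int j - int l\<bar>)))" .
  qed
  also have "\<dots> = W\<^sup>2 * (\<Delta> powr (2 * H) * (C * (\<Sum>j\<in>J. \<Sum>l\<in>J. \<phi> (nat \<bar>int j - int l\<bar>))))"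
    by (simp only: sum_distrib_left)
  also have "\<dots> \<le> W\<^sup>2 * (\<Delta> powr (2 * H) * (C * (real len * (2 * (real len powr (1 - \<beta>) / (1 - \<beta>))))))"
  proof (intro mult_left_mono)
    have "(\<Sum>l\<in>J. \<phi> (nat \<bar>int j - int l\<bar>)) \<le> 2 * (real len powr (1 - \<beta>) / (1 - \<beta>))" if j: "j \<in> J" for j
    proof -
      have "(\<Sum>l\<in>J. \<phi> (nat \<bar>int j - int l\<bar>)) \<le> (\<Sum>l\<in>{s..<s + len}. \<phi> (nat \<bar>int j - int l\<bar>))"
        using J by (intro sum_mono2) (auto simp: \<phi>_def)
      also have "\<dots> = (\<Sum>l\<in>{1..len}. \<phi> (nat \<bar>int (j - s + 1) - int l\<bar>))"
        using j J by (intro sum.reindex_bij_witness[where i="\<lambda>l. l + s - 1" and j="\<lambda>l. l - s + 1"]) (auto intro!: arg_cong[where f=\<phi>] simp: of_nat_diff)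
      also have "\<dots> \<le> 2 * (\<Sum>h<len. \<phi> h)"
      proof (rule sum_lag_le)
        have "s \<le> j" "j < s + len" using j J by auto
        then show "j - s + 1 \<in> {1..len}" by auto
      qed (simp add: \<phi>_def)
      also have "\<dots> \<le> 2 * (real len powr (1 - \<beta>) / (1 - \<beta>))" unfolding \<phi>_def using sum_powr_le[OF \<beta>, of len] by simp
      finally show ?thesis .
    qed
    then have "(\<Sum>j\<in>J. \<Sum>l\<in>J. \<phi> (nat \<bar>int j - int l\<bar>)) \<le> (\<Sum>j\<in>J. 2 * (real len powr (1 - \<beta>) / (1 - \<beta>)))" by (rule sum_mono)
    also have "\<dots> \<le> real len * (2 * (real len powr (1 - \<beta>) / (1 - \<beta>)))"
      using card_mono[OF _ J] \<beta> by (simp only: sum_constant) (intro mult_right_mono, auto)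
    finally show "(\<Sum>j\<in>J. \<Sum>l\<in>J. \<phi> (nat \<bar>int j - int l\<bar>)) \<le> real len * (2 * (real len powr (1 - \<beta>) / (1 - \<beta>)))" .
  qed (use C in auto)
  also have "\<dots> = W\<^sup>2 * \<Delta> powr (2 * H) * (2 * C / (1 - \<beta>)) * real len powr (2 - \<beta>)"
  proof -
    have "real len * real len powr (1 - \<beta>) = real len powr (2 - \<beta>)"
    proof (cases "len = 0")
      case False
      then have "real len * real len powr (1 - \<beta>) = real len powr (1 + (1 - \<beta>))" by (simp only: powr_add) simp
      then show ?thesis by (simp add: algebra_simps)
    qed simp
    then show ?thesis by (simp add: mult_ac)
  qed
  finally show ?thesis unfolding b_def .
qed

end

text \<open>Tonelli for a process that is jointly measurable only with respect to the completed product.\<close>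

lemma (in prob_space) tonelli_measurable_process:
  fixes X :: "real \<Rightarrow> 'a \<Rightarrow> real"
  assumes X: "measurable_process M T X" and T: "T \<in> sets lborel" and I: "I \<subseteq> T" "I \<in> sets lborel"
    and Z[measurable]: "Z \<in> borel_measurable M" "Y \<in> borel_measurable M"
    and le: "\<And>s. s \<in> I \<Longrightarrow> (\<integral>\<^sup>+\<omega>. ennreal (\<bar>Y \<omega>\<bar> * \<bar>X s \<omega> - Z \<omega>\<bar>) \<partial>M) \<le> ennreal c"
  obtains D where "D \<in> borel_measurable M" "AE \<omega> in M. (\<integral>\<^sup>+s\<in>I. ennreal \<bar>X s \<omega> - Z \<omega>\<bar> \<partial>lebesgue) \<le> D \<omega>"
    "(\<integral>\<^sup>+\<omega>. ennreal \<bar>Y \<omega>\<bar> * D \<omega> \<partial>M) \<le> ennreal c * emeasure lborel I"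
proof -
  define \<Lambda> where "\<Lambda> = restrict_space lborel T"
  have T': "T \<inter> space lborel \<in> sets lborel" using T by simp
  interpret L: sigma_finite_measure \<Lambda>
    unfolding \<Lambda>_def by (intro sigma_finite_measure_restrict_space sigma_finite_lborel T)
  interpret PP: pair_sigma_finite \<Lambda> M ..
  from X have "(\<lambda>(t, \<omega>). X t \<omega>) \<in> borel_measurable (completion (\<Lambda> \<Otimes>\<^sub>M M))"
    by (simp add: measurable_process_def \<Lambda>_def)
  from completion_ex_borel_measurable_real[OF this] obtain g where g[measurable]: "g \<in> borel_measurable (\<Lambda> \<Otimes>\<^sub>M M)"
    and ae: "AE p in \<Lambda> \<Otimes>\<^sub>M M. (case p of (t, \<omega>) \<Rightarrow> X t \<omega>) = g p" by auto
  \<comment> \<open>With the measurable version \<open>g\<close> at hand, both orders of "almost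
    every" are used: \<open>ae1\<close> bounds the expectation at almost every time,
    \<open>ae2\<close> compares the time integrals along almost every path.\<close>
  have ae1: "AE s in \<Lambda>. AE \<omega> in M. X s \<omega> = g (s, \<omega>)"
    using PP.AE_pair[OF ae] by simp
  have ae2: "AE \<omega> in M. AE s in \<Lambda>. X s \<omega> = g (s, \<omega>)"
  proof -
    have "AE p in M \<Otimes>\<^sub>M \<Lambda>. (case p of (\<omega>, t) \<Rightarrow> X t \<omega> = g (t, \<omega>))"
    proof -
      interpret PS: pair_sigma_finite M \<Lambda> ..
      have "AE p in distr (M \<Otimes>\<^sub>M \<Lambda>) (\<Lambda> \<Otimes>\<^sub>M M) (\<lambda>(x, y). (y, x)). (case p of (t, \<omega>) \<Rightarrow> X t \<omega>) = g p"
        using ae by (subst PP.distr_pair_swap[symmetric])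
      from AE_distrD[OF _ this] show ?thesis by (auto simp: split_beta)
    qed
    from pair_sigma_finite.AE_pair[OF _ this] show ?thesis
      by (simp add: pair_sigma_finite_def L.sigma_finite_measure_axioms sigma_finite_measure_axioms)
  qed
  have I'[measurable]: "I \<in> sets \<Lambda>" using I T by (auto simp: \<Lambda>_def sets_restrict_space_iff)
  define D where "D \<omega> = (\<integral>\<^sup>+s. ennreal \<bar>g (s, \<omega>) - Z \<omega>\<bar> * indicator I s \<partial>\<Lambda>)" for \<omega>
  have [measurable]: "D \<in> borel_measurable M" unfolding D_def[abs_def] by measurable
  have "AE \<omega> in M. (\<integral>\<^sup>+s\<in>I. ennreal \<bar>X s \<omega> - Z \<omega>\<bar> \<partial>lebesgue) \<le> D \<omega>"
    using ae2
  proof eventually_elim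
    case (elim \<omega>)
    then have "AE s in lborel. s \<in> T \<longrightarrow> X s \<omega> = g (s, \<omega>)"
      unfolding \<Lambda>_def AE_restrict_space_iff[OF T'] .
    then have "AE s in lebesgue. s \<in> T \<longrightarrow> X s \<omega> = g (s, \<omega>)" by (rule AE_completion)
    then have "(\<integral>\<^sup>+s\<in>I. ennreal \<bar>X s \<omega> - Z \<omega>\<bar> \<partial>lebesgue) = (\<integral>\<^sup>+s. ennreal \<bar>g (s, \<omega>) - Z \<omega>\<bar> * indicator I s \<partial>lebesgue)"
      by (intro nn_integral_cong_AE) (auto elim!: eventually_mono split: split_indicator, use I in auto)
    also have "\<dots> = (\<integral>\<^sup>+s. ennreal \<bar>g (s, \<omega>) - Z \<omega>\<bar> * indicator I s * indicator T s \<partial>lebesgue)"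
      using I by (intro nn_integral_cong) (auto split: split_indicator)
    also have "\<dots> = (\<integral>\<^sup>+s. ennreal \<bar>g (s, \<omega>) - Z \<omega>\<bar> * indicator I s * indicator T s \<partial>lborel)"
      by (rule nn_integral_completion)
    also have "\<dots> = D \<omega>"
      unfolding D_def \<Lambda>_def using T by (subst nn_integral_restrict_space) auto
    finally show ?case by simp
  qed
  moreover have "(\<integral>\<^sup>+\<omega>. ennreal \<bar>Y \<omega>\<bar> * D \<omega> \<partial>M) \<le> ennreal c * emeasure lborel I"
  proof -
    have "(\<integral>\<^sup>+\<omega>. ennreal \<bar>Y \<omega>\<bar> * D \<omega> \<partial>M) = (\<integral>\<^sup>+\<omega>. \<integral>\<^sup>+s. ennreal \<bar>Y \<omega>\<bar> * (ennreal \<bar>g (s, \<omega>) - Z \<omega>\<bar> * indicator I s) \<partial>\<Lambda> \<partial>M)"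
    proof (intro nn_integral_cong)
      fix \<omega> assume [measurable]: "\<omega> \<in> space M"
      show "ennreal \<bar>Y \<omega>\<bar> * D \<omega> = (\<integral>\<^sup>+s. ennreal \<bar>Y \<omega>\<bar> * (ennreal \<bar>g (s, \<omega>) - Z \<omega>\<bar> * indicator I s) \<partial>\<Lambda>)"
        unfolding D_def by (rule nn_integral_cmult[symmetric]) measurable
    qed
    also have "\<dots> = (\<integral>\<^sup>+s. \<integral>\<^sup>+\<omega>. ennreal \<bar>Y \<omega>\<bar> * (ennreal \<bar>g (s, \<omega>) - Z \<omega>\<bar> * indicator I s) \<partial>M \<partial>\<Lambda>)"
      by (rule PP.Fubini') measurable
    also have "\<dots> \<le> (\<integral>\<^sup>+s. ennreal c * indicator I s \<partial>\<Lambda>)"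
    proof (rule nn_integral_mono_AE, use ae1 in eventually_elim)
      case (elim s)
      show ?case
      proof (cases "s \<in> I")
        case True
        have "(\<integral>\<^sup>+\<omega>. ennreal \<bar>Y \<omega>\<bar> * (ennreal \<bar>g (s, \<omega>) - Z \<omega>\<bar> * indicator I s) \<partial>M) = (\<integral>\<^sup>+\<omega>. ennreal (\<bar>Y \<omega>\<bar> * \<bar>X s \<omega> - Z \<omega>\<bar>) \<partial>M)"
          using elim True by (intro nn_integral_cong_AE) (auto elim!: eventually_mono simp: ennreal_mult)
        then show ?thesis using le[OF True] True by simp
      qed simp
    qed
    also have "\<dots> = ennreal c * emeasure \<Lambda> I" by (rule nn_integral_cmult_indicator) simp
    also have "emeasure \<Lambda> I = emeasure lborel I" unfolding \<Lambda>_def using I T by (subst emeasure_restrict_space) auto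
    finally show ?thesis .
  qed
  ultimately show ?thesis using that[of D] by simp
qed

section \<open>Integrals of the drift along paths\<close>

lemma set_integral_abs_le:
  fixes g :: "real \<Rightarrow> real"
  assumes g: "set_integrable lebesgue {s<..t} g" and b: "\<And>u. u \<in> {s<..t} \<Longrightarrow> \<bar>g u\<bar> \<le> K" and st: "s \<le> t"
  shows "\<bar>LINT u:{s<..t}|lebesgue. g u\<bar> \<le> K * (t - s)"
proof -
  have "\<bar>LINT u:{s<..t}|lebesgue. g u\<bar> \<le> (\<integral>u. \<bar>indicator {s<..t} u *\<^sub>R g u\<bar> \<partial>lebesgue)"
    unfolding set_lebesgue_integral_def by (rule integral_abs_bound)
  also have "\<dots> \<le> (\<integral>u. K * indicator {s<..t} u \<partial>lebesgue)"
  proof (rule integral_mono)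
    show "integrable lebesgue (\<lambda>u. \<bar>indicator {s<..t} u *\<^sub>R g u\<bar>)"
      using g unfolding set_integrable_def by (rule integrable_abs)
    show "integrable lebesgue (\<lambda>u. K * indicator {s<..t} u)"
      using emeasure_lborel_Ioc[OF st] by (intro integrable_mult_right integrable_real_indicator) auto
    show "\<bar>indicator {s<..t} u *\<^sub>R g u\<bar> \<le> K * indicator {s<..t} u" for u
      using b by (auto split: split_indicator)
  qed
  also have "\<dots> = K * (t - s)" using st by simp
  finally show ?thesis .
qed

lemma set_integrable_continuous_Ioc:
  fixes g :: "real \<Rightarrow> real"
  assumes "continuous_on {s..t} g"
  shows "set_integrable lebesgue {s<..t} g"
proof -
  have "set_integrable lborel {s..t} g" by (rule borel_integrable_atLeastAtMost'[OF assms])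
  then have "set_integrable lborel {s<..t} g" by (rule set_integrable_subset) auto
  then show ?thesis unfolding set_integrable_def by (auto intro!: integrable_completion[THEN iffD2])
qed

locale perturbed_fbm = fractional_bm M T H B for M :: "'a measure" and T H B +
  fixes x K :: real and f :: "real \<Rightarrow> real \<Rightarrow> real" and X :: "real \<Rightarrow> 'a \<Rightarrow> real"
  assumes T_interval: "0 \<in> T" "\<And>t. t \<in> T \<Longrightarrow> {0..t} \<subseteq> T" "T \<in> sets lborel"
    and K: "0 < K" and f_bound: "\<And>s y. s \<in> T \<Longrightarrow> \<bar>f s y\<bar> \<le> K"
    and f_lip: "\<And>s y y'. s \<in> T \<Longrightarrow> \<bar>f s y - f s y'\<bar> \<le> K * \<bar>y - y'\<bar>"
    and f_cont: "\<And>y. continuous_on T (\<lambda>s. f s y)"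
    and X_process: "measurable_process M T X"
    and X_equation: "AE \<omega> in M. \<forall>t\<in>T. set_integrable lebesgue {0..t} (\<lambda>s. f s (X s \<omega>)) \<and>
        X t \<omega> = x + (LINT s:{0..t}|lebesgue. f s (X s \<omega>)) + B t \<omega>"
begin

definition F :: "real \<Rightarrow> 'a \<Rightarrow> real" where "F t \<omega> = X t \<omega> - x - B t \<omega>"

lemma X_measurable: "t \<in> T \<Longrightarrow> X t \<in> borel_measurable M"
  using X_process by (simp add: measurable_process_def)

lemma F_measurable: "t \<in> T \<Longrightarrow> F t \<in> borel_measurable M"
  unfolding F_def[abs_def] using X_measurable[of t] B_measurable[of t] by simp

lemma F_increment:
  "AE \<omega> in M. \<forall>s\<in>T. \<forall>t\<in>T. s \<le> t \<longrightarrow> set_integrable lebesgue {s<..t} (\<lambda>u. f u (X u \<omega>)) \<and>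
     F t \<omega> - F s \<omega> = (LINT u:{s<..t}|lebesgue. f u (X u \<omega>))"
  using X_equation
proof eventually_elim
  case (elim \<omega>)
  show ?case
  proof (intro ballI impI)
    fix s t assume st: "s \<in> T" "t \<in> T" "s \<le> t"
    then have s0: "0 \<le> s" using T0 by auto
    have i: "set_integrable lebesgue {0..t} (\<lambda>u. f u (X u \<omega>))" using elim st by auto
    have i1: "set_integrable lebesgue {s<..t} (\<lambda>u. f u (X u \<omega>))" by (rule set_integrable_subset[OF i]) (use s0 in auto)
    have i2: "set_integrable lebesgue {0..s} (\<lambda>u. f u (X u \<omega>))" using elim st by auto
    have "{0..t} = {0..s} \<union> {s<..t}" "{0..s} \<inter> {s<..t} = {}" using s0 st by auto
    then have "(LINT u:{0..t}|lebesgue. f u (X u \<omega>)) = (LINT u:{0..s}|lebesgue. f u (X u \<omega>)) + (LINT u:{s<..t}|lebesgue. f u (X u \<omega>))"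
      using set_integral_Un[OF _ i2 i1] by simp
    then show "set_integrable lebesgue {s<..t} (\<lambda>u. f u (X u \<omega>)) \<and> F t \<omega> - F s \<omega> = (LINT u:{s<..t}|lebesgue. f u (X u \<omega>))"
      using i1 elim st by (simp add: F_def)
  qed
qed

lemma F_lipschitz: "AE \<omega> in M. \<forall>s\<in>T. \<forall>t\<in>T. \<bar>F t \<omega> - F s \<omega>\<bar> \<le> K * \<bar>t - s\<bar>"
  using F_increment
proof eventually_elim
  case (elim \<omega>)
  have le: "\<bar>F t \<omega> - F s \<omega>\<bar> \<le> K * (t - s)" if "s \<in> T" "t \<in> T" "s \<le> t" for s t
  proof -
    from elim that have "set_integrable lebesgue {s<..t} (\<lambda>u. f u (X u \<omega>))" "F t \<omega> - F s \<omega> = (LINT u:{s<..t}|lebesgue. f u (X u \<omega>))"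
      by auto
    moreover have "u \<in> T" if "u \<in> {s<..t}" for u
    proof -
      have "0 \<le> s" using \<open>s \<in> T\<close> T0 by auto
      then show ?thesis using that T_interval(2)[OF \<open>t \<in> T\<close>] by auto
    qed
    ultimately show ?thesis using set_integral_abs_le[of s t "\<lambda>u. f u (X u \<omega>)" K] f_bound that by auto
  qed
  show ?case
  proof (intro ballI)
    fix s t assume "s \<in> T" "t \<in> T"
    then show "\<bar>F t \<omega> - F s \<omega>\<bar> \<le> K * \<bar>t - s\<bar>"
      using le[of s t] le[of t s] by (cases "s \<le> t") (auto simp: abs_minus_commute)
  qed
qed

lemma X_increment: "AE \<omega> in M. \<forall>s\<in>T. \<forall>t\<in>T. \<bar>X t \<omega> - X s \<omega>\<bar> \<le> \<bar>B t \<omega> - B s \<omega>\<bar> + K * \<bar>t - s\<bar>"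
  using F_lipschitz
proof eventually_elim
  case (elim \<omega>)
  show ?case
  proof (intro ballI)
    fix s t assume "s \<in> T" "t \<in> T"
    then have "\<bar>F t \<omega> - F s \<omega>\<bar> \<le> K * \<bar>t - s\<bar>" using elim by blast
    then show "\<bar>X t \<omega> - X s \<omega>\<bar> \<le> \<bar>B t \<omega> - B s \<omega>\<bar> + K * \<bar>t - s\<bar>" unfolding F_def by linarith
  qed
qed

text \<open>The covariance gives \<open>B 0\<close> second moment 0, so the path starts at the
  deterministic value \<open>x\<close> almost surely. This makes the sum anchored at time 0 in the
  sewing argument Gaussian.\<close>

lemma X_initial: "AE \<omega> in M. X 0 \<omega> = x"
proof -
  have B0: "AE \<omega> in M. B 0 \<omega> = 0"
  proof -
    have "(\<integral>\<omega>. (B 0 \<omega>)\<^sup>2 \<partial>M) = 0" using B_cov[OF T_interval(1,1)] by (simp add: power2_eq_square)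
    then have "AE \<omega> in M. (B 0 \<omega>)\<^sup>2 = 0"
      using integral_nonneg_eq_0_iff_AE[OF integrable_power_G[OF B_in_G[OF T_interval(1)], of 2]] by simp
    then show ?thesis by simp
  qed
  show ?thesis using B0 X_equation
  proof eventually_elim
    case (elim \<omega>)
    have "(LINT s:{0..0}|lebesgue. f s (X s \<omega>)) = 0"
      unfolding set_lebesgue_integral_def
    proof (rule integral_eq_zero_AE, rule AE_I'[of "{0}"])
      show "{0::real} \<in> null_sets lebesgue" by (intro null_sets_completionI finite_imp_null_set_lborel) simp
    qed (auto split: split_indicator)
    then show ?case using elim T_interval(1) by auto
  qed
qed

section \<open>Filtered increments and their drift part\<close>

definition grid_in :: "real list \<Rightarrow> real \<Rightarrow> nat \<Rightarrow> bool" where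
  "grid_in a \<Delta> j \<longleftrightarrow> 0 < \<Delta> \<and> (\<forall>i\<le>filter_p a. real (i + j) * \<Delta> \<in> T)"

definition mass :: "real list \<Rightarrow> real" where "mass a = (\<Sum>i=0..filter_p a. \<bar>a ! i\<bar>)"

lemma mass_nonneg: "0 \<le> mass a"
  unfolding mass_def by (rule sum_nonneg) simp

lemma filter_sum_zero:
  assumes "diff_filter a"
  shows "(\<Sum>i=0..filter_p a. a ! i) = 0"
proof -
  have "{0..filter_p a} = {0..<length a}" using assms by (auto simp: filter_p_def diff_filter_def)
  then show ?thesis using assms by (simp add: diff_filter_def sum_list_sum_nth)
qed

text \<open>Since the coefficients sum to zero, any quantity independent of the filter index may be
  subtracted; the value at the left endpoint turns the filter into a combination of
  increments.\<close>

lemma filter_incr_anchor: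
  assumes "diff_filter a"
  shows "filter_incr a \<Delta> Z j = (\<Sum>i=0..filter_p a. a ! i * (Z (real (i + j) * \<Delta>) - Z (real j * \<Delta>)))"
  unfolding filter_incr_def right_diff_distrib sum_subtractf sum_distrib_right[symmetric] filter_sum_zero[OF assms] by simp

lemma filter_incr_X:
  assumes "diff_filter a"
  shows "filter_incr a \<Delta> (\<lambda>t. X t \<omega>) j = filter_incr a \<Delta> (\<lambda>t. B t \<omega>) j + filter_incr a \<Delta> (\<lambda>t. F t \<omega>) j"
  unfolding filter_incr_anchor[OF assms] sum.distrib[symmetric] F_def
  by (intro sum.cong refl) (simp add: algebra_simps)

lemma filter_incr_measurable:
  assumes "\<And>t. t \<in> T \<Longrightarrow> Z t \<in> borel_measurable M" "grid_in a \<Delta> j"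
  shows "(\<lambda>\<omega>. filter_incr a \<Delta> (\<lambda>t. Z t \<omega>) j) \<in> borel_measurable M"
  unfolding filter_incr_def using assms by (intro borel_measurable_sum borel_measurable_times) (auto simp: grid_in_def)

lemma weighted_sum_le:
  assumes "\<And>i. i \<le> filter_p a \<Longrightarrow> \<bar>g i\<bar> \<le> G"
  shows "\<bar>\<Sum>i=0..filter_p a. a ! i * g i\<bar> \<le> mass a * G"
  unfolding mass_def sum_distrib_right
  using assms by (intro order_trans[OF sum_abs] sum_mono) (simp add: abs_mult mult_left_mono)

lemma filter_incr_F_bound:
  assumes a: "diff_filter a"
  shows "AE \<omega> in M. \<forall>\<Delta> j. grid_in a \<Delta> j \<longrightarrow> \<bar>filter_incr a \<Delta> (\<lambda>t. F t \<omega>) j\<bar> \<le> mass a * (K * (real (filter_p a) * \<Delta>))"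
  using F_lipschitz
proof eventually_elim
  case (elim \<omega>)
  show ?case
  proof (intro allI impI)
    fix \<Delta> j assume g: "grid_in a \<Delta> j"
    show "\<bar>filter_incr a \<Delta> (\<lambda>t. F t \<omega>) j\<bar> \<le> mass a * (K * (real (filter_p a) * \<Delta>))"
      unfolding filter_incr_anchor[OF a]
    proof (rule weighted_sum_le)
      fix i assume i: "i \<le> filter_p a"
      have d: "real (i + j) * \<Delta> - real j * \<Delta> = real i * \<Delta>" by (simp add: algebra_simps)
      have "real (i + j) * \<Delta> \<in> T" "real (0 + j) * \<Delta> \<in> T" using g i unfolding grid_in_def by blast+
      with elim have "\<bar>F (real (i + j) * \<Delta>) \<omega> - F (real j * \<Delta>) \<omega>\<bar> \<le> K * \<bar>real (i + j) * \<Delta> - real j * \<Delta>\<bar>" by simp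
      also have "\<dots> \<le> K * (real (filter_p a) * \<Delta>)"
        unfolding d using K g i by (intro mult_left_mono) (auto simp: grid_in_def abs_mult intro!: mult_right_mono)
      finally show "\<bar>F (real (i + j) * \<Delta>) \<omega> - F (real j * \<Delta>) \<omega>\<bar> \<le> K * (real (filter_p a) * \<Delta>)" .
    qed
  qed
qed

text \<open>The filtered increment of the drift with the space variable held at \<open>y\<close>.
  For fixed \<open>y\<close> it is deterministic, so sums of these numbers times Gaussian increments
  remain in the Gaussian space.\<close>

definition frozen_drift :: "real list \<Rightarrow> real \<Rightarrow> nat \<Rightarrow> real \<Rightarrow> real" where
  "frozen_drift a \<Delta> j y = (\<Sum>i=0..filter_p a. a ! i * (LINT u:{real j * \<Delta><..real (i + j) * \<Delta>}|lebesgue. f u y))"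

lemma grid_interval:
  assumes "grid_in a \<Delta> j" "i \<le> filter_p a"
  shows "{real j * \<Delta>..real (i + j) * \<Delta>} \<subseteq> T" "real j * \<Delta> \<le> real (i + j) * \<Delta>"
    "real (i + j) * \<Delta> - real j * \<Delta> \<le> real (filter_p a) * \<Delta>"
    "\<And>u. u \<in> {real j * \<Delta><..real (i + j) * \<Delta>} \<Longrightarrow> u \<in> T"
proof -
  have \<Delta>: "0 < \<Delta>" and t: "real (i + j) * \<Delta> \<in> T" using assms by (auto simp: grid_in_def)
  show "{real j * \<Delta>..real (i + j) * \<Delta>} \<subseteq> T"
  proof
    fix u assume u: "u \<in> {real j * \<Delta>..real (i + j) * \<Delta>}"
    have "0 \<le> real j * \<Delta>" using \<Delta> by simp
    then have "u \<in> {0..real (i + j) * \<Delta>}" using u by (simp del: of_nat_add)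
    then show "u \<in> T" using T_interval(2)[OF t] by blast
  qed
  then show "u \<in> T" if "u \<in> {real j * \<Delta><..real (i + j) * \<Delta>}" for u
    by (rule subsetD) (use that in \<open>simp del: of_nat_add\<close>)
  show "real j * \<Delta> \<le> real (i + j) * \<Delta>" using \<Delta> by simp
  show "real (i + j) * \<Delta> - real j * \<Delta> \<le> real (filter_p a) * \<Delta>" using \<Delta> assms(2) by (simp add: algebra_simps)
qed

lemma f_integrable:
  assumes "grid_in a \<Delta> j" "i \<le> filter_p a"
  shows "set_integrable lebesgue {real j * \<Delta><..real (i + j) * \<Delta>} (\<lambda>u. f u y)"
  by (rule set_integrable_continuous_Ioc) (rule continuous_on_subset[OF f_cont grid_interval(1)[OF assms]])

lemma frozen_drift_bound:
  assumes g: "grid_in a \<Delta> j"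
  shows "\<bar>frozen_drift a \<Delta> j y\<bar> \<le> mass a * (K * (real (filter_p a) * \<Delta>))"
  unfolding frozen_drift_def
proof (rule weighted_sum_le)
  fix i assume i: "i \<le> filter_p a"
  note gi = grid_interval[OF g i]
  have "\<bar>LINT u:{real j * \<Delta><..real (i + j) * \<Delta>}|lebesgue. f u y\<bar> \<le> K * (real (i + j) * \<Delta> - real j * \<Delta>)"
    by (rule set_integral_abs_le[OF f_integrable[OF g i] _ gi(2)]) (rule f_bound[OF gi(4)])
  also have "\<dots> \<le> K * (real (filter_p a) * \<Delta>)" using K gi(3) by (intro mult_left_mono) auto
  finally show "\<bar>LINT u:{real j * \<Delta><..real (i + j) * \<Delta>}|lebesgue. f u y\<bar> \<le> K * (real (filter_p a) * \<Delta>)" .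
qed

lemma frozen_drift_lipschitz:
  assumes g: "grid_in a \<Delta> j"
  shows "\<bar>frozen_drift a \<Delta> j y - frozen_drift a \<Delta> j y'\<bar> \<le> mass a * (K * (real (filter_p a) * \<Delta>)) * \<bar>y - y'\<bar>"
proof -
  have "frozen_drift a \<Delta> j y - frozen_drift a \<Delta> j y' = (\<Sum>i=0..filter_p a. a ! i * (LINT u:{real j * \<Delta><..real (i + j) * \<Delta>}|lebesgue. f u y - f u y'))"
    unfolding frozen_drift_def sum_subtractf[symmetric] right_diff_distrib[symmetric]
    by (intro sum.cong refl arg_cong2[where f="(*)"] set_integral_diff(2)[symmetric] f_integrable[OF g]) auto
  also have "\<bar>\<dots>\<bar> \<le> mass a * (K * (real (filter_p a) * \<Delta>) * \<bar>y - y'\<bar>)"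
  proof (rule weighted_sum_le)
    fix i assume i: "i \<le> filter_p a"
    note gi = grid_interval[OF g i]
    have "\<bar>LINT u:{real j * \<Delta><..real (i + j) * \<Delta>}|lebesgue. f u y - f u y'\<bar> \<le> (K * \<bar>y - y'\<bar>) * (real (i + j) * \<Delta> - real j * \<Delta>)"
      by (rule set_integral_abs_le[OF set_integral_diff(1)[OF f_integrable[OF g i] f_integrable[OF g i]] _ gi(2)])
        (rule f_lip[OF gi(4)])
    also have "\<dots> \<le> (K * \<bar>y - y'\<bar>) * (real (filter_p a) * \<Delta>)" using K gi(3) by (intro mult_left_mono) auto
    finally show "\<bar>LINT u:{real j * \<Delta><..real (i + j) * \<Delta>}|lebesgue. f u y - f u y'\<bar> \<le> K * (real (filter_p a) * \<Delta>) * \<bar>y - y'\<bar>"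
      by (simp add: mult_ac)
  qed
  finally show ?thesis by (simp add: mult.assoc)
qed

lemma frozen_drift_measurable:
  assumes g: "grid_in a \<Delta> j"
  shows "frozen_drift a \<Delta> j \<in> borel_measurable borel"
proof (rule borel_measurable_continuous_onI, rule continuous_at_imp_continuous_on, rule ballI)
  fix y
  define c where "c = mass a * (K * (real (filter_p a) * \<Delta>))"
  have "((\<lambda>z. c * \<bar>z - y\<bar>) \<longlongrightarrow> c * \<bar>y - y\<bar>) (at y)" by (intro tendsto_intros)
  then have lim: "((\<lambda>z. c * \<bar>z - y\<bar>) \<longlongrightarrow> 0) (at y)" by simp
  have "norm (frozen_drift a \<Delta> j z - frozen_drift a \<Delta> j y) \<le> c * \<bar>z - y\<bar>" for z
    unfolding c_def real_norm_def by (rule frozen_drift_lipschitz[OF g])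
  then have "\<forall>\<^sub>F z in at y. norm (frozen_drift a \<Delta> j z - frozen_drift a \<Delta> j y) \<le> c * \<bar>z - y\<bar>"
    by (rule always_eventually[OF allI])
  then have "((\<lambda>z. frozen_drift a \<Delta> j z - frozen_drift a \<Delta> j y) \<longlongrightarrow> 0) (at y)"
    by (rule Lim_null_comparison[OF _ lim])
  then show "isCont (frozen_drift a \<Delta> j) y" by (simp add: isCont_def LIM_zero_iff)
qed

text \<open>Lipschitz continuity of \<open>f\<close> in space, integrated over the window of the
  filter. The form with nonnegative integrals asks neither for finiteness of the right-hand side nor
  for measurability of the individual path.\<close>

lemma drift_localisation:
  assumes a: "diff_filter a" and g: "grid_in a \<Delta> j"
  shows "AE \<omega> in M. ennreal \<bar>filter_incr a \<Delta> (\<lambda>t. F t \<omega>) j - frozen_drift a \<Delta> j (X (real j * \<Delta>) \<omega>)\<bar>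
    \<le> ennreal (mass a * K) * (\<integral>\<^sup>+s\<in>{real j * \<Delta>..real (filter_p a + j) * \<Delta>}. ennreal \<bar>X s \<omega> - X (real j * \<Delta>) \<omega>\<bar> \<partial>lebesgue)"
  using F_increment
proof eventually_elim
  case (elim \<omega>)
  define y where "y = X (real j * \<Delta>) \<omega>"
  define I where "I = {real j * \<Delta>..real (filter_p a + j) * \<Delta>}"
  define N where "N = (\<integral>\<^sup>+s\<in>I. ennreal \<bar>X s \<omega> - y\<bar> \<partial>lebesgue)"
  show ?case
  proof (cases "N = \<infinity>")
    \<comment> \<open>An infinite integral makes the bound trivial unless \<open>mass a = 0\<close>,
      where 0 times infinity is 0; then all coefficients of the filter vanish and so does the
      left-hand side.\<close>
    case True
    show ?thesis
    proof (cases "mass a = 0")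
      case True
      have "a ! i = 0" if "i \<le> filter_p a" for i
        using True that sum_nonneg_eq_0_iff[of "{0..filter_p a}" "\<lambda>i. \<bar>a ! i\<bar>"] by (auto simp: mass_def)
      then have "filter_incr a \<Delta> (\<lambda>t. F t \<omega>) j = 0" "frozen_drift a \<Delta> j y = 0"
        by (auto simp: filter_incr_def frozen_drift_def)
      then show ?thesis unfolding y_def by simp
    next
      case False
      then have "0 < mass a * K" using mass_nonneg[of a] K by simp
      then have "ennreal (mass a * K) \<noteq> 0" by (simp only: ennreal_eq_0_iff not_le simp_thms)
      then have "ennreal (mass a * K) * N = \<infinity>" using True by (simp only: infinity_ennreal_def ennreal_mult_top if_False)
      then show ?thesis unfolding N_def I_def y_def by (simp only: infinity_ennreal_def top_greatest)
    qed
  next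
    case False
    have jT: "real j * \<Delta> \<in> T" using g unfolding grid_in_def by (metis add_0 le0)
    have eq: "filter_incr a \<Delta> (\<lambda>t. F t \<omega>) j - frozen_drift a \<Delta> j y
      = (\<Sum>i=0..filter_p a. a ! i * (LINT u:{real j * \<Delta><..real (i + j) * \<Delta>}|lebesgue. f u (X u \<omega>) - f u y))"
      unfolding filter_incr_anchor[OF a] frozen_drift_def sum_subtractf[symmetric] right_diff_distrib[symmetric]
    proof (intro sum.cong refl arg_cong2[where f="(*)"])
      fix i assume "i \<in> {0..filter_p a}"
      then have i: "i \<le> filter_p a" by simp
      have "real (i + j) * \<Delta> \<in> T" using g i by (auto simp: grid_in_def)
      then have e: "set_integrable lebesgue {real j * \<Delta><..real (i + j) * \<Delta>} (\<lambda>u. f u (X u \<omega>))"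
        "F (real (i + j) * \<Delta>) \<omega> - F (real j * \<Delta>) \<omega> = (LINT u:{real j * \<Delta><..real (i + j) * \<Delta>}|lebesgue. f u (X u \<omega>))"
        using elim jT grid_interval(2)[OF g i] by auto
      show "F (real (i + j) * \<Delta>) \<omega> - F (real j * \<Delta>) \<omega> - (LINT u:{real j * \<Delta><..real (i + j) * \<Delta>}|lebesgue. f u y)
        = (LINT u:{real j * \<Delta><..real (i + j) * \<Delta>}|lebesgue. f u (X u \<omega>) - f u y)"
        unfolding e(2) by (rule set_integral_diff(2)[OF e(1) f_integrable[OF g i], symmetric])
    qed
    have "\<bar>filter_incr a \<Delta> (\<lambda>t. F t \<omega>) j - frozen_drift a \<Delta> j y\<bar> \<le> mass a * enn2real (ennreal K * N)"
      unfolding eq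
    proof (rule weighted_sum_le)
      fix i assume i: "i \<le> filter_p a"
      note gi = grid_interval[OF g i]
      let ?J = "{real j * \<Delta><..real (i + j) * \<Delta>}"
      have "real (i + j) * \<Delta> \<le> real (filter_p a + j) * \<Delta>" using g i by (intro mult_right_mono) (auto simp: grid_in_def)
      then have JI: "?J \<subseteq> I" unfolding I_def by (auto simp del: of_nat_add)
      have "real (i + j) * \<Delta> \<in> T" using g i by (auto simp: grid_in_def)
      then have iJ: "set_integrable lebesgue ?J (\<lambda>u. f u (X u \<omega>) - f u y)"
        using elim jT gi(2) by (intro set_integral_diff(1) f_integrable[OF g i]) auto
      have "ennreal (norm (\<integral>u. indicator ?J u *\<^sub>R (f u (X u \<omega>) - f u y) \<partial>lebesgue)) \<le> (\<integral>\<^sup>+u. norm (indicator ?J u *\<^sub>R (f u (X u \<omega>) - f u y)) \<partial>lebesgue)"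
        using iJ unfolding set_integrable_def by (rule integral_norm_bound_ennreal)
      also have "\<dots> \<le> (\<integral>\<^sup>+u. ennreal K * (ennreal \<bar>X u \<omega> - y\<bar> * indicator I u) \<partial>lebesgue)"
      proof (intro nn_integral_mono)
        fix u
        show "ennreal (norm (indicator ?J u *\<^sub>R (f u (X u \<omega>) - f u y))) \<le> ennreal K * (ennreal \<bar>X u \<omega> - y\<bar> * indicator I u)"
        proof (cases "u \<in> ?J")
          case True
          then have "\<bar>f u (X u \<omega>) - f u y\<bar> \<le> K * \<bar>X u \<omega> - y\<bar>" by (intro f_lip gi(4))
          then show ?thesis using True JI K by (auto simp: ennreal_mult[symmetric] intro!: ennreal_leI)
        qed simp
      qed
      also have "\<dots> \<le> ennreal K * N"
      proof -
        \<comment> \<open>The integrand is not known here to be measurable, so the constant is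
          pulled out of the supremum over simple functions: a simple function below
          \<open>K * g\<close> divided by \<open>K\<close> is one below \<open>g\<close>.\<close>
        have "(\<integral>\<^sup>+u. ennreal K * g u \<partial>lebesgue) \<le> ennreal K * (\<integral>\<^sup>+u. g u \<partial>lebesgue)" for g :: "real \<Rightarrow> ennreal"
        proof -
          have Kpos: "ennreal K \<noteq> 0" "ennreal K \<noteq> \<infinity>" using K by auto
          show ?thesis
            unfolding nn_integral_def
          proof (rule SUP_least)
            fix h assume h: "h \<in> {h. simple_function lebesgue h \<and> h \<le> (\<lambda>u. ennreal K * g u)}"
            define h' where "h' u = h u / ennreal K" for u
            have sf: "simple_function lebesgue h'" unfolding h'_def using h by (auto intro: simple_function_compose1)
            have hh: "h u = ennreal K * h' u" for u
              using Kpos unfolding h'_def by (metis mult.commute ennreal_times_divide mult_divide_eq_ennreal infinity_ennreal_def)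
            have "h' u \<le> g u" for u
            proof -
              have "h u \<le> ennreal K * g u" using h by (auto simp: le_fun_def)
              then show ?thesis unfolding hh using K by (simp add: ennreal_mult_le_mult_iff)
            qed
            then have "integral\<^sup>S lebesgue h' \<le> (SUP g' \<in> {g'. simple_function lebesgue g' \<and> g' \<le> g}. integral\<^sup>S lebesgue g')"
              using sf by (intro SUP_upper) (auto simp: le_fun_def)
            moreover have "integral\<^sup>S lebesgue h = ennreal K * integral\<^sup>S lebesgue h'"
              unfolding hh[abs_def] using sf by (rule simple_integral_mult)
            ultimately show "integral\<^sup>S lebesgue h \<le> ennreal K * (SUP g' \<in> {g'. simple_function lebesgue g' \<and> g' \<le> g}. integral\<^sup>S lebesgue g')"
              by (simp add: mult_left_mono)
          qed
        qed
        then show ?thesis unfolding N_def .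
      qed
      finally have "ennreal \<bar>LINT u:?J|lebesgue. f u (X u \<omega>) - f u y\<bar> \<le> ennreal K * N"
        by (simp add: set_lebesgue_integral_def)
      then have "enn2real (ennreal \<bar>LINT u:?J|lebesgue. f u (X u \<omega>) - f u y\<bar>) \<le> enn2real (ennreal K * N)"
        using False by (intro enn2real_mono) (auto simp: ennreal_mult_less_top less_top)
      then show "\<bar>LINT u:?J|lebesgue. f u (X u \<omega>) - f u y\<bar> \<le> enn2real (ennreal K * N)" by simp
    qed
    then have "ennreal \<bar>filter_incr a \<Delta> (\<lambda>t. F t \<omega>) j - frozen_drift a \<Delta> j y\<bar> \<le> ennreal (mass a * enn2real (ennreal K * N))"
      by (rule ennreal_leI)
    also have "\<dots> = ennreal (mass a) * (ennreal K * N)"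
      using False mass_nonneg[of a] by (simp add: ennreal_mult ennreal_enn2real ennreal_mult_less_top less_top)
    also have "\<dots> = ennreal (mass a * K) * N"
      using mass_nonneg[of a] K by (simp add: ennreal_mult mult.assoc)
    finally show ?thesis unfolding N_def I_def y_def .
  qed
qed

end

section \<open>Drift cross terms\<close>

text \<open>Rounding the points \<open>z j\<close> to a grid makes the blockwise estimate a statement about finitely many values.\<close>

lemma sewing_bound:
  fixes b z :: "nat \<Rightarrow> real" and \<psi> :: "nat \<Rightarrow> real \<Rightarrow> real" and K :: int and \<delta> :: real
  assumes N: "N < 2 ^ L" and \<delta>: "0 < \<delta>"
    and b: "\<And>j. j \<in> {1..N} \<Longrightarrow> \<bar>b j\<bar> \<le> \<beta>"
    and lip: "\<And>j y y'. j \<in> {1..N} \<Longrightarrow> \<bar>\<psi> j y - \<psi> j y'\<bar> \<le> \<Lambda> * \<bar>y - y'\<bar>" and \<Lambda>: "0 \<le> \<Lambda>"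
    and blk: "\<And>l q k. l < L \<Longrightarrow> q < 2 ^ (L - l) \<Longrightarrow> - K \<le> k \<Longrightarrow> k < K \<Longrightarrow>
      \<bar>\<Sum>j\<in>{q * 2 ^ l..<(q + 1) * 2 ^ l} \<inter> {1..N}. (\<psi> j (of_int (k + 1) * \<delta>) - \<psi> j (of_int k * \<delta>)) * b j\<bar> \<le> \<sigma> l * \<delta>"
    and base: "\<bar>\<Sum>j\<in>{1..N}. \<psi> j (of_int (round (z 0 / \<delta>)) * \<delta>) * b j\<bar> \<le> \<sigma>0"
    and range: "\<And>j. j \<le> N \<Longrightarrow> \<bar>z j\<bar> \<le> of_int (K - 1) * \<delta>"
    and incr: "\<And>l q. l < L \<Longrightarrow> (q + 1) * 2 ^ l \<le> N \<Longrightarrow> \<bar>z ((q + 1) * 2 ^ l) - z (q * 2 ^ l)\<bar> \<le> \<mu> l"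
    and pos: "\<And>l. 0 \<le> \<sigma> l" "\<And>l. 0 \<le> \<mu> l"
  shows "\<bar>\<Sum>j\<in>{1..N}. b j * \<psi> j (z j)\<bar> \<le> real N * \<beta> * \<Lambda> * \<delta> + \<sigma>0 + (\<Sum>l<L. 2 ^ (L - l) * (\<sigma> l * (\<mu> l + \<delta>)))"
proof -
  \<comment> \<open>Index of the grid point nearest to \<open>z j\<close>; the actual point is off
    by at most half a mesh.\<close>
  define kz where "kz j = round (z j / \<delta>)" for j
  \<comment> \<open>Extension by zero outside {1..N} allows telescoping over the full dyadic
    interval.\<close>
  define u where "u j k = (if j \<in> {1..N} then \<psi> j (of_int k * \<delta>) * b j else 0)" for j and k :: int
  have near: "\<bar>z j - of_int (kz j) * \<delta>\<bar> \<le> \<delta> / 2" for j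
  proof -
    have "\<bar>of_int (kz j) - z j / \<delta>\<bar> \<le> 1 / 2" unfolding kz_def by (rule of_int_round_abs_le)
    then have "\<bar>of_int (kz j) - z j / \<delta>\<bar> * \<delta> \<le> 1 / 2 * \<delta>" using \<delta> by (intro mult_right_mono) auto
    moreover have "\<bar>of_int (kz j) - z j / \<delta>\<bar> * \<delta> = \<bar>z j - of_int (kz j) * \<delta>\<bar>"
    proof -
      have "\<bar>of_int (kz j) - z j / \<delta>\<bar> * \<delta> = \<bar>(of_int (kz j) - z j / \<delta>) * \<delta>\<bar>" using \<delta> by (simp add: abs_mult)
      also have "(of_int (kz j) - z j / \<delta>) * \<delta> = of_int (kz j) * \<delta> - z j" using \<delta> by (simp add: field_simps)
      finally show ?thesis by (simp add: abs_minus_commute)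
    qed
    ultimately show ?thesis by simp
  qed
  \<comment> \<open>The range hypothesis reaches only to K - 1, which leaves room for the half mesh
    lost in rounding.\<close>
  have kzr: "- K \<le> kz j \<and> kz j \<le> K" if "j \<le> N" for j
  proof -
    have "\<bar>of_int (kz j) * \<delta>\<bar> \<le> of_int (K - 1) * \<delta> + \<delta> / 2" using near[of j] range[OF that] by linarith
    moreover have "\<bar>of_int (kz j) * \<delta>\<bar> = \<bar>of_int (kz j)\<bar> * \<delta>" using \<delta> by (simp add: abs_mult)
    moreover have "of_int (K - 1) * \<delta> = of_int K * \<delta> - \<delta>" by (simp add: left_diff_distrib)
    ultimately have "\<bar>of_int (kz j)\<bar> * \<delta> \<le> of_int K * \<delta>" using \<delta> by linarith
    then have "\<bar>real_of_int (kz j)\<bar> \<le> of_int K" using \<delta> by (rule mult_right_le_imp_le)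
    then show ?thesis by linarith
  qed
  have usum: "(\<Sum>j\<in>S. u j k) = (\<Sum>j\<in>S \<inter> {1..N}. \<psi> j (of_int k * \<delta>) * b j)" if "finite S" for S k
    unfolding u_def using that by (simp add: sum.If_cases Int_def)
  have tel: "\<bar>(\<Sum>j<2 ^ L. u j (kz j)) - (\<Sum>j<2 ^ L. u j (kz 0))\<bar> \<le> (\<Sum>l<L. 2 ^ (L - l) * (\<sigma> l * (\<mu> l + \<delta>)))"
  proof (rule dyadic_telescope)
    fix l q :: nat assume l: "l < L" and q: "q < 2 ^ (L - l)"
    define S where "S = {q * 2 ^ l..<(q + 1) * 2 ^ l}"
    have fS: "finite S" by (simp add: S_def)
    have pp: "0 \<le> \<sigma> l * (\<mu> l + \<delta>)" using pos[of l] \<delta> by simp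
    show "\<bar>(\<Sum>j\<in>{q * 2 ^ l..<(q + 1) * 2 ^ l}. u j (kz (q * 2 ^ l))) - (\<Sum>j\<in>{q * 2 ^ l..<(q + 1) * 2 ^ l}. u j (kz (q div 2 * 2 ^ (l + 1))))\<bar> \<le> \<sigma> l * (\<mu> l + \<delta>)"
    proof (cases "even q")
      \<comment> \<open>A left child starts where its parent starts, so its anchor does not move;
        only odd \<open>q\<close> contribute.\<close>
      case True
      then have e: "q div 2 * 2 ^ (l + 1) = q * 2 ^ l" by (auto elim!: evenE)
      show ?thesis unfolding e using pp by simp
    next
      case False
      then obtain r where r: "q = 2 * r + 1" by (rule oddE)
      have par: "q div 2 * 2 ^ (l + 1) = (2 * r) * 2 ^ l" "q * 2 ^ l = (2 * r + 1) * 2 ^ l" by (simp_all add: r)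
      show ?thesis
      proof (cases "q * 2 ^ l \<le> N")
        case False
        then have "S \<inter> {1..N} = {}" by (auto simp: S_def)
        then show ?thesis unfolding S_def[symmetric] usum[OF fS] using pp by simp
      next
        case True
        \<comment> \<open>For a right child the two anchors are the starts of neighbouring blocks,
          so the increment bound over one block of length \<open>2 ^ l\<close> applies.\<close>
        then have N1: "(2 * r + 1) * 2 ^ l \<le> N" "(2 * r) * 2 ^ l \<le> N" by (auto simp: r)
        define k k' where "k = kz ((2 * r + 1) * 2 ^ l)" and "k' = kz ((2 * r) * 2 ^ l)"
        define g where "g k = (\<Sum>j\<in>S \<inter> {1..N}. \<psi> j (of_int k * \<delta>) * b j)" for k
        have "\<bar>g k - g k'\<bar> \<le> of_int \<bar>k - k'\<bar> * (\<sigma> l * \<delta>)"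
        proof (rule adjacent_to_lipschitz[of K])
          fix i assume "- K \<le> i" "i < K"
          from blk[OF l q this] show "\<bar>g (i + 1) - g i\<bar> \<le> \<sigma> l * \<delta>"
            unfolding g_def S_def sum_subtractf[symmetric] left_diff_distrib[symmetric] .
        qed (use kzr[OF N1(1)] kzr[OF N1(2)] in \<open>auto simp: k_def k'_def\<close>)
        also have "\<dots> = \<sigma> l * \<bar>of_int k * \<delta> - of_int k' * \<delta>\<bar>"
          using \<delta> by (simp add: abs_mult left_diff_distrib[symmetric])
        also have "\<dots> \<le> \<sigma> l * (\<mu> l + \<delta>)"
        proof (rule mult_left_mono[OF _ pos(1)])
          have "\<bar>z ((2 * r + 1) * 2 ^ l) - z ((2 * r) * 2 ^ l)\<bar> \<le> \<mu> l" by (rule incr[OF l N1(1)])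
          then show "\<bar>of_int k * \<delta> - of_int k' * \<delta>\<bar> \<le> \<mu> l + \<delta>"
            using near[of "(2 * r + 1) * 2 ^ l"] near[of "(2 * r) * 2 ^ l"] unfolding k_def k'_def by linarith
        qed
        finally have "\<bar>g k - g k'\<bar> \<le> \<sigma> l * (\<mu> l + \<delta>)" .
        moreover have "kz (q * 2 ^ l) = k" "kz (q div 2 * 2 ^ (l + 1)) = k'" by (simp_all only: k_def k'_def par)
        ultimately show ?thesis by (simp only: S_def[symmetric] usum[OF fS] g_def)
      qed
    qed
  qed
  have inter: "{..<2 ^ L} \<inter> {1..N} = {1..N}" using N by auto
  have s1: "(\<Sum>j<2 ^ L. u j (kz j)) = (\<Sum>j\<in>{1..N}. \<psi> j (of_int (kz j) * \<delta>) * b j)"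
  proof -
    have "(\<Sum>j<2 ^ L. u j (kz j)) = (\<Sum>j\<in>{1..N}. u j (kz j))"
      using N by (intro sum.mono_neutral_right) (auto simp: u_def)
    then show ?thesis by (simp add: u_def)
  qed
  have s2: "(\<Sum>j<2 ^ L. u j (kz 0)) = (\<Sum>j\<in>{1..N}. \<psi> j (of_int (kz 0) * \<delta>) * b j)"
    using usum[of "{..<2 ^ L}" "kz 0"] unfolding inter by simp
  have round: "\<bar>(\<Sum>j\<in>{1..N}. b j * \<psi> j (z j)) - (\<Sum>j\<in>{1..N}. \<psi> j (of_int (kz j) * \<delta>) * b j)\<bar> \<le> real N * \<beta> * \<Lambda> * \<delta>"
  proof -
    have "\<bar>(\<Sum>j\<in>{1..N}. b j * \<psi> j (z j)) - (\<Sum>j\<in>{1..N}. \<psi> j (of_int (kz j) * \<delta>) * b j)\<bar> =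
        \<bar>\<Sum>j\<in>{1..N}. b j * (\<psi> j (z j) - \<psi> j (of_int (kz j) * \<delta>))\<bar>"
      by (simp add: sum_subtractf[symmetric] right_diff_distrib mult.commute)
    also have "\<dots> \<le> (\<Sum>j\<in>{1..N}. \<beta> * (\<Lambda> * \<delta>))"
    proof (intro order_trans[OF sum_abs] sum_mono)
      fix j assume j: "j \<in> {1..N}"
      have "\<bar>\<psi> j (z j) - \<psi> j (of_int (kz j) * \<delta>)\<bar> \<le> \<Lambda> * \<bar>z j - of_int (kz j) * \<delta>\<bar>" by (rule lip[OF j])
      also have "\<dots> \<le> \<Lambda> * \<delta>" using near[of j] \<delta> \<Lambda> by (intro mult_left_mono) auto
      finally show "\<bar>b j * (\<psi> j (z j) - \<psi> j (of_int (kz j) * \<delta>))\<bar> \<le> \<beta> * (\<Lambda> * \<delta>)"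
        unfolding abs_mult using b[OF j] order_trans[OF abs_ge_zero b[OF j]] by (intro mult_mono) auto
    qed
    also have "\<dots> = real N * \<beta> * \<Lambda> * \<delta>" by simp
    finally show ?thesis .
  qed
  show ?thesis using tel round base[folded kz_def] unfolding s1 s2 by linarith
qed

context perturbed_fbm
begin

lemma filter_incr_B_in_G: "grid_in a \<Delta> j \<Longrightarrow> (\<lambda>\<omega>. filter_incr a \<Delta> (\<lambda>t. B t \<omega>) j) \<in> gaussian_span T B"
  by (rule filter_incr_in_G) (simp add: grid_in_def)

lemma filter_incr_B_variance:
  assumes "diff_filter a" "grid_in a \<Delta> j"
  shows "(\<integral>\<omega>. (filter_incr a \<Delta> (\<lambda>t. B t \<omega>) j)\<^sup>2 \<partial>M) = \<Delta> powr (2 * H) * filter_cov H a a 0"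
  using filter_incr_cov[of a a \<Delta> j j] assms by (simp add: grid_in_def power2_eq_square)

lemma filter_cov_zero_nonneg:
  assumes "diff_filter a" "grid_in a \<Delta> j"
  shows "0 \<le> filter_cov H a a 0"
proof -
  have "0 \<le> \<Delta> powr (2 * H) * filter_cov H a a 0"
    unfolding filter_incr_B_variance[OF assms, symmetric] by simp
  then show ?thesis using assms by (simp add: grid_in_def zero_le_mult_iff)
qed

lemma filter_incr_B_abs:
  assumes a: "diff_filter a" and g: "grid_in a \<Delta> j"
  shows "integrable M (\<lambda>\<omega>. filter_incr a \<Delta> (\<lambda>t. B t \<omega>) j)"
    "(\<integral>\<omega>. \<bar>filter_incr a \<Delta> (\<lambda>t. B t \<omega>) j\<bar> \<partial>M) \<le> \<Delta> powr H * sqrt (filter_cov H a a 0)"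
proof -
  note G = filter_incr_B_in_G[OF g]
  show "integrable M (\<lambda>\<omega>. filter_incr a \<Delta> (\<lambda>t. B t \<omega>) j)" by (rule integrable_G[OF G])
  have "(\<integral>\<omega>. \<bar>filter_incr a \<Delta> (\<lambda>t. B t \<omega>) j\<bar> \<partial>M) \<le> sqrt (\<Delta> powr (2 * H) * filter_cov H a a 0)"
    using expectation_abs_le_sqrt(2)[OF measurable_G[OF G] integrable_power_G[OF G]]
    unfolding filter_incr_B_variance[OF a g] .
  also have "\<Delta> powr (2 * H) = (\<Delta> powr H)\<^sup>2" by (simp add: power2_eq_square powr_add[symmetric])
  finally show "(\<integral>\<omega>. \<bar>filter_incr a \<Delta> (\<lambda>t. B t \<omega>) j\<bar> \<partial>M) \<le> \<Delta> powr H * sqrt (filter_cov H a a 0)"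
    by (simp add: real_sqrt_mult)
qed

text \<open>Both the filtered increment of \<open>B\<close> and the increment of \<open>X\<close>
  within the window are of size \<Delta>^H, and the time integral over a window of length
  \<open>p * \<Delta>\<close> contributes one more factor \<Delta>. Tonelli's theorem permits taking
  expectations at fixed times.\<close>

lemma localisation_L1:
  assumes a: "diff_filter a" and g: "grid_in a \<Delta> j" and \<Delta>1: "\<Delta> \<le> 1"
  defines "p \<equiv> real (filter_p a)" and "r0 \<equiv> filter_cov H a a 0"
  defines "Q \<equiv> \<lambda>\<omega>. filter_incr a \<Delta> (\<lambda>t. B t \<omega>) j * (filter_incr a \<Delta> (\<lambda>t. F t \<omega>) j - frozen_drift a \<Delta> j (X (real j * \<Delta>) \<omega>))"
  defines "C \<equiv> mass a * K * (((r0 + p powr (2 * H)) / 2 + K * p * sqrt r0) * p)"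
  shows "integrable M Q" "(\<integral>\<omega>. \<bar>Q \<omega>\<bar> \<partial>M) \<le> C * \<Delta> powr (1 + 2 * H)"
proof -
  define b where "b \<omega> = filter_incr a \<Delta> (\<lambda>t. B t \<omega>) j" for \<omega>
  define I where "I = {real j * \<Delta>..real (filter_p a + j) * \<Delta>}"
  define Z where "Z = X (real j * \<Delta>)"
  have \<Delta>: "0 < \<Delta>" using g by (simp add: grid_in_def)
  have r0: "0 \<le> r0" unfolding r0_def by (rule filter_cov_zero_nonneg[OF a g])
  have p0: "0 \<le> p" by (simp add: p_def)
  have bG: "b \<in> gaussian_span T B" unfolding b_def[abs_def] by (rule filter_incr_B_in_G[OF g])
  have bm[measurable]: "b \<in> borel_measurable M" by (rule measurable_G[OF bG])
  have IT: "I \<subseteq> T" unfolding I_def by (rule grid_interval(1)[OF g order_refl])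
  have le: "real j * \<Delta> \<le> real (filter_p a + j) * \<Delta>" by (rule grid_interval(2)[OF g order_refl])
  have jI: "real j * \<Delta> \<in> I" using le by (simp add: I_def)
  then have jT: "real j * \<Delta> \<in> T" using IT by auto
  have Zm[measurable]: "Z \<in> borel_measurable M" unfolding Z_def by (rule X_measurable[OF jT])
  \<comment> \<open>The first summand comes from 2 |b d| <= b^2 + d^2 with \<open>d\<close> the
    increment of \<open>B\<close>. The second is the drift part K p \<Delta> E |b|, where
    \<Delta>^(1 + H) is at most \<Delta>^(2 H) because \<Delta> <= 1.\<close>
  define c where "c = \<Delta> powr (2 * H) * ((r0 + p powr (2 * H)) / 2 + K * p * sqrt r0)"
  have c0: "0 \<le> c" using r0 p0 K by (simp add: c_def)
  have cb: "(\<integral>\<^sup>+\<omega>. ennreal (\<bar>b \<omega>\<bar> * \<bar>X s \<omega> - Z \<omega>\<bar>) \<partial>M) \<le> ennreal c" if s: "s \<in> I" for s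
  proof -
    have sT: "s \<in> T" using s IT by auto
    define d where "d \<omega> = B s \<omega> - B (real j * \<Delta>) \<omega>" for \<omega>
    have dG: "d \<in> gaussian_span T B" unfolding d_def[abs_def] by (intro diff_G B_in_G sT jT)
    have dist: "\<bar>s - real j * \<Delta>\<bar> \<le> p * \<Delta>" using s by (simp add: I_def p_def algebra_simps)
    have int: "integrable M (\<lambda>\<omega>. ((b \<omega>)\<^sup>2 + (d \<omega>)\<^sup>2) / 2 + K * (p * \<Delta>) * \<bar>b \<omega>\<bar>)"
      using integrable_power_G[OF bG] integrable_power_G[OF dG] integrable_G[OF bG] by simp
    have "(\<integral>\<^sup>+\<omega>. ennreal (\<bar>b \<omega>\<bar> * \<bar>X s \<omega> - Z \<omega>\<bar>) \<partial>M) \<le> (\<integral>\<^sup>+\<omega>. ennreal (((b \<omega>)\<^sup>2 + (d \<omega>)\<^sup>2) / 2 + K * (p * \<Delta>) * \<bar>b \<omega>\<bar>) \<partial>M)"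
    proof (rule nn_integral_mono_AE, use X_increment in eventually_elim)
      case (elim \<omega>)
      then have "\<bar>X s \<omega> - Z \<omega>\<bar> \<le> \<bar>d \<omega>\<bar> + K * \<bar>s - real j * \<Delta>\<bar>" unfolding Z_def d_def using sT jT by blast
      also have "\<dots> \<le> \<bar>d \<omega>\<bar> + K * (p * \<Delta>)" using dist K by simp
      finally have "\<bar>b \<omega>\<bar> * \<bar>X s \<omega> - Z \<omega>\<bar> \<le> \<bar>b \<omega>\<bar> * (\<bar>d \<omega>\<bar> + K * (p * \<Delta>))" by (rule mult_left_mono) simp
      also have "\<dots> \<le> ((b \<omega>)\<^sup>2 + (d \<omega>)\<^sup>2) / 2 + K * (p * \<Delta>) * \<bar>b \<omega>\<bar>"
        using sum_squares_bound[of "\<bar>b \<omega>\<bar>" "\<bar>d \<omega>\<bar>"] by (simp add: algebra_simps)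
      finally show ?case by (rule ennreal_leI)
    qed
    also have "\<dots> = ennreal (\<integral>\<omega>. ((b \<omega>)\<^sup>2 + (d \<omega>)\<^sup>2) / 2 + K * (p * \<Delta>) * \<bar>b \<omega>\<bar> \<partial>M)"
      using int K p0 \<Delta> by (intro nn_integral_eq_integral) auto
    also have "\<dots> \<le> ennreal c"
    proof (rule ennreal_leI)
      have "(\<integral>\<omega>. ((b \<omega>)\<^sup>2 + (d \<omega>)\<^sup>2) / 2 + K * (p * \<Delta>) * \<bar>b \<omega>\<bar> \<partial>M)
          = ((\<integral>\<omega>. (b \<omega>)\<^sup>2 \<partial>M) + (\<integral>\<omega>. (d \<omega>)\<^sup>2 \<partial>M)) / 2 + K * (p * \<Delta>) * (\<integral>\<omega>. \<bar>b \<omega>\<bar> \<partial>M)"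
        using integrable_power_G[OF bG] integrable_power_G[OF dG] integrable_G[OF bG] by simp
      also have "(\<integral>\<omega>. (b \<omega>)\<^sup>2 \<partial>M) = \<Delta> powr (2 * H) * r0" unfolding b_def r0_def by (rule filter_incr_B_variance[OF a g])
      also have "(\<integral>\<omega>. (d \<omega>)\<^sup>2 \<partial>M) = \<bar>s - real j * \<Delta>\<bar> powr (2 * H)" unfolding d_def by (rule B_increment_variance[OF jT sT])
      also have "((\<Delta> powr (2 * H) * r0) + \<bar>s - real j * \<Delta>\<bar> powr (2 * H)) / 2 + K * (p * \<Delta>) * (\<integral>\<omega>. \<bar>b \<omega>\<bar> \<partial>M)
          \<le> ((\<Delta> powr (2 * H) * r0) + (p * \<Delta>) powr (2 * H)) / 2 + K * (p * \<Delta>) * (\<Delta> powr H * sqrt r0)"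
      proof (intro add_mono divide_right_mono mult_left_mono order_refl)
        show "\<bar>s - real j * \<Delta>\<bar> powr (2 * H) \<le> (p * \<Delta>) powr (2 * H)" using dist H by (intro powr_mono2) auto
        show "(\<integral>\<omega>. \<bar>b \<omega>\<bar> \<partial>M) \<le> \<Delta> powr H * sqrt r0" unfolding b_def r0_def by (rule filter_incr_B_abs(2)[OF a g])
      qed (use K p0 \<Delta> in auto)
      also have "(p * \<Delta>) powr (2 * H) = \<Delta> powr (2 * H) * p powr (2 * H)" using p0 \<Delta> by (simp add: powr_mult)
      also have "K * (p * \<Delta>) * (\<Delta> powr H * sqrt r0) = K * p * sqrt r0 * \<Delta> powr (1 + H)"
        using \<Delta> by (simp add: powr_add)
      also have "\<dots> \<le> K * p * sqrt r0 * \<Delta> powr (2 * H)"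
        using K p0 r0 \<Delta> \<Delta>1 H by (intro mult_left_mono powr_mono') auto
      finally show "(\<integral>\<omega>. ((b \<omega>)\<^sup>2 + (d \<omega>)\<^sup>2) / 2 + K * (p * \<Delta>) * \<bar>b \<omega>\<bar> \<partial>M) \<le> c"
        by (simp add: c_def algebra_simps add_divide_distrib)
    qed
    finally show ?thesis .
  qed
  have IS: "I \<in> sets lborel" by (simp add: I_def)
  obtain D where D[measurable]: "D \<in> borel_measurable M"
    and Dle: "AE \<omega> in M. (\<integral>\<^sup>+s\<in>I. ennreal \<bar>X s \<omega> - Z \<omega>\<bar> \<partial>lebesgue) \<le> D \<omega>"
    and Dint: "(\<integral>\<^sup>+\<omega>. ennreal \<bar>b \<omega>\<bar> * D \<omega> \<partial>M) \<le> ennreal c * emeasure lborel I"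
    by (rule tonelli_measurable_process[OF X_process T_interval(3) IT IS Zm bm cb]) (assumption | rule that)+
  have eI: "emeasure lborel I = ennreal (p * \<Delta>)"
    using le \<Delta> by (simp add: I_def p_def algebra_simps)
  have Fm[measurable]: "(\<lambda>\<omega>. filter_incr a \<Delta> (\<lambda>t. F t \<omega>) j) \<in> borel_measurable M"
    by (rule filter_incr_measurable[OF F_measurable g])
  have [measurable]: "frozen_drift a \<Delta> j \<in> borel_measurable borel" by (rule frozen_drift_measurable[OF g])
  have Qm[measurable]: "Q \<in> borel_measurable M"
    unfolding Q_def b_def[symmetric] Z_def[symmetric] by measurable
  have mK: "0 \<le> mass a * K" using mass_nonneg[of a] K by simp
  have CC: "ennreal (mass a * K) * (ennreal c * ennreal (p * \<Delta>)) = ennreal (C * \<Delta> powr (1 + 2 * H))"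
  proof -
    have "ennreal (mass a * K) * (ennreal c * ennreal (p * \<Delta>)) = ennreal (mass a * K * (c * (p * \<Delta>)))"
      using mK c0 p0 \<Delta> by (simp add: ennreal_mult)
    also have "mass a * K * (c * (p * \<Delta>)) = C * \<Delta> powr (1 + 2 * H)"
      using \<Delta> by (simp add: C_def c_def powr_add mult_ac)
    finally show ?thesis .
  qed
  have "(\<integral>\<^sup>+\<omega>. ennreal \<bar>Q \<omega>\<bar> \<partial>M) \<le> (\<integral>\<^sup>+\<omega>. ennreal (mass a * K) * (ennreal \<bar>b \<omega>\<bar> * D \<omega>) \<partial>M)"
  proof (rule nn_integral_mono_AE, use drift_localisation[OF a g] Dle in eventually_elim)
    case (elim \<omega>)
    have "ennreal \<bar>Q \<omega>\<bar> = ennreal \<bar>b \<omega>\<bar> * ennreal \<bar>filter_incr a \<Delta> (\<lambda>t. F t \<omega>) j - frozen_drift a \<Delta> j (X (real j * \<Delta>) \<omega>)\<bar>"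
      unfolding Q_def b_def[symmetric] abs_mult by (rule ennreal_mult) auto
    also have "\<dots> \<le> ennreal \<bar>b \<omega>\<bar> * (ennreal (mass a * K) * D \<omega>)"
      using order_trans[OF elim(1)[folded I_def Z_def] mult_left_mono[OF elim(2)]] unfolding Z_def
      by (intro mult_left_mono) auto
    finally show ?case by (simp add: mult_ac)
  qed
  also have "\<dots> = ennreal (mass a * K) * (\<integral>\<^sup>+\<omega>. ennreal \<bar>b \<omega>\<bar> * D \<omega> \<partial>M)" by (rule nn_integral_cmult) measurable
  also have "\<dots> \<le> ennreal (mass a * K) * (ennreal c * ennreal (p * \<Delta>))"
    using Dint unfolding eI by (rule mult_left_mono) simp
  also have "\<dots> = ennreal (C * \<Delta> powr (1 + 2 * H))" by (rule CC)
  finally have nn: "(\<integral>\<^sup>+\<omega>. ennreal \<bar>Q \<omega>\<bar> \<partial>M) \<le> ennreal (C * \<Delta> powr (1 + 2 * H))" .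
  show i: "integrable M Q"
    by (rule integrableI_bounded[OF Qm]) (use nn in \<open>simp add: le_less_trans\<close>)
  have C0: "0 \<le> C" using mass_nonneg[of a] r0 p0 K unfolding C_def by (intro mult_nonneg_nonneg add_nonneg_nonneg) auto
  have "ennreal (\<integral>\<omega>. \<bar>Q \<omega>\<bar> \<partial>M) = (\<integral>\<^sup>+\<omega>. ennreal \<bar>Q \<omega>\<bar> \<partial>M)"
    using i by (intro nn_integral_eq_integral[symmetric]) auto
  with nn have "ennreal (\<integral>\<omega>. \<bar>Q \<omega>\<bar> \<partial>M) \<le> ennreal (C * \<Delta> powr (1 + 2 * H))" by simp
  then show "(\<integral>\<omega>. \<bar>Q \<omega>\<bar> \<partial>M) \<le> C * \<Delta> powr (1 + 2 * H)"
    using C0 by (simp add: ennreal_le_iff)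
qed

text \<open>Absolute values suffice here, since \<open>n\<close> terms of size \<open>\<Delta> powr (H + 1)\<close> are small after normalisation.\<close>

lemma cross_term_crude:
  assumes a: "diff_filter a" and \<alpha>: "1/2 < \<alpha> * (1 - H)"
    and grid: "\<And>n j. j \<in> {1..n - filter_p a} \<Longrightarrow> grid_in a (real n powr - \<alpha>) j"
  shows "oP M (\<lambda>n \<omega>. real n powr (- 1/2) * (real n powr - \<alpha>) powr (- 2 * H) *
    (\<Sum>j\<in>{1..n - filter_p a}. filter_incr a (real n powr - \<alpha>) (\<lambda>t. B t \<omega>) j * filter_incr a (real n powr - \<alpha>) (\<lambda>t. F t \<omega>) j))"
proof -
  define r0 where "r0 = filter_cov H a a 0"
  define C where "C = mass a * K * real (filter_p a)"
  have C0: "0 \<le> C" using mass_nonneg[of a] K by (simp add: C_def)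
  define e where "e n = C * sqrt \<bar>r0\<bar> * real n powr (1/2 - \<alpha> * (1 - H))" for n
  show ?thesis
  proof (rule oP_L1[where e=e])
    have "(\<lambda>n. real n powr (1/2 - \<alpha> * (1 - H))) \<longlonglongrightarrow> 0"
      using \<alpha> by (intro tendsto_neg_powr filterlim_real_sequentially) simp
    then show "e \<longlonglongrightarrow> 0" unfolding e_def[abs_def] by (rule tendsto_mult_right_zero)
    show "\<forall>\<^sub>F n in sequentially. integrable M (\<lambda>\<omega>. real n powr (- 1/2) * (real n powr - \<alpha>) powr (- 2 * H) *
        (\<Sum>j\<in>{1..n - filter_p a}. filter_incr a (real n powr - \<alpha>) (\<lambda>t. B t \<omega>) j * filter_incr a (real n powr - \<alpha>) (\<lambda>t. F t \<omega>) j)) \<and>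
      (\<integral>\<omega>. \<bar>real n powr (- 1/2) * (real n powr - \<alpha>) powr (- 2 * H) *
        (\<Sum>j\<in>{1..n - filter_p a}. filter_incr a (real n powr - \<alpha>) (\<lambda>t. B t \<omega>) j * filter_incr a (real n powr - \<alpha>) (\<lambda>t. F t \<omega>) j)\<bar> \<partial>M) \<le> e n"
      using eventually_gt_at_top[of "filter_p a"]
    proof eventually_elim
      case (elim n)
      define \<Delta> where "\<Delta> = real n powr - \<alpha>"
      define w where "w = real n powr (- 1/2) * \<Delta> powr (- 2 * H)"
      have n: "0 < real n" using elim by simp
      have \<Delta>: "0 < \<Delta>" using n by (simp add: \<Delta>_def)
      define b where "b j \<omega> = filter_incr a \<Delta> (\<lambda>t. B t \<omega>) j" for j \<omega>
      define d where "d j \<omega> = filter_incr a \<Delta> (\<lambda>t. F t \<omega>) j" for j \<omega>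
      define J where "J = {1..n - filter_p a}"
      have g: "grid_in a \<Delta> j" if "j \<in> J" for j using grid that by (simp add: J_def \<Delta>_def)
      have "J \<noteq> {}" using elim by (simp add: J_def)
      then have r00: "0 \<le> r0" using filter_cov_zero_nonneg[OF a g] by (auto simp: r0_def)
      have ib: "integrable M (b j)" if "j \<in> J" for j unfolding b_def[abs_def] by (rule filter_incr_B_abs(1)[OF a g[OF that]])
      have dm: "d j \<in> borel_measurable M" if "j \<in> J" for j
        unfolding d_def[abs_def] by (rule filter_incr_measurable[OF F_measurable g[OF that]])
      have db: "AE \<omega> in M. \<bar>d j \<omega>\<bar> \<le> C * \<Delta>" if "j \<in> J" for j
        using filter_incr_F_bound[OF a]
      proof eventually_elim
        case (elim \<omega>)
        have "mass a * (K * (real (filter_p a) * \<Delta>)) = C * \<Delta>" by (simp add: C_def)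
        then show ?case using elim g[OF that] unfolding d_def by metis
      qed
      have bd: "AE \<omega> in M. \<bar>b j \<omega> * d j \<omega>\<bar> \<le> \<bar>b j \<omega>\<bar> * (C * \<Delta>)" if "j \<in> J" for j
        using db[OF that] by eventually_elim (simp add: abs_mult mult_left_mono)
      have ibd: "integrable M (\<lambda>\<omega>. b j \<omega> * d j \<omega>)" if "j \<in> J" for j
      proof (rule Bochner_Integration.integrable_bound)
        show "integrable M (\<lambda>\<omega>. \<bar>b j \<omega>\<bar> * (C * \<Delta>))" using ib[OF that] by (intro integrable_mult_left integrable_abs)
        show "(\<lambda>\<omega>. b j \<omega> * d j \<omega>) \<in> borel_measurable M"
          using borel_measurable_integrable[OF ib[OF that]] dm[OF that] by (rule borel_measurable_times)
        show "AE \<omega> in M. norm (b j \<omega> * d j \<omega>) \<le> norm (\<bar>b j \<omega>\<bar> * (C * \<Delta>))"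
          using bd[OF that] by eventually_elim (use C0 \<Delta> in \<open>simp add: abs_mult\<close>)
      qed
      have Ebd: "(\<integral>\<omega>. \<bar>b j \<omega> * d j \<omega>\<bar> \<partial>M) \<le> \<Delta> powr H * sqrt r0 * (C * \<Delta>)" if "j \<in> J" for j
      proof -
        have "(\<integral>\<omega>. \<bar>b j \<omega> * d j \<omega>\<bar> \<partial>M) \<le> (\<integral>\<omega>. \<bar>b j \<omega>\<bar> * (C * \<Delta>) \<partial>M)"
          using bd[OF that] ibd[OF that] ib[OF that] by (intro integral_mono_AE integrable_abs integrable_mult_left) auto
        also have "\<dots> = (\<integral>\<omega>. \<bar>b j \<omega>\<bar> \<partial>M) * (C * \<Delta>)" by simp
        also have "\<dots> \<le> \<Delta> powr H * sqrt r0 * (C * \<Delta>)"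
          using filter_incr_B_abs(2)[OF a g[OF that]] C0 \<Delta> unfolding b_def r0_def by (intro mult_right_mono) auto
        finally show ?thesis .
      qed
      have w0: "0 \<le> w" by (simp add: w_def)
      have intS: "integrable M (\<lambda>\<omega>. \<Sum>j\<in>J. b j \<omega> * d j \<omega>)" by (rule Bochner_Integration.integrable_sum[OF ibd])
      have "(\<integral>\<omega>. \<bar>w * (\<Sum>j\<in>J. b j \<omega> * d j \<omega>)\<bar> \<partial>M) \<le> (\<integral>\<omega>. w * (\<Sum>j\<in>J. \<bar>b j \<omega> * d j \<omega>\<bar>) \<partial>M)"
      proof (rule integral_mono)
        show "integrable M (\<lambda>\<omega>. \<bar>w * (\<Sum>j\<in>J. b j \<omega> * d j \<omega>)\<bar>)" by (intro integrable_abs integrable_mult_right intS)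
        show "integrable M (\<lambda>\<omega>. w * (\<Sum>j\<in>J. \<bar>b j \<omega> * d j \<omega>\<bar>))"
          by (intro integrable_mult_right Bochner_Integration.integrable_sum integrable_abs ibd)
        show "\<bar>w * (\<Sum>j\<in>J. b j \<omega> * d j \<omega>)\<bar> \<le> w * (\<Sum>j\<in>J. \<bar>b j \<omega> * d j \<omega>\<bar>)" for \<omega>
          unfolding abs_mult[of w] using w0 by (simp add: mult_left_mono sum_abs)
      qed
      also have "\<dots> = w * (\<Sum>j\<in>J. (\<integral>\<omega>. \<bar>b j \<omega> * d j \<omega>\<bar> \<partial>M))"
        by (simp only: integral_mult_right_zero) (subst Bochner_Integration.integral_sum, auto intro!: integrable_abs ibd)
      also have "\<dots> \<le> w * (\<Sum>j\<in>J. \<Delta> powr H * sqrt r0 * (C * \<Delta>))"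
        by (intro mult_left_mono sum_mono Ebd w0)
      also have "\<dots> \<le> w * (real n * (\<Delta> powr H * sqrt r0 * (C * \<Delta>)))"
        using w0 C0 \<Delta> r00 by (intro mult_left_mono) (auto simp: J_def intro!: mult_right_mono)
      also have "\<dots> = C * sqrt r0 * ((real n powr (- 1/2) * real n powr 1) * (\<Delta> powr (- 2 * H) * \<Delta> powr H * \<Delta> powr 1))"
        using n \<Delta> by (simp add: w_def mult_ac)
      also have "(real n powr (- 1/2) * real n powr 1) * (\<Delta> powr (- 2 * H) * \<Delta> powr H * \<Delta> powr 1) = real n powr (1/2 - \<alpha> * (1 - H))"
        unfolding powr_add[symmetric] \<Delta>_def powr_powr by (rule arg_cong[where f="\<lambda>z. real n powr z"]) (simp add: algebra_simps)
      finally have "(\<integral>\<omega>. \<bar>w * (\<Sum>j\<in>J. b j \<omega> * d j \<omega>)\<bar> \<partial>M) \<le> e n" using r00 by (simp add: e_def)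
      moreover have "integrable M (\<lambda>\<omega>. w * (\<Sum>j\<in>J. b j \<omega> * d j \<omega>))" by (intro integrable_mult_right intS)
      ultimately show ?case unfolding w_def b_def d_def J_def \<Delta>_def by simp
    qed
  qed
qed

text \<open>Four families of Gaussian variables are controlled at once: the increments of
  \<open>B\<close> under the filter, its increments between observation times, the block sums at
  neighbouring grid points, and the sum anchored at \<open>x\<close>. On the common event the rest
  is deterministic, by \<open>sewing_bound\<close>. The hypothesis \<alpha>2 makes the anchored sum
  small, \<alpha>3 the cost of moving the anchors.\<close>

lemma cross_term_regular:
  assumes a: "diff_filter a" and H2: "1/2 \<le> H" and T1: "T = {0..1}" and \<alpha>1: "1 \<le> \<alpha>"
    and \<beta>: "0 < \<beta>" "\<beta> < 1" and C: "0 \<le> C" "\<And>h. \<bar>filter_cov H a a h\<bar> \<le> C * (1 + \<bar>of_int h\<bar>) powr (- \<beta>)"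
    and \<alpha>2: "(1 - \<beta>) / 2 < \<alpha> * (1 - H)" and \<alpha>3: "1/2 - \<beta>/2 + H < \<alpha>"
  shows "oP M (\<lambda>n \<omega>. real n powr (- 1/2) * (real n powr - \<alpha>) powr (- 2 * H) *
    (\<Sum>j\<in>{1..n - filter_p a}. filter_incr a (real n powr - \<alpha>) (\<lambda>t. B t \<omega>) j *
      frozen_drift a (real n powr - \<alpha>) j (X (real j * real n powr - \<alpha>) \<omega>)))"
proof -
  define p where "p = filter_p a"
  define \<Delta> where "\<Delta> n = real n powr - \<alpha>" for n :: nat
  define b where "b n j \<omega> = filter_incr a (\<Delta> n) (\<lambda>t. B t \<omega>) j" for n j \<omega>
  define \<psi> where "\<psi> n = frozen_drift a (\<Delta> n)" for n
  define r0 where "r0 = filter_cov H a a 0"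
  \<comment> \<open>The added 1 here and in \<open>Cb\<close> and \<open>Cv\<close> keeps the bounds
    on standard deviations strictly positive, as the union bound requires, even for degenerate
    data.\<close>
  define C1 where "C1 = mass a * K * real p + 1"
  define Cb where "Cb = sqrt \<bar>r0\<bar> + 1"
  define Cv where "Cv = 2 * C / (1 - \<beta>) + 1"
  define \<gamma> where "\<gamma> = 1 - \<beta> / 2"
  \<comment> \<open>The smallest of the three gaps in the exponents of the final bound. A quarter of
    it suffices because the worst term carries n^(3 \<kappa>); the entry 1 ensures \<kappa> <
    1.\<close>
  define slack where "slack = min 1 (min (\<alpha> * (2 - H) - 1/2) (min (\<alpha> * (1 - H) - (1 - \<beta>) / 2) (\<alpha> - (1/2 - \<beta>/2 + H))))"
  define \<kappa> where "\<kappa> = slack / 4"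
  have s1: "1/2 < \<alpha> * (2 - H)"
  proof -
    have "1 * 1 < \<alpha> * (2 - H)" using H \<alpha>1 by (intro mult_le_less_imp_less) auto
    then show ?thesis by simp
  qed
  have \<kappa>: "0 < \<kappa>" using s1 \<alpha>2 \<alpha>3 by (simp add: \<kappa>_def slack_def)
  have sl: "4 * \<kappa> \<le> \<alpha> * (2 - H) - 1/2" "4 * \<kappa> \<le> \<alpha> * (1 - H) - (1 - \<beta>) / 2" "4 * \<kappa> \<le> \<alpha> - (1/2 - \<beta>/2 + H)"
    by (simp_all add: \<kappa>_def slack_def)
  have \<kappa>1: "\<kappa> < 1" by (simp add: \<kappa>_def slack_def)
  have C1: "0 < C1" using mass_nonneg[of a] K by (simp add: C1_def add_nonneg_pos)
  have Cb: "0 < Cb" by (simp add: Cb_def add_nonneg_pos)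
  have Cv: "0 < Cv" using C \<beta> by (simp add: Cv_def add_nonneg_pos)
  have \<gamma>: "1/2 < \<gamma>" "\<gamma> < 1" using \<beta> by (auto simp: \<gamma>_def)
  \<comment> \<open>A dyadic length just above n, at most twice as large, so passing to it costs
    only constants.\<close>
  have "\<exists>L. n < 2 ^ L \<and> 2 ^ L \<le> 2 * n" if "1 \<le> n" for n :: nat
  proof -
    from ex_power_ivl1[OF order_refl that] obtain m where "2 ^ m \<le> n" "n < 2 ^ (m + 1)" by blast
    then show ?thesis by (intro exI[of _ "m + 1"]) auto
  qed
  then obtain Lg :: "nat \<Rightarrow> nat" where Lg: "\<And>n. 1 \<le> n \<Longrightarrow> n < 2 ^ Lg n \<and> 2 ^ Lg n \<le> 2 * n" by metis
  \<comment> \<open>With mesh \<Delta> n the grid has to reach values of size n; the additional 1 is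
    the rounding margin asked for by \<open>sewing_bound\<close>.\<close>
  define Kn where "Kn n = \<lceil>real n / \<Delta> n\<rceil> + 1" for n
  define Blk where "Blk n l q = {q * 2 ^ l..<(q + 1) * 2 ^ l} \<inter> {1..n - p}" for n l q :: nat
  have \<Delta>: "0 < \<Delta> n" "\<Delta> n \<le> 1" "real n * \<Delta> n \<le> 1" if "0 < n" for n
  proof -
    show "0 < \<Delta> n" using that by (simp add: \<Delta>_def)
    have "real n powr - \<alpha> \<le> real n powr 0" using that \<alpha>1 by (intro powr_mono) auto
    then show "\<Delta> n \<le> 1" using that by (simp add: \<Delta>_def)
    have "real n * \<Delta> n = real n powr (1 - \<alpha>)" using that by (simp add: \<Delta>_def powr_diff powr_minus field_simps)
    also have "\<dots> \<le> real n powr 0" using that \<alpha>1 by (intro powr_mono) auto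
    finally show "real n * \<Delta> n \<le> 1" using that by simp
  qed
  have tT: "real u * \<Delta> n \<in> T" if "0 < n" "u \<le> n" for u n
  proof -
    have "real u * \<Delta> n \<le> real n * \<Delta> n" using that \<Delta>(1)[of n] by (intro mult_right_mono) auto
    then have "real u * \<Delta> n \<le> 1" using \<Delta>(3)[OF that(1)] by linarith
    moreover have "0 \<le> real u * \<Delta> n" using \<Delta>(1)[OF that(1)] by simp
    ultimately show ?thesis by (simp add: T1)
  qed
  have grid: "grid_in a (\<Delta> n) j" if "j \<in> {1..n - p}" for n j
    unfolding grid_in_def
  proof (intro conjI allI impI)
    have n: "0 < n" using that by auto
    then show "0 < \<Delta> n" by (rule \<Delta>(1))
    fix i assume "i \<le> filter_p a"
    then have "i + j \<le> n" using that by (auto simp: p_def)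
    then show "real (i + j) * \<Delta> n \<in> T" by (rule tT[OF n])
  qed
  have lip: "\<bar>\<psi> n j y - \<psi> n j y'\<bar> \<le> C1 * \<Delta> n * \<bar>y - y'\<bar>" and bnd: "\<bar>\<psi> n j y\<bar> \<le> C1 * \<Delta> n" if "j \<in> {1..n - p}" for n j y y'
  proof -
    have d: "0 < \<Delta> n" using grid[OF that] by (simp add: grid_in_def)
    have le: "mass a * (K * (real (filter_p a) * \<Delta> n)) \<le> C1 * \<Delta> n" using d by (simp add: C1_def p_def algebra_simps)
    show "\<bar>\<psi> n j y\<bar> \<le> C1 * \<Delta> n" unfolding \<psi>_def by (rule order_trans[OF frozen_drift_bound[OF grid[OF that]] le])
    show "\<bar>\<psi> n j y - \<psi> n j y'\<bar> \<le> C1 * \<Delta> n * \<bar>y - y'\<bar>"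
      unfolding \<psi>_def by (rule order_trans[OF frozen_drift_lipschitz[OF grid[OF that]] mult_right_mono[OF le]]) simp
  qed
  have bG: "b n j \<in> gaussian_span T B" if "j \<in> {1..n - p}" for n j
    unfolding b_def[abs_def] by (rule filter_incr_B_in_G[OF grid[OF that]])
  have blockvar: "(\<integral>\<omega>. (\<Sum>j\<in>J. w j * b n j \<omega>)\<^sup>2 \<partial>M) \<le> (W * (\<Delta> n powr H * sqrt Cv * real len powr \<gamma>))\<^sup>2"
    if n: "0 < n" and J: "J \<subseteq> {s..<s + len}" "J \<subseteq> {1..n - p}" and w: "\<And>j. j \<in> J \<Longrightarrow> \<bar>w j\<bar> \<le> W" "0 \<le> W" for n J s len w W
  proof -
    have "(\<integral>\<omega>. (\<Sum>j\<in>J. w j * b n j \<omega>)\<^sup>2 \<partial>M) \<le> W\<^sup>2 * \<Delta> n powr (2 * H) * (2 * C / (1 - \<beta>)) * real len powr (2 - \<beta>)"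
      unfolding b_def
    proof (rule block_variance[OF a \<Delta>(1)[OF n] _ \<beta> C J(1) w])
      fix i j assume "i \<le> filter_p a" "j \<in> J"
      then show "real (i + j) * \<Delta> n \<in> T" using grid[of j n] J(2) by (auto simp: grid_in_def)
    qed
    also have "\<dots> \<le> W\<^sup>2 * \<Delta> n powr (2 * H) * Cv * real len powr (2 - \<beta>)"
      by (intro mult_right_mono mult_left_mono) (auto simp: Cv_def)
    also have "\<dots> = (W * (\<Delta> n powr H * sqrt Cv * real len powr \<gamma>))\<^sup>2"
    proof -
      have "(\<Delta> n powr H)\<^sup>2 = \<Delta> n powr (2 * H)" "(real len powr \<gamma>)\<^sup>2 = real len powr (2 - \<beta>)"
        by (simp_all add: power2_eq_square powr_add[symmetric] \<gamma>_def)
      then show ?thesis using Cv by (simp add: power_mult_distrib)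
    qed
    finally show ?thesis .
  qed
  \<comment> \<open>Index sets of the union bounds: pairs of observation times for
    \<open>I2\<close>, triples of level, block and grid point for \<open>I3\<close>. Both are of
    polynomial size in n.\<close>
  define I2 where "I2 n = {(u, v). u < v \<and> v \<le> n}" for n :: nat
  define I3 where "I3 n = {..<Lg n} \<times> {..<(2::nat) ^ Lg n} \<times> {- Kn n..<Kn n}" for n
  \<comment> \<open>The difference of a block sum between neighbouring grid points. Its weights are
    deterministic and of size \<Delta>^2, one factor from the window and one from the mesh.\<close>
  define L3 where "L3 n i \<omega> = (case i of (l, q, k) \<Rightarrow> \<Sum>j\<in>Blk n l q. (\<psi> n j (of_int (k + 1) * \<Delta> n) - \<psi> n j (of_int k * \<Delta> n)) * b n j \<omega>)" for n i \<omega>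
  define sg where "sg n l = C1 * \<Delta> n * (\<Delta> n powr H * sqrt Cv * real ((2::nat) ^ l) powr \<gamma>)" for n l
  \<comment> \<open>The starting value is deterministic, so its rounding is too, and the sum
    \<open>L4\<close> anchored there is a single Gaussian variable.\<close>
  define y0 where "y0 n = of_int (round (x / \<Delta> n)) * \<Delta> n" for n
  define L4 where "L4 n i \<omega> = (\<Sum>j\<in>{1..n - p}. \<psi> n j (y0 n) * b n j \<omega>)" for n \<omega> and i :: unit
  have sg0: "0 < sg n l" if "0 < n" for n l using that C1 Cv \<Delta>(1)[OF that] by (simp add: sg_def)
  have fI2: "finite (I2 n)" for n by (rule finite_subset[of _ "{..n} \<times> {..n}"]) (auto simp: I2_def)
  have ev1: "\<forall>\<^sub>F n in sequentially. whp M (\<epsilon>/4) (\<lambda>\<omega>. \<forall>j\<in>{1..n - p}. \<bar>b n j \<omega>\<bar> \<le> real n powr \<kappa> * (Cb * \<Delta> n powr H))" if "0 < \<epsilon>" for \<epsilon>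
  proof (rule whp_union_bound[where q=1])
    show "\<forall>\<^sub>F n in sequentially. \<forall>j\<in>{1..n - p}. b n j \<in> gaussian_span T B \<and> 0 < Cb * \<Delta> n powr H \<and> (\<integral>\<omega>. (b n j \<omega>)\<^sup>2 \<partial>M) \<le> (Cb * \<Delta> n powr H)\<^sup>2"
      using eventually_gt_at_top[of 0]
    proof eventually_elim
      case (elim n)
      show ?case
      proof (intro ballI conjI)
        fix j assume j: "j \<in> {1..n - p}"
        show "b n j \<in> gaussian_span T B" by (rule bG[OF j])
        show "0 < Cb * \<Delta> n powr H" using Cb \<Delta>(1)[OF elim] by simp
        have "(\<integral>\<omega>. (b n j \<omega>)\<^sup>2 \<partial>M) = \<Delta> n powr (2 * H) * r0"
          unfolding b_def r0_def by (rule filter_incr_B_variance[OF a grid[OF j]])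
        also have "\<dots> \<le> \<Delta> n powr (2 * H) * Cb\<^sup>2"
        proof (rule mult_left_mono)
          have "r0 \<le> (sqrt \<bar>r0\<bar>)\<^sup>2" by simp
          also have "\<dots> \<le> Cb\<^sup>2" unfolding Cb_def by (rule power_mono) auto
          finally show "r0 \<le> Cb\<^sup>2" .
        qed simp
        also have "\<dots> = (Cb * \<Delta> n powr H)\<^sup>2" by (simp add: power_mult_distrib power2_eq_square[of "_ powr _"] powr_add[symmetric])
        finally show "(\<integral>\<omega>. (b n j \<omega>)\<^sup>2 \<partial>M) \<le> (Cb * \<Delta> n powr H)\<^sup>2" .
      qed
    qed
    show "\<forall>\<^sub>F n in sequentially. real (card {1..n - p}) \<le> real n powr 1"
      using eventually_gt_at_top[of 0] by eventually_elim simp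
  qed (use \<kappa> that in auto)
  have ev2: "\<forall>\<^sub>F n in sequentially. whp M (\<epsilon>/4) (\<lambda>\<omega>. \<forall>i\<in>I2 n. \<bar>(case i of (u, v) \<Rightarrow> \<lambda>\<omega>. B (real v * \<Delta> n) \<omega> - B (real u * \<Delta> n) \<omega>) \<omega>\<bar> \<le> real n powr \<kappa> * (case i of (u, v) \<Rightarrow> (real (v - u) * \<Delta> n) powr H))" if "0 < \<epsilon>" for \<epsilon>
  proof (rule whp_union_bound[where q=3 and L="\<lambda>n i. case i of (u, v) \<Rightarrow> \<lambda>\<omega>. B (real v * \<Delta> n) \<omega> - B (real u * \<Delta> n) \<omega>"])
    show "\<forall>\<^sub>F n in sequentially. \<forall>i\<in>I2 n. (case i of (u, v) \<Rightarrow> \<lambda>\<omega>. B (real v * \<Delta> n) \<omega> - B (real u * \<Delta> n) \<omega>) \<in> gaussian_span T B \<and>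
      0 < (case i of (u, v) \<Rightarrow> (real (v - u) * \<Delta> n) powr H) \<and>
      (\<integral>\<omega>. ((case i of (u, v) \<Rightarrow> \<lambda>\<omega>. B (real v * \<Delta> n) \<omega> - B (real u * \<Delta> n) \<omega>) \<omega>)\<^sup>2 \<partial>M) \<le> (case i of (u, v) \<Rightarrow> (real (v - u) * \<Delta> n) powr H)\<^sup>2"
      using eventually_gt_at_top[of 0]
    proof eventually_elim
      case (elim n)
      show ?case
      proof (rule ballI)
        fix i assume "i \<in> I2 n"
        then obtain u v where i: "i = (u, v)" "u < v" "v \<le> n" by (auto simp: I2_def)
        have uv: "real u * \<Delta> n \<in> T" "real v * \<Delta> n \<in> T" using i elim by (auto intro!: tT)
        have d: "\<bar>real v * \<Delta> n - real u * \<Delta> n\<bar> = real (v - u) * \<Delta> n"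
          using i \<Delta>(1)[OF elim] by (simp add: of_nat_diff left_diff_distrib)
        have "(\<lambda>\<omega>. B (real v * \<Delta> n) \<omega> - B (real u * \<Delta> n) \<omega>) \<in> gaussian_span T B"
          by (intro diff_G B_in_G uv)
        moreover have "0 < (real (v - u) * \<Delta> n) powr H" using i \<Delta>(1)[OF elim] by simp
        moreover have "(\<integral>\<omega>. (B (real v * \<Delta> n) \<omega> - B (real u * \<Delta> n) \<omega>)\<^sup>2 \<partial>M) = ((real (v - u) * \<Delta> n) powr H)\<^sup>2"
          unfolding B_increment_variance[OF uv] d by (simp add: power2_eq_square powr_add[symmetric])
        ultimately show "(case i of (u, v) \<Rightarrow> \<lambda>\<omega>. B (real v * \<Delta> n) \<omega> - B (real u * \<Delta> n) \<omega>) \<in> gaussian_span T B \<and>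
          0 < (case i of (u, v) \<Rightarrow> (real (v - u) * \<Delta> n) powr H) \<and>
          (\<integral>\<omega>. ((case i of (u, v) \<Rightarrow> \<lambda>\<omega>. B (real v * \<Delta> n) \<omega> - B (real u * \<Delta> n) \<omega>) \<omega>)\<^sup>2 \<partial>M) \<le> (case i of (u, v) \<Rightarrow> (real (v - u) * \<Delta> n) powr H)\<^sup>2"
          by (simp add: i(1))
      qed
    qed
    show "\<forall>\<^sub>F n in sequentially. real (card (I2 n)) \<le> real n powr 3"
      using eventually_ge_at_top[of 4]
    proof eventually_elim
      case (elim n)
      have "card (I2 n) \<le> card ({..n} \<times> {..n})" by (rule card_mono) (auto simp: I2_def)
      then have "card (I2 n) \<le> (n + 1) * (n + 1)" by (simp only: card_cartesian_product card_atMost Suc_eq_plus1)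
      then have "real (card (I2 n)) \<le> real ((n + 1) * (n + 1))" by (simp only: of_nat_le_iff)
      also have "\<dots> = (real n + 1)\<^sup>2" by (simp add: power2_eq_square algebra_simps)
      finally have "real (card (I2 n)) \<le> (real n + 1)\<^sup>2" .
      also have "\<dots> \<le> (2 * real n)\<^sup>2" using elim by (intro power_mono) auto
      also have "\<dots> = 4 * (real n)\<^sup>2" by (simp add: power_mult_distrib)
      also have "\<dots> \<le> real n * (real n)\<^sup>2" using elim by (intro mult_right_mono) auto
      also have "\<dots> = real n powr 3" using elim by (simp add: powr_numeral power3_eq_cube power2_eq_square)
      finally show ?case .
    qed
  qed (use \<kappa> that fI2 in auto)
  have ev3: "\<forall>\<^sub>F n in sequentially. whp M (\<epsilon>/4) (\<lambda>\<omega>. \<forall>i\<in>I3 n. \<bar>L3 n i \<omega>\<bar> \<le> real n powr \<kappa> * (sg n (fst i) * \<Delta> n))" if "0 < \<epsilon>" for \<epsilon>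
  \<comment> \<open>Levels and blocks contribute at most 2 n each and grid points at most 6 n^(1 +
    \<alpha>); the constant 24 is absorbed by a further n^2, in total n^(\<alpha> + 5).\<close>
  proof (rule whp_union_bound[where q="\<alpha> + 5"])
    show "\<forall>\<^sub>F n in sequentially. \<forall>i\<in>I3 n. L3 n i \<in> gaussian_span T B \<and> 0 < sg n (fst i) * \<Delta> n \<and> (\<integral>\<omega>. (L3 n i \<omega>)\<^sup>2 \<partial>M) \<le> (sg n (fst i) * \<Delta> n)\<^sup>2"
      using eventually_gt_at_top[of 0]
    proof eventually_elim
      case (elim n)
      show ?case
      proof (intro ballI conjI)
        fix i assume "i \<in> I3 n"
        obtain l q k where i: "i = (l, q, k)" by (cases i) auto
        have sub: "Blk n l q \<subseteq> {q * 2 ^ l..<q * 2 ^ l + 2 ^ l}" "Blk n l q \<subseteq> {1..n - p}" by (auto simp: Blk_def)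
        define w where "w j = \<psi> n j (of_int (k + 1) * \<Delta> n) - \<psi> n j (of_int k * \<Delta> n)" for j
        have w: "\<bar>w j\<bar> \<le> C1 * \<Delta> n * \<Delta> n" if "j \<in> Blk n l q" for j
        proof -
          have "\<bar>w j\<bar> \<le> C1 * \<Delta> n * \<bar>of_int (k + 1) * \<Delta> n - of_int k * \<Delta> n\<bar>" unfolding w_def using that sub by (intro lip) auto
          also have "\<bar>of_int (k + 1) * \<Delta> n - of_int k * \<Delta> n\<bar> = \<Delta> n" using \<Delta>(1)[OF elim] by (simp add: algebra_simps)
          finally show ?thesis .
        qed
        have Li: "L3 n i = (\<lambda>\<omega>. \<Sum>j\<in>Blk n l q. w j * b n j \<omega>)" by (simp add: L3_def[abs_def] i w_def)
        show "L3 n i \<in> gaussian_span T B" unfolding Li using sub by (intro sum_G bG) (auto simp: Blk_def)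
        show "0 < sg n (fst i) * \<Delta> n" using sg0[OF elim] \<Delta>(1)[OF elim] by simp
        have "(\<integral>\<omega>. (L3 n i \<omega>)\<^sup>2 \<partial>M) \<le> (C1 * \<Delta> n * \<Delta> n * (\<Delta> n powr H * sqrt Cv * real (2 ^ l) powr \<gamma>))\<^sup>2"
          unfolding Li using C1 \<Delta>(1)[OF elim] by (intro blockvar[OF elim sub w]) auto
        then show "(\<integral>\<omega>. (L3 n i \<omega>)\<^sup>2 \<partial>M) \<le> (sg n (fst i) * \<Delta> n)\<^sup>2" by (simp add: sg_def i mult_ac)
      qed
    qed
    show "\<forall>\<^sub>F n in sequentially. real (card (I3 n)) \<le> real n powr (\<alpha> + 5)"
      using eventually_ge_at_top[of 5]
    proof eventually_elim
      case (elim n)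
      then have n: "0 < n" "1 \<le> n" by auto
      have L2: "(2::real) ^ Lg n \<le> 2 * real n"
      proof -
        have "real (2 ^ Lg n) \<le> real (2 * n)" using Lg[OF n(2)] by (simp only: of_nat_le_iff)
        then show ?thesis by simp
      qed
      have "real (Lg n) \<le> 2 ^ Lg n" using less_exp[of "Lg n"] by (simp add: of_nat_less_two_power less_imp_le)
      then have L1: "real (Lg n) \<le> 2 * real n" using L2 by linarith
      have nd: "real n / \<Delta> n = real n powr (1 + \<alpha>)" using n by (simp add: \<Delta>_def powr_add powr_minus field_simps)
      have one: "1 \<le> real n powr (1 + \<alpha>)" using n \<alpha>1 by (intro ge_one_powr_ge_zero) auto
      have "0 \<le> real n / \<Delta> n" using \<Delta>(1)[OF n(1)] by simp
      then have "- 1 < real n / \<Delta> n" by linarith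
      then have "0 \<le> \<lceil>real n / \<Delta> n\<rceil>" by (simp only: zero_le_ceiling)
      then have Kn0: "0 \<le> Kn n" by (simp add: Kn_def)
      have Knle: "real_of_int (Kn n) \<le> real n powr (1 + \<alpha>) + 2" unfolding Kn_def nd by linarith
      have "real (card (I3 n)) = real (Lg n) * (2 ^ Lg n * (2 * of_int (Kn n)))"
        using Kn0 by (simp add: I3_def card_cartesian_product)
      also have "\<dots> \<le> (2 * real n) * ((2 * real n) * (2 * (real n powr (1 + \<alpha>) + 2)))"
        using L1 L2 Knle Kn0 by (intro mult_mono) auto
      also have "\<dots> \<le> (2 * real n) * ((2 * real n) * (2 * (3 * real n powr (1 + \<alpha>))))"
        using one by (intro mult_left_mono) auto
      also have "\<dots> = 24 * (real n)\<^sup>2 * real n powr (1 + \<alpha>)" by (simp add: power2_eq_square)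
      also have "\<dots> \<le> (real n)\<^sup>2 * (real n)\<^sup>2 * real n powr (1 + \<alpha>)"
      proof (intro mult_right_mono)
        have "24 \<le> (5::real)\<^sup>2" by simp
        also have "\<dots> \<le> (real n)\<^sup>2" using elim by (intro power_mono) auto
        finally show "24 \<le> (real n)\<^sup>2" .
      qed auto
      also have "\<dots> = real n powr (2 + 2 + (1 + \<alpha>))"
        using n by (simp only: powr_add powr_numeral of_nat_0_le_iff)
      finally show ?case by (simp add: add.commute)
    qed
  qed (use \<kappa> that in \<open>auto simp: I3_def\<close>)
  have ev4: "\<forall>\<^sub>F n in sequentially. whp M (\<epsilon>/4) (\<lambda>\<omega>. \<forall>i\<in>{()}. \<bar>L4 n i \<omega>\<bar> \<le> real n powr \<kappa> * sg n (Lg n))" if "0 < \<epsilon>" for \<epsilon>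
  proof (rule whp_union_bound[where q=0])
    show "\<forall>\<^sub>F n in sequentially. \<forall>i\<in>{()}. L4 n i \<in> gaussian_span T B \<and> 0 < sg n (Lg n) \<and> (\<integral>\<omega>. (L4 n i \<omega>)\<^sup>2 \<partial>M) \<le> (sg n (Lg n))\<^sup>2"
      using eventually_gt_at_top[of 0]
    proof eventually_elim
      case (elim n)
      have "1 \<le> n" using elim by simp
      from Lg[OF this] have sub: "{1..n - p} \<subseteq> {0..<0 + 2 ^ Lg n}" by auto
      have L4n: "L4 n i = (\<lambda>\<omega>. \<Sum>j\<in>{1..n - p}. \<psi> n j (y0 n) * b n j \<omega>)" for i by (simp add: L4_def[abs_def])
      have "L4 n i \<in> gaussian_span T B" for i unfolding L4n by (intro sum_G bG) auto
      moreover have "(\<integral>\<omega>. (L4 n i \<omega>)\<^sup>2 \<partial>M) \<le> (C1 * \<Delta> n * (\<Delta> n powr H * sqrt Cv * real (2 ^ Lg n) powr \<gamma>))\<^sup>2" for i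
        unfolding L4n using C1 \<Delta>(1)[OF elim] by (intro blockvar[OF elim sub order_refl bnd]) auto
      ultimately show ?case using sg0[OF elim] by (simp add: sg_def)
    qed
    show "\<forall>\<^sub>F n in sequentially. real (card {()}) \<le> real n powr 0"
      using eventually_gt_at_top[of 0] by eventually_elim simp
  qed (use \<kappa> that in auto)
  define TB where "TB n = real (n - p) * (real n powr \<kappa> * (Cb * \<Delta> n powr H)) * (C1 * \<Delta> n) * \<Delta> n + real n powr \<kappa> * sg n (Lg n) +
     (\<Sum>l<Lg n. 2 ^ (Lg n - l) * (real n powr \<kappa> * sg n l * (real n powr \<kappa> * (real (2 ^ l) * \<Delta> n) powr H + K * (real (2 ^ l) * \<Delta> n) + \<Delta> n)))" for n
  have deterministic: "\<bar>\<Sum>j\<in>{1..n - p}. b n j \<omega> * \<psi> n j (X (real j * \<Delta> n) \<omega>)\<bar> \<le> TB n"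
    if n: "0 < n" and nx: "\<bar>x\<bar> + real n powr \<kappa> + K \<le> real n" and e1: "\<forall>j\<in>{1..n - p}. \<bar>b n j \<omega>\<bar> \<le> real n powr \<kappa> * (Cb * \<Delta> n powr H)"
      and e2: "\<forall>i\<in>I2 n. \<bar>(case i of (u, v) \<Rightarrow> \<lambda>\<omega>. B (real v * \<Delta> n) \<omega> - B (real u * \<Delta> n) \<omega>) \<omega>\<bar> \<le> real n powr \<kappa> * (case i of (u, v) \<Rightarrow> (real (v - u) * \<Delta> n) powr H)"
      and e3: "\<forall>i\<in>I3 n. \<bar>L3 n i \<omega>\<bar> \<le> real n powr \<kappa> * (sg n (fst i) * \<Delta> n)"
      and e4: "\<forall>i\<in>{()}. \<bar>L4 n i \<omega>\<bar> \<le> real n powr \<kappa> * sg n (Lg n)"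
      and xi: "\<forall>s\<in>T. \<forall>t\<in>T. \<bar>X t \<omega> - X s \<omega>\<bar> \<le> \<bar>B t \<omega> - B s \<omega>\<bar> + K * \<bar>t - s\<bar>" and x0: "X 0 \<omega> = x" for n \<omega>
    unfolding TB_def
  proof (rule sewing_bound[where z="\<lambda>j. X (real j * \<Delta> n) \<omega>" and K="Kn n"])
    have n1: "1 \<le> n" using n by simp
    show "n - p < 2 ^ Lg n" using Lg[OF n1] by (meson diff_le_self le_less_trans)
    show "0 < \<Delta> n" by (rule \<Delta>(1)[OF n])
    show "\<bar>b n j \<omega>\<bar> \<le> real n powr \<kappa> * (Cb * \<Delta> n powr H)" if "j \<in> {1..n - p}" for j using e1 that by blast
    show "\<bar>\<psi> n j y - \<psi> n j y'\<bar> \<le> C1 * \<Delta> n * \<bar>y - y'\<bar>" if "j \<in> {1..n - p}" for j y y' by (rule lip[OF that])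
    show "0 \<le> C1 * \<Delta> n" using C1 \<Delta>(1)[OF n] by simp
    show "\<bar>\<Sum>j\<in>{q * 2 ^ l..<(q + 1) * 2 ^ l} \<inter> {1..n - p}. (\<psi> n j (of_int (k + 1) * \<Delta> n) - \<psi> n j (of_int k * \<Delta> n)) * b n j \<omega>\<bar> \<le> real n powr \<kappa> * sg n l * \<Delta> n"
      if l: "l < Lg n" and q: "q < 2 ^ (Lg n - l)" and k: "- Kn n \<le> k" "k < Kn n" for l q k
    proof -
      have "q < 2 ^ Lg n" using q by (rule less_le_trans) (intro power_increasing, auto)
      then have "(l, q, k) \<in> I3 n" using l k by (simp add: I3_def)
      with e3 have "\<bar>L3 n (l, q, k) \<omega>\<bar> \<le> real n powr \<kappa> * (sg n l * \<Delta> n)" by fastforce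
      then show ?thesis by (simp add: L3_def Blk_def mult.assoc)
    qed
    show "\<bar>\<Sum>j\<in>{1..n - p}. \<psi> n j (of_int (round (X (real 0 * \<Delta> n) \<omega> / \<Delta> n)) * \<Delta> n) * b n j \<omega>\<bar> \<le> real n powr \<kappa> * sg n (Lg n)"
      using e4 x0 by (simp add: L4_def y0_def)
    have Bdiff: "\<bar>B (real v * \<Delta> n) \<omega> - B (real u * \<Delta> n) \<omega>\<bar> \<le> real n powr \<kappa> * (real (v - u) * \<Delta> n) powr H" if "u < v" "v \<le> n" for u v
      using e2 that by (auto simp: I2_def)
    have Xdiff: "\<bar>X (real v * \<Delta> n) \<omega> - X (real u * \<Delta> n) \<omega>\<bar> \<le> real n powr \<kappa> * (real (v - u) * \<Delta> n) powr H + K * (real (v - u) * \<Delta> n)" if "u < v" "v \<le> n" for u v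
    proof -
      have uv: "real u * \<Delta> n \<in> T" "real v * \<Delta> n \<in> T" using that n by (auto intro!: tT)
      have "\<bar>real v * \<Delta> n - real u * \<Delta> n\<bar> = real (v - u) * \<Delta> n"
        using that \<Delta>(1)[OF n] by (simp add: of_nat_diff left_diff_distrib)
      then show ?thesis using xi[rule_format, OF uv] Bdiff[OF that] by simp
    qed
    show "\<bar>X (real j * \<Delta> n) \<omega>\<bar> \<le> of_int (Kn n - 1) * \<Delta> n" if j: "j \<le> n - p" for j
    proof -
      have "\<bar>X (real j * \<Delta> n) \<omega> - x\<bar> \<le> real n powr \<kappa> + K"
      proof (cases "j = 0")
        case True then show ?thesis using x0 K by (simp add: add_nonneg_nonneg)
      next
        case False
        have j1: "real j * \<Delta> n \<le> 1"
        proof -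
          have "real j * \<Delta> n \<le> real n * \<Delta> n" using j \<Delta>(1)[OF n] by (intro mult_right_mono) auto
          then show ?thesis using \<Delta>(3)[OF n] by linarith
        qed
        have j0: "0 \<le> real j * \<Delta> n" using \<Delta>(1)[OF n] by simp
        have "\<bar>X (real j * \<Delta> n) \<omega> - X (real 0 * \<Delta> n) \<omega>\<bar> \<le> real n powr \<kappa> * (real (j - 0) * \<Delta> n) powr H + K * (real (j - 0) * \<Delta> n)"
          using False j by (intro Xdiff) auto
        also have "\<dots> \<le> real n powr \<kappa> * 1 + K * 1"
          using j0 j1 K H by (intro add_mono mult_left_mono powr_le1) auto
        finally show ?thesis using x0 by simp
      qed
      then have "\<bar>X (real j * \<Delta> n) \<omega>\<bar> \<le> real n" using nx by linarith
      also have "\<dots> \<le> of_int (Kn n - 1) * \<Delta> n"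
      proof -
        have "real n / \<Delta> n \<le> of_int (Kn n - 1)" by (simp add: Kn_def)
        then show ?thesis using \<Delta>(1)[OF n] by (simp add: divide_le_eq)
      qed
      finally show ?thesis .
    qed
    show "\<bar>X (real ((q + 1) * 2 ^ l) * \<Delta> n) \<omega> - X (real (q * 2 ^ l) * \<Delta> n) \<omega>\<bar> \<le> real n powr \<kappa> * (real (2 ^ l) * \<Delta> n) powr H + K * (real (2 ^ l) * \<Delta> n)"
      if "(q + 1) * 2 ^ l \<le> n - p" for l q
    proof -
      have d: "(q + 1) * 2 ^ l - q * 2 ^ l = 2 ^ l" by simp
      have "q * 2 ^ l < (q + 1) * 2 ^ l" "(q + 1) * 2 ^ l \<le> n" using that by auto
      from Xdiff[OF this] show ?thesis unfolding d .
    qed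
    show "0 \<le> real n powr \<kappa> * sg n l" for l using sg0[OF n, of l] by simp
    show "0 \<le> real n powr \<kappa> * (real (2 ^ l) * \<Delta> n) powr H + K * (real (2 ^ l) * \<Delta> n)" for l
      using K \<Delta>(1)[OF n] by (intro add_nonneg_nonneg mult_nonneg_nonneg) auto
  qed
  \<comment> \<open>\<open>TB\<close> after normalisation. In the last exponent one \<kappa> stems
    from the block sums, one from the increments of \<open>X\<close> and one from the number of
    levels.\<close>
  define tot where "tot n = Cb * C1 * real n powr (1/2 + \<kappa> - \<alpha> * (2 - H)) + C1 * sqrt Cv * 2 powr \<gamma> * real n powr (\<kappa> + \<gamma> - 1/2 - \<alpha> * (1 - H)) +
     C1 * sqrt Cv * (K + 2) * 2 powr (\<gamma> + H) * real n powr (3 * \<kappa> + \<gamma> + H - 1/2 - \<alpha>)" for n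
  have tot0: "tot \<longlonglongrightarrow> 0"
  proof -
    have z: "(\<lambda>n. c * real n powr e) \<longlonglongrightarrow> 0" if "e < 0" for c e :: real
      by (rule tendsto_mult_right_zero) (intro tendsto_neg_powr filterlim_real_sequentially that)
    have e1: "1/2 + \<kappa> - \<alpha> * (2 - H) < 0" using sl(1) \<kappa> by linarith
    have "\<kappa> + \<gamma> - 1/2 - A < 0" if "4 * \<kappa> \<le> A - (1 - \<beta>) / 2" for A
      using that \<kappa> unfolding \<gamma>_def by (simp add: field_simps)
    from this[OF sl(2)] have e2: "\<kappa> + \<gamma> - 1/2 - \<alpha> * (1 - H) < 0" .
    have e3: "3 * \<kappa> + \<gamma> + H - 1/2 - \<alpha> < 0" using sl(3) \<kappa> unfolding \<gamma>_def by (simp add: field_simps)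
    show ?thesis unfolding tot_def[abs_def] using tendsto_add[OF tendsto_add[OF z[OF e1] z[OF e2]] z[OF e3]] by simp
  qed
  \<comment> \<open>The number of levels is logarithmic in n, hence eventually below any positive
    power.\<close>
  have Llog: "\<forall>\<^sub>F n in sequentially. real (Lg n) \<le> real n powr \<kappa>"
  proof -
    have "((\<lambda>n. ln (real n) / real n powr \<kappa>) \<longlongrightarrow> 0) sequentially" by (rule lim_ln_over_power[OF \<kappa>])
    then have "\<forall>\<^sub>F n in sequentially. ln (real n) / real n powr \<kappa> < ln 2 / 2" by (intro order_tendstoD) auto
    moreover have "(\<lambda>n. real n powr - \<kappa>) \<longlonglongrightarrow> 0" using \<kappa> by (intro tendsto_neg_powr filterlim_real_sequentially) auto
    then have "\<forall>\<^sub>F n in sequentially. real n powr - \<kappa> < 1 / 2" by (intro order_tendstoD) auto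
    ultimately show ?thesis using eventually_gt_at_top[of 0]
    proof eventually_elim
      case (elim n)
      have n1: "1 \<le> n" using elim by simp
      have nk: "0 < real n powr \<kappa>" using elim by simp
      have "real (2 ^ Lg n) \<le> real (2 * n)" using Lg[OF n1] by (simp only: of_nat_le_iff)
      then have "ln (2 ^ Lg n) \<le> ln (2 * real n)" using elim by (subst ln_le_cancel_iff) auto
      then have "real (Lg n) * ln 2 \<le> ln 2 + ln (real n)" using elim by (simp add: ln_mult ln_realpow)
      also have "ln (real n) \<le> ln 2 / 2 * real n powr \<kappa>" using elim(1) nk by (simp add: divide_less_eq)
      also have "ln 2 + ln 2 / 2 * real n powr \<kappa> \<le> ln 2 * real n powr \<kappa>"
      proof -
        have "1 \<le> real n powr \<kappa> / 2" using elim(2) nk by (simp add: powr_minus field_simps)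
        then have "ln 2 * 1 \<le> ln 2 * (real n powr \<kappa> / 2)" by (intro mult_left_mono) auto
        moreover have "ln 2 / 2 * real n powr \<kappa> = ln 2 * (real n powr \<kappa> / 2)"
          "ln 2 * real n powr \<kappa> = ln 2 * (real n powr \<kappa> / 2) + ln 2 * (real n powr \<kappa> / 2)" by simp_all
        ultimately show ?thesis by linarith
      qed
      finally have "real (Lg n) * ln 2 \<le> real n powr \<kappa> * ln 2" by (simp add: mult.commute)
      then show ?case by (rule mult_right_le_imp_le) simp
    qed
  qed
  have final: "\<forall>\<^sub>F n in sequentially. real n powr (- 1/2) * \<Delta> n powr (- 2 * H) * TB n \<le> tot n"
    using Llog eventually_gt_at_top[of 0]
  proof eventually_elim
    case (elim n)
    have n: "0 < n" "1 \<le> n" "0 < real n" "1 \<le> real n" using elim by auto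
    have L2: "real ((2::nat) ^ Lg n) \<le> 2 * real n"
    proof -
      have "real (2 ^ Lg n) \<le> real (2 * n)" using Lg[OF n(2)] by (simp only: of_nat_le_iff)
      then show ?thesis by simp
    qed
    note d = \<Delta>[OF n(1)]
    define w where "w = real n powr (- 1/2) * \<Delta> n powr (- 2 * H)"
    have w0: "0 \<le> w" by (simp add: w_def)
    have nk1: "1 \<le> real n powr \<kappa>" using n \<kappa> by (intro ge_one_powr_ge_zero) auto
    have Dp: "\<Delta> n powr e = real n powr (- \<alpha> * e)" for e by (simp add: \<Delta>_def powr_powr)
    have D1: "\<Delta> n = real n powr (- \<alpha>)" by (simp add: \<Delta>_def)
    have p1: "w * (real (n - p) * (real n powr \<kappa> * (Cb * \<Delta> n powr H)) * (C1 * \<Delta> n) * \<Delta> n) \<le> Cb * C1 * real n powr (1/2 + \<kappa> - \<alpha> * (2 - H))"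
    proof -
      have "w * (real (n - p) * (real n powr \<kappa> * (Cb * \<Delta> n powr H)) * (C1 * \<Delta> n) * \<Delta> n) \<le> w * (real n * (real n powr \<kappa> * (Cb * \<Delta> n powr H)) * (C1 * \<Delta> n) * \<Delta> n)"
        using w0 C1 Cb d by (intro mult_left_mono mult_right_mono) auto
      also have "\<dots> = Cb * C1 * (real n powr (- 1/2) * real n powr 1 * real n powr \<kappa> * (\<Delta> n powr (- 2 * H) * \<Delta> n powr H * \<Delta> n powr 1 * \<Delta> n powr 1))"
        using n d by (simp add: w_def mult_ac)
      also have "\<dots> = Cb * C1 * real n powr (1/2 + \<kappa> - \<alpha> * (2 - H))"
        unfolding Dp powr_add[symmetric] by (simp add: algebra_simps)
      finally show ?thesis .
    qed
    have p2: "w * (real n powr \<kappa> * sg n (Lg n)) \<le> C1 * sqrt Cv * 2 powr \<gamma> * real n powr (\<kappa> + \<gamma> - 1/2 - \<alpha> * (1 - H))"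
    proof -
      have "real ((2::nat) ^ Lg n) powr \<gamma> \<le> (2 * real n) powr \<gamma>" using L2 \<gamma> by (intro powr_mono2) auto
      also have "\<dots> = 2 powr \<gamma> * real n powr \<gamma>" by (simp add: powr_mult)
      finally have "w * (real n powr \<kappa> * sg n (Lg n)) \<le> w * (real n powr \<kappa> * (C1 * \<Delta> n * (\<Delta> n powr H * sqrt Cv * (2 powr \<gamma> * real n powr \<gamma>))))"
        unfolding sg_def using w0 C1 d Cv by (intro mult_left_mono) auto
      also have "\<dots> = C1 * sqrt Cv * 2 powr \<gamma> * (real n powr (- 1/2) * real n powr \<kappa> * real n powr \<gamma> * (\<Delta> n powr (- 2 * H) * \<Delta> n powr 1 * \<Delta> n powr H))"
        using d by (simp add: w_def mult_ac)
      also have "\<dots> = C1 * sqrt Cv * 2 powr \<gamma> * real n powr (\<kappa> + \<gamma> - 1/2 - \<alpha> * (1 - H))"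
        unfolding Dp powr_add[symmetric] by (simp add: algebra_simps)
      finally show ?thesis .
    qed
    have term_l: "2 ^ (Lg n - l) * (real n powr \<kappa> * sg n l * (real n powr \<kappa> * (real (2 ^ l) * \<Delta> n) powr H + K * (real (2 ^ l) * \<Delta> n) + \<Delta> n))
      \<le> C1 * sqrt Cv * (K + 2) * 2 powr (\<gamma> + H) * (real n powr \<kappa> * real n powr \<kappa> * real n powr (\<gamma> + H) * (\<Delta> n powr 1 * \<Delta> n powr H * \<Delta> n powr H))" if l: "l < Lg n" for l
    proof -
      define z where "z = real ((2::nat) ^ l)"
      define y where "y = (2::real) ^ (Lg n - l)"
      have z1: "1 \<le> z" by (simp add: z_def)
      have y1: "1 \<le> y" by (simp add: y_def)
      have yz: "y * z = real ((2::nat) ^ Lg n)" using l by (simp add: y_def z_def power_add[symmetric])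
      have zn: "z \<le> real n"
      proof -
        have "2 * z \<le> real ((2::nat) ^ Lg n)"
        proof -
          have "(2::nat) ^ Suc l \<le> 2 ^ Lg n" using l by (intro power_increasing) auto
          then have "real ((2::nat) ^ Suc l) \<le> real ((2::nat) ^ Lg n)" by (simp only: of_nat_le_iff)
          then show ?thesis by (simp add: z_def)
        qed
        then show ?thesis using L2 by linarith
      qed
      have zd: "0 < z * \<Delta> n" "z * \<Delta> n \<le> 1"
      proof -
        show "0 < z * \<Delta> n" using z1 d by simp
        have "z * \<Delta> n \<le> real n * \<Delta> n" using zn d by (intro mult_right_mono) auto
        then show "z * \<Delta> n \<le> 1" using d by linarith
      qed
      have zH: "z * \<Delta> n \<le> (z * \<Delta> n) powr H"
        using powr_mono'[of H 1 "z * \<Delta> n"] H zd by simp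
      have dz: "\<Delta> n \<le> (z * \<Delta> n) powr H"
      proof -
        have "\<Delta> n \<le> z * \<Delta> n" using z1 d by simp
        then show ?thesis using zH by linarith
      qed
      have incr: "real n powr \<kappa> * (z * \<Delta> n) powr H + K * (z * \<Delta> n) + \<Delta> n \<le> (K + 2) * real n powr \<kappa> * (z powr H * \<Delta> n powr H)"
      proof -
        have "real n powr \<kappa> * (z * \<Delta> n) powr H + K * (z * \<Delta> n) + \<Delta> n \<le> real n powr \<kappa> * (z * \<Delta> n) powr H + K * (real n powr \<kappa> * (z * \<Delta> n) powr H) + real n powr \<kappa> * (z * \<Delta> n) powr H"
        proof -
          have m: "(z * \<Delta> n) powr H \<le> real n powr \<kappa> * (z * \<Delta> n) powr H"
            using mult_right_mono[OF nk1, of "(z * \<Delta> n) powr H"] by simp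
          have "K * (z * \<Delta> n) \<le> K * (real n powr \<kappa> * (z * \<Delta> n) powr H)" using K zH m by (intro mult_left_mono) auto
          then show ?thesis using dz m by linarith
        qed
        also have "\<dots> = (K + 2) * real n powr \<kappa> * (z * \<Delta> n) powr H" by (simp add: algebra_simps)
        finally have "real n powr \<kappa> * (z * \<Delta> n) powr H + K * (z * \<Delta> n) + \<Delta> n \<le> (K + 2) * real n powr \<kappa> * (z * \<Delta> n) powr H" .
        moreover have "(z * \<Delta> n) powr H = z powr H * \<Delta> n powr H" using z1 d by (simp add: powr_mult)
        ultimately show ?thesis by (simp only:)
      qed
      have s0: "0 \<le> real n powr \<kappa> * sg n l" using sg0[OF n(1), of l] by simp
      have "2 ^ (Lg n - l) * (real n powr \<kappa> * sg n l * (real n powr \<kappa> * (real (2 ^ l) * \<Delta> n) powr H + K * (real (2 ^ l) * \<Delta> n) + \<Delta> n))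
        \<le> y * (real n powr \<kappa> * sg n l * ((K + 2) * real n powr \<kappa> * (z powr H * \<Delta> n powr H)))"
        unfolding y_def z_def[symmetric] by (intro mult_left_mono incr s0) simp
      also have "\<dots> = C1 * sqrt Cv * (K + 2) * (real n powr \<kappa> * real n powr \<kappa> * (\<Delta> n powr 1 * \<Delta> n powr H * \<Delta> n powr H)) * (y * (z powr \<gamma> * z powr H))"
        using d unfolding sg_def z_def[symmetric] by (simp add: mult_ac)
      also have "\<dots> \<le> C1 * sqrt Cv * (K + 2) * (real n powr \<kappa> * real n powr \<kappa> * (\<Delta> n powr 1 * \<Delta> n powr H * \<Delta> n powr H)) * (2 powr (\<gamma> + H) * real n powr (\<gamma> + H))"
      proof (rule mult_left_mono)
        \<comment> \<open>Here \<open>\<gamma> + H >= 1\<close> enters, which uses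
          \<open>H >= 1/2\<close>: the coarsest scale dominates, every level obeys its bound, and
          the sum over levels costs only their number.\<close>
        have "y powr 1 \<le> y powr (\<gamma> + H)" using y1 \<gamma> H2 by (intro powr_mono) auto
        then have "y * (z powr \<gamma> * z powr H) \<le> y powr (\<gamma> + H) * z powr (\<gamma> + H)"
          using y1 z1 by (simp add: powr_add mult_right_mono)
        also have "\<dots> = (y * z) powr (\<gamma> + H)" using y1 z1 by (simp add: powr_mult)
        also have "\<dots> \<le> (2 * real n) powr (\<gamma> + H)" unfolding yz using L2 \<gamma> H by (intro powr_mono2) auto
        also have "\<dots> = 2 powr (\<gamma> + H) * real n powr (\<gamma> + H)" by (simp add: powr_mult)
        finally show "y * (z powr \<gamma> * z powr H) \<le> 2 powr (\<gamma> + H) * real n powr (\<gamma> + H)" .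
      qed (use C1 Cv K in auto)
      finally show ?thesis by (simp add: mult_ac)
    qed
    define Q where "Q = C1 * sqrt Cv * (K + 2) * 2 powr (\<gamma> + H) * (real n powr \<kappa> * real n powr \<kappa> * real n powr (\<gamma> + H) * (\<Delta> n powr 1 * \<Delta> n powr H * \<Delta> n powr H))"
    have Q0: "0 \<le> Q" unfolding Q_def using C1 Cv K by auto
    have p3: "w * (\<Sum>l<Lg n. 2 ^ (Lg n - l) * (real n powr \<kappa> * sg n l * (real n powr \<kappa> * (real (2 ^ l) * \<Delta> n) powr H + K * (real (2 ^ l) * \<Delta> n) + \<Delta> n)))
       \<le> C1 * sqrt Cv * (K + 2) * 2 powr (\<gamma> + H) * real n powr (3 * \<kappa> + \<gamma> + H - 1/2 - \<alpha>)"
    proof -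
      have "w * (\<Sum>l<Lg n. 2 ^ (Lg n - l) * (real n powr \<kappa> * sg n l * (real n powr \<kappa> * (real (2 ^ l) * \<Delta> n) powr H + K * (real (2 ^ l) * \<Delta> n) + \<Delta> n)))
         \<le> w * (\<Sum>l<Lg n. Q)"
        unfolding Q_def by (intro mult_left_mono sum_mono term_l w0) auto
      also have "\<dots> = w * (real (Lg n) * Q)" by simp
      also have "\<dots> \<le> w * (real n powr \<kappa> * Q)" using w0 Q0 elim by (intro mult_left_mono mult_right_mono) auto
      also have "\<dots> = C1 * sqrt Cv * (K + 2) * 2 powr (\<gamma> + H) * (real n powr (- 1/2) * real n powr \<kappa> * real n powr \<kappa> * real n powr \<kappa> * real n powr (\<gamma> + H) *
          (\<Delta> n powr (- 2 * H) * \<Delta> n powr 1 * \<Delta> n powr H * \<Delta> n powr H))"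
        by (simp only: w_def Q_def mult_ac)
      also have "\<dots> = C1 * sqrt Cv * (K + 2) * 2 powr (\<gamma> + H) * real n powr (3 * \<kappa> + \<gamma> + H - 1/2 - \<alpha>)"
        unfolding Dp powr_add[symmetric] by (simp add: algebra_simps)
      finally show ?thesis .
    qed
    show ?case using p1 p2 p3 unfolding w_def[symmetric] TB_def tot_def distrib_left by linarith
  qed
  \<comment> \<open>Keeps \<open>X\<close> inside the rounding grid on the common event; this is
    where \<kappa> < 1 is used.\<close>
  have nx: "\<forall>\<^sub>F n in sequentially. \<bar>x\<bar> + real n powr \<kappa> + K \<le> real n"
  proof -
    have "(\<lambda>n. real n powr (\<kappa> - 1)) \<longlonglongrightarrow> 0" using \<kappa>1 by (intro tendsto_neg_powr filterlim_real_sequentially) auto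
    then have "\<forall>\<^sub>F n in sequentially. real n powr (\<kappa> - 1) < 1 / 2" by (intro order_tendstoD) auto
    moreover have "\<forall>\<^sub>F n in sequentially. 2 * (\<bar>x\<bar> + K) \<le> real n"
      using filterlim_real_sequentially by (simp add: filterlim_at_top)
    ultimately show ?thesis using eventually_gt_at_top[of 0]
    proof eventually_elim
      case (elim n)
      have "real n powr \<kappa> = real n * real n powr (\<kappa> - 1)" using elim by (simp add: powr_diff)
      also have "\<dots> \<le> real n * (1 / 2)" using elim by (intro mult_left_mono) auto
      finally show ?case using elim(2) by simp
    qed
  qed
  show ?thesis
    unfolding oP_def
  proof (intro allI impI)
    fix \<epsilon> \<delta> :: real assume e: "0 < \<epsilon>" "0 < \<delta>"
    have "\<forall>\<^sub>F n in sequentially. tot n < \<delta>" using tot0 e by (intro order_tendstoD) auto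
    with ev1[OF e(1)] ev2[OF e(1)] ev3[OF e(1)] ev4[OF e(1)] final nx eventually_gt_at_top[of 0]
    show "\<forall>\<^sub>F n in sequentially. whp M \<epsilon> (\<lambda>\<omega>. \<bar>real n powr (- 1/2) * (real n powr - \<alpha>) powr (- 2 * H) *
      (\<Sum>j\<in>{1..n - filter_p a}. filter_incr a (real n powr - \<alpha>) (\<lambda>t. B t \<omega>) j *
        frozen_drift a (real n powr - \<alpha>) j (X (real j * real n powr - \<alpha>) \<omega>))\<bar> \<le> \<delta>)"
    proof eventually_elim
      case (elim n)
      have ae: "AE \<omega> in M. (\<forall>s\<in>T. \<forall>t\<in>T. \<bar>X t \<omega> - X s \<omega>\<bar> \<le> \<bar>B t \<omega> - B s \<omega>\<bar> + K * \<bar>t - s\<bar>) \<and> X 0 \<omega> = x"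
        using X_increment X_initial by eventually_elim simp
      from whp_conj[OF whp_conj[OF whp_conj[OF elim(1) elim(2)] whp_conj[OF elim(3) elim(4)]] whp_AE[OF ae order_refl]]
      show ?case
      proof (rule whp_mono)
        show "\<epsilon> / 4 + \<epsilon> / 4 + (\<epsilon> / 4 + \<epsilon> / 4) + 0 \<le> \<epsilon>" by simp
        fix \<omega>
        assume g: "(((\<forall>j\<in>{1..n - p}. \<bar>b n j \<omega>\<bar> \<le> real n powr \<kappa> * (Cb * \<Delta> n powr H)) \<and>
            (\<forall>i\<in>I2 n. \<bar>(case i of (u, v) \<Rightarrow> \<lambda>\<omega>. B (real v * \<Delta> n) \<omega> - B (real u * \<Delta> n) \<omega>) \<omega>\<bar> \<le> real n powr \<kappa> * (case i of (u, v) \<Rightarrow> (real (v - u) * \<Delta> n) powr H))) \<and>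
            (\<forall>i\<in>I3 n. \<bar>L3 n i \<omega>\<bar> \<le> real n powr \<kappa> * (sg n (fst i) * \<Delta> n)) \<and>
            (\<forall>i\<in>{()}. \<bar>L4 n i \<omega>\<bar> \<le> real n powr \<kappa> * sg n (Lg n))) \<and>
            (\<forall>s\<in>T. \<forall>t\<in>T. \<bar>X t \<omega> - X s \<omega>\<bar> \<le> \<bar>B t \<omega> - B s \<omega>\<bar> + K * \<bar>t - s\<bar>) \<and> X 0 \<omega> = x"
        define S where "S = (\<Sum>j\<in>{1..n - p}. b n j \<omega> * \<psi> n j (X (real j * \<Delta> n) \<omega>))"
        have "\<bar>S\<bar> \<le> TB n" unfolding S_def using g by (intro deterministic[OF elim(7) elim(6)]) blast+
        then have "real n powr (- 1/2) * \<Delta> n powr (- 2 * H) * \<bar>S\<bar> \<le> real n powr (- 1/2) * \<Delta> n powr (- 2 * H) * TB n"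
          by (intro mult_left_mono) auto
        also have "\<dots> \<le> \<delta>" using elim by linarith
        finally have "\<bar>real n powr (- 1/2) * \<Delta> n powr (- 2 * H) * S\<bar> \<le> \<delta>" by (simp add: abs_mult)
        then show "\<bar>real n powr (- 1/2) * (real n powr - \<alpha>) powr (- 2 * H) *
          (\<Sum>j\<in>{1..n - filter_p a}. filter_incr a (real n powr - \<alpha>) (\<lambda>t. B t \<omega>) j *
            frozen_drift a (real n powr - \<alpha>) j (X (real j * real n powr - \<alpha>) \<omega>))\<bar> \<le> \<delta>"
          unfolding S_def b_def \<psi>_def p_def \<Delta>_def .
      qed
    qed
  qed
qed

end

section \<open>The estimators\<close>

text \<open>The matrix of \<open>D_hat\<close> is a left inverse of the filter matrix A, and the
  second property is this left inverse applied to A y. It turns the variance vector of the filters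
  back into the numbers d^(2 H). The shifts \<open>d - 1\<close> and \<open>e - 1\<close> account
  for indices starting at 0.\<close>

lemma estimator_linear:
  assumes inv: "invertible_mat (transpose_mat (filter_mat as) * filter_mat as)"
  obtains c :: "nat \<Rightarrow> nat \<Rightarrow> real" where
    "\<And>n \<Delta> Z d. d \<in> {1..max_p as} \<Longrightarrow> D_hat as n \<Delta> Z d = (\<Sum>i<length as. c d i * quad_var (as ! i) n \<Delta> Z)"
    "\<And>y d. d \<in> {1..max_p as} \<Longrightarrow>
      (\<Sum>i<length as. c d i * (\<Sum>e\<in>{1..max_p as}. filter_mat as $$ (i, e - 1) * y e)) = y d"
proof -
  define m where "m = length as"
  define P where "P = max_p as"
  define A where "A = filter_mat as"
  define N where "N = transpose_mat A * A"
  have A: "A \<in> carrier_mat m P" by (simp add: A_def filter_mat_def m_def P_def)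
  have N: "N \<in> carrier_mat P P" using A by (auto simp: N_def)
  obtain B where B: "mat_inverse N = Some B"
  proof (cases "mat_inverse N")
    case None
    from mat_inverse(1)[OF N this, of "()"] have nu: "N \<notin> Units (ring_mat TYPE(real) P ())" .
    obtain B' where B': "N * B' = 1\<^sub>m P" "B' * N = 1\<^sub>m (dim_row B')"
      using inv N unfolding invertible_mat_def inverts_mat_def N_def[symmetric] A_def[symmetric] by auto
    have c: "dim_col B' = P" using arg_cong[OF B'(1), of dim_col] by simp
    have r: "dim_row B' = P" using arg_cong[OF B'(2), of dim_col] N by simp
    have "B' \<in> carrier_mat P P" using c r by auto
    then have "N \<in> Units (ring_mat TYPE(real) P ())"
      using N B' r unfolding Units_def ring_mat_def by auto
    with nu show ?thesis by simp
  qed (use that in blast)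
  from mat_inverse(2)[OF N B] have BN: "B * N = 1\<^sub>m P" and Bc: "B \<in> carrier_mat P P" by auto
  define Q where "Q = B * transpose_mat A"
  have Q: "Q \<in> carrier_mat P m" using A Bc by (auto simp: Q_def)
  have QA: "Q * A = 1\<^sub>m P"
    unfolding Q_def using BN assoc_mult_mat[OF Bc, of "transpose_mat A" m A P] A by (simp add: N_def)
  show ?thesis
  proof (rule that[of "\<lambda>d i. Q $$ (d - 1, i)"])
    fix n \<Delta> Z d assume d: "d \<in> {1..max_p as}"
    have "D_hat as n \<Delta> Z d = vec_index (Q *\<^sub>v quad_var_vec as n \<Delta> Z) (d - 1)"
      unfolding D_hat_def Let_def A_def[symmetric] N_def[symmetric] B by (simp add: Q_def)
    also have "\<dots> = (\<Sum>i<length as. Q $$ (d - 1, i) * quad_var (as ! i) n \<Delta> Z)"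
    proof -
      have "d - 1 < dim_row Q" using Q d by (auto simp: P_def)
      then have "vec_index (Q *\<^sub>v quad_var_vec as n \<Delta> Z) (d - 1) = row Q (d - 1) \<bullet> quad_var_vec as n \<Delta> Z"
        by (rule index_mult_mat_vec)
      also have "\<dots> = (\<Sum>i\<in>{0..<length as}. row Q (d - 1) $ i * quad_var_vec as n \<Delta> Z $ i)"
        by (simp add: scalar_prod_def quad_var_vec_def)
      also have "\<dots> = (\<Sum>i\<in>{0..<length as}. Q $$ (d - 1, i) * quad_var (as ! i) n \<Delta> Z)"
      proof (rule sum.cong[OF refl])
        fix i assume i: "i \<in> {0..<length as}"
        have "row Q (d - 1) $ i = Q $$ (d - 1, i)"
          using Q i \<open>d - 1 < dim_row Q\<close> by (intro index_row) (auto simp: m_def)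
        then show "row Q (d - 1) $ i * quad_var_vec as n \<Delta> Z $ i = Q $$ (d - 1, i) * quad_var (as ! i) n \<Delta> Z"
          using i by (simp add: quad_var_vec_def)
      qed
      finally show ?thesis by (simp only: atLeast0LessThan)
    qed
    finally show "D_hat as n \<Delta> Z d = (\<Sum>i<length as. Q $$ (d - 1, i) * quad_var (as ! i) n \<Delta> Z)" .
  next
    fix y :: "nat \<Rightarrow> real" and d assume d: "d \<in> {1..max_p as}"
    have qa: "(\<Sum>i<length as. Q $$ (d - 1, i) * A $$ (i, e - 1)) = (if e = d then 1 else 0)" if "e \<in> {1..max_p as}" for e
    proof -
      have "(Q * A) $$ (d - 1, e - 1) = (\<Sum>i<length as. Q $$ (d - 1, i) * A $$ (i, e - 1))"
      proof -
        have dr: "d - 1 < dim_row Q" using Q d by (auto simp: P_def)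
        have er: "e - 1 < dim_col A" using A that by (auto simp: P_def)
        have "(Q * A) $$ (d - 1, e - 1) = row Q (d - 1) \<bullet> col A (e - 1)" by (rule index_mult_mat(1)[OF dr er])
        also have "\<dots> = (\<Sum>i\<in>{0..<length as}. row Q (d - 1) $ i * col A (e - 1) $ i)"
          using A by (simp add: scalar_prod_def m_def)
        also have "\<dots> = (\<Sum>i\<in>{0..<length as}. Q $$ (d - 1, i) * A $$ (i, e - 1))"
        proof (rule sum.cong[OF refl])
          fix i assume i: "i \<in> {0..<length as}"
          have "row Q (d - 1) $ i = Q $$ (d - 1, i)" using Q i dr by (intro index_row) (auto simp: m_def)
          moreover have "col A (e - 1) $ i = A $$ (i, e - 1)" using A i er by (intro index_col) (auto simp: m_def)
          ultimately show "row Q (d - 1) $ i * col A (e - 1) $ i = Q $$ (d - 1, i) * A $$ (i, e - 1)" by simp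
        qed
        finally show ?thesis by (simp only: atLeast0LessThan)
      qed
      moreover have "(1\<^sub>m P :: real mat) $$ (d - 1, e - 1) = (if e = d then 1 else 0)"
        using d that by (auto simp: P_def)
      ultimately show ?thesis using QA by simp
    qed
    have "(\<Sum>i<length as. Q $$ (d - 1, i) * (\<Sum>e\<in>{1..max_p as}. A $$ (i, e - 1) * y e))
        = (\<Sum>e\<in>{1..max_p as}. \<Sum>i<length as. Q $$ (d - 1, i) * A $$ (i, e - 1) * y e)"
      unfolding sum_distrib_left by (subst sum.swap) (simp add: mult.assoc)
    also have "\<dots> = (\<Sum>e\<in>{1..max_p as}. (if e = d then 1 else 0) * y e)"
      unfolding sum_distrib_right[symmetric] by (intro sum.cong refl arg_cong2[where f="(*)"] qa)
    also have "\<dots> = (\<Sum>e\<in>{1..max_p as}. if e = d then y e else 0)"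
      by (intro sum.cong refl) simp
    also have "\<dots> = y d" using d by simp
    finally show "(\<Sum>i<length as. Q $$ (d - 1, i) * (\<Sum>e\<in>{1..max_p as}. filter_mat as $$ (i, e - 1) * y e)) = y d"
      unfolding A_def .
  qed
qed

lemma filter_p_le_max_p: "a \<in> set as \<Longrightarrow> filter_p a \<le> max_p as"
  unfolding max_p_def by (intro Max_ge) auto

text \<open>Grouping the index pairs by their distance d turns the coefficient of d^(2 H) into the
  autocorrelation stored in \<open>filter_mat\<close>; the diagonal drops out because 0 powr
  anything is 0. So the vector of variances is the filter matrix applied to the numbers d^(2 H), the
  linear relation which least squares inverts.\<close>

lemma filter_cov_zero_eq:
  assumes "i < length as" "diff_filter (as ! i)" "0 < H"
  shows "filter_cov H (as ! i) (as ! i) 0 = (\<Sum>d\<in>{1..max_p as}. filter_mat as $$ (i, d - 1) * real d powr (2 * H))"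
proof -
  define a where "a = as ! i"
  define p where "p = filter_p a"
  have len: "length a = p + 1" using assms(2) by (auto simp: a_def p_def filter_p_def diff_filter_def)
  define g where "g j k = a ! j * a ! k * \<bar>real j - real k\<bar> powr (2 * H)" for j k
  have gs: "g j k = g k j" for j k unfolding g_def by (simp add: abs_minus_commute mult.commute)
  have gd: "g j j = 0" for j by (simp add: g_def)
  have pP: "p \<le> max_p as" unfolding p_def a_def using assms(1) by (intro filter_p_le_max_p) simp
  have inner: "(\<Sum>k<p + 1. g j k) = (\<Sum>k\<in>{k. k < j}. g j k) + (\<Sum>k\<in>{k. j < k \<and> k < p + 1}. g j k)" if "j < p + 1" for j
  proof -
    have "{..<p + 1} = insert j ({k. k < j} \<union> {k. j < k \<and> k < p + 1})" using that by auto
    then have "(\<Sum>k<p + 1. g j k) = g j j + (\<Sum>k\<in>{k. k < j} \<union> {k. j < k \<and> k < p + 1}. g j k)" by simp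
    also have "(\<Sum>k\<in>{k. k < j} \<union> {k. j < k \<and> k < p + 1}. g j k) = (\<Sum>k\<in>{k. k < j}. g j k) + (\<Sum>k\<in>{k. j < k \<and> k < p + 1}. g j k)"
      by (rule sum.union_disjoint) auto
    finally show ?thesis by (simp add: gd)
  qed
  \<comment> \<open>By symmetry the lower triangle equals the upper one, and the resulting factor 2
    cancels the division by 2 in \<open>filter_cov\<close>.\<close>
  have low: "(\<Sum>j<p + 1. \<Sum>k\<in>{k. k < j}. g j k) = (\<Sum>j<p + 1. \<Sum>k\<in>{k. j < k \<and> k < p + 1}. g j k)"
  proof -
    have "(\<Sum>j<p + 1. \<Sum>k\<in>{k. k < j}. g j k) = (\<Sum>(j, k)\<in>(SIGMA j:{..<p + 1}. {k. k < j}). g j k)"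
      by (rule sum.Sigma) auto
    also have "\<dots> = (\<Sum>(j, k)\<in>(SIGMA j:{..<p + 1}. {k. j < k \<and> k < p + 1}). g j k)"
      by (rule sum.reindex_bij_witness[where i="\<lambda>(j, k). (k, j)" and j="\<lambda>(j, k). (k, j)"]) (auto simp: gs)
    also have "\<dots> = (\<Sum>j<p + 1. \<Sum>k\<in>{k. j < k \<and> k < p + 1}. g j k)"
      by (rule sum.Sigma[symmetric]) auto
    finally show ?thesis .
  qed
  have "(\<Sum>j<p + 1. \<Sum>k<p + 1. g j k) = (\<Sum>j<p + 1. (\<Sum>k\<in>{k. k < j}. g j k) + (\<Sum>k\<in>{k. j < k \<and> k < p + 1}. g j k))"
    by (intro sum.cong refl inner) simp
  also have "\<dots> = 2 * (\<Sum>j<p + 1. \<Sum>k\<in>{k. j < k \<and> k < p + 1}. g j k)"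
    unfolding sum.distrib low by simp
  also have "(\<Sum>j<p + 1. \<Sum>k\<in>{k. j < k \<and> k < p + 1}. g j k) = (\<Sum>(j, k)\<in>(SIGMA j:{..<p + 1}. {k. j < k \<and> k < p + 1}). g j k)"
    by (rule sum.Sigma) auto
  \<comment> \<open>Change of variables in the upper triangle: distance \<open>d\<close> and smaller
    index \<open>k\<close> instead of the two indices.\<close>
  also have "\<dots> = (\<Sum>(d, k)\<in>(SIGMA d:{1..p}. {0..p - d}). g k (k + d))"
    by (rule sum.reindex_bij_witness[where i="\<lambda>(d, k). (k, k + d)" and j="\<lambda>(j, k). (k - j, j)"]) auto
  also have "\<dots> = (\<Sum>d\<in>{1..p}. \<Sum>k=0..p - d. g k (k + d))"
    by (rule sum.Sigma[symmetric]) auto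
  also have "\<dots> = (\<Sum>d\<in>{1..p}. (\<Sum>k=0..p - d. a ! k * a ! (k + d)) * real d powr (2 * H))"
    by (simp add: g_def sum_distrib_right)
  finally have "filter_cov H a a 0 = (\<Sum>d\<in>{1..p}. - (\<Sum>k=0..p - d. a ! k * a ! (k + d)) * real d powr (2 * H))"
    unfolding filter_cov_def len by (simp add: g_def sum_negf)
  also have "\<dots> = (\<Sum>d\<in>{1..max_p as}. filter_mat as $$ (i, d - 1) * real d powr (2 * H))"
  proof (rule sum.mono_neutral_cong_left)
    show "\<forall>d\<in>{1..max_p as} - {1..p}. filter_mat as $$ (i, d - 1) * real d powr (2 * H) = 0"
      using assms(1) by (auto simp: filter_mat_def Let_def a_def[symmetric] p_def)
    fix d assume d: "d \<in> {1..p}"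
    have "filter_mat as $$ (i, d - 1) = (case (i, d - 1) of (i, j') \<Rightarrow> let a = as ! i; j = Suc j' in
        if j \<le> filter_p a then - (\<Sum>k=0..filter_p a - j. a ! k * a ! (k + j)) else 0)"
      unfolding filter_mat_def using d pP assms(1) by (intro index_mat) auto
    moreover have "Suc (d - 1) = d" using d by simp
    ultimately have "filter_mat as $$ (i, d - 1) = - (\<Sum>k=0..p - d. a ! k * a ! (k + d))"
      using d by (simp add: Let_def a_def[symmetric] p_def[symmetric])
    then show "- (\<Sum>k=0..p - d. a ! k * a ! (k + d)) * real d powr (2 * H) = filter_mat as $$ (i, d - 1) * real d powr (2 * H)"
      by simp
  qed (use pP in auto)
  finally show ?thesis unfolding a_def .
qed

text \<open>For |u| <= 1/2 the logarithm ln (1 + u) differs from u by at most 2 u^2. With u = Z /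
  sqrt n the scaled error is 2 Z^2 / sqrt n, which tends to 0 when \<open>Z\<close> is
  stochastically bounded. The formula for \<open>g\<close> is only required where |u| <= 1/2, so the
  behaviour at and beyond the singularity does not matter.\<close>

lemma (in prob_space) log_linearisation:
  assumes Z: "OP M Z" and g: "\<And>n \<omega>. 0 < n \<Longrightarrow> \<bar>Z n \<omega>\<bar> \<le> sqrt (real n) / 2 \<Longrightarrow> g n \<omega> = sqrt (real n) * ln (1 + Z n \<omega> / sqrt (real n))"
  shows "oP M (\<lambda>n \<omega>. g n \<omega> - Z n \<omega>)"
  unfolding oP_def
proof (intro allI impI)
  fix \<epsilon> \<delta> :: real assume e: "0 < \<epsilon>" "0 < \<delta>"
  from OPD[OF Z e(1)] obtain C where C: "0 \<le> C" and ev: "\<forall>\<^sub>F n in sequentially. whp M \<epsilon> (\<lambda>\<omega>. \<bar>Z n \<omega>\<bar> \<le> C)" by auto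
  have lim: "filterlim (\<lambda>n. sqrt (real n)) at_top sequentially"
    by (rule filterlim_compose[OF sqrt_at_top filterlim_real_sequentially])
  have "\<forall>\<^sub>F n in sequentially. 2 * C \<le> sqrt (real n)" "\<forall>\<^sub>F n in sequentially. 2 * C\<^sup>2 / \<delta> \<le> sqrt (real n)"
    using lim by (simp_all add: filterlim_at_top)
  with ev eventually_gt_at_top[of 0] show "\<forall>\<^sub>F n in sequentially. whp M \<epsilon> (\<lambda>\<omega>. \<bar>g n \<omega> - Z n \<omega>\<bar> \<le> \<delta>)"
  proof eventually_elim
    case (elim n)
    from elim(1) show ?case
    proof (rule whp_mono)
      fix \<omega> assume z: "\<bar>Z n \<omega>\<bar> \<le> C"
      define r where "r = sqrt (real n)"
      have r: "0 < r" using elim by (simp add: r_def)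
      define u where "u = Z n \<omega> / r"
      have zh: "\<bar>Z n \<omega>\<bar> \<le> r / 2" using z elim unfolding r_def by linarith
      then have u: "\<bar>u\<bar> \<le> 1 / 2" using r by (simp add: u_def abs_divide field_simps)
      have "g n \<omega> - Z n \<omega> = r * (ln (1 + u) - u)"
        using g[OF elim(2), of \<omega>] zh r unfolding r_def[symmetric] u_def[symmetric] by (simp add: u_def right_diff_distrib)
      then have "\<bar>g n \<omega> - Z n \<omega>\<bar> = r * \<bar>ln (1 + u) - u\<bar>" using r by (simp add: abs_mult)
      also have "\<dots> \<le> r * (2 * u\<^sup>2)" using abs_ln_one_plus_x_minus_x_bound[OF u] r by (intro mult_left_mono) auto
      also have "\<dots> = 2 * (Z n \<omega>)\<^sup>2 / r" using r by (simp add: u_def power_divide power2_eq_square)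
      also have "\<dots> \<le> 2 * C\<^sup>2 / r"
      proof -
        have "(Z n \<omega>)\<^sup>2 \<le> C\<^sup>2" using z by (simp add: abs_le_square_iff[symmetric] C)
        then show ?thesis using r by (simp add: divide_right_mono)
      qed
      also have "\<dots> \<le> \<delta>" using elim(4) e r unfolding r_def[symmetric] by (simp add: field_simps)
      finally show "\<bar>g n \<omega> - Z n \<omega>\<bar> \<le> \<delta>" .
    qed simp
  qed
qed

lemma (in prob_space) weak_conv_centered_normal:
  assumes m: "\<And>n. Z n \<in> borel_measurable M" and s: "0 \<le> s"
    and ch: "\<And>t. (\<lambda>n. \<integral>\<omega>. iexp (t * Z n \<omega>) \<partial>M) \<longlonglongrightarrow> exp (- of_real (s * t\<^sup>2 / 2))"
  shows "weak_conv_m (\<lambda>n. distr M borel (Z n)) (centered_normal (sqrt s))"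
proof (rule levy_continuity)
  show "real_distribution (distr M borel (Z n))" for n using m by (rule real_distribution_distr)
  show "real_distribution (centered_normal (sqrt s))" using s by (intro real_distribution_centered_normal) simp
  fix t
  have "char (distr M borel (Z n)) t = (\<integral>\<omega>. iexp (t * Z n \<omega>) \<partial>M)" for n
    unfolding char_def using m[of n] by (subst integral_distr) auto
  moreover have "char (centered_normal (sqrt s)) t = exp (- of_real (s * t\<^sup>2 / 2))"
    using s by (simp add: char_centered_normal power_mult_distrib exp_of_real[symmetric])
  ultimately show "(\<lambda>n. char (distr M borel (Z n)) t) \<longlonglongrightarrow> char (centered_normal (sqrt s)) t"
    using ch[of t] by simp
qed

section \<open>Replacing the observed process by fractional Brownian motion\<close>

context perturbed_fbm
begin

text \<open>Expanding the square leaves twice the cross term and the sum of squared drift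
  increments. The latter is bounded almost surely by n (C \<Delta>)^2, after normalisation a
  constant times n^(1/2 - \<alpha> (2 - 2 H)).\<close>

lemma drift_negligible:
  assumes a: "diff_filter a" and \<alpha>: "1/2 < \<alpha> * (2 - 2 * H)"
    and grid: "\<And>n j. j \<in> {1..n - filter_p a} \<Longrightarrow> grid_in a (real n powr - \<alpha>) j"
    and cross: "oP M (\<lambda>n \<omega>. real n powr (- 1/2) * (real n powr - \<alpha>) powr (- 2 * H) *
      (\<Sum>j\<in>{1..n - filter_p a}. filter_incr a (real n powr - \<alpha>) (\<lambda>t. B t \<omega>) j * filter_incr a (real n powr - \<alpha>) (\<lambda>t. F t \<omega>) j))"
  shows "oP M (\<lambda>n \<omega>. sqrt (real n) * (quad_var a n (real n powr - \<alpha>) (\<lambda>t. X t \<omega>) - quad_var a n (real n powr - \<alpha>) (\<lambda>t. B t \<omega>))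
     / (real n powr - \<alpha>) powr (2 * H))"
proof -
  define C where "C = mass a * (K * real (filter_p a))"
  define sq where "sq n \<omega> = real n powr (- 1/2) * (real n powr - \<alpha>) powr (- 2 * H) *
    (\<Sum>j\<in>{1..n - filter_p a}. (filter_incr a (real n powr - \<alpha>) (\<lambda>t. F t \<omega>) j)\<^sup>2)" for n \<omega>
  have "oP M sq"
  proof (rule oP_dominated)
    have "(\<lambda>n. real n powr (1/2 - \<alpha> * (2 - 2 * H))) \<longlonglongrightarrow> 0"
      using \<alpha> by (intro tendsto_neg_powr filterlim_real_sequentially) simp
    then show "oP M (\<lambda>n \<omega>. C\<^sup>2 * real n powr (1/2 - \<alpha> * (2 - 2 * H)))"
      by (intro oP_deterministic tendsto_mult_right_zero)
    show "\<forall>\<^sub>F n in sequentially. AE \<omega> in M. \<bar>sq n \<omega>\<bar> \<le> \<bar>C\<^sup>2 * real n powr (1/2 - \<alpha> * (2 - 2 * H))\<bar>"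
      using eventually_gt_at_top[of 0]
    proof eventually_elim
      case (elim n)
      define \<Delta> where "\<Delta> = real n powr - \<alpha>"
      have d: "0 < \<Delta>" using elim by (simp add: \<Delta>_def)
      show ?case using filter_incr_F_bound[OF a]
      proof eventually_elim
        case (elim \<omega>)
        have "(\<Sum>j\<in>{1..n - filter_p a}. (filter_incr a \<Delta> (\<lambda>t. F t \<omega>) j)\<^sup>2) \<le> (\<Sum>j\<in>{1..n - filter_p a}. (C * \<Delta>)\<^sup>2)"
        proof (rule sum_mono)
          fix j assume "j \<in> {1..n - filter_p a}"
          then have "grid_in a \<Delta> j" using grid by (simp add: \<Delta>_def)
          then have "\<bar>filter_incr a \<Delta> (\<lambda>t. F t \<omega>) j\<bar> \<le> mass a * (K * (real (filter_p a) * \<Delta>))" using elim by blast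
          also have "\<dots> = C * \<Delta>" by (simp add: C_def)
          finally have "\<bar>filter_incr a \<Delta> (\<lambda>t. F t \<omega>) j\<bar>\<^sup>2 \<le> (C * \<Delta>)\<^sup>2" by (rule power_mono) simp
          then show "(filter_incr a \<Delta> (\<lambda>t. F t \<omega>) j)\<^sup>2 \<le> (C * \<Delta>)\<^sup>2" by simp
        qed
        also have "\<dots> \<le> real n * (C * \<Delta>)\<^sup>2" by (simp add: mult_right_mono)
        finally have "\<bar>sq n \<omega>\<bar> \<le> real n powr (- 1/2) * \<Delta> powr (- 2 * H) * (real n * (C * \<Delta>)\<^sup>2)"
          unfolding sq_def \<Delta>_def[symmetric] by (simp add: abs_mult sum_nonneg mult_left_mono)
        also have "\<dots> = C\<^sup>2 * ((real n powr (- 1/2) * real n powr 1) * (\<Delta> powr (- 2 * H) * \<Delta> powr 1 * \<Delta> powr 1))"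
          using \<open>0 < n\<close> d by (simp add: power_mult_distrib power2_eq_square mult_ac)
        also have "(real n powr (- 1/2) * real n powr 1) * (\<Delta> powr (- 2 * H) * \<Delta> powr 1 * \<Delta> powr 1) = real n powr (1/2 - \<alpha> * (2 - 2 * H))"
          unfolding powr_add[symmetric] \<Delta>_def powr_powr by (rule arg_cong[where f="\<lambda>z. real n powr z"]) (simp add: algebra_simps)
        finally show ?case by simp
      qed
    qed
  qed
  then have "oP M (\<lambda>n \<omega>. 2 * (real n powr (- 1/2) * (real n powr - \<alpha>) powr (- 2 * H) *
      (\<Sum>j\<in>{1..n - filter_p a}. filter_incr a (real n powr - \<alpha>) (\<lambda>t. B t \<omega>) j * filter_incr a (real n powr - \<alpha>) (\<lambda>t. F t \<omega>) j)) + sq n \<omega>)"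
    by (intro oP_add oP_cmult cross)
  then show ?thesis
  proof (rule oP_cong)
    show "\<forall>\<^sub>F n in sequentially. \<forall>\<omega>\<in>space M. sqrt (real n) * (quad_var a n (real n powr - \<alpha>) (\<lambda>t. X t \<omega>) - quad_var a n (real n powr - \<alpha>) (\<lambda>t. B t \<omega>))
       / (real n powr - \<alpha>) powr (2 * H) = 2 * (real n powr (- 1/2) * (real n powr - \<alpha>) powr (- 2 * H) *
      (\<Sum>j\<in>{1..n - filter_p a}. filter_incr a (real n powr - \<alpha>) (\<lambda>t. B t \<omega>) j * filter_incr a (real n powr - \<alpha>) (\<lambda>t. F t \<omega>) j)) + sq n \<omega>"
      using eventually_gt_at_top[of 0]
    proof eventually_elim
      case (elim n)
      show ?case
      proof (rule ballI)
      fix \<omega> :: 'a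
      note n = elim
      define \<Delta> where "\<Delta> = real n powr - \<alpha>"
      define b where "b j = filter_incr a \<Delta> (\<lambda>t. B t \<omega>) j" for j
      define f where "f j = filter_incr a \<Delta> (\<lambda>t. F t \<omega>) j" for j
      have "quad_var a n \<Delta> (\<lambda>t. X t \<omega>) - quad_var a n \<Delta> (\<lambda>t. B t \<omega>) = 1 / real n * (\<Sum>j\<in>{1..n - filter_p a}. (b j + f j)\<^sup>2 - (b j)\<^sup>2)"
        unfolding quad_var_def filter_incr_X[OF a] b_def f_def by (simp add: sum_subtractf right_diff_distrib diff_divide_distrib)
      also have "(\<Sum>j\<in>{1..n - filter_p a}. (b j + f j)\<^sup>2 - (b j)\<^sup>2) = 2 * (\<Sum>j\<in>{1..n - filter_p a}. b j * f j) + (\<Sum>j\<in>{1..n - filter_p a}. (f j)\<^sup>2)"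
        unfolding sum_distrib_left sum.distrib[symmetric] by (intro sum.cong refl) (simp add: power2_eq_square algebra_simps)
      finally have e: "quad_var a n \<Delta> (\<lambda>t. X t \<omega>) - quad_var a n \<Delta> (\<lambda>t. B t \<omega>) = 1 / real n * (2 * (\<Sum>j\<in>{1..n - filter_p a}. b j * f j) + (\<Sum>j\<in>{1..n - filter_p a}. (f j)\<^sup>2))" .
      have n2: "sqrt (real n) * (1 / real n) = real n powr (- 1/2)"
      proof -
        have "sqrt (real n) = real n powr (1/2)" using n by (simp add: powr_half_sqrt)
        moreover have "1 / real n = real n powr (- 1)" using n by (simp add: powr_minus_divide)
        ultimately have "sqrt (real n) * (1 / real n) = real n powr (1/2 + - 1)" by (simp only: powr_add)
        then show ?thesis by simp
      qed
      have D: "1 / \<Delta> powr (2 * H) = \<Delta> powr (- 2 * H)" by (simp add: powr_minus inverse_eq_divide)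
      have "sqrt (real n) * (quad_var a n \<Delta> (\<lambda>t. X t \<omega>) - quad_var a n \<Delta> (\<lambda>t. B t \<omega>)) / \<Delta> powr (2 * H)
         = (sqrt (real n) * (1 / real n)) * (1 / \<Delta> powr (2 * H)) * (2 * (\<Sum>j\<in>{1..n - filter_p a}. b j * f j) + (\<Sum>j\<in>{1..n - filter_p a}. (f j)\<^sup>2))"
        unfolding e by simp
      then have "sqrt (real n) * (quad_var a n \<Delta> (\<lambda>t. X t \<omega>) - quad_var a n \<Delta> (\<lambda>t. B t \<omega>)) / \<Delta> powr (2 * H)
         = 2 * (real n powr (- 1/2) * \<Delta> powr (- 2 * H) * (\<Sum>j\<in>{1..n - filter_p a}. b j * f j)) + real n powr (- 1/2) * \<Delta> powr (- 2 * H) * (\<Sum>j\<in>{1..n - filter_p a}. (f j)\<^sup>2)"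
        unfolding n2 D by (simp add: algebra_simps)
      then show "sqrt (real n) * (quad_var a n (real n powr - \<alpha>) (\<lambda>t. X t \<omega>) - quad_var a n (real n powr - \<alpha>) (\<lambda>t. B t \<omega>))
       / (real n powr - \<alpha>) powr (2 * H) = 2 * (real n powr (- 1/2) * (real n powr - \<alpha>) powr (- 2 * H) *
      (\<Sum>j\<in>{1..n - filter_p a}. filter_incr a (real n powr - \<alpha>) (\<lambda>t. B t \<omega>) j * filter_incr a (real n powr - \<alpha>) (\<lambda>t. F t \<omega>) j)) + sq n \<omega>"
        unfolding sq_def b_def f_def \<Delta>_def .
      qed
    qed
  qed
qed

text \<open>Each of the at most n localisation errors has mean absolute value of order \<Delta>^(1 +
  2 H), so after normalisation their sum is of order n^(1/2 - \<alpha>).\<close>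

lemma cross_term_from_frozen:
  assumes a: "diff_filter a" and \<alpha>: "1/2 < \<alpha>"
    and grid: "\<And>n j. j \<in> {1..n - filter_p a} \<Longrightarrow> grid_in a (real n powr - \<alpha>) j"
    and frozen: "oP M (\<lambda>n \<omega>. real n powr (- 1/2) * (real n powr - \<alpha>) powr (- 2 * H) *
      (\<Sum>j\<in>{1..n - filter_p a}. filter_incr a (real n powr - \<alpha>) (\<lambda>t. B t \<omega>) j *
        frozen_drift a (real n powr - \<alpha>) j (X (real j * real n powr - \<alpha>) \<omega>)))"
  shows "oP M (\<lambda>n \<omega>. real n powr (- 1/2) * (real n powr - \<alpha>) powr (- 2 * H) *
      (\<Sum>j\<in>{1..n - filter_p a}. filter_incr a (real n powr - \<alpha>) (\<lambda>t. B t \<omega>) j * filter_incr a (real n powr - \<alpha>) (\<lambda>t. F t \<omega>) j))"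
proof -
  define \<Delta> where "\<Delta> n = real n powr - \<alpha>" for n :: nat
  define Q where "Q n j \<omega> = filter_incr a (\<Delta> n) (\<lambda>t. B t \<omega>) j * (filter_incr a (\<Delta> n) (\<lambda>t. F t \<omega>) j - frozen_drift a (\<Delta> n) j (X (real j * \<Delta> n) \<omega>))" for n j \<omega>
  obtain C where C: "\<And>\<Delta> j. grid_in a \<Delta> j \<Longrightarrow> \<Delta> \<le> 1 \<Longrightarrow> (\<integral>\<omega>. \<bar>filter_incr a \<Delta> (\<lambda>t. B t \<omega>) j * (filter_incr a \<Delta> (\<lambda>t. F t \<omega>) j - frozen_drift a \<Delta> j (X (real j * \<Delta>) \<omega>))\<bar> \<partial>M) \<le> C * \<Delta> powr (1 + 2 * H)"
    using localisation_L1(2)[OF a] by blast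
  have rest: "oP M (\<lambda>n \<omega>. real n powr (- 1/2) * \<Delta> n powr (- 2 * H) * (\<Sum>j\<in>{1..n - filter_p a}. Q n j \<omega>))"
  proof (rule oP_L1)
    have "(\<lambda>n. real n powr (1/2 - \<alpha>)) \<longlonglongrightarrow> 0" using \<alpha> by (intro tendsto_neg_powr filterlim_real_sequentially) simp
    then show "(\<lambda>n. \<bar>C\<bar> * real n powr (1/2 - \<alpha>)) \<longlonglongrightarrow> 0" by (rule tendsto_mult_right_zero)
    show "\<forall>\<^sub>F n in sequentially. integrable M (\<lambda>\<omega>. real n powr (- 1/2) * \<Delta> n powr (- 2 * H) * (\<Sum>j\<in>{1..n - filter_p a}. Q n j \<omega>)) \<and>
      (\<integral>\<omega>. \<bar>real n powr (- 1/2) * \<Delta> n powr (- 2 * H) * (\<Sum>j\<in>{1..n - filter_p a}. Q n j \<omega>)\<bar> \<partial>M) \<le> \<bar>C\<bar> * real n powr (1/2 - \<alpha>)"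
      using eventually_gt_at_top[of 0]
    proof eventually_elim
      case (elim n)
      have d: "0 < \<Delta> n" using elim by (simp add: \<Delta>_def)
      have "real n powr - \<alpha> \<le> real n powr 0" using elim \<alpha> by (intro powr_mono) auto
      then have d1: "\<Delta> n \<le> 1" using elim by (simp add: \<Delta>_def)
      define w where "w = real n powr (- 1/2) * \<Delta> n powr (- 2 * H)"
      have w0: "0 \<le> w" by (simp add: w_def)
      define J where "J = {1..n - filter_p a}"
      have g: "grid_in a (\<Delta> n) j" if "j \<in> J" for j using that grid by (simp add: J_def \<Delta>_def)
      have iQ: "integrable M (Q n j)" if "j \<in> J" for j
        unfolding Q_def[abs_def] by (rule localisation_L1(1)[OF a g[OF that] d1])
      have bQ: "(\<integral>\<omega>. \<bar>Q n j \<omega>\<bar> \<partial>M) \<le> \<bar>C\<bar> * \<Delta> n powr (1 + 2 * H)" if "j \<in> J" for j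
        unfolding Q_def by (rule order_trans[OF C[OF g[OF that] d1]]) (simp add: mult_right_mono)
      have iS: "integrable M (\<lambda>\<omega>. \<Sum>j\<in>J. Q n j \<omega>)" by (rule Bochner_Integration.integrable_sum[OF iQ])
      have "(\<integral>\<omega>. \<bar>w * (\<Sum>j\<in>J. Q n j \<omega>)\<bar> \<partial>M) \<le> (\<integral>\<omega>. w * (\<Sum>j\<in>J. \<bar>Q n j \<omega>\<bar>) \<partial>M)"
      proof (rule integral_mono)
        show "integrable M (\<lambda>\<omega>. \<bar>w * (\<Sum>j\<in>J. Q n j \<omega>)\<bar>)" by (intro integrable_abs integrable_mult_right iS)
        show "integrable M (\<lambda>\<omega>. w * (\<Sum>j\<in>J. \<bar>Q n j \<omega>\<bar>))" by (intro integrable_mult_right Bochner_Integration.integrable_sum integrable_abs iQ)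
        show "\<bar>w * (\<Sum>j\<in>J. Q n j \<omega>)\<bar> \<le> w * (\<Sum>j\<in>J. \<bar>Q n j \<omega>\<bar>)" for \<omega>
          unfolding abs_mult[of w] using w0 by (simp add: mult_left_mono sum_abs)
      qed
      also have "\<dots> = w * (\<Sum>j\<in>J. (\<integral>\<omega>. \<bar>Q n j \<omega>\<bar> \<partial>M))"
        by (simp only: integral_mult_right_zero) (subst Bochner_Integration.integral_sum, auto intro!: integrable_abs iQ)
      also have "\<dots> \<le> w * (\<Sum>j\<in>J. \<bar>C\<bar> * \<Delta> n powr (1 + 2 * H))" by (intro mult_left_mono sum_mono bQ w0)
      also have "\<dots> \<le> w * (real n * (\<bar>C\<bar> * \<Delta> n powr (1 + 2 * H)))"
        using w0 by (intro mult_left_mono) (auto simp: J_def intro!: mult_right_mono)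
      also have "\<dots> = \<bar>C\<bar> * ((real n powr (- 1/2) * real n powr 1) * (\<Delta> n powr (- 2 * H) * \<Delta> n powr (1 + 2 * H)))"
        using elim by (simp add: w_def mult_ac)
      also have "(real n powr (- 1/2) * real n powr 1) * (\<Delta> n powr (- 2 * H) * \<Delta> n powr (1 + 2 * H)) = real n powr (1/2 - \<alpha>)"
        unfolding powr_add[symmetric] \<Delta>_def powr_powr by (rule arg_cong[where f="\<lambda>z. real n powr z"]) (simp add: algebra_simps)
      finally have "(\<integral>\<omega>. \<bar>w * (\<Sum>j\<in>J. Q n j \<omega>)\<bar> \<partial>M) \<le> \<bar>C\<bar> * real n powr (1/2 - \<alpha>)" .
      moreover have "integrable M (\<lambda>\<omega>. w * (\<Sum>j\<in>J. Q n j \<omega>))" by (intro integrable_mult_right iS)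
      ultimately show ?case unfolding w_def J_def by simp
    qed
  qed
  from oP_add[OF frozen rest] show ?thesis
  proof (rule oP_cong)
    show "\<forall>\<^sub>F n in sequentially. \<forall>\<omega>\<in>space M. real n powr (- 1/2) * (real n powr - \<alpha>) powr (- 2 * H) *
      (\<Sum>j\<in>{1..n - filter_p a}. filter_incr a (real n powr - \<alpha>) (\<lambda>t. B t \<omega>) j * filter_incr a (real n powr - \<alpha>) (\<lambda>t. F t \<omega>) j) =
      real n powr (- 1/2) * (real n powr - \<alpha>) powr (- 2 * H) *
      (\<Sum>j\<in>{1..n - filter_p a}. filter_incr a (real n powr - \<alpha>) (\<lambda>t. B t \<omega>) j * frozen_drift a (real n powr - \<alpha>) j (X (real j * real n powr - \<alpha>) \<omega>)) +
      real n powr (- 1/2) * \<Delta> n powr (- 2 * H) * (\<Sum>j\<in>{1..n - filter_p a}. Q n j \<omega>)"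
      unfolding Q_def \<Delta>_def distrib_left[symmetric] sum.distrib[symmetric] right_diff_distrib by simp
  qed
qed

end

text \<open>Isolates what the limit theorems use: decay of all mixed covariances with one exponent
  \<beta> > 1/2, observation times within \<open>T\<close>, and a negligible drift. The two regimes
  of H are only distinguished when these assumptions are discharged.\<close>

locale observed_perturbed_fbm = perturbed_fbm M T H B x K f X
  for M :: "'a measure" and T H B x K f X +
  fixes as :: "real list list" and \<alpha> \<beta> C :: real
  assumes filters: "as \<noteq> []" "\<And>a. a \<in> set as \<Longrightarrow> diff_filter a"
    and full_rank: "invertible_mat (transpose_mat (filter_mat as) * filter_mat as)"
    and \<alpha>: "0 < \<alpha>" and \<beta>: "1/2 < \<beta>" "\<beta> < 1"
    and cov_decay: "0 \<le> C" "\<And>a b h. a \<in> set as \<Longrightarrow> b \<in> set as \<Longrightarrow> \<bar>filter_cov H a b h\<bar> \<le> C * (1 + \<bar>of_int h\<bar>) powr (- \<beta>)"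
    and grid: "\<And>a n j. a \<in> set as \<Longrightarrow> j \<in> {1..n - filter_p a} \<Longrightarrow> grid_in a (real n powr - \<alpha>) j"
    and drift: "\<And>a. a \<in> set as \<Longrightarrow> oP M (\<lambda>n \<omega>. sqrt (real n) *
      (quad_var a n (real n powr - \<alpha>) (\<lambda>t. X t \<omega>) - quad_var a n (real n powr - \<alpha>) (\<lambda>t. B t \<omega>)) / (real n powr - \<alpha>) powr (2 * H))"
begin

abbreviation "m \<equiv> length as"
abbreviation "P \<equiv> max_p as"
abbreviation \<Delta> :: "nat \<Rightarrow> real" where "\<Delta> n \<equiv> real n powr - \<alpha>"
abbreviation v :: "nat \<Rightarrow> real" where "v i \<equiv> filter_cov H (as ! i) (as ! i) 0"

definition Y :: "nat \<Rightarrow> nat \<Rightarrow> nat \<Rightarrow> 'a \<Rightarrow> real" where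
  "Y n i j \<omega> = \<Delta> n powr (- H) * filter_incr (as ! i) (\<Delta> n) (\<lambda>t. B t \<omega>) j"

text \<open>All filters are cut to the common range {1..n - P}, so that the pairs (i, j) form one
  rectangular family as in the central limit theorem. The terms omitted for shorter filters are
  shown to be negligible separately.\<close>

definition V :: "(nat \<Rightarrow> real) \<Rightarrow> nat \<Rightarrow> 'a \<Rightarrow> real" where
  "V c n \<omega> = (\<Sum>i<m. c i * (\<Sum>j\<in>{1..n - P}. (Y n i j \<omega>)\<^sup>2 - v i)) / sqrt (real n)"

definition \<zeta> :: "nat \<Rightarrow> nat \<Rightarrow> 'a \<Rightarrow> real" where
  "\<zeta> i n \<omega> = sqrt (real n) * (quad_var (as ! i) n (\<Delta> n) (\<lambda>t. X t \<omega>) / \<Delta> n powr (2 * H) - v i)"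

lemma filter_nth: "i < m \<Longrightarrow> as ! i \<in> set as" "i < m \<Longrightarrow> diff_filter (as ! i)"
  using filters by simp_all

lemma filter_p_nth_le: "i < m \<Longrightarrow> filter_p (as ! i) \<le> P"
  by (intro filter_p_le_max_p filter_nth)

lemma max_p_pos: "1 \<le> P"
proof -
  have "diff_filter (as ! 0)" "filter_p (as ! 0) \<le> P" using filters(1) by (auto intro!: filter_nth filter_p_nth_le)
  then show ?thesis by (auto simp: diff_filter_def filter_p_def)
qed

lemma grid_nth: "i < m \<Longrightarrow> j \<in> {1..n - filter_p (as ! i)} \<Longrightarrow> grid_in (as ! i) (\<Delta> n) j"
  by (intro grid filter_nth)

lemma grid_nth_max_p: "i < m \<Longrightarrow> j \<in> {1..n - P} \<Longrightarrow> grid_in (as ! i) (\<Delta> n) j"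
  using filter_p_nth_le[of i] by (intro grid_nth) auto

lemma Y_in_G: "i < m \<Longrightarrow> grid_in (as ! i) (\<Delta> n) j \<Longrightarrow> Y n i j \<in> gaussian_span T B"
  unfolding Y_def[abs_def] by (intro scale_G filter_incr_B_in_G)

lemma Y_cov:
  assumes n: "0 < n" and "i < m" "grid_in (as ! i) (\<Delta> n) j" "k < m" "grid_in (as ! k) (\<Delta> n) l"
  shows "(\<integral>\<omega>. Y n i j \<omega> * Y n k l \<omega> \<partial>M) = filter_cov H (as ! i) (as ! k) (int j - int l)"
proof -
  have d: "0 < \<Delta> n" using n by simp
  have "(\<integral>\<omega>. Y n i j \<omega> * Y n k l \<omega> \<partial>M)
      = (\<integral>\<omega>. (\<Delta> n powr (- H) * \<Delta> n powr (- H)) * (filter_incr (as ! i) (\<Delta> n) (\<lambda>t. B t \<omega>) j * filter_incr (as ! k) (\<Delta> n) (\<lambda>t. B t \<omega>) l) \<partial>M)"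
    unfolding Y_def by (rule Bochner_Integration.integral_cong[OF refl]) (simp only: mult_ac)
  also have "\<dots> = (\<Delta> n powr (- H) * \<Delta> n powr (- H)) * (\<Delta> n powr (2 * H) * filter_cov H (as ! i) (as ! k) (int j - int l))"
    unfolding integral_mult_right_zero using assms d
    by (intro arg_cong2[where f="(*)"] refl filter_incr_cov) (auto simp: grid_in_def filter_nth)
  also have "\<dots> = (\<Delta> n powr (- H) * \<Delta> n powr (- H) * \<Delta> n powr (2 * H)) * filter_cov H (as ! i) (as ! k) (int j - int l)"
    by (simp only: mult.assoc)
  also have "\<Delta> n powr (- H) * \<Delta> n powr (- H) * \<Delta> n powr (2 * H) = \<Delta> n powr (- H + - H + 2 * H)"
    by (simp only: powr_add)
  also have "\<dots> = 1" using d by simp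
  finally show ?thesis by simp
qed

lemma V_clt:
  shows "\<exists>\<Lambda>\<ge>0. \<forall>t. (\<lambda>n. \<integral>\<omega>. iexp (t * V c n \<omega>) \<partial>M) \<longlonglongrightarrow> exp (- of_real (\<Lambda> * t\<^sup>2 / 2))"
    and "OP M (V c)" and "V c n \<in> borel_measurable M"
proof -
  note qv = quadratic_variation_clt[where m=m and p=P and Y=Y and r="\<lambda>i k. filter_cov H (as ! i) (as ! k)" and c=c and C=C, OF \<beta>]
  have 1: "Y n i j \<in> gaussian_span T B" if "0 < n" "i < m" "j \<in> {1..n - P}" for n i j
    by (rule Y_in_G[OF that(2) grid_nth_max_p[OF that(2,3)]])
  have 2: "(\<integral>\<omega>. Y n i j \<omega> * Y n k l \<omega> \<partial>M) = filter_cov H (as ! i) (as ! k) (int j - int l)"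
    if "0 < n" "i < m" "j \<in> {1..n - P}" "k < m" "l \<in> {1..n - P}" for n i j k l
    by (rule Y_cov[OF that(1,2) grid_nth_max_p[OF that(2,3)] that(4) grid_nth_max_p[OF that(4,5)]])
  have 3: "\<bar>filter_cov H (as ! i) (as ! k) h\<bar> \<le> C * (1 + \<bar>of_int h\<bar>) powr (- \<beta>)" if "i < m" "k < m" for i k h
    using that by (intro cov_decay filter_nth)
  show "\<exists>\<Lambda>\<ge>0. \<forall>t. (\<lambda>n. \<integral>\<omega>. iexp (t * V c n \<omega>) \<partial>M) \<longlonglongrightarrow> exp (- of_real (\<Lambda> * t\<^sup>2 / 2))"
    unfolding V_def by (rule qv(1)[OF 1 2 cov_decay(1) 3 filter_cov_minus])
  show "OP M (V c)" unfolding V_def[abs_def] by (rule qv(2)[OF 1 2 cov_decay(1) 3 filter_cov_minus])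
  show "V c n \<in> borel_measurable M"
  proof (cases "n = 0")
    \<comment> \<open>For n = 0 the division by \<open>sqrt 0\<close> returns 0, so
      \<open>V c 0\<close> is the zero function.\<close>
    case True
    then show ?thesis by (simp add: V_def[abs_def])
  next
    case False
    then have "0 < n" by simp
    show ?thesis unfolding V_def[abs_def] by (rule qv(3)[OF 1 2 cov_decay(1) 3 filter_cov_minus \<open>0 < n\<close>])
  qed
qed

text \<open>At most \<open>P\<close> terms, each of mean \<open>v i\<close>, are divided by sqrt
  n.\<close>

lemma boundary_negligible:
  assumes i: "i < m"
  shows "oP M (\<lambda>n \<omega>. (\<Sum>j\<in>{n - P + 1..n - filter_p (as ! i)}. (Y n i j \<omega>)\<^sup>2) / sqrt (real n))"
proof (rule oP_L1)
  have "(\<lambda>n. 1 / sqrt (real n)) \<longlonglongrightarrow> 0" by real_asymp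
  then show "(\<lambda>n. real P * \<bar>v i\<bar> * (1 / sqrt (real n))) \<longlonglongrightarrow> 0" by (rule tendsto_mult_right_zero)
  show "\<forall>\<^sub>F n in sequentially. integrable M (\<lambda>\<omega>. (\<Sum>j\<in>{n - P + 1..n - filter_p (as ! i)}. (Y n i j \<omega>)\<^sup>2) / sqrt (real n)) \<and>
      (\<integral>\<omega>. \<bar>(\<Sum>j\<in>{n - P + 1..n - filter_p (as ! i)}. (Y n i j \<omega>)\<^sup>2) / sqrt (real n)\<bar> \<partial>M) \<le> real P * \<bar>v i\<bar> * (1 / sqrt (real n))"
    using eventually_gt_at_top[of 0]
  proof eventually_elim
    case (elim n)
    define J where "J = {n - P + 1..n - filter_p (as ! i)}"
    have g: "grid_in (as ! i) (\<Delta> n) j" if "j \<in> J" for j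
      using that by (intro grid_nth[OF i]) (auto simp: J_def)
    have int: "integrable M (\<lambda>\<omega>. (Y n i j \<omega>)\<^sup>2)" if "j \<in> J" for j
      unfolding power2_eq_square by (intro integrable_mult_G Y_in_G i g that)
    have ex: "(\<integral>\<omega>. (Y n i j \<omega>)\<^sup>2 \<partial>M) = v i" if "j \<in> J" for j
      unfolding power2_eq_square Y_cov[OF elim i g[OF that] i g[OF that]] by simp
    have iS: "integrable M (\<lambda>\<omega>. (\<Sum>j\<in>J. (Y n i j \<omega>)\<^sup>2) / sqrt (real n))"
      by (intro integrable_divide Bochner_Integration.integrable_sum int)
    have "(\<integral>\<omega>. \<bar>(\<Sum>j\<in>J. (Y n i j \<omega>)\<^sup>2) / sqrt (real n)\<bar> \<partial>M) = (\<integral>\<omega>. (\<Sum>j\<in>J. (Y n i j \<omega>)\<^sup>2) / sqrt (real n) \<partial>M)"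
      by (rule Bochner_Integration.integral_cong[OF refl]) (simp add: sum_nonneg)
    also have "\<dots> = (\<Sum>j\<in>J. (\<integral>\<omega>. (Y n i j \<omega>)\<^sup>2 \<partial>M)) / sqrt (real n)"
      by (simp only: integral_divide_zero) (subst Bochner_Integration.integral_sum, auto intro: int)
    also have "\<dots> = real (card J) * v i / sqrt (real n)" by (simp add: ex)
    also have "\<dots> \<le> real P * \<bar>v i\<bar> / sqrt (real n)"
    proof (rule divide_right_mono)
      have "real (card J) * v i \<le> real (card J) * \<bar>v i\<bar>" by (rule mult_left_mono) auto
      also have "\<dots> \<le> real P * \<bar>v i\<bar>" by (rule mult_right_mono) (auto simp: J_def)
      finally show "real (card J) * v i \<le> real P * \<bar>v i\<bar>" .
    qed simp
    finally show ?case using iS by (simp add: J_def)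
  qed
qed

text \<open>Three corrections are collected: the drift, the boundary terms beyond n - P, and a
  deterministic remainder from the centring. The last arises because \<open>\<zeta>\<close>
  subtracts n copies of \<open>v i\<close> but \<open>V\<close> only n - P, a difference of
  \<open>P * v i / sqrt n\<close>.\<close>

lemma \<zeta>_minus_V:
  assumes i: "i < m"
  shows "oP M (\<lambda>n \<omega>. \<zeta> i n \<omega> - (\<Sum>j\<in>{1..n - P}. (Y n i j \<omega>)\<^sup>2 - v i) / sqrt (real n))"
proof -
  define p where "p = filter_p (as ! i)"
  have pP: "p \<le> P" unfolding p_def by (rule filter_p_nth_le[OF i])
  have "(\<lambda>n. - (real P * v i) * (1 / sqrt (real n))) \<longlonglongrightarrow> 0"
    by (rule tendsto_mult_right_zero) real_asymp
  from oP_deterministic[OF this]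
  have "oP M (\<lambda>n \<omega>. sqrt (real n) * (quad_var (as ! i) n (\<Delta> n) (\<lambda>t. X t \<omega>) - quad_var (as ! i) n (\<Delta> n) (\<lambda>t. B t \<omega>)) / \<Delta> n powr (2 * H)
    + ((\<Sum>j\<in>{n - P + 1..n - filter_p (as ! i)}. (Y n i j \<omega>)\<^sup>2) / sqrt (real n) + - (real P * v i) * (1 / sqrt (real n))))"
    by (intro oP_add drift boundary_negligible filter_nth i)
  then show ?thesis
  proof (rule oP_cong)
    show "\<forall>\<^sub>F n in sequentially. \<forall>\<omega>\<in>space M. \<zeta> i n \<omega> - (\<Sum>j\<in>{1..n - P}. (Y n i j \<omega>)\<^sup>2 - v i) / sqrt (real n) =
      sqrt (real n) * (quad_var (as ! i) n (\<Delta> n) (\<lambda>t. X t \<omega>) - quad_var (as ! i) n (\<Delta> n) (\<lambda>t. B t \<omega>)) / \<Delta> n powr (2 * H)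
    + ((\<Sum>j\<in>{n - P + 1..n - filter_p (as ! i)}. (Y n i j \<omega>)\<^sup>2) / sqrt (real n) + - (real P * v i) * (1 / sqrt (real n)))"
      using eventually_gt_at_top[of P]
    proof eventually_elim
      case (elim n)
      show ?case
      proof (rule ballI)
        fix \<omega> :: 'a
        have n: "0 < n" "P \<le> n" using elim by auto
        define r where "r = sqrt (real n)"
        have r: "0 < r" "r * r = real n" using n by (simp_all add: r_def)
        define D where "D = \<Delta> n powr (2 * H)"
        define qX where "qX = quad_var (as ! i) n (\<Delta> n) (\<lambda>t. X t \<omega>)"
        define qB where "qB = quad_var (as ! i) n (\<Delta> n) (\<lambda>t. B t \<omega>)"
        define y where "y j = (Y n i j \<omega>)\<^sup>2" for j
        have y: "(filter_incr (as ! i) (\<Delta> n) (\<lambda>t. B t \<omega>) j)\<^sup>2 / D = y j" for j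
        proof -
          have "y j = (\<Delta> n powr (- H))\<^sup>2 * (filter_incr (as ! i) (\<Delta> n) (\<lambda>t. B t \<omega>) j)\<^sup>2"
            by (simp add: y_def Y_def power_mult_distrib)
          also have "(\<Delta> n powr (- H))\<^sup>2 = \<Delta> n powr (- H + - H)" by (simp only: power2_eq_square powr_add)
          also have "\<dots> = 1 / D" unfolding D_def by (simp add: powr_minus_divide[symmetric])
          finally show ?thesis by simp
        qed
        have qB: "qB / D = (\<Sum>j\<in>{1..n - p}. y j) / (r * r)"
          unfolding qB_def quad_var_def p_def[symmetric] r(2) y[symmetric] sum_divide_distrib[symmetric] by simp
        have split: "(\<Sum>j\<in>{1..n - p}. y j) = (\<Sum>j\<in>{1..n - P}. y j) + (\<Sum>j\<in>{n - P + 1..n - p}. y j)"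
        proof -
          have "{1..n - p} = {1..n - P} \<union> {n - P + 1..n - p}" using pP by auto
          then show ?thesis by (simp only:) (rule sum.union_disjoint, auto)
        qed
        define s where "s = (\<Sum>j\<in>{1..n - P}. y j)"
        define b where "b = (\<Sum>j\<in>{n - P + 1..n - p}. y j)"
        have c: "(\<Sum>j\<in>{1..n - P}. y j - v i) = s - (r * r - real P) * v i"
          using n(2) unfolding r(2) s_def by (simp add: sum_subtractf of_nat_diff)
        have "r * (qX / D - v i) - (s - (r * r - real P) * v i) / r
            = r * (qX / D - qB / D) + (b / r + - (real P * v i) * (1 / r))"
          unfolding qB split s_def[symmetric] b_def[symmetric] using r(1) by (simp add: field_simps)
        moreover have "r * (qX / D - qB / D) = r * (qX - qB) / D" by (simp add: diff_divide_distrib right_diff_distrib)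
        ultimately show "\<zeta> i n \<omega> - (\<Sum>j\<in>{1..n - P}. (Y n i j \<omega>)\<^sup>2 - v i) / sqrt (real n) =
      sqrt (real n) * (quad_var (as ! i) n (\<Delta> n) (\<lambda>t. X t \<omega>) - quad_var (as ! i) n (\<Delta> n) (\<lambda>t. B t \<omega>)) / \<Delta> n powr (2 * H)
    + ((\<Sum>j\<in>{n - P + 1..n - filter_p (as ! i)}. (Y n i j \<omega>)\<^sup>2) / sqrt (real n) + - (real P * v i) * (1 / sqrt (real n)))"
          unfolding \<zeta>_def r_def[symmetric] D_def[symmetric] qX_def[symmetric] qB_def[symmetric] p_def[symmetric] y_def[symmetric]
            c b_def[symmetric] by simp
      qed
    qed
  qed
qed

lemma \<zeta>_sum_minus_V: "oP M (\<lambda>n \<omega>. (\<Sum>i<m. c i * \<zeta> i n \<omega>) - V c n \<omega>)"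
proof (rule oP_cong)
  show "oP M (\<lambda>n \<omega>. \<Sum>i<m. c i * (\<zeta> i n \<omega> - (\<Sum>j\<in>{1..n - P}. (Y n i j \<omega>)\<^sup>2 - v i) / sqrt (real n)))"
    by (rule oP_sum[OF finite_lessThan \<zeta>_minus_V]) simp
  show "\<forall>\<^sub>F n in sequentially. \<forall>\<omega>\<in>space M. (\<Sum>i<m. c i * \<zeta> i n \<omega>) - V c n \<omega> =
      (\<Sum>i<m. c i * (\<zeta> i n \<omega> - (\<Sum>j\<in>{1..n - P}. (Y n i j \<omega>)\<^sup>2 - v i) / sqrt (real n)))"
    unfolding V_def right_diff_distrib[of "c _" "\<zeta> _ _ _"] sum_subtractf[of "\<lambda>i. c i * \<zeta> i _ _"]
      sum_divide_distrib[of _ "{..<m}"] times_divide_eq_right by simp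
qed

lemma quad_var_measurable:
  assumes i: "i < m" shows "(\<lambda>\<omega>. quad_var (as ! i) n (\<Delta> n) (\<lambda>t. X t \<omega>)) \<in> borel_measurable M"
  unfolding quad_var_def
  by (intro borel_measurable_times borel_measurable_const borel_measurable_sum borel_measurable_power
      filter_incr_measurable X_measurable grid_nth[OF i])

lemma \<zeta>_sum_measurable: "(\<lambda>\<omega>. \<Sum>i<m. c i * \<zeta> i n \<omega>) \<in> borel_measurable M"
  unfolding \<zeta>_def
  by (intro borel_measurable_sum borel_measurable_times borel_measurable_const borel_measurable_diff borel_measurable_divide quad_var_measurable) auto

lemma \<zeta>_sum_clt:
  "\<exists>\<Lambda>\<ge>0. \<forall>t. (\<lambda>n. \<integral>\<omega>. iexp (t * (\<Sum>i<m. c i * \<zeta> i n \<omega>)) \<partial>M) \<longlonglongrightarrow> exp (- of_real (\<Lambda> * t\<^sup>2 / 2))"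
proof -
  obtain \<Lambda> where L: "0 \<le> \<Lambda>" "\<And>t. (\<lambda>n. \<integral>\<omega>. iexp (t * V c n \<omega>) \<partial>M) \<longlonglongrightarrow> exp (- of_real (\<Lambda> * t\<^sup>2 / 2))"
    using V_clt(1)[of c] by auto
  have "(\<lambda>n. \<integral>\<omega>. iexp (t * (\<Sum>i<m. c i * \<zeta> i n \<omega>)) \<partial>M) \<longlonglongrightarrow> exp (- of_real (\<Lambda> * t\<^sup>2 / 2))" for t
    using tendsto_add[OF char_perturbation[OF \<zeta>_sum_measurable V_clt(3) \<zeta>_sum_minus_V, of t c] L(2)[of t]] by simp
  with L(1) show ?thesis by blast
qed

lemma OP_\<zeta>_sum: "OP M (\<lambda>n \<omega>. \<Sum>i<m. c i * \<zeta> i n \<omega>)"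
  using OP_add[OF oP_imp_OP[OF \<zeta>_sum_minus_V[of c]] V_clt(2)[of c]] by simp

text \<open>The subtracted logarithm is that of (d \<Delta>)^(2 H), the quantity estimated by the
  d-th entry of \<open>D_hat\<close>.\<close>

definition log_error :: "nat \<Rightarrow> nat \<Rightarrow> 'a \<Rightarrow> real" where
  "log_error d n \<omega> = sqrt (real n) * (ln \<bar>D_hat as n (\<Delta> n) (\<lambda>t. X t \<omega>) d\<bar> - 2 * H * ln (real d * \<Delta> n))"

lemma D_hat_measurable:
  assumes d: "d \<in> {1..P}" shows "(\<lambda>\<omega>. D_hat as n (\<Delta> n) (\<lambda>t. X t \<omega>) d) \<in> borel_measurable M"
proof -
  from full_rank obtain c where c: "\<And>n \<Delta> Z d. d \<in> {1..P} \<Longrightarrow> D_hat as n \<Delta> Z d = (\<Sum>i<m. c d i * quad_var (as ! i) n \<Delta> Z)"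
    by (rule estimator_linear) blast
  show ?thesis unfolding c[OF d]
    by (intro borel_measurable_sum borel_measurable_times borel_measurable_const quad_var_measurable) auto
qed

text \<open>By linearity and the left inverse, the d-th entry of \<open>D_hat\<close> equals (d
  \<Delta>)^(2 H) (1 + Z / sqrt n) exactly, with \<open>Z\<close> a fixed linear combination of the
  normalised errors \<open>\<zeta>\<close>. Only the logarithm has to be linearised.\<close>

lemma log_error_expansion:
  obtains c where "\<And>d. d \<in> {1..P} \<Longrightarrow> oP M (\<lambda>n \<omega>. log_error d n \<omega> - (\<Sum>i<m. c d i * \<zeta> i n \<omega>))"
proof -
  from full_rank obtain c where
    c: "\<And>n \<Delta> Z d. d \<in> {1..P} \<Longrightarrow> D_hat as n \<Delta> Z d = (\<Sum>i<m. c d i * quad_var (as ! i) n \<Delta> Z)"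
    and inv: "\<And>y d. d \<in> {1..P} \<Longrightarrow> (\<Sum>i<m. c d i * (\<Sum>e\<in>{1..P}. filter_mat as $$ (i, e - 1) * y e)) = y d"
    by (rule estimator_linear) blast
  \<comment> \<open>Division by d^(2 H) passes from absolute to relative errors, which is what the
    logarithm sees.\<close>
  define c' where "c' d i = c d i / real d powr (2 * H)" for d i
  show ?thesis
  proof (rule that[of c'])
    fix d assume d: "d \<in> {1..P}"
    define Z where "Z n \<omega> = (\<Sum>i<m. c' d i * \<zeta> i n \<omega>)" for n \<omega>
    have cv: "(\<Sum>i<m. c d i * v i) = real d powr (2 * H)"
    proof -
      have "(\<Sum>i<m. c d i * v i) = (\<Sum>i<m. c d i * (\<Sum>e\<in>{1..P}. filter_mat as $$ (i, e - 1) * real e powr (2 * H)))"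
        using filter_cov_zero_eq[OF _ filter_nth(2) H(1)] by (intro sum.cong refl) simp
      also have "\<dots> = real d powr (2 * H)" by (rule inv[OF d])
      finally show ?thesis .
    qed
    show "oP M (\<lambda>n \<omega>. log_error d n \<omega> - (\<Sum>i<m. c' d i * \<zeta> i n \<omega>))"
      unfolding Z_def[symmetric]
    proof (rule log_linearisation)
      show "OP M Z" unfolding Z_def[abs_def] by (rule OP_\<zeta>_sum)
      fix n \<omega> assume n: "0 < n" and small: "\<bar>Z n \<omega>\<bar> \<le> sqrt (real n) / 2"
      define r where "r = sqrt (real n)"
      have r: "0 < r" using n by (simp add: r_def)
      have dd: "0 < real d" "0 < \<Delta> n" using d n by auto
      define D where "D = \<Delta> n powr (2 * H)"
      have D: "0 < D" using dd by (simp add: D_def)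
      define E where "E = real d powr (2 * H)"
      have E: "0 < E" using dd by (simp add: E_def)
      have q: "quad_var (as ! i) n (\<Delta> n) (\<lambda>t. X t \<omega>) = D * (v i + \<zeta> i n \<omega> / r)" for i
        unfolding \<zeta>_def r_def[symmetric] D_def[symmetric] using r D by simp
      have "D_hat as n (\<Delta> n) (\<lambda>t. X t \<omega>) d = (\<Sum>i<m. c d i * (D * (v i + \<zeta> i n \<omega> / r)))"
        unfolding c[OF d] q ..
      also have "\<dots> = (\<Sum>i<m. D * (c d i * v i + E * (c' d i * \<zeta> i n \<omega>) / r))"
        unfolding c'_def E_def[symmetric] using E r by (intro sum.cong refl) (simp add: field_simps)
      also have "\<dots> = D * ((\<Sum>i<m. c d i * v i) + E * (\<Sum>i<m. c' d i * \<zeta> i n \<omega>) / r)"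
        unfolding sum_distrib_left[symmetric] sum.distrib sum_divide_distrib[symmetric] ..
      also have "\<dots> = D * (E + E * Z n \<omega> / r)" unfolding cv E_def Z_def ..
      also have "\<dots> = (D * E) * (1 + Z n \<omega> / r)" by (simp add: algebra_simps)
      finally have Dh: "D_hat as n (\<Delta> n) (\<lambda>t. X t \<omega>) d = (D * E) * (1 + Z n \<omega> / r)" .
      have "\<bar>Z n \<omega> / r\<bar> \<le> 1 / 2" using small r unfolding r_def[symmetric] by (simp add: abs_divide field_simps)
      then have pos: "0 < 1 + Z n \<omega> / r" by linarith
      have "ln \<bar>D_hat as n (\<Delta> n) (\<lambda>t. X t \<omega>) d\<bar> = ln (D * E) + ln (1 + Z n \<omega> / r)"
        unfolding Dh using D E pos by (simp only: abs_mult abs_of_pos) (rule ln_mult_pos, simp_all)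
      also have "ln (D * E) = 2 * H * ln (real d * \<Delta> n)"
      proof -
        have "D * E = (real d * \<Delta> n) powr (2 * H)" unfolding D_def E_def using dd by (simp add: powr_mult)
        then show ?thesis using dd by (simp only: ln_powr)
      qed
      finally show "log_error d n \<omega> = sqrt (real n) * ln (1 + Z n \<omega> / sqrt (real n))"
        unfolding log_error_def r_def by simp
    qed
  qed
qed

lemma weak_limit_degenerate:
  assumes m: "\<And>n. Z n \<in> borel_measurable M" and o: "oP M Z"
  shows "weak_conv_m (\<lambda>n. distr M borel (Z n)) (centered_normal 0)"
proof -
  have "oP M (\<lambda>n \<omega>. Z n \<omega> - 0)" using o by simp
  from char_perturbation[OF m _ this]
  have "(\<lambda>n. (\<integral>\<omega>. iexp (t * Z n \<omega>) \<partial>M) - (\<integral>\<omega>. iexp (t * 0) \<partial>M)) \<longlonglongrightarrow> 0" for t by simp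
  then have "(\<lambda>n. \<integral>\<omega>. iexp (t * Z n \<omega>) \<partial>M) \<longlonglongrightarrow> 1" for t
    using prob_space by (simp add: LIM_zero_iff)
  then show ?thesis using weak_conv_centered_normal[OF m, of 0] by simp
qed

lemma H1_hat_limit:
  "weak_conv_m (\<lambda>n. distr M borel (\<lambda>\<omega>. sqrt (real n) * (H1_hat as n (\<Delta> n) (\<lambda>t. X t \<omega>) - H))) (centered_normal 0)"
proof (rule weak_limit_degenerate)
  show "(\<lambda>\<omega>. sqrt (real n) * (H1_hat as n (\<Delta> n) (\<lambda>t. X t \<omega>) - H)) \<in> borel_measurable M" for n
    unfolding H1_hat_def
    by (intro borel_measurable_times borel_measurable_const borel_measurable_diff borel_measurable_divide borel_measurable_sum
        borel_measurable_ln borel_measurable_abs D_hat_measurable) auto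
  define S where "S n = (\<Sum>d=1..P. (ln (real d * \<Delta> n))\<^sup>2)" for n
  define k where "k d n = ln (real d * \<Delta> n) / (2 * S n)" for d n
  obtain c where c: "\<And>d. d \<in> {1..P} \<Longrightarrow> oP M (\<lambda>n \<omega>. log_error d n \<omega> - (\<Sum>i<m. c d i * \<zeta> i n \<omega>))"
    using log_error_expansion by blast
  have g: "OP M (log_error d)" if "d \<in> {1..P}" for d
    using OP_add[OF oP_imp_OP[OF c[OF that]] OP_\<zeta>_sum[of "c d"]] by simp
  have S: "(ln (\<Delta> n))\<^sup>2 \<le> S n" and Sd: "d \<in> {1..P} \<Longrightarrow> (ln (real d * \<Delta> n))\<^sup>2 \<le> S n" for n d
  proof -
    show 2: "(ln (real d * \<Delta> n))\<^sup>2 \<le> S n" if "d \<in> {1..P}" for d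
      unfolding S_def by (rule member_le_sum[OF that]) auto
    show "(ln (\<Delta> n))\<^sup>2 \<le> S n" using 2[of 1] max_p_pos by simp
  qed
  \<comment> \<open>The summand d = 1 shows that S n is at least (ln \<Delta>)^2, while |ln (d
    \<Delta>)| is at most sqrt (S n). Hence the weight is at most 1 / (2 sqrt (S n)), which is at
    most 1 / (2 \<alpha> ln n).\<close>
  have k: "k d \<longlonglongrightarrow> 0" if d: "d \<in> {1..P}" for d
  proof (rule Lim_null_comparison)
    show "(\<lambda>n. 1 / (2 * (\<alpha> * ln (real n)))) \<longlonglongrightarrow> 0" using \<alpha> by real_asymp
    show "\<forall>\<^sub>F n in sequentially. norm (k d n) \<le> 1 / (2 * (\<alpha> * ln (real n)))"
      using eventually_ge_at_top[of 2]
    proof eventually_elim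
      case (elim n)
      define l where "l = \<alpha> * ln (real n)"
      have l: "0 < l" using elim \<alpha> by (simp add: l_def)
      have "ln (\<Delta> n) = - l" by (simp add: l_def ln_powr)
      then have "l\<^sup>2 \<le> S n" using S[of n] by simp
      then have ls: "l \<le> sqrt (S n)" by (rule real_le_rsqrt)
      define s where "s = sqrt (S n)"
      have Sn: "0 \<le> S n" unfolding S_def by (intro sum_nonneg) simp
      have s: "0 < s" using l ls unfolding s_def by linarith
      have ss: "s * s = S n" using Sn by (simp add: s_def)
      have "\<bar>ln (real d * \<Delta> n)\<bar> \<le> s" unfolding s_def by (rule real_le_rsqrt) (simp add: Sd[OF d])
      then have "\<bar>ln (real d * \<Delta> n)\<bar> / (2 * (s * s)) \<le> s / (2 * (s * s))" using s by (intro divide_right_mono) auto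
      also have "\<dots> = 1 / (2 * s)" using s by simp
      also have "\<dots> \<le> 1 / (2 * l)" using l ls by (simp add: s_def frac_le)
      finally show ?case using s unfolding k_def ss[symmetric] l_def by (simp add: abs_mult)
    qed
  qed
  have "oP M (\<lambda>n \<omega>. \<Sum>d=1..P. 1 * (k d n * log_error d n \<omega>))"
    by (rule oP_sum[OF finite_atLeastAtMost oP_scale_null[OF g k]])
  then show "oP M (\<lambda>n \<omega>. sqrt (real n) * (H1_hat as n (\<Delta> n) (\<lambda>t. X t \<omega>) - H))"
  proof (rule oP_cong)
    show "\<forall>\<^sub>F n in sequentially. \<forall>\<omega>\<in>space M. sqrt (real n) * (H1_hat as n (\<Delta> n) (\<lambda>t. X t \<omega>) - H) = (\<Sum>d=1..P. 1 * (k d n * log_error d n \<omega>))"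
      using eventually_ge_at_top[of 2]
    proof eventually_elim
      case (elim n)
      show ?case
      proof (rule ballI)
        fix \<omega> :: 'a
        define L where "L d = ln \<bar>D_hat as n (\<Delta> n) (\<lambda>t. X t \<omega>) d\<bar>" for d
        define u where "u d = ln (real d * \<Delta> n)" for d
        \<comment> \<open>n = 1 has to be excluded: there \<Delta> = 1 and the normalising sum
          \<open>S n\<close> may vanish.\<close>
        have "ln (\<Delta> n) \<noteq> 0" using elim \<alpha> by (simp add: ln_powr)
        then have "0 < (ln (\<Delta> n))\<^sup>2" by simp
        with S[of n] have S0: "0 < S n" by linarith
        have Su: "S n = (\<Sum>d=1..P. (u d)\<^sup>2)" by (simp add: S_def u_def)
        have "(\<Sum>d=1..P. k d n * log_error d n \<omega>) = (\<Sum>d=1..P. sqrt (real n) / (2 * S n) * (L d * u d - 2 * H * (u d)\<^sup>2))"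
          unfolding k_def log_error_def L_def[symmetric] u_def[symmetric]
          by (intro sum.cong refl) (simp add: power2_eq_square diff_divide_distrib algebra_simps)
        also have "\<dots> = sqrt (real n) / (2 * S n) * ((\<Sum>d=1..P. L d * u d) - 2 * H * S n)"
          unfolding Su sum_distrib_left[symmetric] sum_subtractf ..
        also have "\<dots> = sqrt (real n) * ((\<Sum>d=1..P. L d * u d) / (2 * S n) - H)" using S0 by (simp add: field_simps)
        finally show "sqrt (real n) * (H1_hat as n (\<Delta> n) (\<lambda>t. X t \<omega>) - H) = (\<Sum>d=1..P. 1 * (k d n * log_error d n \<omega>))"
          unfolding H1_hat_def L_def u_def S_def by simp
      qed
    qed
  qed
qed

text \<open>The estimator is half the least squares slope of the logarithms of |D_hat| against ln d,
  with an intercept. The intercept absorbs 2 H ln \<Delta>, so the weights of the logarithmic errors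
  do not depend on n and the limit is that of one fixed linear combination of the
  \<open>\<zeta>\<close>.\<close>

lemma H2_hat_limit:
  assumes P2: "2 \<le> P"
  shows "\<exists>\<sigma>\<ge>0. weak_conv_m (\<lambda>n. distr M borel (\<lambda>\<omega>. sqrt (real n) * (H2_hat as n (\<Delta> n) (\<lambda>t. X t \<omega>) - H))) (centered_normal \<sigma>)"
proof -
  define S1 where "S1 = (\<Sum>d=1..P. ln (real d))"
  define S2 where "S2 = (\<Sum>d=1..P. (ln (real d))\<^sup>2)"
  \<comment> \<open>Centered regressors: they sum to zero, which removes \<Delta>, and their pairing
    with ln d is \<open>den / 2\<close>, which makes the estimator return H exactly when there is no
    error.\<close>
  define q where "q d = ln (real d) - S1 / real P" for d :: nat
  define den where "den = 2 * (S2 - 1 / real P * S1\<^sup>2)"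
  define w where "w d = q d / den" for d
  have sq0: "(\<Sum>d=1..P. q d) = 0" using P2 unfolding q_def sum_subtractf S1_def[symmetric] by simp
  have sql: "(\<Sum>d=1..P. q d * ln (real d)) = den / 2"
  proof -
    have "(\<Sum>d=1..P. q d * ln (real d)) = (\<Sum>d=1..P. (ln (real d))\<^sup>2 - S1 / real P * ln (real d))"
      unfolding q_def by (intro sum.cong refl) (simp add: power2_eq_square left_diff_distrib)
    also have "\<dots> = S2 - S1 / real P * S1" unfolding sum_subtractf sum_distrib_left[symmetric] S2_def S1_def ..
    finally show ?thesis by (simp add: den_def power2_eq_square)
  qed
  \<comment> \<open>Half of \<open>den\<close> is the sum of the squares of \<open>q\<close>. It is
    positive because q 2 - q 1 = ln 2, so that q 1 and q 2 cannot both vanish; both indices occur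
    since P >= 2.\<close>
  have den: "0 < den"
  proof -
    have "(\<Sum>d=1..P. (q d)\<^sup>2) = (\<Sum>d=1..P. q d * ln (real d) - S1 / real P * q d)"
      by (intro sum.cong refl) (simp add: power2_eq_square q_def algebra_simps)
    also have "\<dots> = den / 2" unfolding sum_subtractf sum_distrib_left[symmetric] sq0 sql by simp
    finally have e: "(\<Sum>d=1..P. (q d)\<^sup>2) = den / 2" .
    have "q 2 - q 1 = ln 2" by (simp add: q_def)
    moreover have "0 < ln (2::real)" by simp
    ultimately have "q 1 \<noteq> 0 \<or> q 2 \<noteq> 0" by linarith
    then obtain d where "d \<in> {1..P}" "q d \<noteq> 0" using P2 by (metis atLeastAtMost_iff one_le_numeral order.refl order.trans)
    then have "0 < (\<Sum>d=1..P. (q d)\<^sup>2)" by (intro sum_pos2[of _ d]) auto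
    with e show ?thesis by simp
  qed
  obtain c where c: "\<And>d. d \<in> {1..P} \<Longrightarrow> oP M (\<lambda>n \<omega>. log_error d n \<omega> - (\<Sum>i<m. c d i * \<zeta> i n \<omega>))"
    using log_error_expansion by blast
  define c' where "c' i = (\<Sum>d=1..P. w d * c d i)" for i
  have c': "(\<Sum>i<m. c' i * \<zeta> i n \<omega>) = (\<Sum>d=1..P. w d * (\<Sum>i<m. c d i * \<zeta> i n \<omega>))" for n \<omega>
  proof -
    have "(\<Sum>i<m. c' i * \<zeta> i n \<omega>) = (\<Sum>i<m. \<Sum>d=1..P. w d * (c d i * \<zeta> i n \<omega>))"
      unfolding c'_def sum_distrib_right by (simp only: mult.assoc)
    also have "\<dots> = (\<Sum>d=1..P. \<Sum>i<m. w d * (c d i * \<zeta> i n \<omega>))" by (rule sum.swap)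
    finally show ?thesis by (simp only: sum_distrib_left)
  qed
  define Z where "Z n \<omega> = sqrt (real n) * (H2_hat as n (\<Delta> n) (\<lambda>t. X t \<omega>) - H)" for n \<omega>
  have Zm: "Z n \<in> borel_measurable M" for n
    unfolding Z_def[abs_def] H2_hat_def Let_def
    by (intro borel_measurable_times borel_measurable_const borel_measurable_diff borel_measurable_divide borel_measurable_sum
        borel_measurable_ln borel_measurable_abs D_hat_measurable) auto
  have Ze: "Z n \<omega> = (\<Sum>d=1..P. w d * log_error d n \<omega>)" if n: "0 < n" for n \<omega>
  proof -
    define L where "L d = ln \<bar>D_hat as n (\<Delta> n) (\<lambda>t. X t \<omega>) d\<bar>" for d
    have lg: "ln (real d * \<Delta> n) = ln (real d) + ln (\<Delta> n)" if "d \<in> {1..P}" for d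
      using that n by (intro ln_mult_pos) auto
    have "(\<Sum>d=1..P. q d * (L d - 2 * H * ln (real d * \<Delta> n)))
        = (\<Sum>d=1..P. q d * L d - 2 * H * (q d * ln (real d)) - 2 * H * ln (\<Delta> n) * q d)"
      by (intro sum.cong refl, subst lg) (simp_all only: algebra_simps)
    also have "\<dots> = (\<Sum>d=1..P. q d * L d) - H * den"
      unfolding sum_subtractf sum_distrib_left[symmetric] sq0 sql by simp
    finally have e1: "(\<Sum>d=1..P. q d * (L d - 2 * H * ln (real d * \<Delta> n))) = (\<Sum>d=1..P. q d * L d) - H * den" .
    have e2: "(\<Sum>d=1..P. q d * L d) = (\<Sum>d=1..P. L d * ln (real d)) - 1 / real P * (\<Sum>d=1..P. L d) * S1"
    proof -
      have "(\<Sum>d=1..P. q d * L d) = (\<Sum>d=1..P. L d * ln (real d) - S1 / real P * L d)"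
        by (intro sum.cong refl) (simp add: q_def algebra_simps)
      also have "\<dots> = (\<Sum>d=1..P. L d * ln (real d)) - S1 / real P * (\<Sum>d=1..P. L d)"
        unfolding sum_subtractf sum_distrib_left[symmetric] ..
      finally show ?thesis by simp
    qed
    have "(\<Sum>d=1..P. w d * log_error d n \<omega>) = (\<Sum>d=1..P. sqrt (real n) / den * (q d * (L d - 2 * H * ln (real d * \<Delta> n))))"
      unfolding w_def log_error_def L_def[symmetric] by (intro sum.cong refl) simp
    also have "\<dots> = sqrt (real n) / den * ((\<Sum>d=1..P. q d * L d) - H * den)"
      unfolding sum_distrib_left[symmetric] e1 ..
    also have "\<dots> = sqrt (real n) * ((\<Sum>d=1..P. q d * L d) / den - H)" using den by (simp add: field_simps)
    finally show ?thesis
      unfolding Z_def H2_hat_def Let_def L_def[symmetric] S1_def[symmetric] S2_def[symmetric] den_def[symmetric] e2 by simp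
  qed
  have "oP M (\<lambda>n \<omega>. \<Sum>d=1..P. w d * (log_error d n \<omega> - (\<Sum>i<m. c d i * \<zeta> i n \<omega>)))"
    by (rule oP_sum) (auto intro: c)
  then have o: "oP M (\<lambda>n \<omega>. Z n \<omega> - (\<Sum>i<m. c' i * \<zeta> i n \<omega>))"
  proof (rule oP_cong)
    show "\<forall>\<^sub>F n in sequentially. \<forall>\<omega>\<in>space M. Z n \<omega> - (\<Sum>i<m. c' i * \<zeta> i n \<omega>) =
      (\<Sum>d=1..P. w d * (log_error d n \<omega> - (\<Sum>i<m. c d i * \<zeta> i n \<omega>)))"
      using eventually_gt_at_top[of 0]
      by eventually_elim (simp only: Ze c' right_diff_distrib sum_subtractf, simp)
  qed
  obtain \<Lambda> where L: "0 \<le> \<Lambda>" "\<And>t. (\<lambda>n. \<integral>\<omega>. iexp (t * (\<Sum>i<m. c' i * \<zeta> i n \<omega>)) \<partial>M) \<longlonglongrightarrow> exp (- of_real (\<Lambda> * t\<^sup>2 / 2))"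
    using \<zeta>_sum_clt[of c'] by auto
  have "(\<lambda>n. \<integral>\<omega>. iexp (t * Z n \<omega>) \<partial>M) \<longlonglongrightarrow> exp (- of_real (\<Lambda> * t\<^sup>2 / 2))" for t
    using tendsto_add[OF char_perturbation[OF Zm \<zeta>_sum_measurable o, of t] L(2)[of t]] by simp
  from weak_conv_centered_normal[OF Zm L(1) this]
  have "weak_conv_m (\<lambda>n. distr M borel (Z n)) (centered_normal (sqrt \<Lambda>))" .
  then show ?thesis unfolding Z_def[abs_def] using L(1) by (intro exI[of _ "sqrt \<Lambda>"]) simp
qed

end

section \<open>Extracting the constants and choosing the exponents\<close>

lemma C01b_bounded_lipschitz:
  assumes "f \<in> C01b T" "T \<noteq> {}"
  obtains K where "0 < K" "\<And>s y. s \<in> T \<Longrightarrow> \<bar>f s y\<bar> \<le> K"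
    "\<And>s y y'. s \<in> T \<Longrightarrow> \<bar>f s y - f s y'\<bar> \<le> K * \<bar>y - y'\<bar>"
proof -
  from assms(1) obtain K where K: "0 < K" "\<And>s y s' y'. s \<in> T \<Longrightarrow> s' \<in> T \<Longrightarrow> \<bar>f s y\<bar> + \<bar>deriv (f s') y'\<bar> \<le> K"
    unfolding C01b_def by blast
  from assms(1) have diff: "\<And>s y. s \<in> T \<Longrightarrow> f s differentiable (at y)" unfolding C01b_def by blast
  show ?thesis
  proof (rule that[OF K(1)])
    fix s y assume s: "s \<in> T"
    show "\<bar>f s y\<bar> \<le> K" using K(2)[OF s s, of y y] by linarith
  next
    fix s y y' assume s: "s \<in> T"
    have "norm (f s y - f s y') \<le> K * norm (y - y')"
    proof (rule field_differentiable_bound[where S=UNIV and f'="deriv (f s)"])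
      show "(f s has_field_derivative deriv (f s) z) (at z within UNIV)" for z
        using diff[OF s, of z] DERIV_deriv_iff_real_differentiable by blast
      show "norm (deriv (f s) z) \<le> K" for z using K(2)[OF s s, of z z] by simp
    qed auto
    then show "\<bar>f s y - f s y'\<bar> \<le> K * \<bar>y - y'\<bar>" by simp
  qed
qed

text \<open>There are finitely many pairs of filters, so the sum of their constants serves all of
  them; lowering the decay exponent to \<beta> only weakens the bound, as the base is at least
  1.\<close>

lemma filter_cov_decay_uniform:
  assumes H: "0 < H" "H < 1" and m: "1 \<le> m" and \<beta>: "\<beta> \<le> 2 * real m - 2 * H"
    and ord: "\<And>a k. a \<in> set as \<Longrightarrow> k < m \<Longrightarrow> filter_moment a k = 0"
  obtains C where "0 \<le> C" "\<And>a b h. a \<in> set as \<Longrightarrow> b \<in> set as \<Longrightarrow> \<bar>filter_cov H a b h\<bar> \<le> C * (1 + \<bar>of_int h\<bar>) powr (- \<beta>)"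
proof -
  have "\<exists>C\<ge>0. \<forall>h. \<bar>filter_cov H a b h\<bar> \<le> C * (1 + \<bar>of_int h\<bar>) powr (2 * H - 2 * real m)" if "a \<in> set as" "b \<in> set as" for a b
    by (rule filter_cov_decay[OF H m ord[OF that(1)] ord[OF that(2)]])
  then obtain c where c: "\<And>a b. a \<in> set as \<Longrightarrow> b \<in> set as \<Longrightarrow> 0 \<le> c a b"
    "\<And>a b h. a \<in> set as \<Longrightarrow> b \<in> set as \<Longrightarrow> \<bar>filter_cov H a b h\<bar> \<le> c a b * (1 + \<bar>of_int h\<bar>) powr (2 * H - 2 * real m)"
    by metis
  define C where "C = (\<Sum>(a, b)\<in>set as \<times> set as. c a b)"
  have cC: "c a b \<le> C" if "a \<in> set as" "b \<in> set as" for a b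
    unfolding C_def using c(1) that member_le_sum[of "(a, b)" "set as \<times> set as" "\<lambda>(a, b). c a b"] by auto
  show ?thesis
  proof (rule that[of C])
    show "0 \<le> C" unfolding C_def using c(1) by (intro sum_nonneg) auto
    fix a b h assume ab: "a \<in> set as" "b \<in> set as"
    have "\<bar>filter_cov H a b h\<bar> \<le> c a b * (1 + \<bar>of_int h\<bar>) powr (2 * H - 2 * real m)" by (rule c(2)[OF ab])
    also have "\<dots> \<le> C * (1 + \<bar>of_int h\<bar>) powr (- \<beta>)"
      using \<beta> c(1)[OF ab] cC[OF ab] by (intro mult_mono powr_mono) auto
    finally show "\<bar>filter_cov H a b h\<bar> \<le> C * (1 + \<bar>of_int h\<bar>) powr (- \<beta>)" .
  qed
qed

theorem theorem6:
  fixes M :: "'a measure"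
    and T :: "real set"
    and H x \<alpha> :: real
    and f :: "real \<Rightarrow> real \<Rightarrow> real"
    and B X :: "real \<Rightarrow> 'a \<Rightarrow> real"
    and as :: "real list list"
  assumes "prob_space M"
    and "0 < H" and "H < 1"
    and "(H < 1/2 \<and> T = {0..} \<and> \<alpha> > 1 / (2 * (1 - H))) \<or>
         (H \<ge> 1/2 \<and> T = {0..1} \<and> \<alpha> \<ge> 1 \<and>
            \<alpha> > max ((2 * H - 1) / (2 - 2 * H)) (1 / (4 - 4 * H)))"
    and "fractional_Brownian_motion M T H B"
    and "f \<in> C01b T"
    and "solves_equation M T x f B X"
    and "as \<noteq> []"
    and "\<forall>a\<in>set as. diff_filter a \<and> real (filter_order a) > H + 1/4"
    and "invertible_mat (transpose_mat (filter_mat as) * filter_mat as)"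
  shows "(\<exists>\<sigma>\<ge>0. weak_conv_m
            (\<lambda>n. distr M borel (\<lambda>\<omega>.
               sqrt (real n) * (H1_hat as n (real n powr (-\<alpha>)) (\<lambda>t. X t \<omega>) - H)))
            (centered_normal \<sigma>)) \<and>
         (max_p as \<ge> 2 \<longrightarrow>
         (\<exists>\<sigma>\<ge>0. weak_conv_m
            (\<lambda>n. distr M borel (\<lambda>\<omega>.
               sqrt (real n) * (H2_hat as n (real n powr (-\<alpha>)) (\<lambda>t. X t \<omega>) - H)))
            (centered_normal \<sigma>)))"
proof -
  note M = \<open>prob_space M\<close> and H = \<open>0 < H\<close> \<open>H < 1\<close> and regime = assms(4) and order = assms(9)
  have T: "T = {0..} \<or> T = {0..1}" using regime by auto
  have T0: "0 \<in> T" "T \<subseteq> {0..}" "\<And>t. t \<in> T \<Longrightarrow> {0..t} \<subseteq> T" "T \<in> sets lborel" using T by auto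
  obtain K where K: "0 < K" "\<And>s y. s \<in> T \<Longrightarrow> \<bar>f s y\<bar> \<le> K" "\<And>s y y'. s \<in> T \<Longrightarrow> \<bar>f s y - f s y'\<bar> \<le> K * \<bar>y - y'\<bar>"
    using C01b_bounded_lipschitz[OF \<open>f \<in> C01b T\<close>] T0(1) by blast
  interpret prob_space M by (rule M)
  interpret perturbed_fbm M T H B x K f X
    using \<open>fractional_Brownian_motion M T H B\<close> \<open>f \<in> C01b T\<close> \<open>solves_equation M T x f B X\<close>
    by unfold_locales (use H T0 K in \<open>auto simp: C01b_def solves_equation_def\<close>)

  have \<alpha>0: "0 < \<alpha>"
  proof (cases "H < 1/2")
    case True
    have "0 < 1 / (2 * (1 - H))" using H by simp
    also have "\<dots> < \<alpha>" using regime True by auto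
    finally show ?thesis .
  qed (use regime in auto)
  have rough: "1/2 < \<alpha> * (1 - H)" if "H < 1/2"
    using regime that H by (auto simp: field_simps)
  \<comment> \<open>The two lower bounds on \<alpha> in multiplied form: the first controls the sum
    anchored at the starting value, the second the squared drift increments.\<close>
  have smooth: "T = {0..1}" "1 \<le> \<alpha>" "(2 * H - 1) / 2 < \<alpha> * (1 - H)" "1/2 < \<alpha> * (2 - 2 * H)" if "\<not> H < 1/2"
  proof -
    have r: "T = {0..1}" "1 \<le> \<alpha>" "(2 * H - 1) / (2 - 2 * H) < \<alpha>" "1 / (4 - 4 * H) < \<alpha>" using regime that by auto
    show "T = {0..1}" "1 \<le> \<alpha>" using r by auto
    have "2 * H - 1 < \<alpha> * (2 - 2 * H)" using r(3) H by (simp add: pos_divide_less_eq)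
    moreover have "\<alpha> * (2 - 2 * H) = 2 * (\<alpha> * (1 - H))" by (simp add: algebra_simps)
    ultimately show "(2 * H - 1) / 2 < \<alpha> * (1 - H)" by simp
    have "1 < \<alpha> * (4 - 4 * H)" using r(4) H by (simp add: pos_divide_less_eq)
    moreover have "\<alpha> * (4 - 4 * H) = 2 * (\<alpha> * (2 - 2 * H))" by (simp add: algebra_simps)
    ultimately show "1/2 < \<alpha> * (2 - 2 * H)" by simp
  qed
  have \<alpha>2: "1/2 < \<alpha> * (2 - 2 * H)"
  proof (cases "H < 1/2")
    case True
    have "\<alpha> * (2 - 2 * H) = 2 * (\<alpha> * (1 - H))" by (simp add: algebra_simps)
    with rough[OF True] show ?thesis by linarith
  qed (rule smooth(4))

  \<comment> \<open>The order guaranteed by the filter hypothesis: an integer above H + 1/4 is at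
    least 1, and at least 2 once H reaches 3/4.\<close>
  define m :: nat where "m = (if H < 3/4 then 1 else 2)"
  \<comment> \<open>The summation estimates need \<beta> < 1, so faster decay is weakened to 1 -
    \<eta>. The bound 1/4 keeps \<beta> above 1/2, and \<eta> <= 1 - H serves the inequalities
    relating \<beta> and \<alpha>.\<close>
  define \<eta> where "\<eta> = min (1/4) (1 - H)"
  \<comment> \<open>For H < 1/2 the decay exponent 2 - 2 H exceeds 1 and the drift needs no
    cancellation, so any value between 1/2 and 1 works; 3/4 is arbitrary. Otherwise \<beta> is
    chosen as large as decay and \<eta> permit.\<close>
  define \<beta> where "\<beta> = (if H < 1/2 then 3/4 else min (2 * real m - 2 * H) (1 - \<eta>))"
  have \<eta>: "0 < \<eta>" "\<eta> \<le> 1/4" "\<eta> \<le> 1 - H" using H unfolding \<eta>_def by linarith+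
  have m: "1 \<le> m" by (simp add: m_def)
  have \<beta>: "1/2 < \<beta>" "\<beta> < 1" "\<beta> \<le> 2 * real m - 2 * H"
    using H \<eta> unfolding \<beta>_def m_def by (auto simp: min_def)
  have \<beta>\<alpha>: "(1 - \<beta>) / 2 < \<alpha> * (1 - H)" "1/2 - \<beta>/2 + H < \<alpha>" if "\<not> H < 1/2"
  proof -
    have 1: "1 - H \<le> \<alpha> * (1 - H)" using smooth(2)[OF that] H by simp
    have b: "\<beta> = min (2 * real m - 2 * H) (1 - \<eta>)" using that by (simp add: \<beta>_def)
    have m2: "1 - \<eta> \<le> 2 * real m - 2 * H" if "\<not> H < 3/4" using that H \<eta> by (simp add: m_def)
    \<comment> \<open>Either the filter order limits the decay, \<beta> = 2 - 2 H; then the first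
      inequality is the assumed bound on \<alpha> and the second reads 2 H - 1/2 < \<alpha>, true
      since H < 3/4. Or \<beta> = 1 - \<eta>, and then \<alpha> >= 1 and \<eta> <= 1 - H give
      both.\<close>
    consider "H < 3/4" "\<beta> = 2 - 2 * H" | "\<beta> = 1 - \<eta>"
      using b m2 by (cases "H < 3/4") (auto simp: m_def min_def split: if_splits)
    then have "(1 - \<beta>) / 2 < \<alpha> * (1 - H) \<and> 1/2 - \<beta>/2 + H < \<alpha>"
    proof cases
      case 1
      then have "(1 - \<beta>) / 2 = (2 * H - 1) / 2" "1/2 - \<beta>/2 + H = 2 * H - 1/2" by (simp_all add: field_simps)
      with smooth(2,3)[OF that] 1(1) show ?thesis by linarith
    next
      case 2
      then have "(1 - \<beta>) / 2 = \<eta> / 2" "1/2 - \<beta>/2 + H = \<eta> / 2 + H" by (simp_all add: field_simps)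
      with 1 \<eta> H smooth(2)[OF that] show ?thesis by linarith
    qed
    then show "(1 - \<beta>) / 2 < \<alpha> * (1 - H)" "1/2 - \<beta>/2 + H < \<alpha>" by auto
  qed
  have moments: "filter_moment a k = 0" if a: "a \<in> set as" and k: "k < m" for a k
  proof -
    have "H + 1/4 < real (filter_order a)" using order a by simp
    \<comment> \<open>Integrality of the order is used: for H >= 3/4 the bound H + 1/4 already
      excludes order 1.\<close>
    then have "m \<le> filter_order a" using H unfolding m_def by (cases "filter_order a = 1") (auto split: if_splits)
    with k have "k < filter_order a" by simp
    then show ?thesis unfolding filter_order_def by (meson not_less_Least)
  qed
  obtain C where C: "0 \<le> C" "\<And>a b h. a \<in> set as \<Longrightarrow> b \<in> set as \<Longrightarrow> \<bar>filter_cov H a b h\<bar> \<le> C * (1 + \<bar>of_int h\<bar>) powr (- \<beta>)"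
    using filter_cov_decay_uniform[OF H m \<beta>(3) moments] by blast

  have grid: "grid_in a (real n powr - \<alpha>) j" if j: "j \<in> {1..n - filter_p a}" for a n j
  proof -
    have n: "0 < n" using j by (cases n) auto
    have "real (i + j) * real n powr - \<alpha> \<in> T" if i: "i \<le> filter_p a" for i
    proof (cases "H < 1/2")
      case True
      then show ?thesis using regime by auto
    next
      case False
      \<comment> \<open>The last observation time is at most n \<Delta> = n^(1 - \<alpha>), which
        stays in [0, 1] because \<alpha> >= 1.\<close>
      have "real (i + j) * real n powr - \<alpha> \<le> real n * real n powr - \<alpha>" using i j by (intro mult_right_mono) auto
      also have "\<dots> = real n powr (1 - \<alpha>)" using n by (simp add: powr_diff powr_minus_divide)
      also have "\<dots> \<le> real n powr 0" using n smooth(2)[OF False] by (intro powr_mono) auto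
      finally show ?thesis using smooth(1)[OF False] n by simp
    qed
    then show ?thesis using n by (simp add: grid_in_def)
  qed

  have drift: "oP M (\<lambda>n \<omega>. sqrt (real n) *
      (quad_var a n (real n powr - \<alpha>) (\<lambda>t. X t \<omega>) - quad_var a n (real n powr - \<alpha>) (\<lambda>t. B t \<omega>)) / (real n powr - \<alpha>) powr (2 * H))"
    if a: "a \<in> set as" for a
  proof (rule drift_negligible[OF _ \<alpha>2 grid])
    show df: "diff_filter a" using order a by simp
    show "oP M (\<lambda>n \<omega>. real n powr (- 1/2) * (real n powr - \<alpha>) powr (- 2 * H) *
      (\<Sum>j\<in>{1..n - filter_p a}. filter_incr a (real n powr - \<alpha>) (\<lambda>t. B t \<omega>) j * filter_incr a (real n powr - \<alpha>) (\<lambda>t. F t \<omega>) j))"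
    proof (cases "H < 1/2")
      case True
      show ?thesis by (rule cross_term_crude[OF df rough[OF True] grid])
    next
      case False
      then have H2: "1/2 \<le> H" by simp
      have b0: "0 < \<beta>" using \<beta> by simp
      show ?thesis
      proof (rule cross_term_from_frozen[OF df _ grid])
        show "1/2 < \<alpha>" using smooth(2)[OF False] by simp
        show "oP M (\<lambda>n \<omega>. real n powr (- 1/2) * (real n powr - \<alpha>) powr (- 2 * H) *
          (\<Sum>j\<in>{1..n - filter_p a}. filter_incr a (real n powr - \<alpha>) (\<lambda>t. B t \<omega>) j *
            frozen_drift a (real n powr - \<alpha>) j (X (real j * real n powr - \<alpha>) \<omega>)))"
          by (rule cross_term_regular[OF df H2 smooth(1,2)[OF False] b0 \<beta>(2) C(1) C(2)[OF a a] \<beta>\<alpha>[OF False]])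
      qed
    qed
  qed

  interpret observed_perturbed_fbm M T H B x K f X as \<alpha> \<beta> C
    using assms(8,10) order \<alpha>0 \<beta>(1,2) C grid drift by unfold_locales auto
  show ?thesis using H1_hat_limit H2_hat_limit by blast
qed

end
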